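(* Let $r\in\mathbb{N}$. Suppose that $W_n\to r$ in probability, and that $(m_n)$ is a sequence of positive integers with $m_n/n\to\alpha\in(0,\infty)$ as $n\to\infty$. Then $$\lim_{n\to\infty}n^{-1}\log\mathbb{E}[\mathcal{N}(n,m_n)]=F_r(\alpha);$$ in particular, this limit is strictly positive if and only if $\alpha>\alpha^*_r$. If also $\mathbb{P}[W_n\ge 3]=1$ for all sufficiently large $n$ (so $r\ge 3$) and there is a finite constant $r_1$ with $\mathbb{P}[W_n\le r_1]=1$ for all $n$, then $\alpha^*_r\le\underline{\alpha}_r\le 1$ and for any $\varepsilon>0$, $$\lim_{n\to\infty}\mathbb{P}\left[(\alpha^*_r-\varepsilon)n\le T_n\le(\underline{\alpha}_r+\varepsilon)n\right]=1,$$ and moreover, there exists $\varepsilon_\alpha>0$ such that for all $\varepsilon\in(0,\varepsilon_\alpha)$, $$\lim_{n\to\infty}\mathbb{P}[E(n,m_n;\varepsilon)]=\begin{cases}0&\text{if }\alpha<\underline{\alpha}_r,\\1&\text{if }\alpha>\underline{\alpha}_r.\end{cases}$$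
   Context: Convention: $0^0:=1$. For each $n\in\mathbb{N}$ let $W_n$ be a random variable with values in $\{1,\ldots,n\}$. For each $n$, let $X_1,X_2,\ldots$ be i.i.d. random vectors in $\{0,1\}^n$, each having weight (number of ones) distributed as $W_n$ and, conditionally on its weight being $k$, uniformly distributed over the vectors in $\{0,1\}^n$ of weight $k$. $M(n,m)$ is the $m\times n$ matrix with rows $X_1,\ldots,X_m$. $\mathcal{N}(n,m)$ is the number of row vectors $a\in\{0,1\}^m$, including zero, with $a\,M(n,m)\equiv\mathbf{0}$ (mod 2). $T_n:=\min\{m\in\mathbb{N}:X_m\in\mathrm{span}\{X_1,\ldots,X_{m-1}\}\}$, with span over the field with two elements. 2-core: the 2-core of a $0$-$1$ matrix is the terminal state of the following algorithm: as long as some column has exactly one unit entry (degree one), choose such a column and delete the unique row having a one in that column (columns are never deleted). The terminal set of rows does not depend on the choices made. $E(n,m;\varepsilon)$ is the event that the 2-core of $M(n,m)$ has at least $\varepsilon n$ rows and has more rows than it has columns of non-zero weight. Thresholds: for $\alpha\ge 0$ let $$F_r(\alpha):=\log\sup_{\gamma\in[0,1/2]}\left(\frac{(1+(1-2\gamma)^r)^\alpha}{2\gamma^\gamma(1-\gamma)^{1-\gamma}}\right),\qquad\alpha^*_r:=\inf\{\alpha\ge 0:F_r(\alpha)>0\}.$$ For $r\ge 3$ and $x\in(0,1)$ let $$\psi(x):=x+\left(1+\frac{x}{r}-x\right)\log(1-x),\qquad h(x):=-\frac{\log(1-x)}{r x^{r-1}},$$ let $\alpha^\sharp_r:=\inf_{x\in(0,1)}h(x)$,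 $g^*(\alpha):=\sup\{x\in(0,1):h(x)\le\alpha\}$ (with $\sup\emptyset:=0$), and $\underline{\alpha}_r:=\inf\{\alpha>\alpha^\sharp_r:\psi(g^*(\alpha))<0\}$. *)

theory Defs
  imports
    "HOL-Probability.Probability"
    "HOL-Library.Z2"
    "Jordan_Normal_Form.VS_Connect"
begin

text \<open>Vectors in \<open>{0,1}\<^sup>n\<close> are elements of \<open>carrier_vec n\<close> over the field \<^typ>\<open>bit\<close> with two
  elements, so that all vector and matrix arithmetic below is modulo 2.\<close>

definition weight :: "bit vec \<Rightarrow> nat" where
  "weight v = card {j. j < dim_vec v \<and> v $ j = 1}"

text \<open>For one value of \<open>n\<close>: \<open>W\<close> is a \<open>{1..n}\<close>-valued random variable on \<open>Q\<close>, and the rows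
  \<open>X 1, X 2, \<dots>\<close> (the index \<open>0\<close> is unused) are random vectors on a possibly different
  probability space \<open>P\<close>. They are identically distributed because \<open>weight_law\<close> and
  \<open>cond_uniform\<close> determine the law of each of them.\<close>

locale random_rows = Q: prob_space Q + P: prob_space P
  for n :: nat
    and Q :: "'w measure" and W :: "'w \<Rightarrow> nat"
    and P :: "'a measure" and X :: "nat \<Rightarrow> 'a \<Rightarrow> bit vec" +
  assumes W_random_variable: "Q.random_variable (count_space UNIV) W"
    and W_range: "\<And>x. x \<in> space Q \<Longrightarrow> W x \<in> {1..n}"
    and X_range: "\<And>i \<omega>. 1 \<le> i \<Longrightarrow> \<omega> \<in> space P \<Longrightarrow> X i \<omega> \<in> carrier_vec n"
    and X_indep: "P.indep_vars (\<lambda>_. count_space UNIV) X {1..}"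
    and weight_law: "\<And>i. 1 \<le> i \<Longrightarrow>
      distr P (count_space UNIV) (\<lambda>\<omega>. weight (X i \<omega>)) = distr Q (count_space UNIV) W"
    and cond_uniform: "\<And>i k v. 1 \<le> i \<Longrightarrow> \<P>(\<omega> in P. weight (X i \<omega>) = k) > 0 \<Longrightarrow>
      v \<in> carrier_vec n \<Longrightarrow> weight v = k \<Longrightarrow>
      \<P>(\<omega> in P. X i \<omega> = v \<bar> weight (X i \<omega>) = k)
        = 1 / real (card {u :: bit vec. u \<in> carrier_vec n \<and> weight u = k})"

definition random_matrix :: "nat \<Rightarrow> nat \<Rightarrow> (nat \<Rightarrow> 'a \<Rightarrow> bit vec) \<Rightarrow> 'a \<Rightarrow> bit mat" where
  "random_matrix n m X \<omega> = mat_of_rows n (map (\<lambda>i. X i \<omega>) [1..<Suc m])"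

definition null_vector_count :: "bit mat \<Rightarrow> nat" where
  "null_vector_count A =
     card {a. a \<in> carrier_vec (dim_row A) \<and> mat_of_row a * A = 0\<^sub>m 1 (dim_col A)}"

definition first_dependence :: "nat \<Rightarrow> (nat \<Rightarrow> 'a \<Rightarrow> bit vec) \<Rightarrow> 'a \<Rightarrow> nat" where
  "first_dependence n X \<omega> = (LEAST m. 1 \<le> m \<and>
     X m \<omega> \<in> LinearCombinations.module.span class_ring (module_vec TYPE(bit) n)
                ((\<lambda>i. X i \<omega>) ` {1..<m}))"

text \<open>A state of the deletion algorithm is the set of indices of the remaining rows.\<close>

definition unit_rows :: "bit mat \<Rightarrow> nat set \<Rightarrow> nat \<Rightarrow> nat set" where
  "unit_rows A R j = {i \<in> R. A $$ (i, j) = 1}"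

definition deletion_step :: "bit mat \<Rightarrow> (nat set \<times> nat set) set" where
  "deletion_step A = {(R, R') | R R'. \<exists>j i. j < dim_col A \<and> unit_rows A R j = {i} \<and> R' = R - {i}}"

definition is_terminal_state :: "bit mat \<Rightarrow> nat set \<Rightarrow> bool" where
  "is_terminal_state A R \<longleftrightarrow>
     ({..<dim_row A}, R) \<in> (deletion_step A)\<^sup>* \<and> R \<notin> Domain (deletion_step A)"

definition two_core_rows :: "bit mat \<Rightarrow> nat set" where
  "two_core_rows A = (THE R. is_terminal_state A R)"

text \<open>The set of remaining rows does not depend on the choices made.\<close>

lemma ex1_terminal_state: "\<exists>!R. is_terminal_state A R"
proof -
  have ex: "\<exists>R'. (R, R') \<in> (deletion_step A)\<^sup>* \<and> R' \<notin> Domain (deletion_step A)"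
    if "finite R" for R
    using that
  proof (induction R rule: finite_psubset_induct)
    case (psubset R)
    show ?case
    proof (cases "R \<in> Domain (deletion_step A)")
      case True
      then obtain R1 where R1: "(R, R1) \<in> deletion_step A" by blast
      then have "R1 \<subset> R" by (auto simp: deletion_step_def unit_rows_def)
      from psubset.IH[OF this] R1 show ?thesis
        by (meson converse_rtrancl_into_rtrancl)
    qed blast
  qed
  have sub: "S \<subseteq> R'"
    if "(R, R') \<in> (deletion_step A)\<^sup>*" "S \<subseteq> R" "S \<notin> Domain (deletion_step A)" for R R' S
    using that
  proof (induction rule: rtrancl_induct)
    case (step R1 R2)
    then obtain j i where ji: "j < dim_col A" "unit_rows A R1 j = {i}" "R2 = R1 - {i}"
      by (auto simp: deletion_step_def)
    have S: "S \<subseteq> R1" using step by blast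
    have "i \<notin> S"
    proof
      assume "i \<in> S"
      with S ji(2) have "unit_rows A S j = {i}" by (auto simp: unit_rows_def)
      with ji(1) have "S \<in> Domain (deletion_step A)" by (auto simp: deletion_step_def)
      with step.prems show False by blast
    qed
    with S ji(3) show ?case by blast
  qed
  have below: "R' \<subseteq> R" if "(R, R') \<in> (deletion_step A)\<^sup>*" for R R'
    using that by (induction rule: rtrancl_induct) (auto simp: deletion_step_def)
  show ?thesis
  proof (rule ex_ex1I)
    show "\<exists>R. is_terminal_state A R"
      using ex[of "{..<dim_row A}"] by (auto simp: is_terminal_state_def)
    show "R = R'" if "is_terminal_state A R" "is_terminal_state A R'" for R R'
      using that sub below unfolding is_terminal_state_def by (meson subset_antisym)
  qed
qed

definition core_event :: "nat \<Rightarrow> nat \<Rightarrow> real \<Rightarrow> (nat \<Rightarrow> 'a \<Rightarrow> bit vec) \<Rightarrow> 'a \<Rightarrow> bool" where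
  "core_event n m \<epsilon> X \<omega> \<longleftrightarrow>
     (let A = random_matrix n m X \<omega>; R = two_core_rows A in
        \<epsilon> * real n \<le> real (card R) \<and>
        card {j. j < n \<and> (\<exists>i\<in>R. A $$ (i, j) \<noteq> 0)} < card R)"

text \<open>In the library \<open>0 powr 0 = 0\<close>; here the convention is \<open>0\<^sup>0 = 1\<close>.\<close>

definition rpow :: "real \<Rightarrow> real \<Rightarrow> real" where
  "rpow x y = (if y = 0 then 1 else x powr y)"

definition threshold_F :: "nat \<Rightarrow> real \<Rightarrow> real" where
  "threshold_F r \<alpha> = ln (SUP \<gamma>\<in>{0..1/2}.
     rpow (1 + (1 - 2 * \<gamma>) ^ r) \<alpha> / (2 * rpow \<gamma> \<gamma> * rpow (1 - \<gamma>) (1 - \<gamma>)))"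

definition alpha_star :: "nat \<Rightarrow> real" where
  "alpha_star r = Inf {\<alpha>. 0 \<le> \<alpha> \<and> threshold_F r \<alpha> > 0}"

definition psi :: "nat \<Rightarrow> real \<Rightarrow> real" where
  "psi r x = x + (1 + x / real r - x) * ln (1 - x)"

definition threshold_h :: "nat \<Rightarrow> real \<Rightarrow> real" where
  "threshold_h r x = - (ln (1 - x) / (real r * x ^ (r - 1)))"

definition alpha_sharp :: "nat \<Rightarrow> real" where
  "alpha_sharp r = (INF x\<in>{0<..<1}. threshold_h r x)"

definition g_star :: "nat \<Rightarrow> real \<Rightarrow> real" where
  "g_star r \<alpha> = (let S = {x. 0 < x \<and> x < 1 \<and> threshold_h r x \<le> \<alpha>} in if S = {} then 0 else Sup S)"

definition alpha_under :: "nat \<Rightarrow> real" where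
  "alpha_under r = Inf {\<alpha>. alpha_sharp r < \<alpha> \<and> psi r (g_star r \<alpha>) < 0}"

end

theory Submission
  imports Defs "HOL-Combinatorics.Transposition" "HOL-Real_Asymp.Real_Asymp"
begin

text \<open>The characters of the group of vectors modulo 2 give
  \<open>E N = 2\<^sup>-\<^sup>n \<Sum>\<^sub>u (1 + \<phi> u)\<^sup>m\<close>, where \<open>\<phi> u\<close> is the mean of \<open>(-1)\<close> to the number of common ones of \<open>u\<close> and
  a row. If \<open>u\<close> has \<open>\<gamma> n\<close> ones, then \<open>\<phi> u\<close> is close to \<open>(1 - 2 \<gamma>)\<^sup>r\<close>, and the exponential growth rate is read
  off from the entropy of the binomial coefficients. Below \<open>alpha_star\<close> the mean number of nonzero null
  vectors tends to \<open>0\<close>: null vectors with few ones are unlikely because the rows have at least three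
  ones, and for the others the exponential rate is negative. So dependence is unlikely before
  \<open>alpha_star\<close>.

  For the 2-core, condition on the row weights and place the unit entries independently; rows
  without repeated entries then have the right law, and they occur with probability bounded away
  from \<open>0\<close>. Deleting one entry at a time, entries are either
  forced (their row is being deleted) and then uniform among the remaining ones, or alone in their
  column. Hence the number of \<open>k\<close>-tuples of remaining entries that share a column is, after
  normalisation, a martingale, and it concentrates. This determines the size of the core and the
  number of its nonzero columns: the deletion stops near a zero \<open>y\<close> of the density of light entries, and
  \<open>psi y\<close> is the limiting excess of nonzero columns over rows of the core, divided by \<open>n\<close>. A core with
  more rows than nonzero columns contains a dependence, which bounds the first dependence from above.\<close>

subsection \<open>The threshold of the 2-core\<close>

text \<open>Below \<open>alpha_star\<close> the exponential rate is not uniformly negative: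
  \<open>objective r \<alpha> (1/2) = 1\<close> for every \<alpha>, so the characters near \<gamma>
  = 1/2 give no decay by themselves. The mean count minus \<open>1\<close> is therefore expanded by
  the number \<open>k\<close> of rows in a relation. For \<open>k\<close> up to a small multiple of
  \<open>n\<close> the parities of at least \<open>3 * k\<close> entries are counted directly; for
  larger \<open>k\<close> the characters near \<gamma> = 1/2 are harmless, because the
  \<open>k\<close>-th power of their mean is exponentially small, and only the remaining characters
  are left to the rate. In the deletion, a limit theorem for trajectories is avoided. The
  martingales are evaluated at finitely many fixed times, Bonferroni expansions recover the numbers
  of heavy cells and columns, and a Lipschitz bound reaches the random stopping time between two
  such times. The compensating factor is itself random, but nearly deterministic, since a row of
  weight \<open>w\<close> makes one unforced step and \<open>w - 1\<close> forced ones. Random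
  weights are handled by taking, for each \<open>n\<close>, the least favourable weights with small
  total deviation from \<open>r\<close>; this leaves one deterministic sequence of weights.\<close>

lemma threshold_ratio_deriv:
  fixes c x :: real
  assumes "c < 1" "0 < c" "x < 1"
  shows "((\<lambda>x. x / (1 - c * x) + ln (1 - x)) has_real_derivative
           x * (2 * c - 1 - c\<^sup>2 * x) / ((1 - c * x)\<^sup>2 * (1 - x))) (at x)"
proof -
  have cx: "1 - c * x > 0"
  proof (cases "x \<le> 0")
    case True then have "c * x \<le> 0" using assms by (simp add: mult_nonneg_nonpos)
    then show ?thesis by linarith
  next
    case False
    then have "c * x < 1 * 1" using assms by (intro mult_strict_mono) auto
    then show ?thesis by simp
  qed
  have "((\<lambda>x. x / (1 - c * x) + ln (1 - x)) has_real_derivative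
      (1 * (1 - c * x) - x * (0 - c * 1)) / (1 - c * x)^2 + (1 / (1 - x)) * (0 - 1)) (at x)"
    using cx assms by (auto intro!: derivative_eq_intros simp: power2_eq_square)
  moreover have "(1 * (1 - c * x) - x * (0 - c * 1)) / (1 - c * x)^2 + (1 / (1 - x)) * (0 - 1)
      = x * (2 * c - 1 - c\<^sup>2 * x) / ((1 - c * x)\<^sup>2 * (1 - x))"
    using cx assms by (simp add: divide_simps) (simp add: algebra_simps power2_eq_square)
  ultimately show ?thesis by simp
qed

text \<open>Dividing \<open>psi\<close> by the positive factor \<open>1 - c * x\<close> frees the
  logarithm of its coefficient. The derivative of the quotient is then rational, and for positive
  \<open>x\<close> its sign is that of a linear function.\<close>

lemma psi_factor:
  assumes "1 \<le> r" "0 \<le> x" "x < 1"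
  defines "c \<equiv> 1 - 1 / real r"
  shows "psi r x = (1 - c * x) * (x / (1 - c * x) + ln (1 - x))" "0 < 1 - c * x"
proof -
  have "c * x \<le> 1 * x" using assms by (intro mult_right_mono) auto
  then show "0 < 1 - c * x" using assms by simp
  then show "psi r x = (1 - c * x) * (x / (1 - c * x) + ln (1 - x))"
    by (simp add: psi_def distrib_left) (simp add: c_def algebra_simps)
qed

text \<open>The quotient from \<open>psi_factor\<close> vanishes at \<open>0\<close>, increases up
  to one critical point and decreases afterwards; so it is positive before any point where it is
  nonnegative. The hypothesis \<open>3 \<le> r\<close> puts the critical point to the right of
  \<open>0\<close>.\<close>

lemma psi_pos_below:
  assumes r: "3 \<le> r" and xy: "0 < x" "x < y" "y < 1" and y: "0 \<le> psi r y"
  shows "0 < psi r x"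
proof -
  define c where "c = 1 - 1 / real r"
  define \<phi> where "\<phi> = (\<lambda>x::real. x / (1 - c * x) + ln (1 - x))"
  have c: "0 < c" "c < 1" "2 * c - 1 > 0" using r by (auto simp: c_def field_simps)
  \<comment> \<open>The zero of the numerator of the derivative.\<close>
  define x1 where "x1 = (2 * c - 1) / c\<^sup>2"
  have pf: "psi r z = (1 - c * z) * \<phi> z \<and> 0 < 1 - c * z" if "0 \<le> z" "z < 1" for z
    using psi_factor[of r z] r that by (simp add: c_def \<phi>_def)
  have der: "(\<phi> has_real_derivative z * (2 * c - 1 - c\<^sup>2 * z) / ((1 - c * z)\<^sup>2 * (1 - z))) (at z)"
    if "z < 1" for z
    unfolding \<phi>_def using threshold_ratio_deriv[of c z] c that by simp
  have cont: "continuous_on A \<phi>" if "A \<subseteq> {..<1}" for A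
    using der that by (intro continuous_at_imp_continuous_on ballI) (auto intro!: DERIV_isCont)
  have inc: "\<phi> u < \<phi> v" if "0 \<le> u" "u < v" "v \<le> x1" "v < 1" for u v
  proof (rule DERIV_pos_imp_increasing_open[OF that(2)])
    show "continuous_on {u..v} \<phi>" using that by (intro cont) auto
    fix z assume z: "u < z" "z < v"
    have "c\<^sup>2 * z < c\<^sup>2 * x1" using z that c by (intro mult_strict_left_mono) auto
    then have "2 * c - 1 - c\<^sup>2 * z > 0" using c by (simp add: x1_def)
    moreover have "0 < 1 - c * z" using pf[of z] z that by auto
    ultimately have "z * (2 * c - 1 - c\<^sup>2 * z) / ((1 - c * z)\<^sup>2 * (1 - z)) > 0"
      using z that by (intro divide_pos_pos mult_pos_pos) auto
    then show "\<exists>d. DERIV \<phi> z :> d \<and> d > 0" using der[of z] z that by auto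
  qed
  have dec: "\<phi> v < \<phi> u" if "0 \<le> u" "x1 \<le> u" "u < v" "v < 1" for u v
  proof (rule DERIV_neg_imp_decreasing_open[OF that(3)])
    show "continuous_on {u..v} \<phi>" using that by (intro cont) auto
    fix z assume z: "u < z" "z < v"
    have "c\<^sup>2 * x1 < c\<^sup>2 * z" using z that c by (intro mult_strict_left_mono) auto
    then have "2 * c - 1 - c\<^sup>2 * z < 0" using c by (simp add: x1_def)
    moreover have "0 < 1 - c * z" using pf[of z] z that by auto
    ultimately have "z * (2 * c - 1 - c\<^sup>2 * z) / ((1 - c * z)\<^sup>2 * (1 - z)) < 0"
      using z that by (intro divide_neg_pos mult_pos_neg mult_pos_pos) auto
    then show "\<exists>d. DERIV \<phi> z :> d \<and> d < 0" using der[of z] z that by auto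
  qed
  have "0 \<le> \<phi> y" using y pf[of y] xy by (simp add: zero_le_mult_iff)
  moreover have "\<phi> 0 = 0" by (simp add: \<phi>_def)
  ultimately have "0 < \<phi> x"
    using inc[of x y] inc[of 0 x] dec[of x y] xy
    by (cases "y \<le> x1"; cases "x \<le> x1") (auto)
  then show ?thesis using pf[of x] xy by simp
qed

lemma psi_neg_near_one:
  assumes r: "1 \<le> r"
  obtains x where "0 < x" "x < 1" "psi r x < 0"
proof
  \<comment> \<open>Chosen so that \<open>ln (1 - x) = - r - 1\<close>, while
    \<open>1 - c * x \<ge> 1 / r\<close> keeps the rational part at most \<open>r\<close>.\<close>
  define x where "x = 1 - exp (- real r - 1)"
  define c where "c = 1 - 1 / real r"
  show x: "0 < x" "x < 1" by (auto simp: x_def)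
  have pf: "psi r x = (1 - c * x) * (x / (1 - c * x) + ln (1 - x))" "0 < 1 - c * x"
    using psi_factor[of r x] r x by (simp_all add: c_def)
  have "c * x \<le> c * 1" using r x by (intro mult_left_mono) (auto simp: c_def)
  then have "1 / real r \<le> 1 - c * x" by (simp add: c_def)
  then have "1 \<le> real r * (1 - c * x)" using r by (simp add: field_simps)
  then have "x \<le> real r * (1 - c * x)" using x by linarith
  then have "x / (1 - c * x) \<le> real r"
    using pf(2) by (simp add: divide_simps)
  then have "x / (1 - c * x) + ln (1 - x) < 0" by (simp add: x_def)
  then show "psi r x < 0" using pf by (simp add: mult_pos_neg)
qed

lemma threshold_h_pos:
  assumes "1 \<le> r" "0 < x" "x < 1" shows "0 < threshold_h r x"
  using assms by (auto simp: threshold_h_def divide_less_0_iff)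

text \<open>The lower bound tends to infinity at \<open>1\<close>, so it keeps the sublevel sets of
  \<open>threshold_h r\<close> away from \<open>1\<close>.\<close>

lemma threshold_h_ge:
  assumes "1 \<le> r" "0 < x" "x < 1" shows "- ln (1 - x) / real r \<le> threshold_h r x"
proof -
  have "real r * x ^ (r - 1) \<le> real r * 1"
    using assms by (intro mult_left_mono power_le_one) auto
  moreover have "0 < real r * x ^ (r - 1)" using assms by simp
  ultimately have "- ln (1 - x) / real r \<le> - ln (1 - x) / (real r * x ^ (r - 1))"
    using assms by (intro divide_left_mono) auto
  then show ?thesis by (simp add: threshold_h_def)
qed

lemma continuous_on_threshold_h: "1 \<le> r \<Longrightarrow> continuous_on {0<..<1} (threshold_h r)"
  unfolding threshold_h_def by (intro continuous_intros) auto

text \<open>The supremum in \<open>g_star\<close> is over a subset of an open interval. By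
  \<open>threshold_h_ge\<close> the part of this set to the right of \<open>x0\<close> lies in a
  compact interval, so the supremum is a maximum.\<close>

lemma g_star_attained:
  assumes r: "1 \<le> r" and ex: "0 < x0" "x0 < 1" "threshold_h r x0 \<le> \<alpha>"
  shows "0 < g_star r \<alpha>" "g_star r \<alpha> < 1" "threshold_h r (g_star r \<alpha>) \<le> \<alpha>" "x0 \<le> g_star r \<alpha>"
proof -
  define S where "S = {x. 0 < x \<and> x < 1 \<and> threshold_h r x \<le> \<alpha>}"
  define T where "T = {x0..1 - exp (- real r * \<alpha>)} \<inter> {x. threshold_h r x \<le> \<alpha>}"
  have x0S: "x0 \<in> S" using ex by (simp add: S_def)
  have bound: "x \<le> 1 - exp (- real r * \<alpha>)" if "x \<in> S" for x
  proof -
    have "- ln (1 - x) / real r \<le> \<alpha>"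
      using threshold_h_ge[of r x] that r by (auto simp: S_def)
    then have "- real r * \<alpha> \<le> ln (1 - x)" using r by (simp add: field_simps)
    then show ?thesis using that by (simp add: S_def ln_ge_iff)
  qed
  have "{x0..1 - exp (- real r * \<alpha>)} \<subseteq> {0<..<1}"
  proof
    fix x assume "x \<in> {x0..1 - exp (- real r * \<alpha>)}"
    moreover have "0 < exp (- real r * \<alpha>)" by simp
    ultimately show "x \<in> {0<..<1}" using ex(1) unfolding atLeastAtMost_iff greaterThanLessThan_iff by linarith
  qed
  with continuous_on_threshold_h[OF r]
  have "continuous_on {x0..1 - exp (- real r * \<alpha>)} (threshold_h r)"
    by (rule continuous_on_subset)
  then have "closed ({x \<in> {x0..1 - exp (- real r * \<alpha>)}. threshold_h r x \<le> \<alpha>})"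
    by (intro continuous_on_closed_Collect_le) (auto intro: continuous_intros)
  then have "closed T" by (simp add: T_def Int_def)
  have x0T: "x0 \<in> T" using ex bound[OF x0S] by (auto simp: T_def)
  have bdd: "bdd_above T" by (auto simp: T_def bdd_above_def)
  have "Sup T \<in> T" by (rule closed_contains_Sup) (use x0T bdd \<open>closed T\<close> in auto)
  then have ST: "Sup T \<in> S" using ex by (auto simp: T_def S_def intro: le_less_trans)
  have "Sup S = Sup T"
  proof (rule antisym)
    show "Sup S \<le> Sup T"
    proof (rule cSup_least)
      show "S \<noteq> {}" using x0S by auto
      fix x assume "x \<in> S"
      show "x \<le> Sup T"
      proof (cases "x0 \<le> x")
        case True
        then have "x \<in> T" using \<open>x \<in> S\<close> bound by (auto simp: T_def S_def)
        then show ?thesis using bdd by (rule cSup_upper)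
      next
        case False then show ?thesis using cSup_upper[OF x0T bdd] by simp
      qed
    qed
    show "Sup T \<le> Sup S" using ST by (rule cSup_upper) (auto simp: S_def bdd_above_def intro: less_imp_le)
  qed
  then have g: "g_star r \<alpha> = Sup T"
    using x0S unfolding g_star_def S_def[symmetric] Let_def by auto
  show "0 < g_star r \<alpha>" "g_star r \<alpha> < 1" "threshold_h r (g_star r \<alpha>) \<le> \<alpha>" "x0 \<le> g_star r \<alpha>"
    using ST cSup_upper[OF x0T bdd] by (auto simp: g S_def)
qed

text \<open>By continuity at \<open>g_star r \<alpha>\<close>, a point slightly to its right still
  has a value of \<open>threshold_h\<close> below \<beta>.\<close>

lemma g_star_strict_mono:
  assumes r: "1 \<le> r" and ex: "0 < x0" "x0 < 1" "threshold_h r x0 \<le> \<alpha>" and "\<alpha> < \<beta>"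
  shows "g_star r \<alpha> < g_star r \<beta>"
proof -
  let ?g = "g_star r \<alpha>"
  note g = g_star_attained[OF r ex]
  have "continuous (at ?g) (threshold_h r)"
    using continuous_on_threshold_h[OF r] g by (simp add: continuous_on_eq_continuous_at)
  then have "\<forall>\<^sub>F x in at ?g. threshold_h r x < \<beta>"
    using g(3) \<open>\<alpha> < \<beta>\<close> by (intro order_tendstoD(2)[of _ "threshold_h r ?g"]) (auto simp: continuous_at)
  then obtain d where d: "d > 0" "\<And>x. x \<noteq> ?g \<Longrightarrow> dist x ?g < d \<Longrightarrow> threshold_h r x < \<beta>"
    by (auto simp: eventually_at)
  define x where "x = ?g + min (d/2) ((1 - ?g)/2)"
  have x: "?g < x" "x < 1" "dist x ?g < d" using d(1) g(2)
    by (auto simp: x_def dist_real_def min_def field_simps split: if_splits)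
  then have "threshold_h r x \<le> \<beta>" using d(2)[of x] by auto
  then have "x \<le> g_star r \<beta>" using g_star_attained(4)[of r x \<beta>] r x g(1) by simp
  then show ?thesis using x by simp
qed

lemma alpha_sharp_less_iff:
  assumes r: "1 \<le> r"
  shows "alpha_sharp r < \<alpha> \<longleftrightarrow> (\<exists>x. 0 < x \<and> x < 1 \<and> threshold_h r x < \<alpha>)"
proof -
  have "bdd_below (threshold_h r ` {0<..<1})"
    by (rule bdd_belowI[of _ 0]) (auto intro!: less_imp_le[OF threshold_h_pos[OF r]])
  then show ?thesis unfolding alpha_sharp_def
    by (subst cINF_less_iff) auto
qed

lemma alpha_sharp_nonneg: "1 \<le> r \<Longrightarrow> 0 \<le> alpha_sharp r"
  unfolding alpha_sharp_def
  by (intro cINF_greatest) (auto intro!: less_imp_le[OF threshold_h_pos])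

text \<open>Both regimes are governed by \<open>psi_pos_below\<close>: on the lower side every fixed point \<open>y\<close> of the
  peeling equation lies strictly below a point with \<open>psi \<ge> 0\<close>.\<close>

lemma alpha_under_nonneg_nonempty:
  assumes r: "3 \<le> r"
  shows "{\<alpha>. alpha_sharp r < \<alpha> \<and> psi r (g_star r \<alpha>) < 0} \<noteq> {}" "0 \<le> alpha_under r"
    "bdd_below {\<alpha>. alpha_sharp r < \<alpha> \<and> psi r (g_star r \<alpha>) < 0}"
proof -
  have r1: "1 \<le> r" using r by simp
  obtain x where x: "0 < x" "x < 1" "psi r x < 0" using psi_neg_near_one[of r] r by auto
  define \<alpha> where "\<alpha> = threshold_h r x + 1"
  have sh: "alpha_sharp r < \<alpha>" using x alpha_sharp_less_iff[of r \<alpha>] r by (auto simp: \<alpha>_def)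
  have hx: "threshold_h r x \<le> \<alpha>" by (simp add: \<alpha>_def)
  note g = g_star_attained[OF r1 x(1,2) hx]
  \<comment> \<open>Were \<open>psi\<close> nonnegative at \<open>g_star r \<alpha> \<ge> x\<close>,
    it would be nonnegative at \<open>x\<close> as well.\<close>
  have "psi r (g_star r \<alpha>) < 0"
    using psi_pos_below[OF r x(1) _ g(2)] g(4) x(3) by (cases "x = g_star r \<alpha>") force+
  then show ne: "{\<alpha>. alpha_sharp r < \<alpha> \<and> psi r (g_star r \<alpha>) < 0} \<noteq> {}" using sh by auto
  show "bdd_below {\<alpha>. alpha_sharp r < \<alpha> \<and> psi r (g_star r \<alpha>) < 0}"
    by (rule bdd_belowI[of _ "alpha_sharp r"]) auto
  have "alpha_sharp r \<le> alpha_under r" unfolding alpha_under_def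
    by (rule cInf_greatest[OF ne]) auto
  then show "0 \<le> alpha_under r" using alpha_sharp_nonneg[OF r1] by simp
qed

lemma psi_pos_of_less_alpha_under:
  assumes r: "3 \<le> r" and \<alpha>: "\<alpha> < alpha_under r" and y: "0 < y" "y < 1" "threshold_h r y \<le> \<alpha>"
  shows "0 < psi r y"
proof -
  have r1: "1 \<le> r" using r by simp
  \<comment> \<open>The room between \<alpha> and \<beta> puts \<open>y\<close> strictly below
    \<open>g_star r \<beta>\<close>, which turns \<open>0 \<le> psi\<close> there into strict
    positivity at \<open>y\<close>.\<close>
  obtain \<beta> where \<beta>: "\<alpha> < \<beta>" "\<beta> < alpha_under r" using \<alpha> dense by blast
  have "alpha_sharp r < \<beta>" using y \<beta> by (subst alpha_sharp_less_iff[OF r1]) force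
  then have "0 \<le> psi r (g_star r \<beta>)"
    using \<beta>(2) cInf_lower[OF _ alpha_under_nonneg_nonempty(3)[OF r], of \<beta>]
    unfolding alpha_under_def by (simp, meson not_le)
  moreover have "threshold_h r y \<le> \<beta>" using y \<beta> by simp
  ultimately show ?thesis
    using g_star_strict_mono[OF r1 y \<beta>(1)] g_star_attained[OF r1 y] g_star_attained[OF r1 y(1,2), of \<beta>]
      psi_pos_below[OF r y(1), of "g_star r \<beta>"] by auto
qed

text \<open>The point \<open>y\<close> serves as a barrier for the deletion:
  \<open>threshold_h r y < \<alpha>\<close> makes the density of light cells negative there, so the
  deletion stops earlier, and the sign of \<open>psi\<close> from \<open>y\<close> on decides
  between rows and columns wherever it stops.\<close>

lemma psi_neg_of_greater_alpha_under:
  assumes r: "3 \<le> r" and \<alpha>: "alpha_under r < \<alpha>"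
  obtains y where "0 < y" "y < 1" "threshold_h r y < \<alpha>" "\<And>x. y \<le> x \<Longrightarrow> x < 1 \<Longrightarrow> psi r x < 0"
proof -
  have r1: "1 \<le> r" using r by simp
  obtain \<beta> where \<beta>: "alpha_sharp r < \<beta>" "psi r (g_star r \<beta>) < 0" "\<beta> < \<alpha>"
    using \<alpha> cInf_less_iff[OF alpha_under_nonneg_nonempty(1,3)[OF r]] unfolding alpha_under_def by auto
  then obtain x where x: "0 < x" "x < 1" "threshold_h r x \<le> \<beta>"
    using alpha_sharp_less_iff[OF r1] by (meson less_imp_le)
  note g = g_star_attained[OF r1 x]
  show ?thesis
  proof
    show "0 < g_star r \<beta>" "g_star r \<beta> < 1" "threshold_h r (g_star r \<beta>) < \<alpha>" using g \<beta> by auto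
    fix z assume "g_star r \<beta> \<le> z" "z < 1"
    then show "psi r z < 0" using psi_pos_below[OF r g(1), of z] \<beta>(2)
      by (cases "z = g_star r \<beta>") force+
  qed
qed

subsection \<open>Deletion in random configurations\<close>

text \<open>A configuration puts each cell (unit entry) independently into a uniform column. Deletion is
  slowed down to one cell per step: once a cell of a row is removed, the other cells of this row are
  pending and are removed next (\<open>forced\<close> steps); otherwise a cell that is alone in its column is
  removed, which starts the deletion of a new row. The factor \<open>growth\<close> compensates the mean loss of
  coincidences in forced steps and makes \<open>growth * coincidences\<close> a martingale.\<close>

locale cell_system =
  fixes Z :: "'c set" and row :: "'c \<Rightarrow> nat" and n :: nat
  assumes finite_Z: "finite Z" and n_pos: "0 < n"
begin

definition configs :: "('c \<Rightarrow> nat) set" where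
  "configs = Z \<rightarrow>\<^sub>E {..<n}"

definition mean :: "(('c \<Rightarrow> nat) \<Rightarrow> real) \<Rightarrow> real" where
  "mean f = (\<Sum>c\<in>configs. f c) / real n ^ card Z"

definition deg :: "('c \<Rightarrow> nat) \<Rightarrow> 'c set \<Rightarrow> nat \<Rightarrow> nat" where
  "deg c C j = card {x \<in> C. c x = j}"

definition pending :: "'c set \<Rightarrow> 'c set" where
  "pending C = {x \<in> C. \<exists>y\<in>Z - C. row y = row x}"

text \<open>The choice depends on the set \<open>C\<close> alone and never on the configuration; the
  exchange argument for forced steps rests on this.\<close>

definition pending_cell :: "'c set \<Rightarrow> 'c" where
  "pending_cell C = (SOME x. x \<in> pending C)"

definition next_cell :: "('c \<Rightarrow> nat) \<Rightarrow> 'c set \<Rightarrow> 'c option" where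
  "next_cell c C =
     (if pending C \<noteq> {} then Some (pending_cell C)
      else if \<exists>j. deg c C j = 1 then Some (THE x. x \<in> C \<and> c x = (LEAST j. deg c C j = 1))
      else None)"

definition remove_next :: "('c \<Rightarrow> nat) \<Rightarrow> 'c set \<Rightarrow> 'c set" where
  "remove_next c C = (case next_cell c C of None \<Rightarrow> C | Some x \<Rightarrow> C - {x})"

definition remaining :: "('c \<Rightarrow> nat) \<Rightarrow> nat \<Rightarrow> 'c set" where
  "remaining c t = (remove_next c ^^ t) Z"

text \<open>A binomial moment of the degrees. For \<open>2 \<le> k\<close> a column of degree one
  contributes nothing, so only forced steps change it.\<close>

definition coincidences :: "nat \<Rightarrow> ('c \<Rightarrow> nat) \<Rightarrow> 'c set \<Rightarrow> real" where
  "coincidences k c C = (\<Sum>j<n. real (deg c C j choose k))"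

definition forced :: "('c \<Rightarrow> nat) \<Rightarrow> nat \<Rightarrow> bool" where
  "forced c t \<longleftrightarrow> pending (remaining c t) \<noteq> {}"

definition growth :: "nat \<Rightarrow> ('c \<Rightarrow> nat) \<Rightarrow> nat \<Rightarrow> real" where
  "growth k c t = (\<Prod>s<t. if forced c s
     then real (card (remaining c s)) / (real (card (remaining c s)) - real k) else 1)"

lemma remaining_0 [simp]: "remaining c 0 = Z"
  by (simp add: remaining_def)

lemma remaining_Suc: "remaining c (Suc t) = remove_next c (remaining c t)"
  by (simp add: remaining_def)

lemma remove_next_subset: "remove_next c C \<subseteq> C"
  by (auto simp: remove_next_def split: option.splits)

lemma remaining_antimono: "s \<le> t \<Longrightarrow> remaining c t \<subseteq> remaining c s"
  by (induction t rule: dec_induct) (use remove_next_subset in \<open>auto simp: remaining_Suc\<close>)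

lemma remaining_subset: "remaining c t \<subseteq> Z"
  using remaining_antimono[of 0 t c] by simp

lemma finite_remaining [simp]: "finite (remaining c t)"
  using remaining_subset finite_Z finite_subset by blast

lemma finite_configs [simp]: "finite configs"
  by (simp add: configs_def finite_Z finite_PiE)

lemma card_configs: "card configs = n ^ card Z"
  by (simp add: configs_def finite_Z card_PiE)

lemma pending_cell_in: "pending C \<noteq> {} \<Longrightarrow> pending_cell C \<in> C"
  unfolding pending_cell_def using someI_ex[of "\<lambda>x. x \<in> pending C"] by (auto simp: pending_def)

lemma light_cell:
  assumes "\<exists>j. deg c C j = 1"
  defines "j0 \<equiv> LEAST j. deg c C j = 1"
  obtains x where "x \<in> C" "c x = j0" "{y \<in> C. c y = j0} = {x}" "deg c C j0 = 1"
    "(THE x. x \<in> C \<and> c x = j0) = x"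
proof -
  have d: "deg c C j0 = 1" unfolding j0_def using assms(1) by (rule LeastI_ex)
  then obtain x where x: "{y \<in> C. c y = j0} = {x}" unfolding deg_def by (meson card_1_singletonE)
  then have "x \<in> C" "c x = j0" by auto
  moreover have "(THE x. x \<in> C \<and> c x = j0) = x" using x by (intro the_equality) auto
  ultimately show ?thesis using that x d by blast
qed

lemma next_cell_in: "next_cell c C = Some x \<Longrightarrow> x \<in> C"
  using pending_cell_in[of C] light_cell[of c C "x \<in> C"] by (auto simp: next_cell_def split: if_splits)

lemma next_cell_light:
  assumes "next_cell c C = Some x" "pending C = {}"
  shows "deg c C (c x) = 1"
  using assms light_cell[of c C] by (auto simp: next_cell_def split: if_splits) metis

lemma deg_remove:
  assumes "finite C" "x \<in> C"
  shows "deg c (C - {x}) j = (if j = c x then deg c C j - 1 else deg c C j)"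
proof -
  have "{y \<in> C - {x}. c y = j} = (if j = c x then {y \<in> C. c y = j} - {x} else {y \<in> C. c y = j})"
    by auto
  then show ?thesis using assms by (auto simp: deg_def)
qed

lemma deg_pos: "finite C \<Longrightarrow> x \<in> C \<Longrightarrow> 0 < deg c C (c x)"
  by (auto simp: deg_def card_gt_0_iff)

lemma deg_swap:
  assumes "y \<in> C" "z \<in> C"
  shows "deg (c \<circ> Transposition.transpose y z) C j = deg c C j"
proof -
  have "bij_betw (Transposition.transpose y z) {x \<in> C. (c \<circ> Transposition.transpose y z) x = j} {x \<in> C. c x = j}"
    by (rule bij_betw_byWitness[where f' = "Transposition.transpose y z"])
       (use assms in \<open>auto simp: Transposition.transpose_def\<close>)
  then show ?thesis by (auto simp: deg_def dest: bij_betw_same_card)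
qed

text \<open>An unforced step sees the configuration only through the degrees in \<open>C\<close>,
  which a swap inside \<open>C\<close> preserves, and through the lone cell, which is not swapped
  because \<open>y\<close> and \<open>z\<close> survive the step.\<close>

lemma remove_next_swap:
  assumes "y \<in> remove_next c C" "z \<in> remove_next c C"
  shows "remove_next (c \<circ> Transposition.transpose y z) C = remove_next c C"
proof -
  have yz: "y \<in> C" "z \<in> C" using assms remove_next_subset by blast+
  note d = deg_swap[OF yz, of c]
  show ?thesis
  proof (cases "pending C = {} \<and> (\<exists>j. deg c C j = 1)")
    case True
    define j0 where "j0 = (LEAST j. deg c C j = 1)"
    obtain x where x: "x \<in> C" "c x = j0" "{y \<in> C. c y = j0} = {x}" "(THE x. x \<in> C \<and> c x = j0) = x"
      using True light_cell[of c C] unfolding j0_def by blast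
    have r: "remove_next c C = C - {x}"
      using True x by (simp add: remove_next_def next_cell_def j0_def)
    then have "x \<noteq> y" "x \<noteq> z" using assms by auto
    then have cx: "(c \<circ> Transposition.transpose y z) x = j0" using x by (simp add: Transposition.transpose_def)
    have ex: "\<exists>j. deg (c \<circ> Transposition.transpose y z) C j = 1" using True by (simp only: d)
    have eq: "(LEAST j. deg (c \<circ> Transposition.transpose y z) C j = 1) = j0" by (simp only: d j0_def)
    obtain x' where x': "x' \<in> C" "{w \<in> C. (c \<circ> Transposition.transpose y z) w = j0} = {x'}"
      "(THE x. x \<in> C \<and> (c \<circ> Transposition.transpose y z) x = j0) = x'"
      using light_cell[OF ex] unfolding eq by blast
    have "x \<in> {w \<in> C. (c \<circ> Transposition.transpose y z) w = j0}" using cx x(1) by (simp only: mem_Collect_eq simp_thms)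
    then have "x' = x" unfolding x'(2) by simp
    then show ?thesis using r True x'
      by (simp add: remove_next_def next_cell_def j0_def d)
  next
    case False
    then show ?thesis by (auto simp: remove_next_def next_cell_def d)
  qed
qed

lemma remaining_swap:
  assumes "y \<in> remaining c t" "z \<in> remaining c t" "s \<le> t"
  shows "remaining (c \<circ> Transposition.transpose y z) s = remaining c s"
  using assms(3)
proof (induction s)
  case (Suc s)
  have "y \<in> remaining c (Suc s)" "z \<in> remaining c (Suc s)"
    using assms remaining_antimono[OF Suc.prems] by blast+
  then show ?case using Suc remove_next_swap[of y c "remaining c s" z]
    unfolding remaining_Suc by (simp del: comp_apply add: Suc_leD)
qed simp

lemma swap_in_configs: "c \<in> configs \<Longrightarrow> y \<in> Z \<Longrightarrow> z \<in> Z \<Longrightarrow> c \<circ> Transposition.transpose y z \<in> configs"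
  unfolding configs_def by (auto simp: PiE_iff extensional_def Transposition.transpose_def)

text \<open>Swapping two cells that are still present does not change the history of the process, so a
  forced removal hits each of the remaining cells with equal probability.\<close>

lemma sum_forced_removal:
  assumes G: "\<And>c y z. y \<in> remaining c t \<Longrightarrow> z \<in> remaining c t \<Longrightarrow> G (c \<circ> Transposition.transpose y z) = (G c :: real)"
    and \<phi>: "\<And>c y z. y \<in> remaining c t \<Longrightarrow> z \<in> remaining c t \<Longrightarrow> \<phi> (c \<circ> Transposition.transpose y z) y = (\<phi> c z :: real)"
  shows "(\<Sum>c\<in>{c \<in> configs. forced c t}. G c * \<phi> c (pending_cell (remaining c t)))
       = (\<Sum>c\<in>{c \<in> configs. forced c t}. G c * (\<Sum>z\<in>remaining c t. \<phi> c z) / real (card (remaining c t)))"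
proof -
  let ?F = "{c \<in> configs. forced c t}"
  let ?R = "\<lambda>c. remaining c t"
  let ?y = "\<lambda>c. pending_cell (?R c)"
  \<comment> \<open>An involution on the pairs of a forced configuration and a remaining cell, since
    the swap changes neither the remaining set nor the pending cell. It exchanges the value of
    \<phi> at \<open>z\<close> with that at the pending cell.\<close>
  let ?h = "\<lambda>(c, z). (c \<circ> Transposition.transpose (?y c) z, z)"
  have y: "?y c \<in> ?R c" if "c \<in> ?F" for c
    using that pending_cell_in by (auto simp: forced_def)
  have fin: "finite ?F" by simp
  have R: "?R (c \<circ> Transposition.transpose (?y c) z) = ?R c" if "c \<in> ?F" "z \<in> ?R c" for c z
    using remaining_swap[OF y[OF that(1)] that(2)] by simp
  have card_pos: "card (?R c) > 0" if "c \<in> ?F" for c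
    using y[OF that] by (auto simp: card_gt_0_iff)
  have h_in: "(c \<circ> Transposition.transpose (?y c) z) \<in> ?F" if "c \<in> ?F" "z \<in> ?R c" for c z
    using swap_in_configs[of c "?y c" z] that y[OF that(1)] R[OF that] remaining_subset
    by (auto simp: forced_def)
  have "(\<Sum>c\<in>?F . G c * (\<Sum>z\<in>?R c. \<phi> c z) / real (card (?R c)))
      = (\<Sum>(c, z)\<in>Sigma ?F ?R. G c * \<phi> c z / real (card (?R c)))"
    by (simp add: sum.Sigma[symmetric] sum_distrib_left sum_divide_distrib)
  also have "\<dots> = (\<Sum>(c, z)\<in>Sigma ?F ?R. G c * \<phi> c (?y c) / real (card (?R c)))"
  proof (rule sum.reindex_bij_witness[where i = ?h and j = ?h], goal_cases)
    case (1 a) then show ?case using R by (auto simp: comp_assoc simp del: comp_apply)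
  next
    case (2 a) then show ?case using R h_in by auto
  next
    case (3 a) then show ?case using R by (auto simp: comp_assoc simp del: comp_apply)
  next
    case (4 a) then show ?case using R h_in by auto
  next
    case (5 a)
    obtain c z where a: "a = (c, z)" "c \<in> ?F" "z \<in> ?R c" using 5 by auto
    then show ?case using R[OF a(2,3)] G[OF y[OF a(2)] a(3)] \<phi>[OF y[OF a(2)] a(3)] by simp
  qed
  also have "\<dots> = (\<Sum>c\<in>?F . \<Sum>z\<in>?R c. G c * \<phi> c (?y c) / real (card (?R c)))"
    by (simp add: sum.Sigma[symmetric])
  also have "\<dots> = (\<Sum>c\<in>?F . G c * \<phi> c (?y c))"
  proof (rule sum.cong[OF refl])
    fix c assume "c \<in> ?F"
    then have "real (card (?R c)) \<noteq> 0" using card_pos[of c] by linarith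
    then show "(\<Sum>z\<in>?R c. G c * \<phi> c (?y c) / real (card (?R c))) = G c * \<phi> c (?y c)"
      unfolding sum_constant by (simp add: field_simps)
  qed
  finally show ?thesis by simp
qed

lemma sum_over_cells:
  assumes "c \<in> configs" "C \<subseteq> Z"
  shows "(\<Sum>z\<in>C. F (deg c C (c z))) = (\<Sum>j<n. real (deg c C j) * F (deg c C j) :: real)"
proof -
  have "finite C" using assms finite_Z finite_subset by blast
  have a: "(\<Sum>j<n. \<Sum>z\<in>{x \<in> C. c x = j}. F (deg c C (c z))) = (\<Sum>z\<in>C. F (deg c C (c z)))"
    by (rule sum.group) (use assms \<open>finite C\<close> in \<open>auto simp: configs_def PiE_iff\<close>)
  have b: "(\<Sum>z\<in>{x \<in> C. c x = j}. F (deg c C (c z))) = real (deg c C j) * F (deg c C j)" for j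
    by (subst sum.cong[OF refl, of _ _ "\<lambda>_. F (deg c C j)"]) (auto simp: deg_def)
  show ?thesis using a by (simp only: b)
qed

text \<open>The sets that are lost are those containing \<open>x\<close>; in the column of
  \<open>x\<close> this is Pascal's rule.\<close>

lemma coincidences_remove:
  assumes "c \<in> configs" "C \<subseteq> Z" "x \<in> C" "1 \<le> k"
  shows "coincidences k c (C - {x}) = coincidences k c C - real ((deg c C (c x) - 1) choose (k - 1))"
proof -
  have fC: "finite C" using assms finite_Z finite_subset by blast
  have cx: "c x < n" using assms by (auto simp: configs_def PiE_iff)
  have d: "deg c C (c x) = Suc (deg c C (c x) - 1)" using deg_pos[OF fC assms(3), of c] by simp
  obtain k' where k: "k = Suc k'" using assms(4) by (cases k) auto
  have "coincidences k c (C - {x})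
      = (\<Sum>j<n. real (deg c C j choose k) - (if j = c x then real ((deg c C (c x) - 1) choose (k - 1)) else 0))"
    unfolding coincidences_def
  proof (rule sum.cong)
    fix j
    show "real (deg c (C - {x}) j choose k)
      = real (deg c C j choose k) - (if j = c x then real ((deg c C (c x) - 1) choose (k - 1)) else 0)"
      using deg_remove[OF fC assms(3), of c j] d by (cases "j = c x") (auto simp: k, metis binomial_Suc_Suc add_diff_cancel_left' of_nat_add add.commute)
  qed simp
  then show ?thesis using cx by (simp add: coincidences_def sum_subtractf)
qed

lemma remaining_stuck:
  assumes "next_cell c (remaining c s) = None" "s \<le> t"
  shows "remaining c t = remaining c s"
  using assms(2) by (induction t rule: dec_induct) (use assms(1) in \<open>auto simp: remaining_Suc remove_next_def\<close>)

lemma card_remaining: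
  assumes "\<And>s. s < t \<Longrightarrow> next_cell c (remaining c s) \<noteq> None"
  shows "card (remaining c t) = card Z - t"
  using assms
proof (induction t)
  case (Suc t)
  obtain x where x: "next_cell c (remaining c t) = Some x" using Suc.prems[of t] by auto
  then have "card (remaining c (Suc t)) = card (remaining c t) - 1"
    using next_cell_in[OF x] by (simp add: remaining_Suc remove_next_def)
  then show ?case using Suc by simp
qed simp

text \<open>A stuck state has nothing pending and persists, so a forced time never comes after it:
  all \<open>t\<close> steps have removed a cell. This makes the factors of \<open>growth\<close>
  explicit.\<close>

lemma card_remaining_forced:
  assumes "forced c t" shows "card (remaining c t) = card Z - t"
proof (rule card_remaining)
  fix s assume "s < t"
  show "next_cell c (remaining c s) \<noteq> None"
  proof
    assume a: "next_cell c (remaining c s) = None"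
    then have "remaining c t = remaining c s" using \<open>s < t\<close> by (intro remaining_stuck) auto
    with a assms show False by (auto simp: forced_def next_cell_def)
  qed
qed

lemma remaining_Suc_forced:
  "forced c t \<Longrightarrow> remaining c (Suc t) = remaining c t - {pending_cell (remaining c t)}"
  by (auto simp: remaining_Suc remove_next_def next_cell_def forced_def)

lemma coincidences_Suc_unforced:
  assumes "c \<in> configs" "\<not> forced c t" "2 \<le> k"
  shows "coincidences k c (remaining c (Suc t)) = coincidences k c (remaining c t)"
proof (cases "next_cell c (remaining c t)")
  case None then show ?thesis by (simp add: remaining_Suc remove_next_def)
next
  case (Some x)
  have "deg c (remaining c t) (c x) = 1" using next_cell_light[OF Some] assms by (simp add: forced_def)
  then show ?thesis using coincidences_remove[OF assms(1) remaining_subset next_cell_in[OF Some], of k] Some assms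
    by (simp add: remaining_Suc remove_next_def binomial_eq_0)
qed

lemma growth_swap:
  assumes "y \<in> remaining c t" "z \<in> remaining c t" "s \<le> Suc t"
  shows "growth k (c \<circ> Transposition.transpose y z) s = growth k c s"
  unfolding growth_def forced_def
  by (rule prod.cong) (use assms remaining_swap in auto)

lemma coincidences_swap:
  assumes "y \<in> remaining c t" "z \<in> remaining c t"
  shows "coincidences k (c \<circ> Transposition.transpose y z) (remaining (c \<circ> Transposition.transpose y z) t) = coincidences k c (remaining c t)"
  unfolding coincidences_def using assms by (simp add: remaining_swap deg_swap)

lemma deg_swap_at:
  assumes "y \<in> remaining c t" "z \<in> remaining c t"
  shows "deg (c \<circ> Transposition.transpose y z) (remaining (c \<circ> Transposition.transpose y z) t) ((c \<circ> Transposition.transpose y z) y)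
       = deg c (remaining c t) (c z)"
  using assms by (simp add: remaining_swap deg_swap)

lemma growth_nonneg:
  assumes "t + k < card Z" shows "1 \<le> growth k c t" "0 \<le> growth k c t"
proof -
  show "1 \<le> growth k c t" unfolding growth_def
  proof (rule prod_ge_1)
    fix s assume "s \<in> {..<t}"
    then show "1 \<le> (if forced c s
     then real (card (remaining c s)) / (real (card (remaining c s)) - real k) else 1)"
      using assms card_remaining_forced[of c s] by (auto simp: divide_simps)
  qed
  then show "0 \<le> growth k c t" by simp
qed

text \<open>A bound regardless of which steps are forced. A forced step with \<open>A + k\<close>
  remaining cells contributes \<open>1 + k / A\<close>; by Bernoulli's inequality this is at most
  \<open>(A / (A - 1)) ^ k\<close>, and these powers telescope.\<close>

lemma growth_le:
  assumes "t + k < card Z"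
  shows "growth k c t \<le> (real (card Z) / real (card Z - t - k)) ^ k"
  using assms
proof (induction t)
  case 0
  then have "1 \<le> real (card Z) / real (card Z - 0 - k)" by (simp add: field_simps)
  then show ?case by (simp add: growth_def one_le_power del: diff_zero)
next
  case (Suc t)
  define A where "A = real (card Z - t - k)"
  have A: "A \<ge> 2" using Suc.prems by (simp add: A_def)
  have A': "real (card Z - Suc t - k) = A - 1" using Suc.prems by (simp add: A_def)
  have b: "1 + real k / A \<le> (A / (A - 1)) ^ k"
  proof -
    have "1 + real k / A \<le> 1 + real k * (1 / (A - 1))" using A by (simp add: field_simps)
    also have "\<dots> \<le> (1 + 1 / (A - 1)) ^ k" using A by (intro Bernoulli_inequality) (simp add: field_simps)
    also have "1 + 1 / (A - 1) = A / (A - 1)" using A by (simp add: field_simps)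
    finally show ?thesis .
  qed
  have f: "(if forced c t then real (card (remaining c t)) / (real (card (remaining c t)) - real k) else 1)
      \<le> 1 + real k / A"
    using card_remaining_forced[of c t] Suc.prems A by (auto simp: A_def divide_simps)
  have "growth k c (Suc t) = growth k c t * (if forced c t then real (card (remaining c t)) / (real (card (remaining c t)) - real k) else 1)"
    by (simp add: growth_def)
  also have "\<dots> \<le> (real (card Z) / A) ^ k * (1 + real k / A)"
    using Suc growth_nonneg[of t k c] f A unfolding A_def[symmetric]
    by (intro mult_mono) (auto simp: A_def card_remaining_forced)
  also have "\<dots> \<le> (real (card Z) / A) ^ k * (A / (A - 1)) ^ k"
    using b A by (intro mult_left_mono) auto
  also have "\<dots> = (real (card Z) / (A - 1)) ^ k"
    using A by (simp add: power_mult_distrib[symmetric])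
  finally show ?case using A' by simp
qed

text \<open>The base \<open>8\<close> is what \<open>binomial_sq_le\<close> and \<open>binomial_tail\<close> need.\<close>

definition spread :: "('c \<Rightarrow> nat) \<Rightarrow> real" where
  "spread c = (\<Sum>j<n. 8 ^ deg c Z j)"

lemma deg_mono: "C \<subseteq> D \<Longrightarrow> D \<subseteq> Z \<Longrightarrow> deg c C j \<le> deg c D j"
  unfolding deg_def using finite_subset[OF _ finite_Z, of D] by (intro card_mono) auto

lemma binomial_sq_le: "real d * (real ((d - 1) choose k))\<^sup>2 \<le> 8 ^ d"
proof -
  have "((d - 1) choose k)\<^sup>2 \<le> (2 ^ d)\<^sup>2"
    by (intro power_mono order_trans[OF binomial_le_pow2]) auto
  then have "d * ((d - 1) choose k)\<^sup>2 \<le> 2 ^ d * (2 ^ d)\<^sup>2"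
    by (intro mult_mono) (auto intro: less_imp_le)
  also have "\<dots> = (8::nat) ^ d" by (simp add: power_mult_distrib[symmetric] power2_eq_square)
  finally show ?thesis by (metis of_nat_le_iff of_nat_mult of_nat_numeral of_nat_power)
qed

lemma mean_add: "mean (\<lambda>c. f c + g c) = mean f + mean g"
  by (simp add: mean_def sum.distrib add_divide_distrib)

lemma mean_cmult: "mean (\<lambda>c. a * f c) = a * mean f"
  by (simp add: mean_def sum_distrib_left)

lemma mean_const: "mean (\<lambda>c. a) = a"
  using n_pos by (simp add: mean_def card_configs)

lemma mean_mono: "(\<And>c. c \<in> configs \<Longrightarrow> f c \<le> g c) \<Longrightarrow> mean f \<le> mean g"
  unfolding mean_def by (intro divide_right_mono sum_mono) auto

lemma mean_cong: "(\<And>c. c \<in> configs \<Longrightarrow> f c = g c) \<Longrightarrow> mean f = mean g"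
  unfolding mean_def by (simp cong: sum.cong)

lemma mean_if_forced:
  "mean (\<lambda>c. if forced c t then f c else g c) =
     ((\<Sum>c\<in>{c\<in>configs. forced c t}. f c) + (\<Sum>c\<in>{c\<in>configs. \<not> forced c t}. g c)) / real n ^ card Z"
  unfolding mean_def by (subst sum.If_cases) (simp_all add: Int_def)

lemma times_binomial_pred: "1 \<le> k \<Longrightarrow> d * ((d - 1) choose (k - 1)) = k * (d choose k)"
  using Suc_times_binomial_eq[of "d - 1" "k - 1"] by (cases k; cases d) (simp_all add: mult.commute)

text \<open>The arithmetic of one forced removal among \<open>A\<close> cells. A fraction
  \<open>k / A\<close> of the coincidences is lost on average, which the factor
  \<open>A / (A - k)\<close> undoes exactly; in the second moment the squared factor is outweighed
  by the cross term, because \<open>A\<^sup>2 - 2 * k * A \<le> (A - k)\<^sup>2\<close>.\<close>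

lemma removal_compensation:
  fixes A k :: real
  assumes "0 \<le> k" "k < A"
  shows "g * (A / (A - k)) * x - g * (A / (A - k)) * (k * x) / A = g * x"
    "(A / (A - k))\<^sup>2 * (1 - 2 * k / A) \<le> 1"
proof -
  have "g * q * x - g * q * (k * x) / A = g * x * (q * (1 - k / A))" for q :: real
    by (simp add: algebra_simps)
  moreover have "A / (A - k) * (1 - k / A) = 1" using assms by (simp add: field_simps)
  ultimately have "g * (A / (A - k)) * x - g * (A / (A - k)) * (k * x) / A = g * x * 1" by metis
  then show "g * (A / (A - k)) * x - g * (A / (A - k)) * (k * x) / A = g * x" by simp
  have "(A / (A - k))\<^sup>2 * (1 - 2 * k / A) = (A\<^sup>2 - 2 * k * A) / (A - k)\<^sup>2"
    using assms by (simp add: power2_eq_square divide_simps) (simp add: algebra_simps)?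
  also have "\<dots> \<le> 1"
  proof -
    have "A\<^sup>2 - 2 * k * A \<le> (A - k)\<^sup>2" by (simp add: power2_diff)
    moreover have "0 < (A - k)\<^sup>2" using assms by simp
    ultimately show ?thesis by (simp add: divide_le_eq_1)
  qed
  finally show "(A / (A - k))\<^sup>2 * (1 - 2 * k / A) \<le> 1" .
qed

text \<open>The martingale property in averaged form. In a forced step
  \<open>sum_forced_removal\<close> replaces the loss at the pending cell by its average over the
  remaining cells, and the new factor of \<open>growth\<close> cancels it; an unforced step changes
  neither factor.\<close>

lemma mean_growth_coincidences:
  assumes k: "2 \<le> k" and t: "t + k < card Z"
  shows "mean (\<lambda>c. growth k c t * coincidences k c (remaining c t)) = mean (\<lambda>c. coincidences k c Z)"
  using t
proof (induction t)
  case 0 then show ?case by (simp add: growth_def)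
next
  case (Suc t)
  let ?R = "\<lambda>c. remaining c t"
  let ?A = "real (card Z - t)"
  let ?F = "{c \<in> configs. forced c t}"
  let ?q = "?A / (?A - real k)"
  let ?D = "\<lambda>c z. real ((deg c (?R c) (c z) - 1) choose (k - 1))"
  let ?y = "\<lambda>c. pending_cell (?R c)"
  have A: "?A - real k > 0" using Suc.prems by simp
  have S: "(\<Sum>c\<in>?F . growth k c (Suc t) * real ((deg c (?R c) (c (pending_cell (?R c))) - 1) choose (k - 1)))
     = (\<Sum>c\<in>?F . growth k c (Suc t) * (\<Sum>z\<in>?R c. real ((deg c (?R c) (c z) - 1) choose (k - 1))) / real (card (?R c)))"
    by (rule sum_forced_removal) (use growth_swap deg_swap_at in auto)
  have S2: "(\<Sum>z\<in>?R c. real ((deg c (?R c) (c z) - 1) choose (k - 1))) = real k * coincidences k c (?R c)"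
    if "c \<in> configs" for c
    using sum_over_cells[OF that remaining_subset[of c t], of "\<lambda>d. real ((d - 1) choose (k - 1))"] k
    by (simp add: coincidences_def sum_distrib_left times_binomial_pred[unfolded One_nat_def] flip: of_nat_mult)
  have "mean (\<lambda>c. growth k c (Suc t) * coincidences k c (remaining c (Suc t)))
     = mean (\<lambda>c. if forced c t then growth k c (Suc t) * coincidences k c (?R c)
          - growth k c (Suc t) * real ((deg c (?R c) (c (pending_cell (?R c))) - 1) choose (k - 1))
        else growth k c t * coincidences k c (?R c))"
  proof (rule mean_cong)
    fix c assume c: "c \<in> configs"
    show "growth k c (Suc t) * coincidences k c (remaining c (Suc t)) =
       (if forced c t then growth k c (Suc t) * coincidences k c (?R c)
          - growth k c (Suc t) * real ((deg c (?R c) (c (pending_cell (?R c))) - 1) choose (k - 1))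
        else growth k c t * coincidences k c (?R c))"
    proof (cases "forced c t")
      case True
      then have "pending_cell (?R c) \<in> ?R c" by (intro pending_cell_in) (simp add: forced_def)
      then have "coincidences k c (remaining c (Suc t)) = coincidences k c (?R c) - ?D c (?y c)"
        unfolding remaining_Suc_forced[OF True] using k by (intro coincidences_remove c remaining_subset) auto
      then show ?thesis using True by (simp only: if_True right_diff_distrib)
    next
      case False
      then show ?thesis using coincidences_Suc_unforced[OF c False k] by (simp add: growth_def)
    qed
  qed
  also have "\<dots> = mean (\<lambda>c. if forced c t then growth k c (Suc t) * coincidences k c (?R c)
          - growth k c (Suc t) * (real k * coincidences k c (?R c)) / real (card (?R c))
        else growth k c t * coincidences k c (?R c))"
    unfolding mean_if_forced sum_subtractf S
    by (subst sum.cong[OF refl, of ?F _ "\<lambda>c. growth k c (Suc t) * (real k * coincidences k c (?R c)) / real (card (?R c))"])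
       (use S2 in \<open>simp_all only: mem_Collect_eq\<close>)
  also have "\<dots> = mean (\<lambda>c. growth k c t * coincidences k c (?R c))"
  proof (rule mean_cong)
    fix c assume c: "c \<in> configs"
    have "growth k c t * ?q * x - growth k c t * ?q * (real k * x) / ?A = growth k c t * x" for x
      using removal_compensation(1)[of "real k" ?A "growth k c t" x] A by simp
    then show "(if forced c t then growth k c (Suc t) * coincidences k c (?R c)
          - growth k c (Suc t) * (real k * coincidences k c (?R c)) / real (card (?R c))
        else growth k c t * coincidences k c (?R c)) = growth k c t * coincidences k c (?R c)"
      using card_remaining_forced[of c t] by (simp add: growth_def)
  qed
  finally show ?case using Suc by simp
qed

text \<open>In the square of a forced step the cross term is averaged by
  \<open>sum_forced_removal\<close> and compensates the new factor of \<open>growth\<close>. What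
  remains is the mean squared jump, which is at most \<open>spread\<close> divided by the number of
  remaining cells, times the squared factor.\<close>

lemma mean_growth_coincidences_sq:
  assumes k: "2 \<le> k" and T: "T + k < card Z" and t: "t \<le> T"
  shows "mean (\<lambda>c. (growth k c t * coincidences k c (remaining c t))\<^sup>2)
      \<le> mean (\<lambda>c. (coincidences k c Z)\<^sup>2)
        + real t * ((real (card Z) / real (card Z - T - k)) ^ (2 * k) / real (card Z - T)) * mean spread"
  using t
proof (induction t)
  case 0 then show ?case by (simp add: growth_def)
next
  case (Suc t)
  let ?R = "\<lambda>c. remaining c t"
  let ?A = "real (card Z - t)"
  let ?F = "{c \<in> configs. forced c t}"
  let ?q = "?A / (?A - real k)"
  let ?D = "\<lambda>c z. real ((deg c (?R c) (c z) - 1) choose (k - 1))"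
  let ?y = "\<lambda>c. pending_cell (?R c)"
  \<comment> \<open>\<open>L\<close> bounds \<open>growth\<close> at all times up to
    \<open>T\<close>, so that every step costs the same multiple of \<open>spread\<close>.\<close>
  define L where "L = (real (card Z) / real (card Z - T - k)) ^ k"
  let ?Q = "L\<^sup>2 / real (card Z - T)"
  have A: "?A - real k > 0" using Suc.prems T by simp
  have S: "(\<Sum>c\<in>?F . (2 * (growth k c (Suc t))\<^sup>2 * coincidences k c (?R c)) * ?D c (?y c))
     = (\<Sum>c\<in>?F . (2 * (growth k c (Suc t))\<^sup>2 * coincidences k c (?R c)) * (\<Sum>z\<in>?R c. ?D c z) / real (card (?R c)))"
    by (rule sum_forced_removal) (use growth_swap deg_swap_at coincidences_swap in auto)
  have S': "(\<Sum>c\<in>?F . (growth k c (Suc t))\<^sup>2 * (?D c (?y c))\<^sup>2)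
     = (\<Sum>c\<in>?F . (growth k c (Suc t))\<^sup>2 * (\<Sum>z\<in>?R c. (?D c z)\<^sup>2) / real (card (?R c)))"
    by (rule sum_forced_removal) (use growth_swap deg_swap_at in auto)
  have S2: "(\<Sum>z\<in>?R c. ?D c z) = real k * coincidences k c (?R c)" if "c \<in> configs" for c
    using sum_over_cells[OF that remaining_subset[of c t], of "\<lambda>d. real ((d - 1) choose (k - 1))"] k
    by (simp add: coincidences_def sum_distrib_left times_binomial_pred[unfolded One_nat_def] flip: of_nat_mult)
  have S3: "(\<Sum>z\<in>?R c. (?D c z)\<^sup>2) \<le> spread c" if "c \<in> configs" for c
  proof -
    have "(\<Sum>z\<in>?R c. (?D c z)\<^sup>2) = (\<Sum>j<n. real (deg c (?R c) j) * (real ((deg c (?R c) j - 1) choose (k - 1)))\<^sup>2)"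
      using sum_over_cells[OF that remaining_subset[of c t], of "\<lambda>d. (real ((d - 1) choose (k - 1)))\<^sup>2"] by simp
    also have "\<dots> \<le> (\<Sum>j<n. 8 ^ deg c (?R c) j)" by (intro sum_mono binomial_sq_le)
    also have "\<dots> \<le> spread c" unfolding spread_def
      by (intro sum_mono power_increasing deg_mono remaining_subset) auto
    finally show ?thesis .
  qed
  have "mean (\<lambda>c. (growth k c (Suc t) * coincidences k c (remaining c (Suc t)))\<^sup>2)
     = mean (\<lambda>c. if forced c t then (growth k c (Suc t) * coincidences k c (?R c))\<^sup>2
          - (2 * (growth k c (Suc t))\<^sup>2 * coincidences k c (?R c)) * ?D c (?y c)
          + (growth k c (Suc t))\<^sup>2 * (?D c (?y c))\<^sup>2
        else (growth k c t * coincidences k c (?R c))\<^sup>2)"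
  proof (rule mean_cong)
    fix c assume c: "c \<in> configs"
    show "(growth k c (Suc t) * coincidences k c (remaining c (Suc t)))\<^sup>2 =
       (if forced c t then (growth k c (Suc t) * coincidences k c (?R c))\<^sup>2
          - (2 * (growth k c (Suc t))\<^sup>2 * coincidences k c (?R c)) * ?D c (?y c)
          + (growth k c (Suc t))\<^sup>2 * (?D c (?y c))\<^sup>2
        else (growth k c t * coincidences k c (?R c))\<^sup>2)"
    proof (cases "forced c t")
      case True
      then have "pending_cell (?R c) \<in> ?R c" by (intro pending_cell_in) (simp add: forced_def)
      then have "coincidences k c (remaining c (Suc t)) = coincidences k c (?R c) - ?D c (?y c)"
        unfolding remaining_Suc_forced[OF True] using k by (intro coincidences_remove c remaining_subset) auto
      moreover have "(g * (b - d))\<^sup>2 = (g * b)\<^sup>2 - (2 * g\<^sup>2 * b) * d + g\<^sup>2 * d\<^sup>2" for g b d :: real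
        by (simp add: power2_eq_square algebra_simps)
      ultimately show ?thesis using True by (simp only: if_True)
    next
      case False
      then show ?thesis using coincidences_Suc_unforced[OF c False k] by (simp add: growth_def)
    qed
  qed
  also have "\<dots> = mean (\<lambda>c. if forced c t then (growth k c (Suc t) * coincidences k c (?R c))\<^sup>2
          - (2 * (growth k c (Suc t))\<^sup>2 * coincidences k c (?R c)) * (real k * coincidences k c (?R c)) / real (card (?R c))
          + (growth k c (Suc t))\<^sup>2 * (\<Sum>z\<in>?R c. (?D c z)\<^sup>2) / real (card (?R c))
        else (growth k c t * coincidences k c (?R c))\<^sup>2)"
    unfolding mean_if_forced sum.distrib sum_subtractf S S'
    by (subst sum.cong[OF refl, of ?F "\<lambda>c. (2 * (growth k c (Suc t))\<^sup>2 * coincidences k c (?R c)) * (\<Sum>z\<in>?R c. ?D c z) / real (card (?R c))"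
         "\<lambda>c. (2 * (growth k c (Suc t))\<^sup>2 * coincidences k c (?R c)) * (real k * coincidences k c (?R c)) / real (card (?R c))"])
       (use S2 in \<open>simp_all only: mem_Collect_eq\<close>)
  also have "\<dots> \<le> mean (\<lambda>c. (growth k c t * coincidences k c (?R c))\<^sup>2 + ?Q * spread c)"
  proof (rule mean_mono)
    fix c assume c: "c \<in> configs"
    have spread0: "0 \<le> spread c" by (auto simp: spread_def intro: sum_nonneg)
    have Q0: "0 \<le> ?Q" by simp
    show "(if forced c t then (growth k c (Suc t) * coincidences k c (?R c))\<^sup>2
          - (2 * (growth k c (Suc t))\<^sup>2 * coincidences k c (?R c)) * (real k * coincidences k c (?R c)) / real (card (?R c))
          + (growth k c (Suc t))\<^sup>2 * (\<Sum>z\<in>?R c. (?D c z)\<^sup>2) / real (card (?R c))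
        else (growth k c t * coincidences k c (?R c))\<^sup>2) \<le> (growth k c t * coincidences k c (?R c))\<^sup>2 + ?Q * spread c"
    proof (cases "forced c t")
      case True
      let ?g = "growth k c t" and ?b = "coincidences k c (?R c)"
      have g: "growth k c (Suc t) = ?g * ?q" using True card_remaining_forced[of c t] by (simp add: growth_def)
      have "growth k c (Suc t) \<le> (real (card Z) / real (card Z - Suc t - k)) ^ k"
        using Suc.prems T by (intro growth_le) auto
      also have "\<dots> \<le> L" unfolding L_def using Suc.prems T
        by (intro power_mono divide_left_mono) auto
      finally have "(growth k c (Suc t))\<^sup>2 \<le> L\<^sup>2"
        using growth_nonneg[of "Suc t" k c] Suc.prems T by (intro power_mono) auto
      then have "(growth k c (Suc t))\<^sup>2 * (\<Sum>z\<in>?R c. (?D c z)\<^sup>2) / ?A \<le> L\<^sup>2 * spread c / real (card Z - T)"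
        using S3[OF c] spread0 Suc.prems T
        by (intro frac_le mult_mono) (auto intro: sum_nonneg)
      moreover have "?q\<^sup>2 * (1 - 2 * real k / ?A) \<le> 1"
        using removal_compensation(2)[of "real k" ?A] A by simp
      then have "(?g * ?b)\<^sup>2 * (?q\<^sup>2 * (1 - 2 * real k / ?A)) \<le> (?g * ?b)\<^sup>2 * 1"
        by (intro mult_left_mono) auto
      moreover have "(growth k c (Suc t) * ?b)\<^sup>2 - (2 * (growth k c (Suc t))\<^sup>2 * ?b) * (real k * ?b) / ?A
          = (?g * ?b)\<^sup>2 * (?q\<^sup>2 * (1 - 2 * real k / ?A))"
      proof -
        have "(g * q * b)\<^sup>2 - (2 * (g * q)\<^sup>2 * b) * (k * b) / a = (g * b)\<^sup>2 * (q\<^sup>2 * (1 - 2 * k / a))"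
          for g q b k a :: real by (simp add: power2_eq_square algebra_simps)
        then show ?thesis unfolding g .
      qed
      ultimately show ?thesis using True card_remaining_forced[of c t] by simp
    next
      case False then show ?thesis using spread0 Q0 by simp
    qed
  qed
  also have "\<dots> = mean (\<lambda>c. (growth k c t * coincidences k c (?R c))\<^sup>2) + ?Q * mean spread"
    by (simp only: mean_add mean_cmult)
  also have "\<dots> \<le> mean (\<lambda>c. (coincidences k c Z)\<^sup>2) + real t * ?Q * mean spread + ?Q * mean spread"
    using Suc by (simp add: L_def power_mult[symmetric] mult.commute)
  finally show ?case by (simp add: algebra_simps add_divide_distrib L_def power_mult[symmetric] power_even_eq)
qed

section \<open>Moments of the initial configuration, from the independence of the cells\<close>

lemma mean_prod: "mean (\<lambda>c. \<Prod>x\<in>Z. f x (c x)) = (\<Prod>x\<in>Z. (\<Sum>i<n. f x i) / real n)"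
proof -
  have "(\<Prod>x\<in>Z. (\<Sum>i<n. f x i) / real n) = (\<Prod>x\<in>Z. (\<Sum>i<n. f x i)) / real n ^ card Z"
    by (simp add: prod_dividef)
  also have "(\<Prod>x\<in>Z. (\<Sum>i<n. f x i)) = (\<Sum>c\<in>configs. \<Prod>x\<in>Z. f x (c x))"
    unfolding configs_def by (rule prod_sum_PiE) (auto simp: finite_Z)
  finally show ?thesis by (simp add: mean_def)
qed

lemma mean_sum: "finite I \<Longrightarrow> mean (\<lambda>c. \<Sum>i\<in>I. f i c) = (\<Sum>i\<in>I. mean (f i))"
  unfolding mean_def by (subst sum.swap) (simp add: sum_divide_distrib)

lemma mean_spread: "mean spread = real n * (1 + 7 / real n) ^ card Z"
proof -
  have "(8::real) ^ deg c Z j = (\<Prod>x\<in>Z. if c x = j then 8 else 1)" for c j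
    using finite_Z by (simp add: prod.If_cases deg_def Int_def)
  then have "mean spread = (\<Sum>j<n. mean (\<lambda>c. \<Prod>x\<in>Z. if c x = j then 8 else 1))"
    unfolding spread_def by (simp add: mean_sum)
  also have "\<dots> = (\<Sum>j<n. \<Prod>x\<in>Z. (\<Sum>i<n. if i = j then 8 else 1) / real n)"
    by (subst mean_prod[where f = "\<lambda>x i. if i = _ then 8 else 1"]) simp
  also have "\<dots> = (\<Sum>j<n. \<Prod>x\<in>Z. 1 + 7 / real n)"
  proof (intro sum.cong prod.cong refl)
    fix j assume "j \<in> {..<n}"
    then have "(\<Sum>i<n. if i = j then 8 else 1::real) = (\<Sum>i<n. 1 + (if i = j then 7 else 0))"
      by (intro sum.cong) auto
    also have "\<dots> = real n + 7" using \<open>j \<in> {..<n}\<close> by (subst sum.distrib) simp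
    finally show "(\<Sum>i<n. if i = j then 8 else 1::real) / real n = 1 + 7 / real n"
      using n_pos by (simp add: field_simps)
  qed
  finally show ?thesis by simp
qed

text \<open>The binomial coefficient counts the \<open>k\<close>-sets of cells that lie entirely in
  column \<open>j\<close>. Each indicator is written as a product over all of \<open>Z\<close>, the
  form to which \<open>mean_prod\<close> applies.\<close>

lemma choose_eq_sum:
  "real (deg c Z j choose k) = (\<Sum>Y\<in>{Y. Y \<subseteq> Z \<and> card Y = k}. \<Prod>x\<in>Z. if x \<in> Y \<and> c x \<noteq> j then 0 else 1)"
proof -
  have "(\<Prod>x\<in>Z. if x \<in> Y \<and> c x \<noteq> j then 0 else 1) = (if Y \<subseteq> {x \<in> Z. c x = j} then 1 else 0::real)"
    if "Y \<subseteq> Z" for Y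
  proof (cases "Y \<subseteq> {x \<in> Z. c x = j}")
    case True then show ?thesis by (auto intro!: prod.neutral)
  next
    case False
    then obtain x where x: "x \<in> Y" "\<not> (x \<in> Z \<and> c x = j)" by auto
    then have "x \<in> Z" "x \<in> Y \<and> c x \<noteq> j" using \<open>Y \<subseteq> Z\<close> by auto
    then have "\<exists>x\<in>Z. (if x \<in> Y \<and> c x \<noteq> j then 0 else 1::real) = 0" by auto
    then show ?thesis using False finite_Z by (simp add: prod_zero)
  qed
  then have "(\<Sum>Y\<in>{Y. Y \<subseteq> Z \<and> card Y = k}. \<Prod>x\<in>Z. if x \<in> Y \<and> c x \<noteq> j then 0 else 1)
     = (\<Sum>Y\<in>{Y. Y \<subseteq> Z \<and> card Y = k}. if Y \<subseteq> {x \<in> Z. c x = j} then 1 else 0::real)"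
    by (intro sum.cong) auto
  also have "\<dots> = real (card {Y. Y \<subseteq> {x \<in> Z. c x = j} \<and> card Y = k})"
    using finite_Z by (subst sum.If_cases) (auto intro!: arg_cong[where f = card])
  also have "\<dots> = real (deg c Z j choose k)"
    using n_subsets[of "{x \<in> Z. c x = j}" k] finite_Z by (simp add: deg_def)
  finally show ?thesis by simp
qed

lemma prod_fraction: "Y \<subseteq> Z \<Longrightarrow> (\<Prod>x\<in>Z. if x \<in> Y then a else 1) = (a::real) ^ card Y"
  using finite_Z by (simp add: prod.If_cases Int_absorb1)

lemma sum_indicator_one: "j < n \<Longrightarrow> (\<Sum>i<n. if i \<noteq> j then 0 else 1::real) = 1"
  by (subst sum.cong[OF refl, of _ _ "\<lambda>i. if i = j then 1 else 0"]) auto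

lemma mean_coincidences:
  "mean (\<lambda>c. coincidences k c Z) = real n * real (card Z choose k) / real n ^ k"
proof -
  have *: "mean (\<lambda>c. \<Prod>x\<in>Z. if x \<in> Y \<and> c x \<noteq> j then 0 else 1) = (1 / real n) ^ card Y"
    if "Y \<subseteq> Z" "j < n" for Y j
  proof -
    have "mean (\<lambda>c. \<Prod>x\<in>Z. if x \<in> Y \<and> c x \<noteq> j then 0 else 1)
       = (\<Prod>x\<in>Z. (\<Sum>i<n. if x \<in> Y \<and> i \<noteq> j then 0 else 1) / real n)"
      by (rule mean_prod[where f = "\<lambda>x i. if x \<in> Y \<and> i \<noteq> j then 0 else 1"])
    also have "\<dots> = (\<Prod>x\<in>Z. if x \<in> Y then 1 / real n else 1)"
    proof (rule prod.cong)
      fix x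
      have "(\<Sum>i<n. if i \<noteq> j then 0 else 1::real) = 1" using that(2) sum_indicator_one by simp
      then show "(\<Sum>i<n. if x \<in> Y \<and> i \<noteq> j then 0 else 1) / real n = (if x \<in> Y then 1 / real n else 1)"
        using n_pos by auto
    qed simp
    finally show ?thesis using prod_fraction[OF that(1)] by simp
  qed
  have fin: "finite {Y. Y \<subseteq> Z \<and> card Y = k}" using finite_Z by simp
  have "mean (\<lambda>c. coincidences k c Z)
     = (\<Sum>j<n. \<Sum>Y\<in>{Y. Y \<subseteq> Z \<and> card Y = k}. mean (\<lambda>c. \<Prod>x\<in>Z. if x \<in> Y \<and> c x \<noteq> j then 0 else 1))"
    unfolding coincidences_def choose_eq_sum by (simp add: mean_sum fin)
  also have "\<dots> = (\<Sum>j<n. \<Sum>Y\<in>{Y. Y \<subseteq> Z \<and> card Y = k}. (1 / real n) ^ k)"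
    by (intro sum.cong refl) (simp add: *)
  also have "\<dots> = real n * real (card Z choose k) / real n ^ k"
    using n_subsets[OF finite_Z, of k] by (simp add: power_divide)
  finally show ?thesis .
qed

text \<open>In two different columns, overlapping sets \<open>Y\<close> and \<open>Y'\<close> cannot
  both be complete, and disjoint ones are independent; so the off-diagonal terms are at most the
  product of the means. The diagonal is absorbed into \<open>spread\<close>.\<close>

lemma mean_coincidences_sq:
  "mean (\<lambda>c. (coincidences k c Z)\<^sup>2) \<le> (real n * real (card Z choose k) / real n ^ k)\<^sup>2 + mean spread"
proof -
  let ?P = "{Y. Y \<subseteq> Z \<and> card Y = k}"
  let ?I = "\<lambda>Y j x i. if x \<in> Y \<and> i \<noteq> j then 0 else 1::real"
  have fin: "finite ?P" using finite_Z by simp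
  have *: "mean (\<lambda>c. (\<Prod>x\<in>Z. ?I Y j x (c x)) * (\<Prod>x\<in>Z. ?I Y' j' x (c x))) \<le> (1 / real n) ^ k * (1 / real n) ^ k"
    if "Y \<in> ?P" "Y' \<in> ?P" "j < n" "j' < n" "j \<noteq> j'" for Y Y' j j'
  proof -
    have "mean (\<lambda>c. (\<Prod>x\<in>Z. ?I Y j x (c x)) * (\<Prod>x\<in>Z. ?I Y' j' x (c x)))
       = (\<Prod>x\<in>Z. (\<Sum>i<n. ?I Y j x i * ?I Y' j' x i) / real n)"
      unfolding prod.distrib[symmetric]
      by (rule mean_prod[where f = "\<lambda>x i. ?I Y j x i * ?I Y' j' x i"])
    also have "\<dots> \<le> (\<Prod>x\<in>Z. (if x \<in> Y then 1 / real n else 1) * (if x \<in> Y' then 1 / real n else 1))"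
    proof (rule prod_mono, safe)
      fix x
      show "0 \<le> (\<Sum>i<n. ?I Y j x i * ?I Y' j' x i) / real n" by (auto intro!: divide_nonneg_nonneg sum_nonneg)
      have one: "(\<Sum>i<n. if i \<noteq> l then 0 else 1::real) = 1" if "l < n" for l
        using that by (rule sum_indicator_one)
      have zero: "(\<Sum>i<n. (if i \<noteq> j then 0 else 1) * (if i \<noteq> j' then 0 else 1)::real) = 0"
        using that(5) by (intro sum.neutral) auto
      show "(\<Sum>i<n. ?I Y j x i * ?I Y' j' x i) / real n
        \<le> (if x \<in> Y then 1 / real n else 1) * (if x \<in> Y' then 1 / real n else 1)"
        using n_pos one[OF that(3)] one[OF that(4)] zero by (cases "x \<in> Y"; cases "x \<in> Y'") simp_all
    qed
    also have "\<dots> = (1 / real n) ^ k * (1 / real n) ^ k"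
      using that by (simp only: prod.distrib prod_fraction mem_Collect_eq)
    finally show ?thesis .
  qed
  have off: "mean (\<lambda>c. real (deg c Z j choose k) * real (deg c Z j' choose k))
      \<le> (real (card Z choose k) / real n ^ k)\<^sup>2" if "j < n" "j' < n" "j \<noteq> j'" for j j'
  proof -
    have "mean (\<lambda>c. real (deg c Z j choose k) * real (deg c Z j' choose k))
      = (\<Sum>Y\<in>?P. \<Sum>Y'\<in>?P. mean (\<lambda>c. (\<Prod>x\<in>Z. ?I Y j x (c x)) * (\<Prod>x\<in>Z. ?I Y' j' x (c x))))"
      unfolding choose_eq_sum sum_product by (simp add: mean_sum fin)
    also have "\<dots> \<le> (\<Sum>Y\<in>?P. \<Sum>Y'\<in>?P. (1 / real n) ^ k * (1 / real n) ^ k)"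
      by (intro sum_mono *) (use that in auto)
    also have "\<dots> = (real (card Z choose k) / real n ^ k)\<^sup>2"
      using n_subsets[OF finite_Z, of k] by (simp add: power_divide power2_eq_square)
    finally show ?thesis .
  qed
  have diag: "mean (\<lambda>c. real (deg c Z j choose k) * real (deg c Z j choose k)) \<le> mean (\<lambda>c. 8 ^ deg c Z j)" for j
  proof (rule mean_mono)
    fix c
    have "real (deg c Z j choose k) \<le> 2 ^ deg c Z j"
      by (metis binomial_le_pow2 of_nat_le_iff of_nat_numeral of_nat_power)
    then have "real (deg c Z j choose k) * real (deg c Z j choose k) \<le> 2 ^ deg c Z j * 2 ^ deg c Z j"
      by (intro mult_mono) auto
    also have "\<dots> \<le> 8 ^ deg c Z j" by (simp add: power_mult_distrib[symmetric] power_mono)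
    finally show "real (deg c Z j choose k) * real (deg c Z j choose k) \<le> 8 ^ deg c Z j" .
  qed
  have "mean (\<lambda>c. (coincidences k c Z)\<^sup>2)
      = (\<Sum>j<n. \<Sum>j'<n. mean (\<lambda>c. real (deg c Z j choose k) * real (deg c Z j' choose k)))"
    unfolding coincidences_def power2_eq_square sum_product by (simp add: mean_sum)
  also have "\<dots> \<le> (\<Sum>j<n. \<Sum>j'<n. (real (card Z choose k) / real n ^ k)\<^sup>2
      + (if j' = j then mean (\<lambda>c. 8 ^ deg c Z j) else 0))"
  proof (intro sum_mono)
    fix j j' assume "j \<in> {..<n}" "j' \<in> {..<n}"
    show "mean (\<lambda>c. real (deg c Z j choose k) * real (deg c Z j' choose k))
      \<le> (real (card Z choose k) / real n ^ k)\<^sup>2 + (if j' = j then mean (\<lambda>c. 8 ^ deg c Z j) else 0)"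
    proof (cases "j' = j")
      case True
      then show ?thesis using add_increasing[OF zero_le_power2 diag[of j]] by (simp only: if_True simp_thms)
    next
      case False
      then show ?thesis using off[of j j'] \<open>j \<in> {..<n}\<close> \<open>j' \<in> {..<n}\<close>
        by (simp only: if_False add_0_right lessThan_iff simp_thms)
    qed
  qed
  also have "\<dots> = (\<Sum>j<n. \<Sum>j'<n. (real (card Z choose k) / real n ^ k)\<^sup>2) + (\<Sum>j<n. mean (\<lambda>c. 8 ^ deg c Z j))"
    unfolding sum.distrib by simp
  also have "(\<Sum>j<n. mean (\<lambda>c. 8 ^ deg c Z j)) = mean spread"
    unfolding spread_def by (rule mean_sum[symmetric]) simp
  also have "(\<Sum>j<n. \<Sum>j'<n. (real (card Z choose k) / real n ^ k)\<^sup>2) = (real n * real (card Z choose k) / real n ^ k)\<^sup>2"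
    by (simp add: power2_eq_square)
  finally show ?thesis .
qed

text \<open>The mean has not changed since time \<open>0\<close>, so the squared means cancel. While
  a positive fraction of the cells remains and \<open>card Z\<close> is of order \<open>n\<close>,
  the right-hand side is of order \<open>n\<close>, against \<open>n\<^sup>2\<close> for the square
  of a deviation of order \<open>n\<close>.\<close>

theorem variance_coincidences:
  assumes k: "2 \<le> k" and t: "t + k < card Z"
  shows "mean (\<lambda>c. (growth k c t * coincidences k c (remaining c t) - real n * real (card Z choose k) / real n ^ k)\<^sup>2)
     \<le> (1 + real t * ((real (card Z) / real (card Z - t - k)) ^ (2 * k) / real (card Z - t))) * (real n * (1 + 7 / real n) ^ card Z)"
proof -
  let ?b = "real n * real (card Z choose k) / real n ^ k"
  let ?M = "\<lambda>c. growth k c t * coincidences k c (remaining c t)"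
  have "mean (\<lambda>c. (?M c - ?b)\<^sup>2) = mean (\<lambda>c. (?M c)\<^sup>2 + ((-2 * ?b) * ?M c + ?b\<^sup>2))"
    by (rule mean_cong) (simp add: power2_eq_square algebra_simps)
  also have "\<dots> = mean (\<lambda>c. (?M c)\<^sup>2) + (-2 * ?b * mean ?M + ?b\<^sup>2)"
    by (simp only: mean_add mean_cmult mean_const)
  also have "mean ?M = ?b" using mean_growth_coincidences[OF k t] mean_coincidences by simp
  finally have "mean (\<lambda>c. (?M c - ?b)\<^sup>2) = mean (\<lambda>c. (?M c)\<^sup>2) - ?b\<^sup>2"
    by (simp only: power2_eq_square minus_mult_left[symmetric]) (simp add: algebra_simps)?
  also have "\<dots> \<le> (?b\<^sup>2 + mean spread)
      + real t * ((real (card Z) / real (card Z - t - k)) ^ (2 * k) / real (card Z - t)) * mean spread - ?b\<^sup>2"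
    by (rule diff_right_mono order_trans[OF mean_growth_coincidences_sq[OF k t order_refl]]
        add_right_mono mean_coincidences_sq)+
  finally show ?thesis unfolding mean_spread distrib_right mult_1_left add_diff_cancel_left add.assoc
    by simp
qed

section \<open>The stopping time and the number of forced steps\<close>

definition core_cells :: "('c \<Rightarrow> nat) \<Rightarrow> 'c set" where
  "core_cells c = remaining c (card Z)"

definition stop :: "('c \<Rightarrow> nat) \<Rightarrow> nat" where
  "stop c = card Z - card (core_cells c)"

text \<open>Every step that is not stuck removes one cell. Hence \<open>card Z\<close> steps reach
  the terminal state, and the number of removed cells is the first stuck time.\<close>

lemma stop_properties:
  shows "remaining c (stop c) = core_cells c"
    and "next_cell c (core_cells c) = None"
    and "\<And>s. s < stop c \<Longrightarrow> next_cell c (remaining c s) \<noteq> None"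
proof -
  have *: "remaining c (stop c) = core_cells c \<and> next_cell c (core_cells c) = None \<and>
    (\<forall>s<stop c. next_cell c (remaining c s) \<noteq> None)"
  proof (cases "\<exists>s. s < card Z \<and> next_cell c (remaining c s) = None")
    case True
    define s where "s = (LEAST s. s < card Z \<and> next_cell c (remaining c s) = None)"
    have s: "s < card Z" "next_cell c (remaining c s) = None"
      using LeastI_ex[OF True] unfolding s_def by auto
    have before: "next_cell c (remaining c u) \<noteq> None" if "u < s" for u
      using not_less_Least[of u "\<lambda>s. s < card Z \<and> next_cell c (remaining c s) = None"] that s(1)
      unfolding s_def by auto
    have "core_cells c = remaining c s"
      unfolding core_cells_def using s by (intro remaining_stuck) auto
    moreover have "stop c = s"
      unfolding stop_def calculation using card_remaining[OF before] s(1) by simp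
    ultimately show ?thesis using s before by auto
  next
    case False
    then have "card (core_cells c) = 0"
      unfolding core_cells_def by (subst card_remaining) auto
    then have e: "core_cells c = {}" by (simp add: core_cells_def)
    then have "stop c = card Z" by (simp add: stop_def)
    moreover have "next_cell c {} = None" by (simp add: next_cell_def pending_def deg_def)
    ultimately show ?thesis using False e by (simp add: core_cells_def)
  qed
  then show "remaining c (stop c) = core_cells c" "next_cell c (core_cells c) = None"
    "\<And>s. s < stop c \<Longrightarrow> next_cell c (remaining c s) \<noteq> None" by auto
qed

lemma card_remaining_le_stop: "t \<le> stop c \<Longrightarrow> card (remaining c t) = card Z - t"
  using stop_properties(3) by (intro card_remaining) auto

lemma stop_le: "stop c \<le> card Z"
  by (simp add: stop_def)

definition touched :: "'c set \<Rightarrow> nat set" where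
  "touched C = row ` (Z - C)"

definition weight_of :: "nat \<Rightarrow> nat" where
  "weight_of i = card {x \<in> Z. row x = i}"

text \<open>A step is unforced only when nothing is pending, that is, when all touched rows are
  completely gone; it therefore opens a new row. Until the next unforced step only this row has
  pending cells.\<close>

lemma touched_accounting:
  assumes "t \<le> stop c"
  shows "card (touched (remaining c t)) = card {s. s < t \<and> \<not> forced c s} \<and>
    (\<exists>i. \<forall>x\<in>pending (remaining c t). row x = i)"
  using assms
proof (induction t)
  case 0 then show ?case by (simp add: touched_def pending_def)
next
  case (Suc t)
  let ?C = "remaining c t"
  obtain x where x: "next_cell c ?C = Some x" using stop_properties(3)[of t c] Suc.prems by auto
  have C: "remaining c (Suc t) = ?C - {x}" using x by (simp add: remaining_Suc remove_next_def)
  have xC: "x \<in> ?C" "x \<in> Z" using next_cell_in[OF x] remaining_subset by auto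
  have T: "touched (?C - {x}) = insert (row x) (touched ?C)"
    using xC by (auto simp: touched_def)
  have fin: "finite (touched ?C)" using finite_Z by (simp add: touched_def)
  have S: "{s. s < Suc t \<and> \<not> forced c s} = {s. s < t \<and> \<not> forced c s} \<union> (if forced c t then {} else {t})"
    by (auto simp: less_Suc_eq)
  show ?case
  proof (cases "forced c t")
    case True
    then have "x = pending_cell ?C" using x by (auto simp: next_cell_def forced_def)
    then have xp: "x \<in> pending ?C" using True someI_ex[of "\<lambda>x. x \<in> pending ?C"]
      by (auto simp: forced_def pending_cell_def)
    then have "row x \<in> touched ?C" by (auto simp: pending_def touched_def) (metis DiffI imageI)
    moreover have "pending (?C - {x}) \<subseteq> pending ?C" using xp by (auto simp: pending_def)
    moreover obtain i where "\<forall>x\<in>pending ?C. row x = i" using Suc by auto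
    ultimately show ?thesis using Suc T S True C by (auto simp: insert_absorb intro!: exI[of _ i])
  next
    case False
    then have np: "pending ?C = {}" by (simp add: forced_def)
    then have nt: "row x \<notin> touched ?C" using xC by (fastforce simp: pending_def touched_def)
    moreover have "\<forall>y\<in>pending (?C - {x}). row y = row x" using np xC by (auto simp: pending_def)
    moreover have "card {s. s < Suc t \<and> \<not> forced c s} = Suc (card {s. s < t \<and> \<not> forced c s})"
      unfolding S using False by simp
    ultimately show ?thesis using Suc T C fin by auto
  qed
qed

lemma sum_weight_of: "finite I \<Longrightarrow> (\<Sum>i\<in>I. weight_of i) = card {x \<in> Z. row x \<in> I}"
proof -
  assume "finite I"
  have "card {x \<in> Z. row x \<in> I} = card (\<Union>i\<in>I. {x \<in> Z. row x = i})"
    by (rule arg_cong[where f = card]) auto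
  also have "\<dots> = (\<Sum>i\<in>I. card {x \<in> Z. row x = i})"
    by (rule card_UN_disjoint) (use \<open>finite I\<close> finite_Z in auto)
  finally show ?thesis by (simp add: weight_of_def)
qed

text \<open>Up to the last row, which may be only partly removed, every row contributes one unforced step
  and otherwise forced ones.\<close>

lemma forced_count:
  assumes t: "t \<le> stop c" and r: "1 \<le> r" and R: "\<And>i. weight_of i \<le> R"
    and D: "(\<Sum>i\<in>row ` Z. \<bar>real (weight_of i) - real r\<bar>) + real R \<le> D"
  shows "\<bar>real (card {s. s < t \<and> forced c s}) - (real r - 1) / real r * real t\<bar> \<le> D"
proof -
  let ?C = "remaining c t"
  let ?T = "touched ?C"
  have acc: "card ?T = card {s. s < t \<and> \<not> forced c s}" "\<exists>i. \<forall>x\<in>pending ?C. row x = i"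
    using touched_accounting[OF t] by auto
  have fin: "finite ?T" "?T \<subseteq> row ` Z" using finite_Z by (auto simp: touched_def)
  \<comment> \<open>The cells of the touched rows are the removed and the pending ones. The pending
    ones belong to a single row, whence the allowance \<open>R\<close> in \<open>D\<close>.\<close>
  have "{x \<in> Z. row x \<in> ?T} = (Z - ?C) \<union> pending ?C"
    using remaining_subset[of c t] unfolding touched_def pending_def by (auto simp: image_iff, metis Diff_iff)
  then have "card {x \<in> Z. row x \<in> ?T} = card (Z - ?C) + card (pending ?C)"
    using finite_Z by (simp only:, subst card_Un_disjoint) (auto simp: pending_def)
  also have "card (Z - ?C) = t"
    using card_remaining_le_stop[OF t] remaining_subset[of c t] t stop_le[of c] by (simp add: card_Diff_subset)
  finally have w: "(\<Sum>i\<in>?T. weight_of i) = t + card (pending ?C)" using sum_weight_of[OF fin(1)] by simp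
  obtain i where "\<forall>x\<in>pending ?C. row x = i" using acc by auto
  then have "pending ?C \<subseteq> {x \<in> Z. row x = i}" using remaining_subset[of c t] by (auto simp: pending_def)
  then have p: "card (pending ?C) \<le> R"
    using card_mono[of "{x \<in> Z. row x = i}" "pending ?C"] R[of i] finite_Z by (simp add: weight_of_def)
  have "\<bar>(\<Sum>i\<in>?T. real (weight_of i) - real r)\<bar> \<le> (\<Sum>i\<in>row ` Z. \<bar>real (weight_of i) - real r\<bar>)"
    by (rule order_trans[OF sum_abs sum_mono2]) (use fin finite_Z in auto)
  then have "\<bar>real t + real (card (pending ?C)) - real r * real (card ?T)\<bar>
      \<le> (\<Sum>i\<in>row ` Z. \<bar>real (weight_of i) - real r\<bar>)"
    using arg_cong[OF w, of real] by (simp add: sum_subtractf mult.commute)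
  then have 1: "\<bar>real t - real r * real (card ?T)\<bar> \<le> D" using p D by linarith
  have "{s. s < t \<and> forced c s} \<union> {s. s < t \<and> \<not> forced c s} = {..<t}" by auto
  then have "card {s. s < t \<and> forced c s} + card {s. s < t \<and> \<not> forced c s} = card {..<t}"
    by (subst card_Un_disjoint[symmetric]) (auto simp del: card_lessThan)
  then have 2: "real (card {s. s < t \<and> forced c s}) = real t - real (card ?T)"
    using acc(1) by simp
  have "real (card {s. s < t \<and> forced c s}) - (real r - 1) / real r * real t
      = (real t - real r * real (card ?T)) / real r"
    using r unfolding 2 by (simp add: field_simps)
  then have "\<bar>real (card {s. s < t \<and> forced c s}) - (real r - 1) / real r * real t\<bar>
      = \<bar>real t - real r * real (card ?T)\<bar> / real r"
    by (simp add: abs_divide)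
  also have "\<dots> \<le> \<bar>real t - real r * real (card ?T)\<bar> / 1" using r by (intro divide_left_mono) auto
  finally show ?thesis using 1 by simp
qed

end

text \<open>Summation by parts. The forced steps have density \<open>(r - 1) / r\<close> only on
  average; against monotone weights the bounded discrepancy \<open>e\<close> of their number still
  gives a controlled error.\<close>

lemma abel_bound:
  fixes e g :: "nat \<Rightarrow> real"
  assumes e: "e 0 = 0" "\<And>s. s \<le> t \<Longrightarrow> \<bar>e s\<bar> \<le> D" and g: "\<And>s. s < t \<Longrightarrow> g s \<le> g (Suc s)" "0 \<le> g 0"
  shows "\<bar>\<Sum>s<t. (e (Suc s) - e s) * g s\<bar> \<le> 2 * D * g t"
proof -
  have D: "0 \<le> D" using e(2)[of 0] by linarith
  have "\<bar>(\<Sum>s<t. (e (Suc s) - e s) * g s) - e t * g t\<bar> \<le> D * (g t - g 0)"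
    using e(2) g(1)
  proof (induction t)
    case 0 then show ?case using e(1) by simp
  next
    case (Suc t)
    have IH: "\<bar>(\<Sum>s<t. (e (Suc s) - e s) * g s) - e t * g t\<bar> \<le> D * (g t - g 0)"
      using Suc by auto
    have "(\<Sum>s<Suc t. (e (Suc s) - e s) * g s) - e (Suc t) * g (Suc t)
      = ((\<Sum>s<t. (e (Suc s) - e s) * g s) - e t * g t) + e (Suc t) * (g t - g (Suc t))"
      by (simp add: algebra_simps)
    moreover have "\<bar>e (Suc t) * (g t - g (Suc t))\<bar> \<le> D * (g (Suc t) - g t)"
      unfolding abs_mult using Suc.prems D by (intro mult_mono) auto
    ultimately show ?case using IH by (simp add: algebra_simps)
  qed
  moreover have "\<bar>e t * g t\<bar> \<le> D * g t"
  proof -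
    have "g 0 \<le> g t" using g(1) by (induction t) (auto intro: order_trans)
    then show ?thesis unfolding abs_mult using e(2)[of t] g by (intro mult_mono) auto
  qed
  moreover have "D * g 0 \<ge> 0" using D g by simp
  ultimately show ?thesis by (simp add: algebra_simps)
qed

text \<open>Both sides are logarithms of the same quotient of factorials. The right one has the
  fixed number \<open>k\<close> of terms, so limits can be taken term by term.\<close>

lemma sum_ln_quotients:
  assumes "t + k < N"
  shows "(\<Sum>s<t. ln (real (N - s) / real (N - s - k))) = (\<Sum>i<k. ln (real (N - i) / real (N - t - i)))"
  using assms
proof (induction t)
  case (Suc t)
  have "(\<Sum>i<k. ln (real (N - i) / real (N - Suc t - i))) - (\<Sum>i<k. ln (real (N - i) / real (N - t - i)))
     = (\<Sum>i<k. ln (real (N - t - i)) - ln (real (N - t - Suc i)))"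
    unfolding sum_subtractf[symmetric]
  proof (rule sum.cong)
    fix i assume "i \<in> {..<k}"
    then have "0 < real (N - i)" "0 < real (N - Suc t - i)" "0 < real (N - t - i)" using Suc.prems by auto
    moreover have "N - Suc t - i = N - t - Suc i" by simp
    ultimately show "ln (real (N - i) / real (N - Suc t - i)) - ln (real (N - i) / real (N - t - i))
      = ln (real (N - t - i)) - ln (real (N - t - Suc i))" by (simp add: ln_div)
  qed simp
  also have "\<dots> = ln (real (N - t)) - ln (real (N - t - k))"
    by (subst sum_lessThan_telescope') simp
  also have "\<dots> = ln (real (N - t) / real (N - t - k))"
    using Suc.prems by (simp add: ln_div)
  finally show ?case using Suc by simp
qed (simp)

context cell_system
begin

text \<open>\<open>growth\<close> depends on which steps are forced, but \<open>forced_count\<close>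
  knows their number up to any time. By \<open>abel_bound\<close> each step may be charged with
  \<open>(r - 1) / r\<close> of its logarithmic factor, which leaves a deterministic
  expression.\<close>

lemma ln_growth:
  assumes t: "t \<le> stop c" "t + k < card Z" and r: "1 \<le> r" and R: "\<And>i. weight_of i \<le> R"
    and D: "(\<Sum>i\<in>row ` Z. \<bar>real (weight_of i) - real r\<bar>) + real R \<le> D"
  shows "\<bar>ln (growth k c t) - (real r - 1) / real r * (\<Sum>i<k. ln (real (card Z - i) / real (card Z - t - i)))\<bar>
     \<le> 2 * D * ln (real (card Z - t) / real (card Z - t - k))"
proof -
  define N where "N = card Z"
  define g where "g s = ln (real (N - s) / real (N - s - k))" for s
  define e where "e s = real (card {u. u < s \<and> forced c u}) - (real r - 1) / real r * real s" for s
  have pos: "0 < (if forced c s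
     then real (card (remaining c s)) / (real (card (remaining c s)) - real k) else 1)" if "s < t" for s
    using t that by (auto simp: card_remaining_forced)
  have "ln (growth k c t) = (\<Sum>s<t. ln (if forced c s
     then real (card (remaining c s)) / (real (card (remaining c s)) - real k) else 1))"
    unfolding growth_def by (rule ln_prod[OF finite_lessThan]) (rule less_imp_neq[OF pos, THEN not_sym], simp)
  also have "\<dots> = (\<Sum>s<t. (if forced c s then 1 else 0) * g s)"
  proof (rule sum.cong)
    fix s assume "s \<in> {..<t}"
    then have "real (N - s) - real k = real (N - s - k)" using t by (simp add: N_def)
    then show "ln (if forced c s
     then real (card (remaining c s)) / (real (card (remaining c s)) - real k) else 1) = (if forced c s then 1 else 0) * g s"
      by (simp add: card_remaining_forced g_def N_def)
  qed simp
  finally have 1: "ln (growth k c t) = (\<Sum>s<t. (if forced c s then 1 else 0) * g s)" .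
  have e_Suc: "e (Suc s) - e s = (if forced c s then 1 else 0) - (real r - 1) / real r" for s
  proof -
    have "{u. u < Suc s \<and> forced c u} = {u. u < s \<and> forced c u} \<union> (if forced c s then {s} else {})"
      by (auto simp: less_Suc_eq)
    then have "card {u. u < Suc s \<and> forced c u} = card {u. u < s \<and> forced c u} + (if forced c s then 1 else 0)"
      by auto
    then show ?thesis by (auto simp add: e_def distrib_left)
  qed
  have "\<bar>\<Sum>s<t. (e (Suc s) - e s) * g s\<bar> \<le> 2 * D * g t"
  proof (rule abel_bound)
    show "e 0 = 0" by (simp add: e_def)
    show "\<bar>e s\<bar> \<le> D" if "s \<le> t" for s
      unfolding e_def by (rule forced_count[where R = R]) (use that t r R D in auto)
    show "0 \<le> g 0" unfolding g_def using t by (auto intro!: ln_ge_zero simp: N_def)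
    fix s assume "s < t"
    then show "g s \<le> g (Suc s)" unfolding g_def using t
      by (intro ln_mono) (auto simp: N_def divide_simps of_nat_diff algebra_simps)
  qed
  moreover have "(\<Sum>s<t. (e (Suc s) - e s) * g s) = ln (growth k c t) - (real r - 1) / real r * (\<Sum>s<t. g s)"
    unfolding e_Suc 1 by (simp add: left_diff_distrib sum_subtractf sum_distrib_left)
  moreover have "(\<Sum>s<t. g s) = (\<Sum>i<k. ln (real (card Z - i) / real (card Z - t - i)))"
    unfolding g_def N_def using t by (intro sum_ln_quotients) auto
  ultimately show ?thesis by (simp add: g_def N_def)
qed

section \<open>Heavy cells and heavy columns\<close>

definition heavy_cells :: "('c \<Rightarrow> nat) \<Rightarrow> 'c set \<Rightarrow> real" where
  "heavy_cells c C = (\<Sum>j<n. if 2 \<le> deg c C j then real (deg c C j) else 0)"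

definition heavy_columns :: "('c \<Rightarrow> nat) \<Rightarrow> 'c set \<Rightarrow> real" where
  "heavy_columns c C = (\<Sum>j<n. if 2 \<le> deg c C j then 1 else 0)"

lemma sum_deg: "c \<in> configs \<Longrightarrow> C \<subseteq> Z \<Longrightarrow> (\<Sum>j<n. real (deg c C j)) = real (card C)"
  using sum_over_cells[of c C "\<lambda>_. 1"] by simp

lemma heavy_cells_le: "c \<in> configs \<Longrightarrow> C \<subseteq> Z \<Longrightarrow> heavy_cells c C \<le> real (card C)"
  unfolding sum_deg[symmetric] heavy_cells_def by (intro sum_mono) auto

lemma core_no_light: "deg c (core_cells c) j \<noteq> 1"
  using stop_properties(2)[of c] by (auto simp: next_cell_def split: if_splits)

lemma core_not_pending: "pending (core_cells c) = {}"
  using stop_properties(2)[of c] by (auto simp: next_cell_def split: if_splits)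

lemma heavy_cells_core: "c \<in> configs \<Longrightarrow> heavy_cells c (core_cells c) = real (card (core_cells c))"
proof -
  assume c: "c \<in> configs"
  have "core_cells c \<subseteq> Z" by (simp add: core_cells_def remaining_subset)
  from sum_deg[OF c this, symmetric] show ?thesis
    unfolding heavy_cells_def
  proof (elim ssubst, intro sum.cong refl)
    fix j
    show "(if 2 \<le> deg c (core_cells c) j then real (deg c (core_cells c) j) else 0) = real (deg c (core_cells c) j)"
      using core_no_light[of c j] by (cases "deg c (core_cells c) j") auto
  qed
qed

text \<open>The constant \<open>2\<close> occurs when a column of degree two becomes light: both of
  its cells leave the count.\<close>

lemma heavy_remove:
  assumes "c \<in> configs" "C \<subseteq> Z" "x \<in> C"
  shows "\<bar>heavy_cells c (C - {x}) - heavy_cells c C\<bar> \<le> 2"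
    "\<bar>heavy_columns c (C - {x}) - heavy_columns c C\<bar> \<le> 1"
proof -
  have fC: "finite C" using assms finite_Z finite_subset by blast
  have "heavy_cells c C - heavy_cells c (C - {x})
     = (\<Sum>j<n. if j = c x then (if 2 \<le> deg c C j then real (deg c C j) else 0) - (if 2 \<le> deg c C j - 1 then real (deg c C j - 1) else 0) else 0)"
    unfolding heavy_cells_def sum_subtractf[symmetric]
    by (intro sum.cong) (auto simp: deg_remove[OF fC assms(3)])
  then show "\<bar>heavy_cells c (C - {x}) - heavy_cells c C\<bar> \<le> 2" by (auto simp: of_nat_diff split: if_splits)
  have "heavy_columns c C - heavy_columns c (C - {x})
     = (\<Sum>j<n. if j = c x then (if 2 \<le> deg c C j then 1 else 0) - (if 2 \<le> deg c C j - 1 then 1 else 0) else 0)"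
    unfolding heavy_columns_def sum_subtractf[symmetric]
    by (intro sum.cong) (auto simp: deg_remove[OF fC assms(3)])
  then show "\<bar>heavy_columns c (C - {x}) - heavy_columns c C\<bar> \<le> 1" by (auto split: if_splits)
qed

text \<open>Concentration is available at fixed times only; this carries it over to the random
  stopping time.\<close>

lemma heavy_lipschitz:
  assumes c: "c \<in> configs" and st: "s \<le> t"
  shows "\<bar>heavy_cells c (remaining c t) - heavy_cells c (remaining c s)\<bar> \<le> 2 * real (t - s)"
    "\<bar>heavy_columns c (remaining c t) - heavy_columns c (remaining c s)\<bar> \<le> real (t - s)"
proof -
  have step: "\<bar>heavy_cells c (remaining c (Suc u)) - heavy_cells c (remaining c u)\<bar> \<le> 2"
    "\<bar>heavy_columns c (remaining c (Suc u)) - heavy_columns c (remaining c u)\<bar> \<le> 1" for u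
    using heavy_remove[OF c remaining_subset, of _ c u] next_cell_in[of c "remaining c u"]
    by (auto simp: remaining_Suc remove_next_def split: option.splits)
  show "\<bar>heavy_cells c (remaining c t) - heavy_cells c (remaining c s)\<bar> \<le> 2 * real (t - s)"
    using st
  proof (induction t rule: dec_induct)
    case (step u) then show ?case using step(1) \<open>\<And>u. \<bar>heavy_cells c (remaining c (Suc u)) - heavy_cells c (remaining c u)\<bar> \<le> 2\<close>[of u]
      by (simp add: of_nat_diff)
  qed simp
  show "\<bar>heavy_columns c (remaining c t) - heavy_columns c (remaining c s)\<bar> \<le> real (t - s)"
    using st
  proof (induction t rule: dec_induct)
    case (step u) then show ?case using step(1) \<open>\<And>u. \<bar>heavy_columns c (remaining c (Suc u)) - heavy_columns c (remaining c u)\<bar> \<le> 1\<close>[of u]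
      by (simp add: of_nat_diff)
  qed simp
qed

end

text \<open>For \<open>K < k\<close> one has \<open>k \<le> 4 ^ k / 2 ^ K\<close>, and the binomial
  theorem sums the powers of \<open>4\<close> to \<open>5 ^ x\<close>. The truncation error is thus
  geometrically small in \<open>K\<close>, with a factor that \<open>spread\<close>
  controls.\<close>

lemma binomial_tail:
  fixes a :: "nat \<Rightarrow> real"
  assumes "\<And>k. \<bar>a k\<bar> \<le> real k"
  shows "\<bar>(\<Sum>k\<le>x. a k * real (x choose k)) - (\<Sum>k\<le>K. a k * real (x choose k))\<bar> \<le> 8 ^ x / 2 ^ K"
proof -
  define M where "M = max x K"
  have ext: "(\<Sum>k\<le>x. a k * real (x choose k)) = (\<Sum>k\<le>M. a k * real (x choose k))"
    by (rule sum.mono_neutral_left) (auto simp: M_def binomial_eq_0)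
  have "(\<Sum>k\<le>M. a k * real (x choose k)) - (\<Sum>k\<le>K. a k * real (x choose k))
      = (\<Sum>k\<in>{..M} - {..K}. a k * real (x choose k))"
    by (subst sum_diff) (auto simp: M_def)
  also have "\<bar>\<dots>\<bar> \<le> (\<Sum>k\<in>{..M} - {..K}. 4 ^ k * real (x choose k) / 2 ^ K)"
  proof (rule order_trans[OF sum_abs sum_mono])
    fix k assume k: "k \<in> {..M} - {..K}"
    have "real k * 2 ^ K \<le> 2 ^ k * 2 ^ k"
      using k by (intro mult_mono power_increasing) (auto intro: less_imp_le)
    also have "\<dots> = 4 ^ k" by (simp add: power_mult_distrib[symmetric])
    finally have "real k \<le> 4 ^ k / 2 ^ K" by (simp add: field_simps)
    then have "\<bar>a k\<bar> * real (x choose k) \<le> 4 ^ k / 2 ^ K * real (x choose k)"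
      using assms[of k] by (intro mult_right_mono) auto
    then show "\<bar>a k * real (x choose k)\<bar> \<le> 4 ^ k * real (x choose k) / 2 ^ K" by (simp add: abs_mult)
  qed
  also have "\<dots> \<le> (\<Sum>k\<le>M. 4 ^ k * real (x choose k) / 2 ^ K)"
    by (rule sum_mono2) auto
  also have "\<dots> = (\<Sum>k\<le>x. 4 ^ k * real (x choose k) / 2 ^ K)"
    by (rule sum.mono_neutral_right) (auto simp: M_def binomial_eq_0)
  also have "\<dots> = (4 + 1) ^ x / 2 ^ K"
    unfolding sum_divide_distrib[symmetric] binomial_ring by (simp add: mult.commute)
  also have "\<dots> \<le> 8 ^ x / 2 ^ K" by (intro divide_right_mono power_mono) auto
  finally show ?thesis using ext by simp
qed

text \<open>Bonferroni expansions in the coincidence numbers, so that \<open>variance_coincidences\<close> controls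
  the number of heavy cells and columns.\<close>

lemma heavy_expansion:
  fixes x K :: nat
  shows "\<bar>(if 2 \<le> x then real x else 0) - (\<Sum>k=2..K. (-1) ^ k * real k * real (x choose k))\<bar> \<le> 8 ^ x / 2 ^ K"
    "\<bar>(if 2 \<le> x then 1 else 0) - (\<Sum>k=2..K. (-1) ^ k * (real k - 1) * real (x choose k))\<bar> \<le> 8 ^ x / 2 ^ K"
proof -
  define a where "a k = (if 2 \<le> k then (-1) ^ k * real k else 0)" for k :: nat
  define b where "b k = (if 2 \<le> k then (-1) ^ k * (real k - 1) else 0)" for k :: nat
  have restrict: "(\<Sum>k\<le>M. f k * real (x choose k)) = (\<Sum>k=2..M. g k * real (x choose k))"
    if "\<And>k. f k = (if 2 \<le> k then g k else 0)" for f g :: "nat \<Rightarrow> real" and M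
    unfolding that by (rule sum.mono_neutral_cong_right) auto
  \<comment> \<open>Over all \<open>k\<close> the two alternating sums detect only
    \<open>x = 0\<close> and \<open>x = 1\<close>. Taking out the terms with \<open>k < 2\<close>
    leaves the heavy counts.\<close>
  have alt0: "(\<Sum>k\<le>x. (-1) ^ k * real (x choose k)) = (if x = 0 then 1 else 0)"
    using choose_alternating_sum[of x, where ?'a = real] by auto
  have alt1: "(\<Sum>k\<le>x. (-1) ^ k * real k * real (x choose k)) = (if x = 1 then -1 else 0)"
    using choose_alternating_linear_sum[of x, where ?'a = real] by auto
  have one: "(\<Sum>k\<le>x. if k = 1 then real x else 0) = real x" by (cases x) auto
  have "(\<Sum>k\<le>x. a k * real (x choose k))
      = (\<Sum>k\<le>x. (-1) ^ k * real k * real (x choose k) + (if k = 1 then real x else 0))"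
    by (rule sum.cong) (auto simp: a_def not_le less_2_cases_iff)
  also have "\<dots> = (if 2 \<le> x then real x else 0)"
    unfolding sum.distrib alt1 one by (cases x) auto
  finally have A: "(\<Sum>k\<le>x. a k * real (x choose k)) = (if 2 \<le> x then real x else 0)" .
  have "(\<Sum>k\<le>x. b k * real (x choose k))
      = (\<Sum>k\<le>x. ((-1) ^ k * real k * real (x choose k) - (-1) ^ k * real (x choose k)) + (if k = 0 then 1 else 0))"
    by (rule sum.cong) (auto simp: b_def not_le less_2_cases_iff algebra_simps)
  also have "\<dots> = (if 2 \<le> x then 1 else 0)"
    unfolding sum.distrib sum_subtractf alt1 alt0 by (cases x) auto
  finally have B: "(\<Sum>k\<le>x. b k * real (x choose k)) = (if 2 \<le> x then 1 else 0)" .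
  show "\<bar>(if 2 \<le> x then real x else 0) - (\<Sum>k=2..K. (-1) ^ k * real k * real (x choose k))\<bar> \<le> 8 ^ x / 2 ^ K"
    using binomial_tail[of a x K] unfolding A restrict[OF a_def, of K] by (simp add: a_def abs_mult)
  show "\<bar>(if 2 \<le> x then 1 else 0) - (\<Sum>k=2..K. (-1) ^ k * (real k - 1) * real (x choose k))\<bar> \<le> 8 ^ x / 2 ^ K"
    using binomial_tail[of b x K] unfolding B restrict[OF b_def, of K] by (simp add: b_def abs_mult)
qed

context cell_system
begin

lemma heavy_approximation:
  assumes "C \<subseteq> Z"
  shows "\<bar>heavy_cells c C - (\<Sum>k=2..K. (-1) ^ k * real k * coincidences k c C)\<bar> \<le> spread c / 2 ^ K"
    "\<bar>heavy_columns c C - (\<Sum>k=2..K. (-1) ^ k * (real k - 1) * coincidences k c C)\<bar> \<le> spread c / 2 ^ K"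
proof -
  have tail: "(\<Sum>j<n. 8 ^ deg c C j / 2 ^ K) \<le> spread c / (2::real) ^ K"
    unfolding spread_def sum_divide_distrib
    by (intro sum_mono divide_right_mono power_increasing deg_mono assms) auto
  have "heavy_cells c C - (\<Sum>k=2..K. (-1) ^ k * real k * coincidences k c C)
     = (\<Sum>j<n. (if 2 \<le> deg c C j then real (deg c C j) else 0)
         - (\<Sum>k=2..K. (-1) ^ k * real k * real (deg c C j choose k)))"
    unfolding heavy_cells_def coincidences_def sum_subtractf sum_distrib_left
    by (subst sum.swap) simp
  also have "\<bar>\<dots>\<bar> \<le> (\<Sum>j<n. 8 ^ deg c C j / 2 ^ K)"
    by (rule order_trans[OF sum_abs sum_mono]) (rule heavy_expansion)
  finally show "\<bar>heavy_cells c C - (\<Sum>k=2..K. (-1) ^ k * real k * coincidences k c C)\<bar> \<le> spread c / 2 ^ K"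
    using tail by linarith
  have "heavy_columns c C - (\<Sum>k=2..K. (-1) ^ k * (real k - 1) * coincidences k c C)
     = (\<Sum>j<n. (if 2 \<le> deg c C j then 1 else 0)
         - (\<Sum>k=2..K. (-1) ^ k * (real k - 1) * real (deg c C j choose k)))"
    unfolding heavy_columns_def coincidences_def sum_subtractf sum_distrib_left
    by (subst sum.swap) simp
  also have "\<bar>\<dots>\<bar> \<le> (\<Sum>j<n. 8 ^ deg c C j / 2 ^ K)"
    by (rule order_trans[OF sum_abs sum_mono]) (rule heavy_expansion)
  finally show "\<bar>heavy_columns c C - (\<Sum>k=2..K. (-1) ^ k * (real k - 1) * coincidences k c C)\<bar> \<le> spread c / 2 ^ K"
    using tail by linarith
qed

definition prob :: "(('c \<Rightarrow> nat) \<Rightarrow> bool) \<Rightarrow> real" where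
  "prob A = mean (\<lambda>c. of_bool (A c))"

lemma prob_nonneg: "0 \<le> prob A"
  unfolding prob_def mean_def by (auto intro!: divide_nonneg_nonneg sum_nonneg)

lemma prob_mono: "(\<And>c. c \<in> configs \<Longrightarrow> A c \<Longrightarrow> B c) \<Longrightarrow> prob A \<le> prob B"
  unfolding prob_def by (rule mean_mono) auto

lemma prob_disj: "prob (\<lambda>c. A c \<or> B c) \<le> prob A + prob B"
  unfolding prob_def mean_add[symmetric] by (rule mean_mono) auto

lemma prob_bex:
  assumes "finite I" shows "prob (\<lambda>c. \<exists>i\<in>I. A i c) \<le> (\<Sum>i\<in>I. prob (A i))"
  unfolding prob_def mean_sum[OF assms, symmetric]
proof (rule mean_mono)
  fix c
  show "of_bool (\<exists>i\<in>I. A i c) \<le> (\<Sum>i\<in>I. of_bool (A i c) :: real)"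
  proof (cases "\<exists>i\<in>I. A i c")
    case True
    then obtain i where "i \<in> I" "A i c" by auto
    then have "of_bool (A i c) \<le> (\<Sum>i\<in>I. of_bool (A i c) :: real)"
      using assms by (intro member_le_sum) auto
    then show ?thesis using True \<open>A i c\<close> by simp
  qed (auto intro: sum_nonneg)
qed

lemma prob_markov:
  assumes "0 < s" "\<And>c. c \<in> configs \<Longrightarrow> 0 \<le> f c"
  shows "prob (\<lambda>c. s < f c) \<le> mean f / s"
proof -
  have "prob (\<lambda>c. s < f c) \<le> mean (\<lambda>c. (1 / s) * f c)"
    unfolding prob_def using assms by (intro mean_mono) (auto simp: of_bool_def divide_simps)
  then show ?thesis by (simp only: mean_cmult) simp
qed

lemma prob_chebyshev:
  assumes "0 < s" shows "prob (\<lambda>c. s < \<bar>f c\<bar>) \<le> mean (\<lambda>c. (f c)\<^sup>2) / s\<^sup>2"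
proof -
  have "prob (\<lambda>c. s < \<bar>f c\<bar>) \<le> prob (\<lambda>c. s\<^sup>2 < (f c)\<^sup>2)"
  proof (rule prob_mono)
    fix c assume "s < \<bar>f c\<bar>"
    then show "s\<^sup>2 < (f c)\<^sup>2" using power_strict_mono[of s "\<bar>f c\<bar>" 2] assms by simp
  qed
  also have "\<dots> \<le> mean (\<lambda>c. (f c)\<^sup>2) / s\<^sup>2"
    by (rule prob_markov) (use assms in auto)
  finally show ?thesis .
qed

end

text \<open>\<open>\<mu> ^ k / fact k\<close> is the \<open>k\<close>-th binomial moment of a
  Poisson variable \<open>D\<close> with mean \<mu>. Accordingly the limits are the mean of
  \<open>D\<close> on the event \<open>D \<ge> 2\<close> and the probability of this event.\<close>

lemma heavy_series:
  fixes \<mu> :: real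
  shows "(\<lambda>K. \<Sum>k=2..Suc K. (-1) ^ k * real k * (\<mu> ^ k / fact k)) \<longlonglongrightarrow> \<mu> * (1 - exp (- \<mu>))"
    "(\<lambda>K. \<Sum>k=2..Suc K. (-1) ^ k * (real k - 1) * (\<mu> ^ k / fact k)) \<longlonglongrightarrow> 1 - exp (- \<mu>) - \<mu> * exp (- \<mu>)"
proof -
  define E where "E K = (\<Sum>k\<le>K. (- \<mu>) ^ k / fact k)" for K :: nat
  have E: "E \<longlonglongrightarrow> exp (- \<mu>)"
    using exp_converges[of "- \<mu>"] unfolding sums_def_le E_def[abs_def] by (simp add: divide_inverse mult.commute)
  have A: "(\<Sum>k=2..Suc K. (-1) ^ k * real k * (\<mu> ^ k / fact k)) = - \<mu> * (E K - 1)" for K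
  proof (induction K)
    case (Suc K)
    have "(-1) ^ (K + 2) * real (K + 2) * (\<mu> ^ (K + 2) / fact (K + 2)) = - \<mu> * ((- \<mu>) ^ Suc K / fact (Suc K))"
    proof -
      have "fact (K + 2) = real (K + 2) * fact (Suc K)" using fact_Suc[of "Suc K", where ?'a = real] by simp
      then have "real (K + 2) * (\<mu> ^ (K + 2) / fact (K + 2)) = \<mu> ^ (K + 2) / fact (Suc K)"
        by (simp only: times_divide_eq_right nonzero_mult_divide_mult_cancel_left of_nat_eq_0_iff add_is_0) simp
      then have "(-1) ^ (K + 2) * real (K + 2) * (\<mu> ^ (K + 2) / fact (K + 2)) = (-1) ^ (K + 2) * (\<mu> ^ (K + 2) / fact (Suc K))"
        by (simp only: mult.assoc)
      then show ?thesis by (simp add: power_minus[of \<mu>])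
    qed
    then show ?case using Suc by (simp add: E_def algebra_simps)
  qed (simp add: E_def)
  have B: "(\<Sum>k=2..Suc K. (-1) ^ k * (\<mu> ^ k / fact k)) = E (Suc K) - 1 + \<mu>" for K
  proof (induction K)
    case (Suc K) then show ?case by (simp add: E_def power_minus[of \<mu>])
  qed (simp add: E_def)
  have "(\<lambda>K. - \<mu> * (E K - 1)) \<longlonglongrightarrow> - \<mu> * (exp (- \<mu>) - 1)" by (intro tendsto_intros E)
  then show 1: "(\<lambda>K. \<Sum>k=2..Suc K. (-1) ^ k * real k * (\<mu> ^ k / fact k)) \<longlonglongrightarrow> \<mu> * (1 - exp (- \<mu>))"
    unfolding A by (simp add: algebra_simps)
  have "(\<lambda>K. - \<mu> * (E K - 1) - (E (Suc K) - 1 + \<mu>)) \<longlonglongrightarrow> - \<mu> * (exp (- \<mu>) - 1) - (exp (- \<mu>) - 1 + \<mu>)"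
    by (intro tendsto_intros E LIMSEQ_Suc)
  then have lim: "(\<lambda>K. - \<mu> * (E K - 1) - (E (Suc K) - 1 + \<mu>)) \<longlonglongrightarrow> 1 - exp (- \<mu>) - \<mu> * exp (- \<mu>)"
    by (simp add: algebra_simps)
  have C: "(\<Sum>k=2..Suc K. (-1) ^ k * (real k - 1) * (\<mu> ^ k / fact k)) = - \<mu> * (E K - 1) - (E (Suc K) - 1 + \<mu>)" for K
    unfolding A[symmetric] B[symmetric] sum_subtractf[symmetric] by (rule sum.cong) (auto simp: algebra_simps)
  show "(\<lambda>K. \<Sum>k=2..Suc K. (-1) ^ k * (real k - 1) * (\<mu> ^ k / fact k)) \<longlonglongrightarrow> 1 - exp (- \<mu>) - \<mu> * exp (- \<mu>)"
    unfolding C by (rule lim)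
qed

subsection \<open>Asymptotics of the deletion process\<close>

locale peeling_sequence =
  fixes Z :: "nat \<Rightarrow> 'c set" and row :: "nat \<Rightarrow> 'c \<Rightarrow> nat" and r R :: nat and a :: real
  assumes finite_cells: "\<And>n. finite (Z n)"
    and r: "1 \<le> r" and a: "0 < a"
    and size: "(\<lambda>n. real (card (Z n)) / real n) \<longlonglongrightarrow> a"
    and weights_le: "\<And>n i. card {x \<in> Z n. row n x = i} \<le> R"
    and deviation: "(\<lambda>n. (\<Sum>i\<in>row n ` Z n. \<bar>real (card {x \<in> Z n. row n x = i}) - real r\<bar>) / real n) \<longlonglongrightarrow> 0"
begin

abbreviation "remaining n \<equiv> cell_system.remaining (Z n) (row n)"
abbreviation "coincidences \<equiv> cell_system.coincidences"
abbreviation "growth n \<equiv> cell_system.growth (Z n) (row n)"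
abbreviation "stop n \<equiv> cell_system.stop (Z n) (row n)"
abbreviation "core_cells n \<equiv> cell_system.core_cells (Z n) (row n)"
abbreviation "prob n \<equiv> cell_system.prob (Z n) n"
abbreviation "mean n \<equiv> cell_system.mean (Z n) n"
abbreviation "configs n \<equiv> cell_system.configs (Z n) n"
abbreviation "heavy_cells \<equiv> cell_system.heavy_cells"
abbreviation "heavy_columns \<equiv> cell_system.heavy_columns"
abbreviation "spread n \<equiv> cell_system.spread (Z n) n"

text \<open>At time \<open>level y n\<close> a fraction \<open>y ^ r\<close> of the cells is left; the coincidence numbers, which do not
  see the columns of degree less than \<open>2\<close>, are then those of Poisson degrees with parameter \<open>mu y\<close>.\<close>

definition level :: "real \<Rightarrow> nat \<Rightarrow> nat" where
  "level y n = nat \<lfloor>(1 - y ^ r) * real (card (Z n))\<rfloor>"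

lemma system: "1 \<le> n \<Longrightarrow> cell_system (Z n) n"
  by unfold_locales (auto simp: finite_cells)

lemma level_bounds:
  assumes "0 \<le> y" "y \<le> 1"
  shows "real (level y n) \<le> (1 - y ^ r) * real (card (Z n))"
    "(1 - y ^ r) * real (card (Z n)) - 1 < real (level y n)" "level y n \<le> card (Z n)"
proof -
  have y: "0 \<le> 1 - y ^ r" "1 - y ^ r \<le> 1" using assms by (auto simp: power_le_one)
  then have nn: "0 \<le> (1 - y ^ r) * real (card (Z n))" by simp
  then show 1: "real (level y n) \<le> (1 - y ^ r) * real (card (Z n))" by (simp add: level_def)
  show "(1 - y ^ r) * real (card (Z n)) - 1 < real (level y n)" using nn unfolding level_def by linarith
  have "(1 - y ^ r) * real (card (Z n)) \<le> 1 * real (card (Z n))" using y by (intro mult_right_mono) auto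
  then show "level y n \<le> card (Z n)" using 1 by linarith
qed

lemma level_lim:
  assumes "0 \<le> y" "y \<le> 1"
  shows "(\<lambda>n. real (level y n) / real n) \<longlonglongrightarrow> (1 - y ^ r) * a"
    "(\<lambda>n. real (card (Z n) - level y n) / real n) \<longlonglongrightarrow> y ^ r * a"
proof -
  have up: "(\<lambda>n. (1 - y ^ r) * (real (card (Z n)) / real n)) \<longlonglongrightarrow> (1 - y ^ r) * a"
    by (intro tendsto_intros size)
  have lo: "(\<lambda>n. (1 - y ^ r) * (real (card (Z n)) / real n) - 1 / real n) \<longlonglongrightarrow> (1 - y ^ r) * a"
    by (rule tendsto_eq_rhs[OF tendsto_diff[OF up lim_1_over_n]]) simp
  show 1: "(\<lambda>n. real (level y n) / real n) \<longlonglongrightarrow> (1 - y ^ r) * a"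
  proof (rule tendsto_sandwich[OF _ _ lo up])
    show "\<forall>\<^sub>F n in sequentially. (1 - y ^ r) * (real (card (Z n)) / real n) - 1 / real n \<le> real (level y n) / real n"
      using eventually_gt_at_top[of 0]
    proof eventually_elim
      case (elim n)
      have "((1 - y ^ r) * real (card (Z n)) - 1) / real n \<le> real (level y n) / real n"
        using level_bounds(2)[OF assms, of n] by (intro divide_right_mono) auto
      then show ?case by (simp add: diff_divide_distrib)
    qed
    show "\<forall>\<^sub>F n in sequentially. real (level y n) / real n \<le> (1 - y ^ r) * (real (card (Z n)) / real n)"
      using level_bounds(1)[OF assms] by (intro always_eventually allI) (simp add: divide_right_mono)
  qed
  have "(\<lambda>n. real (card (Z n)) / real n - real (level y n) / real n) \<longlonglongrightarrow> a - (1 - y ^ r) * a"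
    by (intro tendsto_diff size 1)
  then show "(\<lambda>n. real (card (Z n) - level y n) / real n) \<longlonglongrightarrow> y ^ r * a"
    using level_bounds(3)[OF assms] by (simp add: of_nat_diff diff_divide_distrib algebra_simps)
qed

lemma shift_lim:
  assumes "(\<lambda>n. real (f n) / real n) \<longlonglongrightarrow> L" "0 < L"
  shows "(\<lambda>n. real (f n - i) / real n) \<longlonglongrightarrow> L" "\<forall>\<^sub>F n in sequentially. i < f n"
proof -
  have "filterlim (\<lambda>n. real (f n) / real n * real n) at_top sequentially"
    by (rule filterlim_tendsto_pos_mult_at_top[OF assms]) (rule filterlim_real_sequentially)
  then have "\<forall>\<^sub>F n in sequentially. real i < real (f n) / real n * real n"
    by (simp add: filterlim_at_top_dense)
  then show ev: "\<forall>\<^sub>F n in sequentially. i < f n"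
    using eventually_gt_at_top[of 0] by eventually_elim auto
  have "(\<lambda>n. real (f n) / real n - real i / real n) \<longlonglongrightarrow> L"
    by (rule tendsto_eq_rhs[OF tendsto_diff[OF assms(1) lim_const_over_n]]) simp
  then show "(\<lambda>n. real (f n - i) / real n) \<longlonglongrightarrow> L"
    by (rule Lim_transform_eventually) (rule eventually_mono[OF ev], simp add: of_nat_diff diff_divide_distrib)
qed

lemma ratio_lim:
  assumes y: "0 < y" "y \<le> 1"
  shows "(\<lambda>n. real (card (Z n) - i) / real (card (Z n) - level y n - j)) \<longlonglongrightarrow> 1 / y ^ r"
proof -
  have "(\<lambda>n. (real (card (Z n) - i) / real n) / (real (card (Z n) - level y n - j) / real n)) \<longlonglongrightarrow> a / (y ^ r * a)"
    using y a by (intro tendsto_divide shift_lim size level_lim) auto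
  then have "(\<lambda>n. (real (card (Z n) - i) / real n) / (real (card (Z n) - level y n - j) / real n)) \<longlonglongrightarrow> 1 / y ^ r"
    by (rule tendsto_eq_rhs) (use a in simp)
  then show ?thesis
    by (rule Lim_transform_eventually) (rule eventually_mono[OF eventually_gt_at_top[of 0]], simp)
qed

text \<open>The exponent \<open>(r - 1) / r\<close> from \<open>ln_growth\<close> meets
  \<open>k\<close> quotients that tend to \<open>1 / y ^ r\<close>, which gives \<open>y\<close> to
  the power \<open>- k * (r - 1)\<close>. The error is uniform over all configurations that have not
  stopped before the level.\<close>

lemma growth_lim:
  assumes y: "0 < y" "y \<le> 1" and \<delta>: "0 < \<delta>"
  shows "\<forall>\<^sub>F n in sequentially. \<forall>c. level y n \<le> stop n c \<longrightarrow>
     \<bar>growth n k c (level y n) - 1 / (y ^ (r - 1)) ^ k\<bar> < \<delta>"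
proof -
  define N where "N n = card (Z n)" for n
  define L where "L n = (real r - 1) / real r * (\<Sum>i<k. ln (real (N n - i) / real (N n - level y n - i)))" for n
  define D where "D n = (\<Sum>i\<in>row n ` Z n. \<bar>real (card {x \<in> Z n. row n x = i}) - real r\<bar>) + real R" for n
  define err where "err n = 2 * D n * ln (real (N n - level y n) / real (N n - level y n - k))" for n
  have y0: "0 \<le> y" using y by simp
  have "L \<longlonglongrightarrow> (real r - 1) / real r * (\<Sum>i<k. ln (1 / y ^ r))"
    unfolding L_def[abs_def] N_def using y by (intro tendsto_intros ratio_lim) auto
  also have "(real r - 1) / real r * (\<Sum>i<k. ln (1 / y ^ r)) = - (real (k * (r - 1)) * ln y)"
    using y r by (simp add: ln_div ln_realpow of_nat_diff)
  finally have L: "L \<longlonglongrightarrow> - (real (k * (r - 1)) * ln y)" .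
  have Dn: "(\<lambda>n. D n / real n) \<longlonglongrightarrow> 0 + 0"
    unfolding D_def add_divide_distrib by (intro tendsto_add deviation lim_const_over_n)
  have lvl: "(\<lambda>n. real (card (Z n) - level y n - k) / real n) \<longlonglongrightarrow> y ^ r * a"
    "\<forall>\<^sub>F n in sequentially. k < card (Z n) - level y n"
    using shift_lim[OF level_lim(2)[OF y0 y(2)], of k] y a by auto
  have "(\<lambda>n. 2 * (D n / real n) * (real k / (real (card (Z n) - level y n - k) / real n))) \<longlonglongrightarrow> 2 * (0 + 0) * (real k / (y ^ r * a))"
    using y a by (intro tendsto_intros Dn lvl) auto
  then have up: "(\<lambda>n. 2 * (D n / real n) * (real k / (real (card (Z n) - level y n - k) / real n))) \<longlonglongrightarrow> 0"
    by (rule tendsto_eq_rhs) simp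
  have D0: "0 \<le> D n" for n unfolding D_def by (auto intro!: add_nonneg_nonneg sum_nonneg)
  have err: "err \<longlonglongrightarrow> 0"
  proof (rule tendsto_sandwich[OF _ _ tendsto_const up])
    show "\<forall>\<^sub>F n in sequentially. 0 \<le> err n"
      using lvl(2) by eventually_elim (auto simp: err_def N_def intro!: mult_nonneg_nonneg D0 ln_ge_zero)
    show "\<forall>\<^sub>F n in sequentially. err n \<le> 2 * (D n / real n) * (real k / (real (card (Z n) - level y n - k) / real n))"
      using lvl(2) eventually_gt_at_top[of 0]
    proof eventually_elim
      case (elim n)
      let ?A = "real (card (Z n) - level y n)"
      have A: "real (card (Z n) - level y n - k) = ?A - real k" "real k < ?A" using elim by auto
      have "ln (?A / (?A - real k)) \<le> ?A / (?A - real k) - 1" using A by (intro ln_le_minus_one) auto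
      also have "\<dots> = real k / (?A - real k)" using A by (simp add: field_simps)
      finally have "2 * D n * ln (?A / (?A - real k)) \<le> 2 * D n * (real k / (?A - real k))"
        using D0[of n] by (intro mult_left_mono) auto
      then show ?case using elim unfolding err_def N_def A(1) by simp
    qed
  qed
  have G: "exp (- (real (k * (r - 1)) * ln y)) = 1 / (y ^ (r - 1)) ^ k"
  proof -
    have "exp (real (k * (r - 1)) * ln y) = y ^ (k * (r - 1))" using y by (simp only: exp_of_nat_mult exp_ln)
    then show ?thesis by (simp only: exp_minus inverse_eq_divide power_mult[symmetric] mult.commute)
  qed
  have lo: "(\<lambda>n. exp (L n - err n)) \<longlonglongrightarrow> 1 / (y ^ (r - 1)) ^ k"
    using tendsto_exp[OF tendsto_diff[OF L err]] G by simp
  have hi: "(\<lambda>n. exp (L n + err n)) \<longlonglongrightarrow> 1 / (y ^ (r - 1)) ^ k"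
    using tendsto_exp[OF tendsto_add[OF L err]] G by simp
  show ?thesis
    using tendstoD[OF lo \<delta>] tendstoD[OF hi \<delta>] lvl(2) eventually_gt_at_top[of 0]
  proof eventually_elim
    case (elim n)
    interpret S: cell_system "Z n" "row n" n using system elim by simp
    show ?case
    proof (intro allI impI)
      fix c assume c: "level y n \<le> stop n c"
      have lk: "level y n + k < card (Z n)" using elim(3) by simp
      have "\<bar>ln (growth n k c (level y n)) - L n\<bar> \<le> err n"
        unfolding L_def err_def N_def
        by (rule S.ln_growth[where R = R, OF c lk r]) (auto simp: S.weight_of_def weights_le D_def)
      moreover have "0 < growth n k c (level y n)" using S.growth_nonneg(1)[OF lk, of c] by linarith
      ultimately have "exp (L n - err n) \<le> growth n k c (level y n)" "growth n k c (level y n) \<le> exp (L n + err n)"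
        by (auto simp: abs_le_iff ln_ge_iff[symmetric] simp flip: ln_le_cancel_iff)
      then show "\<bar>growth n k c (level y n) - 1 / (y ^ (r - 1)) ^ k\<bar> < \<delta>"
        using elim(1,2) by (auto simp: dist_real_def abs_less_iff)
    qed
  qed
qed

lemma expected_coincidences_lim:
  "(\<lambda>n. real n * real (card (Z n) choose k) / real n ^ k / real n) \<longlonglongrightarrow> a ^ k / fact k"
proof -
  have lim: "(\<lambda>n. (\<Prod>i=0..<k. real (card (Z n)) / real n - real i / real n) / fact k) \<longlonglongrightarrow> (\<Prod>i=0..<k. a - 0) / fact k"
    by (intro tendsto_intros size lim_const_over_n) simp
  have "\<forall>\<^sub>F n in sequentially. (\<Prod>i=0..<k. real (card (Z n)) / real n - real i / real n) / fact k
      = real n * real (card (Z n) choose k) / real n ^ k / real n"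
    using eventually_gt_at_top[of 0]
  proof eventually_elim
    case (elim n)
    have "(\<Prod>i=0..<k. real (card (Z n)) / real n - real i / real n) = (\<Prod>i=0..<k. real (card (Z n)) - real i) / real n ^ k"
      by (simp add: diff_divide_distrib[symmetric] prod_dividef)
    then show ?case using elim by (simp add: binomial_gbinomial gbinomial_prod_rev)
  qed
  from Lim_transform_eventually[OF lim this] show ?thesis by simp
qed

text \<open>Dividing the initial density \<open>a ^ k / fact k\<close> by the limit of
  \<open>growth\<close> leaves the \<open>k\<close>-th power of this number over
  \<open>fact k\<close>.\<close>

definition mu :: "real \<Rightarrow> real" where
  "mu y = a * y ^ (r - 1)"

lemma variance_lim:
  assumes y: "0 < y" "y \<le> 1"
  shows "(\<lambda>n. (1 + real (level y n) * ((real (card (Z n)) / real (card (Z n) - level y n - k)) ^ (2 * k)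
      / real (card (Z n) - level y n))) * (real n * (1 + 7 / real n) ^ card (Z n)) / real n ^ 2) \<longlonglongrightarrow> 0"
proof -
  let ?U = "\<lambda>n. 1 + real (level y n) / real n * ((real (card (Z n) - 0) / real (card (Z n) - level y n - k)) ^ (2 * k)
      / (real (card (Z n) - level y n) / real n))"
  have y0: "0 \<le> y" using y by simp
  have U: "?U \<longlonglongrightarrow> 1 + (1 - y ^ r) * a * ((1 / y ^ r) ^ (2 * k) / (y ^ r * a))"
    using y a by (intro tendsto_intros ratio_lim level_lim) auto
  have "(\<lambda>n. exp (7 * (real (card (Z n)) / real n))) \<longlonglongrightarrow> exp (7 * a)" by (intro tendsto_intros size)
  from tendsto_mult[OF tendsto_mult[OF U this] lim_1_over_n]
  have up: "(\<lambda>n. ?U n * exp (7 * (real (card (Z n)) / real n)) * (1 / real n)) \<longlonglongrightarrow> 0" by simp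
  show ?thesis
  proof (rule tendsto_sandwich[OF _ _ tendsto_const up])
    show "\<forall>\<^sub>F n in sequentially. 0 \<le> (1 + real (level y n) * ((real (card (Z n)) / real (card (Z n) - level y n - k)) ^ (2 * k)
      / real (card (Z n) - level y n))) * (real n * (1 + 7 / real n) ^ card (Z n)) / real n ^ 2"
      by (intro always_eventually allI divide_nonneg_nonneg mult_nonneg_nonneg add_nonneg_nonneg) auto
    show "\<forall>\<^sub>F n in sequentially. (1 + real (level y n) * ((real (card (Z n)) / real (card (Z n) - level y n - k)) ^ (2 * k)
      / real (card (Z n) - level y n))) * (real n * (1 + 7 / real n) ^ card (Z n)) / real n ^ 2
      \<le> ?U n * exp (7 * (real (card (Z n)) / real n)) * (1 / real n)"
      using eventually_gt_at_top[of 0]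
    proof eventually_elim
      case (elim n)
      have "1 + 7 / real n \<le> exp (7 / real n)" by (rule exp_ge_add_one_self)
      then have "(1 + 7 / real n) ^ card (Z n) \<le> exp (7 / real n) ^ card (Z n)" by (intro power_mono) auto
      also have "\<dots> = exp (7 * (real (card (Z n)) / real n))" by (simp add: exp_of_nat_mult[symmetric])
      finally have e: "(1 + 7 / real n) ^ card (Z n) \<le> exp (7 * (real (card (Z n)) / real n))" .
      have "(1 + real (level y n) * ((real (card (Z n)) / real (card (Z n) - level y n - k)) ^ (2 * k)
      / real (card (Z n) - level y n))) = ?U n" using elim by simp
      then have "(1 + real (level y n) * ((real (card (Z n)) / real (card (Z n) - level y n - k)) ^ (2 * k)
      / real (card (Z n) - level y n))) * (real n * (1 + 7 / real n) ^ card (Z n)) / real n ^ 2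
        = ?U n * (1 + 7 / real n) ^ card (Z n) * (1 / real n)"
        using elim by (simp only: power2_eq_square) simp
      also have "\<dots> \<le> ?U n * exp (7 * (real (card (Z n)) / real n)) * (1 / real n)"
        using e by (intro mult_right_mono mult_left_mono) (auto intro!: add_nonneg_nonneg)
      finally show ?case .
    qed
  qed
qed

lemma coincidences_lim:
  assumes k: "2 \<le> k" and y: "0 < y" "y \<le> 1" and \<delta>: "0 < \<delta>"
  shows "(\<lambda>n. prob n (\<lambda>c. level y n \<le> stop n c \<and>
     \<delta> < \<bar>coincidences n k c (remaining n c (level y n)) / real n - mu y ^ k / fact k\<bar>)) \<longlonglongrightarrow> 0"
proof -
  define b where "b n = real n * real (card (Z n) choose k) / real n ^ k" for n
  define X where "X = a ^ k / fact k"
  define G where "G = 1 / (y ^ (r - 1)) ^ k"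
  let ?V = "\<lambda>n. (1 + real (level y n) * ((real (card (Z n)) / real (card (Z n) - level y n - k)) ^ (2 * k)
      / real (card (Z n) - level y n))) * (real n * (1 + 7 / real n) ^ card (Z n))"
  have X0: "0 \<le> X" using a by (simp add: X_def)
  have yp: "0 < (y ^ (r - 1)) ^ k" "(y ^ (r - 1)) ^ k \<le> 1" using y by (auto simp: power_le_one)
  then have G1: "1 \<le> G" by (simp add: G_def)
  have XG: "X / G = mu y ^ k / fact k" by (simp add: X_def G_def mu_def power_mult_distrib)
  \<comment> \<open>The second tolerance ensures
    \<open>X * \<bar>g - G\<bar> \<le> \<delta> / 4\<close>; the \<open>1\<close> guards against a
    small \<open>X\<close>.\<close>
  have d4: "0 < \<delta> / 4" "0 < \<delta> / (4 * (X + 1))" using \<delta> X0 by auto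
  have up: "(\<lambda>n. ?V n / real n ^ 2 * (16 / \<delta>\<^sup>2)) \<longlonglongrightarrow> 0"
    by (rule tendsto_eq_rhs[OF tendsto_mult[OF variance_lim[OF y] tendsto_const]]) simp
  have lvl: "\<forall>\<^sub>F n in sequentially. k < card (Z n) - level y n"
    using shift_lim(2)[OF level_lim(2)[of y], of k] y a by auto
  show ?thesis
  proof (rule tendsto_sandwich[OF _ _ tendsto_const up])
    show "\<forall>\<^sub>F n in sequentially. 0 \<le> prob n (\<lambda>c. level y n \<le> stop n c \<and>
     \<delta> < \<bar>coincidences n k c (remaining n c (level y n)) / real n - mu y ^ k / fact k\<bar>)"
      using eventually_gt_at_top[of 0] by eventually_elim (intro cell_system.prob_nonneg system, simp)
    have "(\<lambda>n. b n / real n) \<longlonglongrightarrow> X" unfolding b_def X_def by (rule expected_coincidences_lim)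
    from tendstoD[OF this d4(1)] growth_lim[OF y d4(2), of k] lvl eventually_gt_at_top[of 0]
    show "\<forall>\<^sub>F n in sequentially. prob n (\<lambda>c. level y n \<le> stop n c \<and>
     \<delta> < \<bar>coincidences n k c (remaining n c (level y n)) / real n - mu y ^ k / fact k\<bar>) \<le> ?V n / real n ^ 2 * (16 / \<delta>\<^sup>2)"
    proof eventually_elim
      case (elim n)
      interpret S: cell_system "Z n" "row n" n using system elim by simp
      let ?M = "\<lambda>c. growth n k c (level y n) * coincidences n k c (remaining n c (level y n))"
      have lk: "level y n + k < card (Z n)" using elim(3) by simp
      have "S.prob (\<lambda>c. level y n \<le> stop n c \<and>
         \<delta> < \<bar>coincidences n k c (remaining n c (level y n)) / real n - mu y ^ k / fact k\<bar>)
         \<le> S.prob (\<lambda>c. \<delta> / 4 * real n < \<bar>?M c - b n\<bar>)"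
      proof (rule S.prob_mono, rule ccontr)
        fix c assume c: "level y n \<le> stop n c \<and>
         \<delta> < \<bar>coincidences n k c (remaining n c (level y n)) / real n - mu y ^ k / fact k\<bar>"
          and "\<not> \<delta> / 4 * real n < \<bar>?M c - b n\<bar>"
        then have M: "\<bar>?M c - b n\<bar> \<le> \<delta> / 4 * real n" by simp
        define g where "g = growth n k c (level y n)"
        define x where "x = ?M c / real n"
        have g1: "1 \<le> g" unfolding g_def by (rule S.growth_nonneg(1)[OF lk])
        have "\<bar>x - b n / real n\<bar> \<le> \<delta> / 4"
          using M elim(4) unfolding x_def diff_divide_distrib[symmetric] by (simp add: divide_le_eq)
        then have xX: "\<bar>x - X\<bar> \<le> \<delta> / 2" using elim(1) unfolding dist_real_def by linarith
        have gG: "\<bar>g - G\<bar> < \<delta> / (4 * (X + 1))" using elim(2) c by (simp add: g_def G_def)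
        have "x / g - X / G = (x - X) / g + X * ((G - g) / (g * G))" using g1 G1 by (simp add: field_simps)
        also have "\<bar>\<dots>\<bar> \<le> \<bar>x - X\<bar> / 1 + X * (\<bar>g - G\<bar> / 1)"
        proof -
          have "\<bar>(x - X) / g\<bar> \<le> \<bar>x - X\<bar> / 1" unfolding abs_divide using g1 by (intro divide_left_mono) auto
          moreover have "1 * 1 \<le> g * G" using g1 G1 by (intro mult_mono) auto
          then have "\<bar>(G - g) / (g * G)\<bar> \<le> \<bar>g - G\<bar> / 1"
            unfolding abs_divide abs_minus_commute[of G] using g1 G1 by (intro divide_left_mono) auto
          then have "\<bar>X * ((G - g) / (g * G))\<bar> \<le> X * (\<bar>g - G\<bar> / 1)"
            unfolding abs_mult using X0 by (metis abs_of_nonneg mult_left_mono)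
          ultimately show ?thesis by linarith
        qed
        also have "\<dots> \<le> \<delta> / 2 + X * (\<delta> / (4 * (X + 1)))"
        proof -
          have "X * \<bar>g - G\<bar> \<le> X * (\<delta> / (4 * (X + 1)))" using gG X0 by (intro mult_left_mono) auto
          then show ?thesis using xX by simp
        qed
        also have "\<dots> \<le> \<delta> / 2 + \<delta> / 4" using X0 \<delta> by (simp add: field_simps)
        finally have "\<bar>x / g - X / G\<bar> \<le> \<delta> / 2 + \<delta> / 4" .
        moreover have "x / g = coincidences n k c (remaining n c (level y n)) / real n"
          using g1 by (simp add: x_def g_def)
        ultimately show False using c XG \<delta> by auto
      qed
      also have "\<dots> \<le> S.mean (\<lambda>c. (?M c - b n)\<^sup>2) / (\<delta> / 4 * real n)\<^sup>2"
        by (rule S.prob_chebyshev) (use \<delta> elim(4) in auto)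
      also have "\<dots> \<le> ?V n / (\<delta> / 4 * real n)\<^sup>2"
        unfolding b_def by (intro divide_right_mono S.variance_coincidences k lk) simp
      finally show ?case by (simp add: power_mult_distrib power_divide field_simps)
    qed
  qed
qed

lemma prob_lim_bex:
  assumes "finite I" "\<And>i. i \<in> I \<Longrightarrow> (\<lambda>n. prob n (A i n)) \<longlonglongrightarrow> 0"
  shows "(\<lambda>n. prob n (\<lambda>c. \<exists>i\<in>I. A i n c)) \<longlonglongrightarrow> 0"
proof -
  have lim: "(\<lambda>n. \<Sum>i\<in>I. prob n (A i n)) \<longlonglongrightarrow> 0"
    by (rule tendsto_eq_rhs[OF tendsto_sum[OF assms(2)]]) auto
  show ?thesis
  proof (rule tendsto_sandwich[OF _ _ tendsto_const lim])
    show "\<forall>\<^sub>F n in sequentially. 0 \<le> prob n (\<lambda>c. \<exists>i\<in>I. A i n c)"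
      using eventually_gt_at_top[of 0] by eventually_elim (intro cell_system.prob_nonneg system, simp)
    show "\<forall>\<^sub>F n in sequentially. prob n (\<lambda>c. \<exists>i\<in>I. A i n c) \<le> (\<Sum>i\<in>I. prob n (A i n))"
      using eventually_gt_at_top[of 0] by eventually_elim (intro cell_system.prob_bex system assms, simp)
  qed
qed

lemma prob_lim_mono:
  assumes "(\<lambda>n. prob n (B n)) \<longlonglongrightarrow> 0"
    and "\<forall>\<^sub>F n in sequentially. \<forall>c\<in>configs n. A n c \<longrightarrow> B n c"
  shows "(\<lambda>n. prob n (A n)) \<longlonglongrightarrow> 0"
proof (rule tendsto_sandwich[OF _ _ tendsto_const assms(1)])
  show "\<forall>\<^sub>F n in sequentially. 0 \<le> prob n (A n)"
    using eventually_gt_at_top[of 0] by eventually_elim (intro cell_system.prob_nonneg system, simp)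
  show "\<forall>\<^sub>F n in sequentially. prob n (A n) \<le> prob n (B n)"
    using assms(2) eventually_gt_at_top[of 0] by eventually_elim (intro cell_system.prob_mono system, auto)
qed

lemma spread_tail:
  assumes "0 < \<eta>"
  obtains S where "0 < S" "\<forall>\<^sub>F n in sequentially. prob n (\<lambda>c. S * real n < spread n c) \<le> \<eta>"
proof
  \<comment> \<open>For Markov's inequality: \<open>mean n (spread n)\<close> is at most
    \<open>n * exp (7 * (a + 1))\<close> as soon as \<open>card (Z n) / n < a + 1\<close>.\<close>
  define S where "S = exp (7 * (a + 1)) / \<eta>"
  show S: "0 < S" using assms by (simp add: S_def)
  show "\<forall>\<^sub>F n in sequentially. prob n (\<lambda>c. S * real n < spread n c) \<le> \<eta>"
    using order_tendstoD(2)[OF size, of "a + 1", simplified] eventually_gt_at_top[of 0]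
  proof eventually_elim
    case (elim n)
    interpret S: cell_system "Z n" "row n" n using system elim by simp
    have "S.prob (\<lambda>c. S * real n < spread n c) \<le> S.mean (spread n) / (S * real n)"
      by (rule S.prob_markov) (use S elim in \<open>auto simp: S.spread_def intro: sum_nonneg\<close>)
    also have "\<dots> = (1 + 7 / real n) ^ card (Z n) / S" using elim by (simp add: S.mean_spread)
    also have "(1 + 7 / real n) ^ card (Z n) \<le> exp (7 / real n) ^ card (Z n)"
      by (intro power_mono exp_ge_add_one_self) auto
    also have "\<dots> = exp (7 * (real (card (Z n)) / real n))" by (simp add: exp_of_nat_mult[symmetric])
    also have "\<dots> \<le> exp (7 * (a + 1))" using elim by simp
    finally show ?case using S assms by (simp add: divide_right_mono S_def)
  qed
qed

text \<open>The event is confined to configurations that have not stopped before the level, since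
  \<open>growth\<close> is under control only there.\<close>

definition heavy_deviates :: "real \<Rightarrow> real \<Rightarrow> nat \<Rightarrow> ('c \<Rightarrow> nat) \<Rightarrow> bool" where
  "heavy_deviates \<delta> y n c \<longleftrightarrow> level y n \<le> stop n c \<and>
     (\<delta> < \<bar>heavy_cells n c (remaining n c (level y n)) / real n - mu y * (1 - exp (- mu y))\<bar> \<or>
      \<delta> < \<bar>heavy_columns n c (remaining n c (level y n)) / real n - (1 - exp (- mu y) - mu y * exp (- mu y))\<bar>)"

text \<open>The order of choices matters. \<open>S\<close> bounds \<open>spread\<close> up to small
  probability; then \<open>K\<close> makes the truncation error below \<open>\<delta> / 3\<close>;
  only then are finitely many coincidence numbers asked for the precision \<open>d\<close>.\<close>

lemma heavy_lim:
  assumes y: "0 < y" "y \<le> 1" and \<delta>: "0 < \<delta>"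
  shows "(\<lambda>n. prob n (heavy_deviates \<delta> y n)) \<longlonglongrightarrow> 0"
proof (rule LIMSEQ_I)
  fix \<eta> :: real assume \<eta>: "0 < \<eta>"
  let ?m = "mu y"
  have "0 < \<eta> / 2" using \<eta> by simp
  then obtain S where S: "0 < S" "\<forall>\<^sub>F n in sequentially. prob n (\<lambda>c. S * real n < spread n c) \<le> \<eta> / 2"
    by (rule spread_tail)
  have d3: "0 < \<delta> / 3" using \<delta> by simp
  have "(\<lambda>K. S * (1 / 2) ^ Suc K) \<longlonglongrightarrow> S * 0"
    by (intro tendsto_mult tendsto_const LIMSEQ_Suc LIMSEQ_power_zero) simp
  from order_tendstoD(2)[OF this, of "\<delta> / 3"] d3
  have "\<forall>\<^sub>F K in sequentially. S * (1 / 2) ^ Suc K < \<delta> / 3" by simp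
  with tendstoD[OF heavy_series(1)[of ?m] d3] tendstoD[OF heavy_series(2)[of ?m] d3]
  have "\<forall>\<^sub>F K in sequentially. S * (1 / 2) ^ Suc K < \<delta> / 3
     \<and> dist (\<Sum>k=2..Suc K. (-1) ^ k * real k * (?m ^ k / fact k)) (?m * (1 - exp (- ?m))) < \<delta> / 3
     \<and> dist (\<Sum>k=2..Suc K. (-1) ^ k * (real k - 1) * (?m ^ k / fact k)) (1 - exp (- ?m) - ?m * exp (- ?m)) < \<delta> / 3"
    by eventually_elim auto
  then obtain K0 where K0: "S * (1 / 2) ^ Suc K0 < \<delta> / 3"
     "dist (\<Sum>k=2..Suc K0. (-1) ^ k * real k * (?m ^ k / fact k)) (?m * (1 - exp (- ?m))) < \<delta> / 3"
     "dist (\<Sum>k=2..Suc K0. (-1) ^ k * (real k - 1) * (?m ^ k / fact k)) (1 - exp (- ?m) - ?m * exp (- ?m)) < \<delta> / 3"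
    by (metis (no_types, lifting) eventually_sequentially order_refl)
  define K where "K = Suc K0"
  note K = K0[folded K_def]
  \<comment> \<open>At most \<open>K\<close> terms with coefficients at most \<open>K\<close>
    together cost at most \<open>\<delta> / 3\<close>.\<close>
  define d where "d = \<delta> / (3 * (real K + 1)\<^sup>2)"
  have d: "0 < d" using \<delta> by (simp add: d_def)
  let ?B = "\<lambda>k n c. level y n \<le> stop n c \<and> d < \<bar>coincidences n k c (remaining n c (level y n)) / real n - ?m ^ k / fact k\<bar>"
  have "(\<lambda>n. prob n (\<lambda>c. \<exists>k\<in>{2..K}. ?B k n c)) \<longlonglongrightarrow> 0"
    by (rule prob_lim_bex) (auto intro!: coincidences_lim y d)
  from order_tendstoD(2)[OF this, of "\<eta> / 2"] \<eta>
  have ev: "\<forall>\<^sub>F n in sequentially. prob n (\<lambda>c. \<exists>k\<in>{2..K}. ?B k n c) < \<eta> / 2" by simp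
  have "\<forall>\<^sub>F n in sequentially. norm (prob n (heavy_deviates \<delta> y n) - 0) < \<eta>"
    using ev S(2) eventually_gt_at_top[of 0]
  proof eventually_elim
    case (elim n)
    interpret S: cell_system "Z n" "row n" n using system elim by simp
    have "S.prob (heavy_deviates \<delta> y n) \<le> S.prob (\<lambda>c. (\<exists>k\<in>{2..K}. ?B k n c) \<or> S * real n < spread n c)"
    proof (rule S.prob_mono, rule ccontr)
      fix c assume c: "c \<in> S.configs" and dev: "heavy_deviates \<delta> y n c"
        and "\<not> ((\<exists>k\<in>{2..K}. ?B k n c) \<or> S * real n < spread n c)"
      then have B: "\<And>k. k \<in> {2..K} \<Longrightarrow> \<bar>coincidences n k c (remaining n c (level y n)) / real n - ?m ^ k / fact k\<bar> \<le> d"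
        and sp: "spread n c \<le> S * real n" by (auto simp: heavy_deviates_def not_less)
      let ?C = "remaining n c (level y n)"
      have "spread n c / 2 ^ K / real n \<le> S * (1 / 2) ^ K"
        using sp elim by (simp add: field_simps power_divide)
      then have sp': "spread n c / 2 ^ K / real n < \<delta> / 3" using K(1) by linarith
      have main: "\<bar>H / real n - L\<bar> < \<delta>"
        if H: "\<bar>H - (\<Sum>k=2..K. w k * coincidences n k c ?C)\<bar> \<le> spread n c / 2 ^ K"
          and w: "\<And>k. k \<in> {2..K} \<Longrightarrow> \<bar>w k\<bar> \<le> real K"
          and L: "dist (\<Sum>k=2..K. w k * (?m ^ k / fact k)) L < \<delta> / 3" for H L w
      proof -
        have "\<bar>H / real n - (\<Sum>k=2..K. w k * coincidences n k c ?C) / real n\<bar> \<le> spread n c / 2 ^ K / real n"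
          unfolding diff_divide_distrib[symmetric] abs_divide abs_of_nat using H by (intro divide_right_mono) auto
        moreover have "\<bar>(\<Sum>k=2..K. w k * coincidences n k c ?C) / real n - (\<Sum>k=2..K. w k * (?m ^ k / fact k))\<bar> \<le> \<delta> / 3"
        proof -
          have "(\<Sum>k=2..K. w k * coincidences n k c ?C) / real n - (\<Sum>k=2..K. w k * (?m ^ k / fact k))
             = (\<Sum>k=2..K. w k * (coincidences n k c ?C / real n - ?m ^ k / fact k))"
            by (simp add: sum_divide_distrib sum_subtractf right_diff_distrib)
          also have "\<bar>\<dots>\<bar> \<le> (\<Sum>k=2..K. (real K + 1) * d)"
          proof (rule order_trans[OF sum_abs sum_mono])
            fix k assume k: "k \<in> {2..K}"
            show "\<bar>w k * (coincidences n k c ?C / real n - ?m ^ k / fact k)\<bar> \<le> (real K + 1) * d"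
              unfolding abs_mult using w[OF k] B[OF k] by (intro mult_mono) auto
          qed
          also have "\<dots> \<le> (real K + 1) * ((real K + 1) * d)" using d by (simp add: mult_right_mono)
          also have "\<dots> = (real K + 1)\<^sup>2 * d" by (simp add: power2_eq_square)
          also have "\<dots> = \<delta> / 3"
          proof -
            have "q * (\<delta> / (3 * q)) = \<delta> / 3" if "0 < q" for q :: real using that by simp
            then show ?thesis unfolding d_def by simp
          qed
          finally show ?thesis .
        qed
        ultimately show ?thesis using L sp' unfolding dist_real_def by linarith
      qed
      have "\<bar>heavy_cells n c ?C / real n - ?m * (1 - exp (- ?m))\<bar> < \<delta>"
        by (rule main[OF S.heavy_approximation(1)[OF S.remaining_subset]]) (use K in \<open>auto simp: abs_mult power_abs\<close>)
      moreover have "\<bar>heavy_columns n c ?C / real n - (1 - exp (- ?m) - ?m * exp (- ?m))\<bar> < \<delta>"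
        by (rule main[OF S.heavy_approximation(2)[OF S.remaining_subset]]) (use K in \<open>auto simp: abs_mult power_abs\<close>)
      ultimately show False using dev by (auto simp: heavy_deviates_def)
    qed
    also have "\<dots> \<le> S.prob (\<lambda>c. \<exists>k\<in>{2..K}. ?B k n c) + S.prob (\<lambda>c. S * real n < spread n c)"
      by (rule S.prob_disj)
    also have "\<dots> < \<eta>" using elim by linarith
    finally show ?case using S.prob_nonneg[of "heavy_deviates \<delta> y n"] by simp
  qed
  then show "\<exists>no. \<forall>n\<ge>no. norm (prob n (heavy_deviates \<delta> y n) - 0) < \<eta>"
    by (simp add: eventually_sequentially)
qed

text \<open>The limiting density of light cells at \<open>level y\<close>; the process stops near a zero of this
  function.\<close>

definition light_density :: "real \<Rightarrow> real" where
  "light_density y = a * y ^ r - mu y * (1 - exp (- mu y))"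

definition column_density :: "real \<Rightarrow> real" where
  "column_density y = 1 - exp (- mu y) - mu y * exp (- mu y)"

text \<open>If the process passes the level of \<open>y0\<close>, only a sign is recorded. This is
  enough in both uses: either \<open>y0\<close> is so small that the core is negligible anyway, or
  the density is negative at \<open>y0\<close> and this case is impossible.\<close>

definition good_stop :: "real \<Rightarrow> real \<Rightarrow> nat \<Rightarrow> ('c \<Rightarrow> nat) \<Rightarrow> bool" where
  "good_stop \<delta> y0 n c \<longleftrightarrow>
     (if level y0 n \<le> stop n c then - \<delta> \<le> light_density y0
      else \<exists>y. y0 \<le> y \<and> y \<le> 1 \<and> \<bar>light_density y\<bar> \<le> \<delta> \<and>
        \<bar>real (card (core_cells n c)) / real n - a * y ^ r\<bar> \<le> \<delta> \<and>
        \<bar>heavy_columns n c (core_cells n c) / real n - column_density y\<bar> \<le> \<delta>)"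

lemma power_diff_le:
  fixes x y :: real
  assumes "0 \<le> x" "x \<le> y" "y \<le> 1"
  shows "y ^ k - x ^ k \<le> real k * (y - x)"
proof (induction k)
  case (Suc k)
  have "y ^ Suc k - x ^ Suc k = y * (y ^ k - x ^ k) + x ^ k * (y - x)" by (simp add: algebra_simps)
  also have "\<dots> \<le> 1 * (real k * (y - x)) + 1 * (y - x)"
    using assms Suc by (intro add_mono mult_mono mult_right_mono) (auto simp: power_le_one power_mono)
  finally show ?case by (simp add: algebra_simps)
qed simp

text \<open>A finite grid of levels suffices, because the counts move by at most a constant per
  step. At the stop all remaining cells are heavy, so at the neighbouring grid point the heavy cells
  nearly exhaust the cells, and \<open>light_density\<close> is close to \<open>0\<close>.\<close>

theorem good_stop_lim:
  assumes y0: "0 < y0" "y0 < 1" and \<delta>: "0 < \<delta>"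
  shows "(\<lambda>n. prob n (\<lambda>c. \<not> good_stop \<delta> y0 n c)) \<longlonglongrightarrow> 0"
proof -
  \<comment> \<open>The factor \<open>16\<close> makes neighbouring levels differ by at most
    \<open>\<delta> / 16 * n\<close>; rounding the levels costs another
    \<open>\<delta> / 16 * n\<close>.\<close>
  obtain G :: nat where G: "16 * (a + 1) * real r / \<delta> < real G"
    using reals_Archimedean2 by blast
  have "0 \<le> 16 * (a + 1) * real r / \<delta>" using a \<delta> by auto
  then have G0: "0 < real G" using G by linarith
  define w where "w = (1 - y0) / real G"
  define ys where "ys i = y0 + real i * w" for i :: nat
  have w: "0 < w" using y0 G0 by (simp add: w_def)
  have ys0: "ys 0 = y0" "ys G = 1" using G0 by (auto simp: ys_def w_def)
  have ys_range: "0 < ys i" "ys i \<le> 1" "y0 \<le> ys i" if "i \<le> G" for i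
  proof -
    show "y0 \<le> ys i" using w by (simp add: ys_def)
    then show "0 < ys i" using y0 by simp
    have "real i * w \<le> real G * w" using that w by (intro mult_right_mono) auto
    then show "ys i \<le> 1" using ys0(2) by (simp add: ys_def)
  qed
  have lim: "(\<lambda>n. prob n (\<lambda>c. \<exists>i\<in>{..G}. heavy_deviates (\<delta> / 8) (ys i) n c)) \<longlonglongrightarrow> 0"
    by (rule prob_lim_bex) (use ys_range \<delta> in \<open>auto intro!: heavy_lim\<close>)
  have lv: "\<forall>\<^sub>F n in sequentially. \<forall>i\<in>{..G}. \<bar>real (card (Z n) - level (ys i) n) / real n - ys i ^ r * a\<bar> < \<delta> / 8"
  proof (rule eventually_ball_finite)
    show "\<forall>i\<in>{..G}. \<forall>\<^sub>F n in sequentially. \<bar>real (card (Z n) - level (ys i) n) / real n - ys i ^ r * a\<bar> < \<delta> / 8"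
      using tendstoD[OF level_lim(2), of _ "\<delta> / 8"] ys_range \<delta> by (auto simp: dist_real_def less_imp_le)
  qed simp
  have "\<forall>\<^sub>F n in sequentially. 1 / real n < \<delta> / 16"
    using order_tendstoD(2)[OF lim_1_over_n, of "\<delta> / 16"] \<delta> by simp
  with lv order_tendstoD(2)[OF size, of "a + 1", simplified] eventually_gt_at_top[of 0]
  have ev: "\<forall>\<^sub>F n in sequentially. \<forall>c\<in>configs n. \<not> good_stop \<delta> y0 n c \<longrightarrow>
     (\<exists>i\<in>{..G}. heavy_deviates (\<delta> / 8) (ys i) n c)"
  proof eventually_elim
    case (elim n)
    interpret S: cell_system "Z n" "row n" n using system elim by simp
    show ?case
    proof (intro ballI impI, rule ccontr)
      fix c assume c: "c \<in> S.configs" and bad: "\<not> good_stop \<delta> y0 n c"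
        and "\<not> (\<exists>i\<in>{..G}. heavy_deviates (\<delta> / 8) (ys i) n c)"
      then have H: "\<And>i. i \<le> G \<Longrightarrow> level (ys i) n \<le> stop n c \<Longrightarrow>
          \<bar>heavy_cells n c (remaining n c (level (ys i) n)) / real n - mu (ys i) * (1 - exp (- mu (ys i)))\<bar> \<le> \<delta> / 8 \<and>
          \<bar>heavy_columns n c (remaining n c (level (ys i) n)) / real n - column_density (ys i)\<bar> \<le> \<delta> / 8"
        by (auto simp: heavy_deviates_def column_density_def not_less)
      have A: "\<bar>real (card (Z n) - level (ys i) n) / real n - a * ys i ^ r\<bar> < \<delta> / 8" if "i \<le> G" for i
        using elim(1) that by (auto simp: mult.commute)
      show False
      proof (cases "level y0 n \<le> stop n c")
        case True
        have "heavy_cells n c (remaining n c (level y0 n)) \<le> real (card (remaining n c (level y0 n)))"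
          by (rule S.heavy_cells_le[OF c S.remaining_subset])
        then have "heavy_cells n c (remaining n c (level y0 n)) / real n \<le> real (card (Z n) - level y0 n) / real n"
          unfolding S.card_remaining_le_stop[OF True] by (rule divide_right_mono) simp
        then have "- \<delta> \<le> light_density y0"
          using H[of 0] A[of 0] True \<delta> unfolding ys0 light_density_def by linarith
        then show False using bad True by (simp add: good_stop_def)
      next
        case False
        \<comment> \<open>Levels decrease along the grid and \<open>level 1 n = 0\<close>, so the
          index exists; the stop lies between the levels of \<open>ys i\<close> and of its
          predecessor.\<close>
        define i where "i = (LEAST i. level (ys i) n \<le> stop n c)"
        have ex: "level (ys G) n \<le> stop n c" unfolding ys0 by (simp add: level_def)
        then have i: "level (ys i) n \<le> stop n c" "i \<le> G" unfolding i_def by (auto intro: LeastI Least_le)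
        have "i \<noteq> 0" using False i(1) ys0(1) by (metis (no_types))
        then obtain p where p: "i = Suc p" by (cases i) auto
        then have pl: "stop n c < level (ys p) n"
          using not_less_Least[of p "\<lambda>i. level (ys i) n \<le> stop n c"] unfolding i_def by auto
        let ?y = "ys i"
        have yy: "ys p \<le> ?y" "?y - ys p = w" using w by (auto simp: p ys_def algebra_simps)
        have pr: "0 < ys p" "ys p \<le> 1" using ys_range[of p] i p by auto
        have gap: "real (stop n c - level ?y n) / real n \<le> \<delta> / 8"
        proof -
          have "real (stop n c - level ?y n) \<le> real (level (ys p) n) - real (level ?y n)" using pl i by simp
          also have "\<dots> \<le> (1 - ys p ^ r) * real (card (Z n)) - ((1 - ?y ^ r) * real (card (Z n)) - 1)"
            using level_bounds(1)[of "ys p" n] level_bounds(2)[of ?y n] pr ys_range[of i] i by auto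
          also have "\<dots> = (?y ^ r - ys p ^ r) * real (card (Z n)) + 1" by (simp add: algebra_simps)
          also have "\<dots> \<le> (real r * (?y - ys p)) * real (card (Z n)) + 1"
            using power_diff_le[of "ys p" ?y r] pr yy ys_range[of i] i by (intro add_right_mono mult_right_mono) auto
          finally have "real (stop n c - level ?y n) / real n \<le> (real r * w * real (card (Z n)) + 1) / real n"
            unfolding yy by (rule divide_right_mono) simp
          also have "\<dots> = real r * w * (real (card (Z n)) / real n) + 1 / real n" by (simp add: add_divide_distrib)
          also have "\<dots> \<le> real r * (1 / real G) * (a + 1) + \<delta> / 16"
            using elim w y0 G0 a by (intro add_mono mult_mono) (auto simp: w_def divide_right_mono)
          also have "real r * (1 / real G) * (a + 1) \<le> \<delta> / 16"
            using G G0 \<delta> by (simp add: field_simps)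
          finally show ?thesis by simp
        qed
        have core: "remaining n c (stop n c) = core_cells n c" by (rule S.stop_properties(1))
        have cc: "real (card (core_cells n c)) = real (card (Z n) - level ?y n) - real (stop n c - level ?y n)"
          using S.card_remaining_le_stop[OF order_refl, of c] i(1) S.stop_le[of c] unfolding core by simp
        have c1: "\<bar>real (card (core_cells n c)) / real n - real (card (Z n) - level ?y n) / real n\<bar> \<le> \<delta> / 8"
          using gap unfolding cc by (simp add: diff_divide_distrib)
        have "\<bar>heavy_cells n c (core_cells n c) / real n - heavy_cells n c (remaining n c (level ?y n)) / real n\<bar>
            \<le> 2 * real (stop n c - level ?y n) / real n"
          unfolding diff_divide_distrib[symmetric] abs_divide abs_of_nat core[symmetric]
          by (intro divide_right_mono S.heavy_lipschitz c i) simp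
        then have c2: "\<bar>real (card (core_cells n c)) / real n - heavy_cells n c (remaining n c (level ?y n)) / real n\<bar> \<le> \<delta> / 4"
          using gap unfolding S.heavy_cells_core[OF c] by linarith
        have "\<bar>heavy_columns n c (core_cells n c) / real n - heavy_columns n c (remaining n c (level ?y n)) / real n\<bar>
            \<le> real (stop n c - level ?y n) / real n"
          unfolding diff_divide_distrib[symmetric] abs_divide abs_of_nat core[symmetric]
          by (intro divide_right_mono S.heavy_lipschitz c i) simp
        then have c3: "\<bar>heavy_columns n c (core_cells n c) / real n - heavy_columns n c (remaining n c (level ?y n)) / real n\<bar> \<le> \<delta> / 8"
          using gap by linarith
        have "\<bar>light_density ?y\<bar> \<le> \<delta>" using c1 c2 H[OF i(2,1)] A[OF i(2)] \<delta>
          unfolding light_density_def by linarith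
        moreover have "\<bar>real (card (core_cells n c)) / real n - a * ?y ^ r\<bar> \<le> \<delta>"
          using c1 A[OF i(2)] \<delta> by linarith
        moreover have "\<bar>heavy_columns n c (core_cells n c) / real n - column_density ?y\<bar> \<le> \<delta>"
          using c3 H[OF i(2,1)] \<delta> by linarith
        ultimately have "good_stop \<delta> y0 n c" using False ys_range[OF i(2)] by (auto simp: good_stop_def)
        then show False using bad by simp
      qed
    qed
  qed
  show ?thesis by (rule prob_lim_mono[OF lim ev])
qed

end

subsection \<open>The law of the rows\<close>

definition support :: "bit vec \<Rightarrow> nat set" where
  "support v = {j. j < dim_vec v \<and> v $ j = 1}"

lemma weight_eq_card_support: "weight v = card (support v)"
  by (simp add: weight_def support_def)

lemma support_subset: "v \<in> carrier_vec n \<Longrightarrow> support v \<subseteq> {..<n}"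
  by (auto simp: support_def)

lemma bij_betw_support: "bij_betw support (carrier_vec n) (Pow {..<n})"
proof (rule bij_betw_byWitness[where f' = "\<lambda>s. vec n (\<lambda>j. if j \<in> s then 1 else 0)"])
  show "\<forall>v\<in>carrier_vec n. vec n (\<lambda>j. if j \<in> support v then 1 else 0) = v"
    by (auto simp: support_def bit_not_one_iff)
qed (auto simp: support_def split: if_splits)

lemma support_eq_iff: "u \<in> carrier_vec n \<Longrightarrow> v \<in> carrier_vec n \<Longrightarrow> support u = support v \<longleftrightarrow> u = v"
  using bij_betw_support[of n] by (auto simp: bij_betw_def inj_on_def)

lemma card_vec_of_weight: "card {u :: bit vec. u \<in> carrier_vec n \<and> weight u = k} = n choose k"
proof -
  have "bij_betw support {u \<in> carrier_vec n. card (support u) = k} {s \<in> Pow {..<n}. card s = k}"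
    by (rule bij_betw_Collect[OF bij_betw_support]) simp
  then have "card {u :: bit vec. u \<in> carrier_vec n \<and> weight u = k} = card {s. s \<subseteq> {..<n} \<and> card s = k}"
    by (auto dest: bij_betw_same_card simp: weight_eq_card_support)
  then show ?thesis by (simp add: n_subsets)
qed

abbreviation row_families :: "nat \<Rightarrow> nat \<Rightarrow> (nat \<Rightarrow> nat set) set" where
  "row_families n m \<equiv> {..<m} \<rightarrow>\<^sub>E Pow {..<n}"

context random_rows
begin

definition weight_prob :: "nat \<Rightarrow> real" where
  "weight_prob k = \<P>(x in Q. W x = k)"

definition row_law :: "nat set \<Rightarrow> real" where
  "row_law s = weight_prob (card s) / real (n choose card s)"

text \<open>Indices are shifted by one to agree with the matrix, and the restriction places the
  value in the finite set \<open>row_families n m\<close>.\<close>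

definition rows :: "nat \<Rightarrow> 'a \<Rightarrow> nat \<Rightarrow> nat set" where
  "rows m \<omega> = (\<lambda>i\<in>{..<m}. support (X (Suc i) \<omega>))"

lemma X_measurable [measurable]: "1 \<le> i \<Longrightarrow> X i \<in> P \<rightarrow>\<^sub>M count_space UNIV"
  using X_indep by (auto simp: P.indep_vars_def)

lemma prob_weight: "1 \<le> i \<Longrightarrow> \<P>(\<omega> in P. weight (X i \<omega>) = k) = weight_prob k"
proof -
  assume i: "1 \<le> i"
  have "\<P>(\<omega> in P. weight (X i \<omega>) = k) = measure (distr P (count_space UNIV) (\<lambda>\<omega>. weight (X i \<omega>))) {k}"
    by (subst measure_distr) (auto intro!: arg_cong[where f = "measure P"] measurable_compose[OF X_measurable[OF i]])
  also have "\<dots> = measure (distr Q (count_space UNIV) W) {k}" by (simp only: weight_law[OF i])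
  also have "\<dots> = weight_prob k"
    unfolding weight_prob_def
    by (subst measure_distr) (auto intro!: arg_cong[where f = "measure Q"] W_random_variable)
  finally show ?thesis .
qed

lemma prob_support:
  assumes i: "1 \<le> i" and s: "s \<subseteq> {..<n}"
  shows "\<P>(\<omega> in P. support (X i \<omega>) = s) = row_law s"
proof -
  obtain v :: "bit vec" where v: "v \<in> carrier_vec n" "support v = s"
    using bij_betw_support[of n] s unfolding bij_betw_def by (metis PowI imageE)
  have eq: "{\<omega> \<in> space P. support (X i \<omega>) = s} = {\<omega> \<in> space P. X i \<omega> = v \<and> weight (X i \<omega>) = card s}"
    using support_eq_iff[OF X_range[OF i] v(1)] v by (auto simp: weight_eq_card_support)
  show ?thesis
  proof (cases "0 < weight_prob (card s)")
    case True
    then have "0 < \<P>(\<omega> in P. weight (X i \<omega>) = card s)" by (simp only: prob_weight[OF i])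
    moreover have "weight v = card s" by (simp add: weight_eq_card_support v)
    ultimately have "\<P>(\<omega> in P. X i \<omega> = v \<bar> weight (X i \<omega>) = card s) = 1 / real (n choose card s)"
      using cond_uniform[OF i _ v(1)] by (simp only: card_vec_of_weight)
    then show ?thesis using True
      unfolding cond_prob_def eq prob_weight[OF i] row_law_def by (simp add: field_simps)
  next
    case False
    \<comment> \<open>For a weight of probability \<open>0\<close> the hypothesis
      \<open>cond_uniform\<close> says nothing; both sides are then \<open>0\<close>.\<close>
    then have z: "weight_prob (card s) = 0" by (simp add: weight_prob_def less_le)
    have "\<P>(\<omega> in P. X i \<omega> = v \<and> weight (X i \<omega>) = card s) \<le> \<P>(\<omega> in P. weight (X i \<omega>) = card s)"
      by (rule P.finite_measure_mono) (use X_measurable[OF i] in auto)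
    then have "\<P>(\<omega> in P. X i \<omega> = v \<and> weight (X i \<omega>) = card s) = 0"
      unfolding prob_weight[OF i] z by (simp only: measure_le_0_iff)
    then show ?thesis unfolding eq row_law_def z by simp
  qed
qed

lemma support_event: "{\<omega> \<in> space P. X (Suc i) \<omega> \<in> A} \<in> P.events"
  using measurable_sets[OF X_measurable, of "Suc i" A] by (simp add: vimage_def Int_def conj_commute)

lemma rows_in: "\<omega> \<in> space P \<Longrightarrow> rows m \<omega> \<in> row_families n m"
  using support_subset[OF X_range] by (auto simp: rows_def)

lemma rows_event: "s \<in> row_families n m \<Longrightarrow>
   {\<omega> \<in> space P. rows m \<omega> = s} = space P \<inter> (\<Inter>i\<in>{..<m}. X (Suc i) -` {v. support v = s i} \<inter> space P)"
  by (auto simp: rows_def fun_eq_iff PiE_iff extensional_def restrict_def)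

lemma finite_row_families [simp]: "finite (row_families n m)"
  by (simp add: finite_PiE)

lemma rows_eq_event: "s \<in> row_families n m \<Longrightarrow> {\<omega> \<in> space P. rows m \<omega> = s} \<in> P.events"
proof -
  assume s: "s \<in> row_families n m"
  have "{\<omega> \<in> space P. rows m \<omega> = s} = {\<omega> \<in> space P. \<forall>i\<in>{..<m}. X (Suc i) \<omega> \<in> {v. support v = s i}}"
    using s by (auto simp: rows_event[OF s])
  also have "\<dots> \<in> P.events"
    by (intro sets.sets_Collect_finite_All) (auto simp del: mem_Collect_eq intro: support_event)
  finally show ?thesis .
qed

lemma prob_rows_eq:
  assumes s: "s \<in> row_families n m"
  shows "\<P>(\<omega> in P. rows m \<omega> = s) = (\<Prod>i<m. row_law (s i))"
proof (cases "m = 0")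
  \<comment> \<open>With no rows, the intersection used below would be the whole type instead of
    \<open>space P\<close>.\<close>
  case True
  then have "{\<omega> \<in> space P. rows m \<omega> = s} = space P" using s by (auto simp: rows_def)
  then show ?thesis using True by (simp add: P.prob_space)
next
  case False
  let ?A = "\<lambda>i. {v. support v = s (i - 1)}"
  have "{\<omega> \<in> space P. rows m \<omega> = s} = (\<Inter>i\<in>{1..m}. X i -` ?A i \<inter> space P)"
  proof -
    have "(\<Inter>i\<in>{1..m}. X i -` ?A i \<inter> space P) = (\<Inter>i\<in>{..<m}. X (Suc i) -` {v. support v = s i} \<inter> space P)"
      by (subst image_Suc_lessThan[symmetric]) (simp add: image_image)
    then show ?thesis unfolding rows_event[OF s] using False by auto
  qed
  then have "\<P>(\<omega> in P. rows m \<omega> = s) = (\<Prod>i\<in>{1..m}. P.prob (X i -` ?A i \<inter> space P))"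
    using P.indep_varsD[OF X_indep, of "{1..m}" ?A] False by auto
  also have "\<dots> = (\<Prod>i\<in>{1..m}. row_law (s (i - 1)))"
  proof (rule prod.cong)
    fix i assume i: "i \<in> {1..m}"
    then have "s (i - 1) \<subseteq> {..<n}" using s by (auto simp: PiE_iff)
    moreover have "X i -` ?A i \<inter> space P = {\<omega> \<in> space P. support (X i \<omega>) = s (i - 1)}" by auto
    ultimately show "P.prob (X i -` ?A i \<inter> space P) = row_law (s (i - 1))"
      using prob_support[of i "s (i - 1)"] i by simp
  qed simp
  also have "\<dots> = (\<Prod>i<m. row_law (s i))"
    by (subst image_Suc_lessThan[symmetric], subst prod.reindex) auto
  finally show ?thesis .
qed

lemma expectation_rows:
  fixes g :: "(nat \<Rightarrow> nat set) \<Rightarrow> real"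
  shows "P.expectation (\<lambda>\<omega>. g (rows m \<omega>)) = (\<Sum>s\<in>row_families n m. g s * (\<Prod>i<m. row_law (s i)))"
proof -
  have "P.expectation (\<lambda>\<omega>. g (rows m \<omega>))
     = P.expectation (\<lambda>\<omega>. \<Sum>s\<in>row_families n m. g s * indicator {\<omega> \<in> space P. rows m \<omega> = s} \<omega>)"
  proof (rule Bochner_Integration.integral_cong[OF refl])
    fix \<omega> assume \<omega>: "\<omega> \<in> space P"
    have "(\<Sum>s\<in>row_families n m. g s * indicator {\<omega> \<in> space P. rows m \<omega> = s} \<omega>)
       = (\<Sum>s\<in>row_families n m. if s = rows m \<omega> then g s else 0)"
      using \<omega> by (intro sum.cong) (auto simp: indicator_def)
    then show "g (rows m \<omega>) = (\<Sum>s\<in>row_families n m. g s * indicator {\<omega> \<in> space P. rows m \<omega> = s} \<omega>)"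
      using rows_in[OF \<omega>, of m] by simp
  qed
  also have "\<dots> = (\<Sum>s\<in>row_families n m. g s * \<P>(\<omega> in P. rows m \<omega> = s))"
    using rows_eq_event by (subst Bochner_Integration.integral_sum) (auto simp: P.emeasure_eq_measure)
  finally show ?thesis by (simp add: prob_rows_eq)
qed

lemma rows_pred_event: "{\<omega> \<in> space P. \<Phi> (rows m \<omega>)} \<in> P.events"
proof -
  have "{\<omega> \<in> space P. \<Phi> (rows m \<omega>)} = (\<Union>s\<in>{s \<in> row_families n m. \<Phi> s}. {\<omega> \<in> space P. rows m \<omega> = s})"
    using rows_in by auto
  also have "\<dots> \<in> P.events" using rows_eq_event by (intro sets.finite_UN) auto
  finally show ?thesis .
qed

lemma prob_rows:
  "\<P>(\<omega> in P. \<Phi> (rows m \<omega>)) = (\<Sum>s\<in>row_families n m. of_bool (\<Phi> s) * (\<Prod>i<m. row_law (s i)))"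
proof -
  have "\<P>(\<omega> in P. \<Phi> (rows m \<omega>)) = P.expectation (indicator {\<omega> \<in> space P. \<Phi> (rows m \<omega>)})"
    using rows_pred_event by (simp add: P.emeasure_eq_measure)
  also have "\<dots> = P.expectation (\<lambda>\<omega>. of_bool (\<Phi> (rows m \<omega>)))"
    by (rule Bochner_Integration.integral_cong) (auto simp: indicator_def)
  also have "\<dots> = (\<Sum>s\<in>row_families n m. of_bool (\<Phi> s) * (\<Prod>i<m. row_law (s i)))"
    by (rule expectation_rows)
  finally show ?thesis .
qed

lemma weight_prob_nonneg: "0 \<le> weight_prob k"
  by (simp add: weight_prob_def)

lemma expectation_W:
  fixes g :: "nat \<Rightarrow> real"
  shows "(\<Sum>k\<le>n. weight_prob k * of_bool (A k)) = \<P>(x in Q. A (W x))"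
proof -
  have ev: "{x \<in> space Q. B (W x)} \<in> Q.events" for B
    using measurable_sets[OF W_random_variable, of "{k. B k}"] by (simp add: vimage_def Int_def conj_commute)
  have "{x \<in> space Q. A (W x)} = (\<Union>k\<in>{k. k \<le> n \<and> A k}. {x \<in> space Q. W x = k})"
    using W_range by fastforce
  also have "Q.prob \<dots> = (\<Sum>k\<in>{k. k \<le> n \<and> A k}. weight_prob k)"
    unfolding weight_prob_def
    by (rule Q.finite_measure_finite_Union) (use ev in \<open>auto simp: disjoint_family_on_def\<close>)
  also have "\<dots> = (\<Sum>k\<le>n. weight_prob k * of_bool (A k))"
    by (rule sum.mono_neutral_cong_left) auto
  finally show ?thesis by simp
qed

lemma sum_weight_prob: "(\<Sum>k\<le>n. weight_prob k) = 1"
  using expectation_W[of "\<lambda>_. True"] by (simp add: Q.prob_space)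

lemma sum_row_law: "(\<Sum>s\<in>Pow {..<n}. row_law s * f (card s)) = (\<Sum>k\<le>n. weight_prob k * f k)"
proof -
  have "(\<Sum>s\<in>Pow {..<n}. row_law s * f (card s))
      = (\<Sum>k\<le>n. \<Sum>s\<in>{s \<in> Pow {..<n}. card s = k}. row_law s * f (card s))"
    by (rule sum.group[symmetric]) (auto intro: card_mono[of "{..<n}", simplified])
  also have "\<dots> = (\<Sum>k\<le>n. weight_prob k * f k)"
  proof (rule sum.cong)
    fix k assume "k \<in> {..n}"
    then have "real (n choose k) \<noteq> 0" by simp
    moreover have "(\<Sum>s\<in>{s \<in> Pow {..<n}. card s = k}. row_law s * f (card s))
        = real (n choose k) * (weight_prob k / real (n choose k) * f k)"
      using n_subsets[of "{..<n}" k] by (simp add: row_law_def)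
    ultimately show "(\<Sum>s\<in>{s \<in> Pow {..<n}. card s = k}. row_law s * f (card s)) = weight_prob k * f k"
      by simp
  qed simp
  finally show ?thesis .
qed

text \<open>Conditions on the row weights; the last summand is Markov's bound for their total deviation
  from \<open>r\<close>.\<close>

lemma prob_rows_le:
  assumes \<eta>: "0 < \<eta>" and \<beta>: "0 \<le> \<beta>"
    and S: "\<And>k. k \<le> n \<Longrightarrow> k \<notin> S \<Longrightarrow> weight_prob k = 0"
    and bound: "\<And>w. w \<in> {..<m} \<rightarrow>\<^sub>E S \<Longrightarrow> (\<Sum>i<m. \<bar>real (w i) - real r\<bar>) \<le> \<eta> \<Longrightarrow>
      real (card {s \<in> row_families n m. (\<forall>i<m. card (s i) = w i) \<and> \<Phi> s}) \<le> \<beta> * (\<Prod>i<m. real (n choose w i))"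
  shows "\<P>(\<omega> in P. \<Phi> (rows m \<omega>)) \<le> \<beta> + real m * (\<Sum>k\<le>n. weight_prob k * \<bar>real k - real r\<bar>) / \<eta>"
proof -
  let ?F = "row_families n m"
  let ?c = "\<lambda>s. \<lambda>i\<in>{..<m}. card (s i)"
  let ?W = "{..<m} \<rightarrow>\<^sub>E {..n}"
  let ?dev = "\<lambda>w. \<Sum>i<m. \<bar>real (w i) - real r\<bar>"
  let ?q = "\<lambda>w. \<Prod>i<m. weight_prob (w i)"
  have wp: "0 \<le> ?q w" for w by (intro prod_nonneg weight_prob_nonneg)
  have qsum: "(\<Sum>w\<in>?W. ?q w) = 1"
    using prod_sum_PiE[of "{..<m}" "\<lambda>_. {..n}" "\<lambda>_. weight_prob"] by (simp add: sum_weight_prob)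
  have qdev: "(\<Sum>w\<in>?W. ?q w * \<bar>real (w j) - real r\<bar>) = (\<Sum>k\<le>n. weight_prob k * \<bar>real k - real r\<bar>)" if j: "j < m" for j
  proof -
    have "(\<Sum>w\<in>?W. ?q w * \<bar>real (w j) - real r\<bar>)
        = (\<Sum>w\<in>?W. \<Prod>i<m. weight_prob (w i) * (if i = j then \<bar>real (w i) - real r\<bar> else 1))"
      using j by (simp add: prod.distrib)
    also have "\<dots> = (\<Prod>i<m. \<Sum>k\<le>n. weight_prob k * (if i = j then \<bar>real k - real r\<bar> else 1))"
      by (rule prod_sum_PiE[symmetric]) auto
    also have "\<dots> = (\<Prod>i<m. if i = j then (\<Sum>k\<le>n. weight_prob k * \<bar>real k - real r\<bar>) else 1)"
      by (rule prod.cong) (auto simp: sum_weight_prob)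
    finally show ?thesis using j by simp
  qed
  have in_W: "?c s \<in> ?W" if "s \<in> ?F" for s
    using that by (auto simp: PiE_iff intro: card_mono[of "{..<n}", simplified])
  \<comment> \<open>Given the weights \<open>w\<close>, the families are equally likely, so the
    conditional probability is the ratio of two counts. It is at most \<beta> if the deviation is
    small, and otherwise at most \<open>1\<close>, hence at most the deviation over \<eta>.\<close>
  have fiber: "(\<Sum>s\<in>{s \<in> ?F. ?c s = w}. of_bool (\<Phi> s) * (\<Prod>i<m. row_law (s i)))
      \<le> ?q w * (\<beta> + ?dev w / \<eta>)" if w: "w \<in> ?W" for w
  proof -
    let ?N = "real (card {s \<in> ?F. (\<forall>i<m. card (s i) = w i) \<and> \<Phi> s})"
    let ?C = "\<Prod>i<m. real (n choose w i)"
    have Cpos: "0 < ?C" using w by (intro prod_pos) (auto simp: PiE_iff)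
    have set: "{s \<in> ?F. ?c s = w} = {s \<in> ?F. \<forall>i<m. card (s i) = w i}"
      using w by (auto simp: fun_eq_iff PiE_iff extensional_def restrict_def)
    have "(\<Sum>s\<in>{s \<in> ?F. ?c s = w}. of_bool (\<Phi> s) * (\<Prod>i<m. row_law (s i)))
        = (\<Sum>s\<in>{s \<in> ?F. \<forall>i<m. card (s i) = w i}. of_bool (\<Phi> s) * (?q w / ?C))"
      unfolding set by (intro sum.cong) (auto simp: row_law_def prod_dividef)
    also have "\<dots> = ?N * (?q w / ?C)"
    proof -
      have "(\<Sum>s\<in>{s \<in> ?F. \<forall>i<m. card (s i) = w i}. of_bool (\<Phi> s) * (?q w / ?C))
        = (\<Sum>s\<in>{s \<in> ?F. (\<forall>i<m. card (s i) = w i) \<and> \<Phi> s}. ?q w / ?C)"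
        by (rule sum.mono_neutral_cong_right) auto
      then show ?thesis by simp
    qed
    finally have eq: "(\<Sum>s\<in>{s \<in> ?F. ?c s = w}. of_bool (\<Phi> s) * (\<Prod>i<m. row_law (s i))) = ?q w * (?N / ?C)"
      by simp
    show ?thesis
    proof (cases "w \<in> {..<m} \<rightarrow>\<^sub>E S")
      case False
      then obtain i where "i < m" "w i \<notin> S" "w i \<le> n" using w by (auto simp: PiE_iff)
      then have "\<exists>i\<in>{..<m}. weight_prob (w i) = 0" using S by auto
      then have q0: "?q w = 0" by (intro prod_zero) auto
      show ?thesis unfolding eq q0 by simp
    next
      case True
      have "?N / ?C \<le> \<beta> + ?dev w / \<eta>"
      proof (cases "?dev w \<le> \<eta>")
        case le: True
        have "0 \<le> ?dev w / \<eta>" using \<eta> by (auto intro!: divide_nonneg_nonneg sum_nonneg)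
        moreover have "?N / ?C \<le> \<beta>" using bound[OF True le] Cpos by (simp add: divide_le_eq)
        ultimately show ?thesis by linarith
      next
        case False
        have "{s \<in> ?F. (\<forall>i<m. card (s i) = w i) \<and> \<Phi> s} \<subseteq> PiE {..<m} (\<lambda>i. {s. s \<subseteq> {..<n} \<and> card s = w i})"
          unfolding PiE_iff subset_iff by blast
        then have "card {s \<in> ?F. (\<forall>i<m. card (s i) = w i) \<and> \<Phi> s} \<le> card (PiE {..<m} (\<lambda>i. {s. s \<subseteq> {..<n} \<and> card s = w i}))"
          by (intro card_mono finite_PiE) auto
        also have "\<dots> = (\<Prod>i<m. n choose w i)" by (simp add: card_PiE n_subsets)
        finally have "?N / ?C \<le> 1" using Cpos
          by (simp add: divide_le_eq of_nat_prod[symmetric] del: of_nat_prod)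
        also have "1 \<le> ?dev w / \<eta>" using False \<eta> by (simp add: field_simps)
        finally show ?thesis using \<beta> by simp
      qed
      then show ?thesis unfolding eq using wp by (intro mult_left_mono) auto
    qed
  qed
  have "\<P>(\<omega> in P. \<Phi> (rows m \<omega>)) = (\<Sum>w\<in>?W. \<Sum>s\<in>{s \<in> ?F. ?c s = w}. of_bool (\<Phi> s) * (\<Prod>i<m. row_law (s i)))"
    unfolding prob_rows
    by (rule sum.group[symmetric]) (simp_all only: finite_row_families finite_PiE finite_lessThan finite_atMost image_subsetI[OF in_W])
  also have "\<dots> \<le> (\<Sum>w\<in>?W. ?q w * (\<beta> + ?dev w / \<eta>))" by (intro sum_mono fiber)
  also have "\<dots> = \<beta> * (\<Sum>w\<in>?W. ?q w) + (\<Sum>w\<in>?W. \<Sum>i<m. ?q w * \<bar>real (w i) - real r\<bar>) / \<eta>"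
    by (simp add: distrib_left sum.distrib sum_distrib_left sum_divide_distrib mult.commute)
  also have "(\<Sum>w\<in>?W. \<Sum>i<m. ?q w * \<bar>real (w i) - real r\<bar>) = (\<Sum>i<m. \<Sum>k\<le>n. weight_prob k * \<bar>real k - real r\<bar>)"
    by (subst sum.swap) (simp add: qdev)
  finally show ?thesis by (simp add: qsum)
qed

end

subsection \<open>The 2-core as a maximal stable set of rows\<close>

definition stable :: "nat \<Rightarrow> (nat \<Rightarrow> nat set) \<Rightarrow> nat set \<Rightarrow> bool" where
  "stable n s R \<longleftrightarrow> (\<forall>j<n. card {i \<in> R. j \<in> s i} \<noteq> 1)"

definition is_core :: "nat \<Rightarrow> nat \<Rightarrow> (nat \<Rightarrow> nat set) \<Rightarrow> nat set \<Rightarrow> bool" where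
  "is_core n m s R \<longleftrightarrow> R \<subseteq> {..<m} \<and> stable n s R \<and> (\<forall>S. S \<subseteq> {..<m} \<longrightarrow> stable n s S \<longrightarrow> S \<subseteq> R)"

definition hit_columns :: "nat \<Rightarrow> (nat \<Rightarrow> nat set) \<Rightarrow> nat set \<Rightarrow> nat set" where
  "hit_columns n s R = {j. j < n \<and> (\<exists>i\<in>R. j \<in> s i)}"

definition dense_core :: "nat \<Rightarrow> nat \<Rightarrow> real \<Rightarrow> (nat \<Rightarrow> nat set) \<Rightarrow> bool" where
  "dense_core n m \<epsilon> s \<longleftrightarrow>
     (\<exists>R. is_core n m s R \<and> \<epsilon> * real n \<le> real (card R) \<and> card (hit_columns n s R) < card R)"

lemma is_core_unique: "is_core n m s R \<Longrightarrow> is_core n m s R' \<Longrightarrow> R = R'"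
  unfolding is_core_def by blast

lemma finite_columns [simp]: "finite (hit_columns n s R)"
  by (simp add: hit_columns_def)

context
  fixes A :: "bit mat" and n m :: nat and s :: "nat \<Rightarrow> nat set"
  assumes dim: "dim_row A = m" "dim_col A = n"
    and entries: "\<And>i j. i < m \<Longrightarrow> j < n \<Longrightarrow> A $$ (i, j) = 1 \<longleftrightarrow> j \<in> s i"
begin

lemma unit_rows_eq: "R \<subseteq> {..<m} \<Longrightarrow> j < n \<Longrightarrow> unit_rows A R j = {i \<in> R. j \<in> s i}"
  unfolding unit_rows_def using entries by blast

lemma stable_iff: "R \<subseteq> {..<m} \<Longrightarrow> stable n s R \<longleftrightarrow> R \<notin> Domain (deletion_step A)"
proof -
  assume R: "R \<subseteq> {..<m}"
  have "card {i \<in> R. j \<in> s i} = 1 \<longleftrightarrow> (\<exists>i. unit_rows A R j = {i})" if "j < n" for j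
    using unit_rows_eq[OF R that] by (simp add: card_1_singleton_iff)
  moreover have "R \<in> Domain (deletion_step A) \<longleftrightarrow> (\<exists>j<n. \<exists>i. unit_rows A R j = {i})"
    by (auto simp: deletion_step_def Domain_iff dim)
  ultimately show ?thesis unfolding stable_def by blast
qed

text \<open>Two invariants. A row of a stable set is never the only one in a column, so stable sets
  survive; and the deletion of a row empties the column that caused it, so the number of rows minus
  the number of hit columns never decreases.\<close>

lemma deletion_steps:
  assumes "({..<m}, R) \<in> (deletion_step A)\<^sup>*"
  shows "R \<subseteq> {..<m} \<and> (\<forall>S. S \<subseteq> {..<m} \<longrightarrow> stable n s S \<longrightarrow> S \<subseteq> R) \<and>
    m + card (hit_columns n s R) \<le> card R + card (hit_columns n s {..<m})"
  using assms
proof (induction rule: rtrancl_induct)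
  case (step R R')
  then obtain j i where ji: "j < n" "unit_rows A R j = {i}" "R' = R - {i}"
    using dim by (auto simp: deletion_step_def)
  have R: "R \<subseteq> {..<m}" and fR: "finite R" using step finite_subset by auto
  have u: "{i \<in> R. j \<in> s i} = {i}" using ji unit_rows_eq[OF R] by simp
  have "S \<subseteq> R'" if S: "S \<subseteq> {..<m}" "stable n s S" for S
  proof -
    have SR: "S \<subseteq> R" using step.IH S by blast
    have "i \<notin> S"
    proof
      assume "i \<in> S"
      then have "{i \<in> S. j \<in> s i} = {i}" using SR u by blast
      then show False using S(2) ji(1) by (auto simp: stable_def)
    qed
    then show ?thesis using SR ji by blast
  qed
  moreover have "card R = Suc (card R')" using u fR ji by (metis card.remove insertI1 mem_Collect_eq)
  moreover have "j \<in> hit_columns n s R" "hit_columns n s R' \<subseteq> hit_columns n s R - {j}"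
    using u ji unfolding hit_columns_def by blast+
  then have "card (hit_columns n s R') < card (hit_columns n s R)"
    by (metis Diff_iff finite_columns insertI1 psubset_card_mono psubsetI subset_trans Diff_subset subsetD)
  ultimately show ?case using step.IH R ji by auto
qed simp

lemma is_core_two_core_rows:
  shows "is_core n m s (two_core_rows A)"
    and "m + card (hit_columns n s (two_core_rows A)) \<le> card (two_core_rows A) + n"
proof -
  have "is_terminal_state A (two_core_rows A)"
    unfolding two_core_rows_def by (rule theI'[OF ex1_terminal_state])
  then have *: "({..<m}, two_core_rows A) \<in> (deletion_step A)\<^sup>*" "two_core_rows A \<notin> Domain (deletion_step A)"
    by (auto simp: is_terminal_state_def dim)
  show "is_core n m s (two_core_rows A)"
    using deletion_steps[OF *(1)] *(2) stable_iff unfolding is_core_def by blast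
  have "card (hit_columns n s {..<m}) \<le> card {..<n}"
    by (rule card_mono) (auto simp: hit_columns_def)
  then show "m + card (hit_columns n s (two_core_rows A)) \<le> card (two_core_rows A) + n"
    using deletion_steps[OF *(1)] by simp
qed

end

context random_rows
begin

lemma random_matrix_entries:
  assumes "\<omega> \<in> space P"
  shows "dim_row (random_matrix n m X \<omega>) = m" "dim_col (random_matrix n m X \<omega>) = n"
    "i < m \<Longrightarrow> j < n \<Longrightarrow> random_matrix n m X \<omega> $$ (i, j) = X (Suc i) \<omega> $ j"
    "i < m \<Longrightarrow> j < n \<Longrightarrow> random_matrix n m X \<omega> $$ (i, j) = 1 \<longleftrightarrow> j \<in> rows m \<omega> i"
proof -
  have v: "X (Suc i) \<omega> \<in> carrier_vec n" for i using X_range assms by simp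
  show "dim_row (random_matrix n m X \<omega>) = m" "dim_col (random_matrix n m X \<omega>) = n"
    by (simp_all add: random_matrix_def)
  show *: "random_matrix n m X \<omega> $$ (i, j) = X (Suc i) \<omega> $ j" if "i < m" "j < n" for i j
    using that by (simp add: random_matrix_def mat_of_rows_def del: upt_Suc)
  show "i < m \<Longrightarrow> j < n \<Longrightarrow> random_matrix n m X \<omega> $$ (i, j) = 1 \<longleftrightarrow> j \<in> rows m \<omega> i"
    using v[of i] by (auto simp: * rows_def support_def)
qed

lemma core_event_iff:
  assumes "\<omega> \<in> space P"
  shows "core_event n m \<epsilon> X \<omega> \<longleftrightarrow> dense_core n m \<epsilon> (rows m \<omega>)"
proof -
  let ?A = "random_matrix n m X \<omega>"
  note A = random_matrix_entries[OF assms, where m = m]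
  have c: "is_core n m (rows m \<omega>) (two_core_rows ?A)"
    by (rule is_core_two_core_rows(1)[OF A(1,2,4)])
  then have sub: "two_core_rows ?A \<subseteq> {..<m}" by (simp add: is_core_def)
  have "{j. j < n \<and> (\<exists>i\<in>two_core_rows ?A. ?A $$ (i, j) \<noteq> 0)} = hit_columns n (rows m \<omega>) (two_core_rows ?A)"
    using sub A(4) unfolding hit_columns_def bit_not_zero_iff by blast
  moreover have "dense_core n m \<epsilon> (rows m \<omega>) \<longleftrightarrow> \<epsilon> * real n \<le> real (card (two_core_rows ?A)) \<and>
      card (hit_columns n (rows m \<omega>) (two_core_rows ?A)) < card (two_core_rows ?A)"
    unfolding dense_core_def using c is_core_unique[OF c] by metis
  ultimately show ?thesis unfolding core_event_def Let_def by simp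
qed

text \<open>Every deletion empties at least one column, so a surplus of rows survives in the core.\<close>

lemma dense_core_surplus:
  assumes "\<omega> \<in> space P" "n < m" "\<epsilon> * real n \<le> real (m - n)"
  shows "dense_core n m \<epsilon> (rows m \<omega>)"
proof -
  let ?A = "random_matrix n m X \<omega>"
  note A = random_matrix_entries[OF assms(1), where m = m]
  have c: "is_core n m (rows m \<omega>) (two_core_rows ?A)"
    "m + card (hit_columns n (rows m \<omega>) (two_core_rows ?A)) \<le> card (two_core_rows ?A) + n"
    by (rule is_core_two_core_rows[OF A(1,2,4)]; assumption)+
  then have "real (m - n) \<le> real (card (two_core_rows ?A))" by simp
  then show ?thesis unfolding dense_core_def using c assms by (intro exI[of _ "two_core_rows ?A"]) auto
qed

end

section \<open>Transfer between families of rows and configurations of cells\<close>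

definition cells :: "nat \<Rightarrow> (nat \<Rightarrow> nat) \<Rightarrow> (nat \<times> nat) set" where
  "cells m w = (SIGMA i:{..<m}. {..<w i})"

definition rows_of :: "nat \<Rightarrow> (nat \<Rightarrow> nat) \<Rightarrow> (nat \<times> nat \<Rightarrow> nat) \<Rightarrow> nat \<Rightarrow> nat set" where
  "rows_of m w c = (\<lambda>i\<in>{..<m}. (\<lambda>l. c (i, l)) ` {..<w i})"

definition simple_rows :: "nat \<Rightarrow> (nat \<Rightarrow> nat) \<Rightarrow> (nat \<times> nat \<Rightarrow> nat) \<Rightarrow> bool" where
  "simple_rows m w c \<longleftrightarrow> (\<forall>i<m. inj_on (\<lambda>l. c (i, l)) {..<w i})"

lemma finite_cells: "finite (cells m w)"
  by (simp add: cells_def)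

lemma card_cells: "card (cells m w) = (\<Sum>i<m. w i)"
  by (simp add: cells_def)

lemma card_row_cells: "card {x \<in> cells m w. fst x = i} = (if i < m then w i else 0)"
proof -
  have "{x \<in> cells m w. fst x = i} = (if i < m then {i} \<times> {..<w i} else {})" by (auto simp: cells_def)
  then show ?thesis by (simp add: card_cartesian_product)
qed

text \<open>The injection sends a family together with a permutation for each row to the
  configuration that lists the row in this order; \<open>e\<close> fixes a reference order of every
  set.\<close>

lemma card_families_le:
  "card {s \<in> row_families n m. (\<forall>i<m. card (s i) = w i) \<and> \<Phi> s} * (\<Prod>i<m. fact (w i))
     \<le> card {c \<in> cells m w \<rightarrow>\<^sub>E {..<n}. simple_rows m w c \<and> \<Phi> (rows_of m w c)}"
proof -
  let ?S = "{s \<in> row_families n m. (\<forall>i<m. card (s i) = w i) \<and> \<Phi> s}"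
  let ?\<Pi> = "PiE {..<m} (\<lambda>i. {p. p permutes {..<w i}})"
  define e :: "nat set \<Rightarrow> nat \<Rightarrow> nat" where "e S = (SOME h. bij_betw h {0..<card S} S)" for S
  have e: "bij_betw (e S) {..<card S} S" if "finite S" for S
    using someI_ex[OF ex_bij_betw_nat_finite[OF that]] unfolding e_def lessThan_atLeast0 .
  let ?f = "\<lambda>(s, p). \<lambda>(i, l)\<in>cells m w. e (s i) (p i l)"
  have bij: "bij_betw (\<lambda>l. ?f (s, p) (i, l)) {..<w i} (s i)" if "s \<in> ?S" "p \<in> ?\<Pi>" "i < m" for s p i
  proof -
    have "finite (s i)" "card (s i) = w i"
      using that finite_subset[of "s i" "{..<n}"] by (auto simp: PiE_iff)
    then have "bij_betw (e (s i) \<circ> p i) {..<w i} (s i)"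
      using e[of "s i"] permutes_imp_bij[of "p i" "{..<w i}"] that by (auto intro!: bij_betw_trans simp: PiE_iff)
    then show ?thesis
      by (rule bij_betw_cong[THEN iffD1, rotated]) (use that in \<open>auto simp: cells_def\<close>)
  qed
  have "inj_on ?f (?S \<times> ?\<Pi>)"
  proof (rule inj_onI, clarify)
    fix s p s' p'
    assume s: "s \<in> row_families n m" "\<forall>i<m. card (s i) = w i" "\<Phi> s" and p: "p \<in> ?\<Pi>"
      and s': "s' \<in> row_families n m" "\<forall>i<m. card (s' i) = w i" "\<Phi> s'" and p': "p' \<in> ?\<Pi>"
      and eq: "(\<lambda>(i, l)\<in>cells m w. e (s i) (p i l)) = (\<lambda>(i, l)\<in>cells m w. e (s' i) (p' i l))"
    have S: "s \<in> ?S" "s' \<in> ?S" using s s' by auto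
    have "s i = s' i" if "i < m" for i
      using bij[OF S(1) p that] bij[OF S(2) p' that] eq by (auto simp: bij_betw_def)
    then have ss: "s = s'" using s(1) s'(1) by (auto intro: PiE_ext)
    have "p i l = p' i l" if "i < m" for i l
    proof (cases "l < w i")
      case True
      have "finite (s i)" "card (s i) = w i"
        using that s finite_subset[of "s i" "{..<n}"] by (auto simp: PiE_iff)
      then have "inj_on (e (s i)) {..<w i}" using e[of "s i"] by (simp add: bij_betw_def)
      moreover have "e (s i) (p i l) = e (s i) (p' i l)"
        using fun_cong[OF eq, of "(i, l)"] True that ss by (simp add: cells_def)
      moreover have "p i l \<in> {..<w i}" "p' i l \<in> {..<w i}"
        using p p' that True permutes_in_image[of _ "{..<w i}" l] by (auto simp: PiE_iff)
      ultimately show ?thesis by (rule inj_onD)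
    next
      case False
      moreover have "p i permutes {..<w i}" "p' i permutes {..<w i}" using p p' that by (auto simp: PiE_iff)
      ultimately show ?thesis by (simp add: permutes_not_in)
    qed
    then show "s = s' \<and> p = p'" using ss p p' by (auto intro!: PiE_ext[of p "{..<m}" _ p'])
  qed
  moreover have "?f ` (?S \<times> ?\<Pi>) \<subseteq> {c \<in> cells m w \<rightarrow>\<^sub>E {..<n}. simple_rows m w c \<and> \<Phi> (rows_of m w c)}"
  proof (rule image_subsetI)
    fix x assume "x \<in> ?S \<times> ?\<Pi>"
    then obtain s p where x: "x = (s, p)" "s \<in> ?S" "p \<in> ?\<Pi>" by auto
    note b = bij[OF x(2,3)]
    have "rows_of m w (?f (s, p)) = s"
    proof (rule PiE_ext[of _ "{..<m}" "\<lambda>_. UNIV"])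
      show "rows_of m w (?f (s, p)) i = s i" if "i \<in> {..<m}" for i
        using b[of i] that unfolding rows_of_def by (auto simp: bij_betw_def)
    qed (use x in \<open>auto simp: rows_of_def PiE_iff extensional_def\<close>)
    moreover have "simple_rows m w (?f (s, p))"
      using b unfolding simple_rows_def bij_betw_def by blast
    moreover have "?f (s, p) \<in> cells m w \<rightarrow>\<^sub>E {..<n}"
    proof (rule PiE_I)
      fix y assume y: "y \<in> cells m w"
      then obtain i l where il: "y = (i, l)" "i < m" "l < w i" by (auto simp: cells_def)
      have "?f (s, p) (i, l) \<in> s i" using b[OF il(2)] il(3) by (auto simp: bij_betw_def)
      moreover have "s i \<subseteq> {..<n}" using x il by (auto simp: PiE_iff)
      ultimately show "?f (s, p) y \<in> {..<n}" using il(1) by blast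
    qed auto
    ultimately show "?f x \<in> {c \<in> cells m w \<rightarrow>\<^sub>E {..<n}. simple_rows m w c \<and> \<Phi> (rows_of m w c)}"
      using x by simp
  qed
  ultimately have "card (?S \<times> ?\<Pi>) \<le> card {c \<in> cells m w \<rightarrow>\<^sub>E {..<n}. simple_rows m w c \<and> \<Phi> (rows_of m w c)}"
    by (intro card_inj_on_le[of ?f]) (simp_all add: finite_cells finite_PiE)
  moreover have "card ?\<Pi> = (\<Prod>i<m. fact (w i))"
    by (simp add: card_PiE card_permutations)
  ultimately show ?thesis by (simp add: card_cartesian_product)
qed

lemma fact_binomial_ge:
  assumes "k \<le> R" "R < n"
  shows "(real n - real R) ^ k \<le> fact k * real (n choose k)"
proof -
  have "(real n - real R) ^ k = (\<Prod>i=0..<k. real n - real R)" by simp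
  also have "\<dots> \<le> (\<Prod>i=0..<k. real n - real i)" using assms by (intro prod_mono) auto
  also have "\<dots> = fact k * real (n choose k)" by (simp add: binomial_gbinomial gbinomial_prod_rev)
  finally show ?thesis .
qed

text \<open>The power of \<open>n / (n - R)\<close> bounds the reciprocal of the probability that a
  configuration is simple. It stays bounded when the number of cells is of order \<open>n\<close>,
  so events of vanishing probability for cells also vanish for rows.\<close>

lemma families_le_prob:
  assumes n: "R < n" and w: "\<And>i. i < m \<Longrightarrow> w i \<le> R"
    and A: "\<And>c. c \<in> cells m w \<rightarrow>\<^sub>E {..<n} \<Longrightarrow> simple_rows m w c \<Longrightarrow> \<Phi> (rows_of m w c) \<Longrightarrow> A c"
  shows "real (card {s \<in> row_families n m. (\<forall>i<m. card (s i) = w i) \<and> \<Phi> s})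
    \<le> cell_system.prob (cells m w) n A * (real n / (real n - real R)) ^ card (cells m w) * (\<Prod>i<m. real (n choose w i))"
proof -
  interpret cell_system "cells m w" fst n using n by unfold_locales (auto simp: finite_cells)
  let ?N = "card (cells m w)"
  let ?s = "real (card {s \<in> row_families n m. (\<forall>i<m. card (s i) = w i) \<and> \<Phi> s})"
  have nR: "0 < real n - real R" using n by simp
  have "?s * (\<Prod>i<m. fact (w i)) = real (card {s \<in> row_families n m. (\<forall>i<m. card (s i) = w i) \<and> \<Phi> s} * (\<Prod>i<m. fact (w i)))"
    by simp
  also have "\<dots> \<le> real (card {c \<in> configs. A c})"
  proof (rule of_nat_mono, rule order_trans[OF card_families_le], rule card_mono)
    show "finite {c \<in> configs. A c}" by simp
    show "{c \<in> cells m w \<rightarrow>\<^sub>E {..<n}. simple_rows m w c \<and> \<Phi> (rows_of m w c)} \<subseteq> {c \<in> configs. A c}"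
      using A by (auto simp: configs_def)
  qed
  also have "\<dots> = prob A * real n ^ ?N"
    using n by (simp add: prob_def mean_def of_bool_def sum.If_cases Int_def)
  also have "\<dots> = prob A * (real n / (real n - real R)) ^ ?N * (real n - real R) ^ ?N"
    using nR by (simp add: power_divide)
  also have "(real n - real R) ^ ?N = (\<Prod>i<m. (real n - real R) ^ w i)"
    by (simp add: card_cells power_sum)
  also have "prob A * (real n / (real n - real R)) ^ ?N * (\<Prod>i<m. (real n - real R) ^ w i)
     \<le> prob A * (real n / (real n - real R)) ^ ?N * (\<Prod>i<m. fact (w i) * real (n choose w i))"
    using nR w n prob_nonneg by (intro mult_left_mono prod_mono conjI fact_binomial_ge[of _ R]) auto
  finally have "?s * (\<Prod>i<m. fact (w i)) \<le> (prob A * (real n / (real n - real R)) ^ ?N * (\<Prod>i<m. real (n choose w i))) * (\<Prod>i<m. fact (w i))"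
    by (simp add: prod.distrib mult_ac)
  then show ?thesis by (rule mult_right_le_imp_le) (auto intro: prod_pos)
qed

context
  fixes n m :: nat and w :: "nat \<Rightarrow> nat"
  assumes n: "0 < n"
begin

interpretation cell_system "cells m w" fst n
  using n by unfold_locales (auto simp: finite_cells)

lemma deg_rows:
  assumes "simple_rows m w c" "R \<subseteq> {..<m}"
  shows "deg c {x \<in> cells m w. fst x \<in> R} j = card {i \<in> R. j \<in> rows_of m w c i}"
proof -
  have "bij_betw fst {x \<in> {x \<in> cells m w. fst x \<in> R}. c x = j} {i \<in> R. j \<in> rows_of m w c i}"
    unfolding bij_betw_def
  proof
    show "inj_on fst {x \<in> {x \<in> cells m w. fst x \<in> R}. c x = j}"
      using assms by (fastforce simp: inj_on_def simple_rows_def cells_def)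
    show "fst ` {x \<in> {x \<in> cells m w. fst x \<in> R}. c x = j} = {i \<in> R. j \<in> rows_of m w c i}"
    proof
      show "fst ` {x \<in> {x \<in> cells m w. fst x \<in> R}. c x = j} \<subseteq> {i \<in> R. j \<in> rows_of m w c i}"
        by (auto simp: rows_of_def cells_def)
      show "{i \<in> R. j \<in> rows_of m w c i} \<subseteq> fst ` {x \<in> {x \<in> cells m w. fst x \<in> R}. c x = j}"
      proof
        fix i assume i: "i \<in> {i \<in> R. j \<in> rows_of m w c i}"
        then have im: "i < m" using assms(2) by auto
        then obtain l where "l < w i" "c (i, l) = j" using i by (auto simp: rows_of_def)
        then show "i \<in> fst ` {x \<in> {x \<in> cells m w. fst x \<in> R}. c x = j}"
          using i im by (intro image_eqI[of _ _ "(i, l)"]) (auto simp: cells_def)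
      qed
    qed
  qed
  then show ?thesis unfolding deg_def by (rule bij_betw_same_card)
qed

text \<open>While all cells of a stable set of rows are present, none of them is pending, because
  its row is complete, and none is alone in its column, because the rows are stable.\<close>

lemma stable_cells_remain:
  assumes c: "c \<in> configs" "simple_rows m w c" and R: "R \<subseteq> {..<m}" "stable n (rows_of m w c) R"
  shows "{x \<in> cells m w. fst x \<in> R} \<subseteq> remaining c t"
proof (induction t)
  case 0 then show ?case by auto
next
  case (Suc t)
  let ?C = "remaining c t" and ?K = "{x \<in> cells m w. fst x \<in> R}"
  show ?case
  proof (cases "next_cell c ?C")
    case None then show ?thesis using Suc by (simp add: remaining_Suc remove_next_def)
  next
    case (Some x)
    have "x \<notin> ?K"
    proof
      assume xK: "x \<in> ?K"
      show False
      proof (cases "pending ?C = {}")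
        case True
        have "deg c ?C (c x) = 1" by (rule next_cell_light[OF Some True])
        then obtain x' where "{y \<in> ?C. c y = c x} = {x'}" unfolding deg_def by (meson card_1_singletonE)
        then have "{y \<in> ?C. c y = c x} = {x}" using next_cell_in[OF Some] by auto
        then have "{y \<in> ?K. c y = c x} = {x}" using Suc xK by blast
        then have "deg c ?K (c x) = 1" by (simp add: deg_def)
        then have "card {i \<in> R. c x \<in> rows_of m w c i} = 1" using deg_rows[OF c(2) R(1)] by simp
        moreover have "c x < n" using c(1) xK by (auto simp: configs_def PiE_iff)
        ultimately show False using R(2) by (auto simp: stable_def)
      next
        case False
        then have "x \<in> pending ?C" using Some someI_ex[of "\<lambda>x. x \<in> pending ?C"]
          by (auto simp: next_cell_def pending_cell_def)
        then obtain y where "y \<in> cells m w - ?C" "fst y = fst x" by (auto simp: pending_def)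
        then show False using xK Suc by auto
      qed
    qed
    then show ?thesis using Suc Some by (auto simp: remaining_Suc remove_next_def)
  qed
qed

text \<open>At the end nothing is pending, so complete rows remain; no column is light, so these
  rows are stable, and by \<open>stable_cells_remain\<close> they contain every stable set. Positive
  weights make each row visible through its cell \<open>(i, 0)\<close>. Without light columns, heavy
  and hit columns agree.\<close>

lemma core_cells_is_core:
  assumes c: "c \<in> configs" "simple_rows m w c" and w: "\<And>i. i < m \<Longrightarrow> 0 < w i"
  defines "U \<equiv> fst ` core_cells c"
  shows "is_core n m (rows_of m w c) U"
    and "card (core_cells c) = (\<Sum>i\<in>U. w i)"
    and "heavy_columns c (core_cells c) = real (card (hit_columns n (rows_of m w c) U))"
proof -
  have sub: "core_cells c \<subseteq> cells m w" by (simp add: core_cells_def remaining_subset)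
  then have Um: "U \<subseteq> {..<m}" by (auto simp: U_def cells_def)
  have eq: "core_cells c = {x \<in> cells m w. fst x \<in> U}"
  proof
    show "{x \<in> cells m w. fst x \<in> U} \<subseteq> core_cells c"
    proof (rule subsetI, rule ccontr)
      fix x assume x: "x \<in> {x \<in> cells m w. fst x \<in> U}" "x \<notin> core_cells c"
      then obtain y where "y \<in> core_cells c" "fst x = fst y" by (auto simp: U_def)
      then have "y \<in> pending (core_cells c)" using x unfolding pending_def by blast
      then show False using core_not_pending by blast
    qed
  qed (use sub in \<open>auto simp: U_def\<close>)
  have d: "deg c (core_cells c) j = card {i \<in> U. j \<in> rows_of m w c i}" for j
    unfolding eq by (rule deg_rows[OF c(2) Um])
  have st: "stable n (rows_of m w c) U" using core_no_light[of c] unfolding stable_def d by blast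
  have "S \<subseteq> U" if S: "S \<subseteq> {..<m}" "stable n (rows_of m w c) S" for S
  proof
    fix i assume i: "i \<in> S"
    then have "(i, 0) \<in> {x \<in> cells m w. fst x \<in> S}" using S w by (auto simp: cells_def)
    then have "(i, 0) \<in> core_cells c" using stable_cells_remain[OF c S] unfolding core_cells_def by blast
    then show "i \<in> U" unfolding U_def by force
  qed
  with Um st show "is_core n m (rows_of m w c) U" unfolding is_core_def by blast
  have "core_cells c = (SIGMA i:U. {..<w i})" unfolding eq using Um by (auto simp: cells_def)
  moreover have fU: "finite U" using Um finite_subset by blast
  ultimately show "card (core_cells c) = (\<Sum>i\<in>U. w i)" by (simp add: card_SigmaI)
  have "heavy_columns c (core_cells c) = real (card {j. j < n \<and> 2 \<le> deg c (core_cells c) j})"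
    unfolding heavy_columns_def by (subst sum.If_cases) (simp_all add: Int_def)
  also have "{j. j < n \<and> 2 \<le> deg c (core_cells c) j} = hit_columns n (rows_of m w c) U"
  proof -
    have "2 \<le> deg c (core_cells c) j \<longleftrightarrow> (\<exists>i\<in>U. j \<in> rows_of m w c i)" for j
    proof -
      have "2 \<le> deg c (core_cells c) j \<longleftrightarrow> deg c (core_cells c) j \<noteq> 0" using core_no_light[of c j] by auto
      also have "\<dots> \<longleftrightarrow> (\<exists>i\<in>U. j \<in> rows_of m w c i)"
        unfolding d using fU by auto
      finally show ?thesis .
    qed
    then show ?thesis by (auto simp: hit_columns_def)
  qed
  finally show "heavy_columns c (core_cells c) = real (card (hit_columns n (rows_of m w c) U))" .
qed

end

text \<open>A uniform form of positivity of \<open>g\<close> at the zeros of \<open>f\<close>: the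
  maximum of \<open>\<bar>f\<bar>\<close> and \<open>g\<close> is positive on the compact interval,
  hence at least some \<open>c\<close>, and where \<open>\<bar>f\<bar> < c\<close> it must be
  \<open>g\<close>.\<close>

lemma compact_positive_max:
  fixes f g :: "real \<Rightarrow> real"
  assumes "continuous_on {a..b} f" "continuous_on {a..b} g" and pos: "\<And>y. y \<in> {a..b} \<Longrightarrow> f y = 0 \<Longrightarrow> 0 < g y"
  obtains c where "0 < c" "\<And>y. y \<in> {a..b} \<Longrightarrow> \<bar>f y\<bar> < c \<Longrightarrow> c \<le> g y"
proof (cases "{a..b} = {}")
  case True
  then show ?thesis using that[of 1] by auto
next
  case False
  have cont: "continuous_on {a..b} (\<lambda>y. max \<bar>f y\<bar> (g y))" by (intro continuous_intros assms)
  obtain x where x: "x \<in> {a..b}" "\<And>y. y \<in> {a..b} \<Longrightarrow> max \<bar>f x\<bar> (g x) \<le> max \<bar>f y\<bar> (g y)"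
    using continuous_attains_inf[OF compact_Icc False cont] by blast
  have "0 < max \<bar>f x\<bar> (g x)" using pos[OF x(1)] by (cases "f x = 0") auto
  then show ?thesis using x(2) by (intro that) (auto simp: le_max_iff_disj not_less[symmetric])
qed

section \<open>The core for a given sequence of row weights\<close>

locale weighted_cells =
  fixes m :: "nat \<Rightarrow> nat" and w :: "nat \<Rightarrow> nat \<Rightarrow> nat" and r R :: nat and \<alpha> :: real
  assumes r3: "3 \<le> r" and \<alpha>: "0 < \<alpha>"
    and m: "(\<lambda>n. real (m n) / real n) \<longlonglongrightarrow> \<alpha>"
    and w: "\<And>n i. 1 \<le> w n i" "\<And>n i. w n i \<le> R"
    and dev: "(\<lambda>n. (\<Sum>i<m n. \<bar>real (w n i) - real r\<bar>) / real n) \<longlonglongrightarrow> 0"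
begin

lemma card_cells_bounds:
  "\<bar>real (card (cells (m n) (w n))) - real r * real (m n)\<bar> \<le> (\<Sum>i<m n. \<bar>real (w n i) - real r\<bar>)"
proof -
  have "real (card (cells (m n) (w n))) - real r * real (m n) = (\<Sum>i<m n. real (w n i) - real r)"
    by (simp add: card_cells sum_subtractf)
  then show ?thesis by (simp add: sum_abs)
qed

lemma card_cells_lim: "(\<lambda>n. real (card (cells (m n) (w n))) / real n) \<longlonglongrightarrow> real r * \<alpha>"
proof -
  let ?d = "\<lambda>n. (\<Sum>i<m n. \<bar>real (w n i) - real r\<bar>) / real n"
  have 1: "(\<lambda>n. real r * (real (m n) / real n) - ?d n) \<longlonglongrightarrow> real r * \<alpha>"
    by (rule tendsto_eq_rhs[OF tendsto_diff[OF tendsto_mult[OF tendsto_const m] dev]]) simp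
  have 2: "(\<lambda>n. real r * (real (m n) / real n) + ?d n) \<longlonglongrightarrow> real r * \<alpha>"
    by (rule tendsto_eq_rhs[OF tendsto_add[OF tendsto_mult[OF tendsto_const m] dev]]) simp
  have b: "real r * (real (m n) / real n) - ?d n \<le> real (card (cells (m n) (w n))) / real n"
    "real (card (cells (m n) (w n))) / real n \<le> real r * (real (m n) / real n) + ?d n" for n
    using card_cells_bounds[of n]
    by (auto simp: diff_divide_distrib[symmetric] add_divide_distrib[symmetric] intro!: divide_right_mono)
  show ?thesis by (rule tendsto_sandwich[OF _ _ 1 2]) (use b in auto)
qed

sublocale peeling_sequence "\<lambda>n. cells (m n) (w n)" "\<lambda>n. fst" r R "real r * \<alpha>"
proof
  show "finite (cells (m n) (w n))" for n by (rule finite_cells)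
  show "1 \<le> r" "0 < real r * \<alpha>" using r3 \<alpha> by auto
  show "(\<lambda>n. real (card (cells (m n) (w n))) / real n) \<longlonglongrightarrow> real r * \<alpha>" by (rule card_cells_lim)
  show "card {x \<in> cells (m n) (w n). fst x = i} \<le> R" for n i
    using w(2)[of n i] by (simp add: card_row_cells)
  have "fst ` cells (m n) (w n) = {..<m n}" for n
    using w(1)[of n] by (force simp: cells_def image_iff less_eq_Suc_le)
  then show "(\<lambda>n. (\<Sum>i\<in>fst ` cells (m n) (w n). \<bar>real (card {x \<in> cells (m n) (w n). fst x = i}) - real r\<bar>) / real n) \<longlonglongrightarrow> 0"
    using dev by (simp add: card_row_cells)
qed

lemma mu_eq: "mu y = real r * \<alpha> * y ^ (r - 1)"
  by (simp add: mu_def)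

lemma light_density_eq: "light_density y = mu y * (y - (1 - exp (- mu y)))"
proof -
  have "y ^ r = y ^ (r - 1) * y" using r3 by (cases r) auto
  then show ?thesis unfolding light_density_def mu_eq by (simp add: algebra_simps)
qed

lemma mu_pos: "0 < y \<Longrightarrow> 0 < mu y"
  using r3 \<alpha> by (simp add: mu_eq)

text \<open>A positive zero solves the fixed point equation \<open>y = 1 - exp (- mu y)\<close>.
  Taking logarithms gives \<open>threshold_h\<close>. Replacing the exponential by
  \<open>1 - y\<close> turns the column density into \<open>y + (1 - y) * ln (1 - y)\<close> and the
  row density \<open>\<alpha> * y ^ r\<close> into \<open>- y * ln (1 - y) / r\<close>; their
  difference is \<open>psi\<close>.\<close>

lemma light_density_zero:
  assumes y: "0 < y" "y \<le> 1" and z: "light_density y = 0"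
  shows "y < 1" "threshold_h r y = \<alpha>" "column_density y - \<alpha> * y ^ r = psi r y"
proof -
  have e: "exp (- mu y) = 1 - y" using z mu_pos[OF y(1)] by (simp add: light_density_eq)
  then have "0 < 1 - y" by (metis exp_gt_zero)
  then show y1: "y < 1" by simp
  have l: "ln (1 - y) = - mu y" using e by (metis ln_exp)
  show "threshold_h r y = \<alpha>" using y r3 unfolding threshold_h_def l by (simp add: mu_eq)
  have "y ^ r = y ^ (r - 1) * y" using r3 by (cases r) auto
  then have "\<alpha> * y ^ r = mu y * y / real r" using r3 by (simp add: mu_eq)
  then show "column_density y - \<alpha> * y ^ r = psi r y"
    unfolding column_density_def psi_def l e by (simp add: algebra_simps)
qed

lemma continuous_densities:
  "continuous_on S light_density" "continuous_on S (\<lambda>y. column_density y - \<alpha> * y ^ r)"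
  unfolding light_density_def[abs_def] column_density_def[abs_def] mu_def[abs_def]
  by (intro continuous_intros)+

abbreviation "core_rows n c \<equiv> fst ` core_cells n c"

lemma core_rows_bounds:
  assumes c: "c \<in> configs n" "simple_rows (m n) (w n) c" and n: "1 \<le> n"
  shows "\<bar>real (card (core_cells n c)) - real r * real (card (core_rows n c))\<bar> \<le> (\<Sum>i<m n. \<bar>real (w n i) - real r\<bar>)"
    "card (core_rows n c) \<le> card (core_cells n c)"
    "is_core n (m n) (rows_of (m n) (w n) c) (core_rows n c)"
    "heavy_columns n c (core_cells n c) = real (card (hit_columns n (rows_of (m n) (w n) c) (core_rows n c)))"
proof -
  have n0: "0 < n" using n by simp
  have w0: "0 < w n i" for i using w(1)[of n i] by simp
  note core = core_cells_is_core[OF n0 c w0]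
  show "is_core n (m n) (rows_of (m n) (w n) c) (core_rows n c)"
    "heavy_columns n c (core_cells n c) = real (card (hit_columns n (rows_of (m n) (w n) c) (core_rows n c)))"
    by (rule core)+
  have sub: "core_rows n c \<subseteq> {..<m n}" using core(1) by (simp add: is_core_def)
  have "real (card (core_cells n c)) - real r * real (card (core_rows n c)) = (\<Sum>i\<in>core_rows n c. real (w n i) - real r)"
    by (simp add: core(2) sum_subtractf)
  also have "\<bar>\<dots>\<bar> \<le> (\<Sum>i\<in>core_rows n c. \<bar>real (w n i) - real r\<bar>)" by (rule sum_abs)
  also have "\<dots> \<le> (\<Sum>i<m n. \<bar>real (w n i) - real r\<bar>)" by (rule sum_mono2) (use sub in auto)
  finally show "\<bar>real (card (core_cells n c)) - real r * real (card (core_rows n c))\<bar> \<le> (\<Sum>i<m n. \<bar>real (w n i) - real r\<bar>)" .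
  have "(\<Sum>i\<in>core_rows n c. 1) \<le> (\<Sum>i\<in>core_rows n c. w n i)" by (intro sum_mono w)
  then show "card (core_rows n c) \<le> card (core_cells n c)" using core(2) by simp
qed

text \<open>Passing from cells to rows adds a second error \<delta>, and division by
  \<open>r \<ge> 2\<close> absorbs it.\<close>

lemma row_density:
  fixes U C d x :: real
  assumes "\<bar>C - real r * U\<bar> \<le> d" "\<bar>C / N - real r * x\<bar> \<le> \<delta>" "0 < N" "d / N \<le> \<delta>"
  shows "\<bar>U / N - x\<bar> \<le> \<delta>"
proof -
  define u where "u = U / N"
  have "\<bar>C - real r * U\<bar> / N = \<bar>C / N - real r * u\<bar>"
    using assms(3) by (simp add: u_def diff_divide_distrib[symmetric] abs_divide)
  then have "\<bar>C / N - real r * u\<bar> \<le> d / N"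
    using divide_right_mono[OF assms(1), of N] assms(3) by simp
  then have "\<bar>real r * u - real r * x\<bar> \<le> 2 * \<delta>" using assms by linarith
  then have "\<bar>real r * (U / N - x)\<bar> \<le> 2 * \<delta>" by (simp only: right_diff_distrib u_def)
  moreover have "2 * \<bar>U / N - x\<bar> \<le> real r * \<bar>U / N - x\<bar>" using r3 by (intro mult_right_mono) auto
  ultimately show ?thesis by (simp add: abs_mult)
qed

text \<open>Either the deletion gets below the level of \<open>y0\<close>, where too few cells are
  left for a core of \<open>\<epsilon> * n\<close> rows, or it stops near a zero of the light
  density. There \<open>psi\<close> is positive, uniformly by compactness, so the columns outnumber
  the rows.\<close>

lemma core_sparse:
  assumes "\<alpha> < alpha_under r" and \<epsilon>: "0 < \<epsilon>"
  shows "(\<lambda>n. prob n (\<lambda>c. simple_rows (m n) (w n) c \<and> dense_core n (m n) \<epsilon> (rows_of (m n) (w n) c))) \<longlonglongrightarrow> 0"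
proof -
  \<comment> \<open>Makes \<open>r * \<alpha> * y0 ^ r\<close>, the density of cells left at the
    level of \<open>y0\<close>, at most \<open>\<epsilon> / 4\<close>.\<close>
  define y0 where "y0 = min (1/2) (\<epsilon> / (4 * (real r * \<alpha>)))"
  have ra: "0 < real r * \<alpha>" using r3 \<alpha> by simp
  have y0: "0 < y0" "y0 < 1" using \<epsilon> ra by (auto simp: y0_def)
  have "real r * \<alpha> * y0 ^ r \<le> real r * \<alpha> * y0 ^ 1"
    using y0 r3 ra by (intro mult_left_mono power_decreasing) auto
  also have "\<dots> \<le> real r * \<alpha> * (\<epsilon> / (4 * (real r * \<alpha>)))" using ra by (intro mult_left_mono) (auto simp: y0_def)
  also have "\<dots> = \<epsilon> / 4"
  proof -
    have "q * (\<epsilon> / (4 * q)) = \<epsilon> / 4" if "0 < q" for q using that by simp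
    then show ?thesis using ra by blast
  qed
  finally have small: "y0 ^ r * (real r * \<alpha>) < \<epsilon>" using \<epsilon> by (simp add: mult.commute)
  obtain c0 where c0: "0 < c0" "\<And>y. y \<in> {y0..1} \<Longrightarrow> \<bar>light_density y\<bar> < c0 \<Longrightarrow> c0 \<le> column_density y - \<alpha> * y ^ r"
  proof (rule compact_positive_max[of y0 1 light_density "\<lambda>y. column_density y - \<alpha> * y ^ r"])
    fix y assume y: "y \<in> {y0..1}" "light_density y = 0"
    then have "0 < y" "y \<le> 1" using y0 by auto
    note z = light_density_zero[OF this y(2)]
    show "0 < column_density y - \<alpha> * y ^ r"
      unfolding z(3) using psi_pos_of_less_alpha_under[OF r3 assms(1) \<open>0 < y\<close> z(1)] z(2) by simp
  qed (auto intro: continuous_densities)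
  define \<delta> where "\<delta> = c0 / 4"
  have \<delta>: "0 < \<delta>" using c0 by (simp add: \<delta>_def)
  show ?thesis
  proof (rule prob_lim_mono[OF good_stop_lim[OF y0 \<delta>]])
    have lv: "(\<lambda>n. real (card (cells (m n) (w n)) - level y0 n) / real n) \<longlonglongrightarrow> y0 ^ r * (real r * \<alpha>)"
      using level_lim(2)[of y0] y0 by simp
    show "\<forall>\<^sub>F n in sequentially. \<forall>c\<in>configs n. simple_rows (m n) (w n) c \<and> dense_core n (m n) \<epsilon> (rows_of (m n) (w n) c) \<longrightarrow> \<not> good_stop \<delta> y0 n c"
      using order_tendstoD(2)[OF lv small] order_tendstoD(2)[OF dev \<delta>] eventually_gt_at_top[of 0]
    proof eventually_elim
      case (elim n)
      have n: "1 \<le> n" using elim by simp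
      interpret S: cell_system "cells (m n) (w n)" fst n using system[OF n] .
      show ?case
      proof (intro ballI impI notI)
        fix c assume c: "c \<in> configs n" and sd: "simple_rows (m n) (w n) c \<and> dense_core n (m n) \<epsilon> (rows_of (m n) (w n) c)"
          and good: "good_stop \<delta> y0 n c"
        note b = core_rows_bounds[OF c conjunct1[OF sd] n]
        have d: "\<epsilon> * real n \<le> real (card (core_rows n c))"
          "heavy_columns n c (core_cells n c) < real (card (core_rows n c))"
          using sd is_core_unique[OF b(3)] unfolding dense_core_def b(4) by auto
        show False
        proof (cases "level y0 n \<le> stop n c")
          case True
          have "card (core_cells n c) = card (cells (m n) (w n)) - stop n c"
            using S.card_remaining_le_stop[OF order_refl, of c] S.stop_properties(1) by simp
          then have "real (card (core_rows n c)) \<le> real (card (cells (m n) (w n)) - level y0 n)"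
            using True b(2) by simp
          then have "\<epsilon> \<le> real (card (cells (m n) (w n)) - level y0 n) / real n"
            using d(1) elim(3) by (simp add: le_divide_eq)
          then show False using elim(1) by simp
        next
          case False
          then obtain y where y: "y0 \<le> y" "y \<le> 1" "\<bar>light_density y\<bar> \<le> \<delta>"
            "\<bar>real (card (core_cells n c)) / real n - real r * \<alpha> * y ^ r\<bar> \<le> \<delta>"
            "\<bar>heavy_columns n c (core_cells n c) / real n - column_density y\<bar> \<le> \<delta>"
            using good by (auto simp: good_stop_def)
          have "4 * \<delta> \<le> column_density y - \<alpha> * y ^ r" using c0(2)[of y] y \<delta> by (auto simp: \<delta>_def)
          moreover have "\<bar>real (card (core_rows n c)) / real n - \<alpha> * y ^ r\<bar> \<le> \<delta>"
            by (rule row_density[OF b(1)]) (use y(4) elim in \<open>auto simp: mult.assoc\<close>)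
          moreover have "heavy_columns n c (core_cells n c) / real n \<le> real (card (core_rows n c)) / real n"
            using d(2) by (intro divide_right_mono) auto
          ultimately show False using y(5) \<delta> by linarith
        qed
      qed
    qed
  qed
qed

text \<open>The light density is negative at \<open>y1\<close>, so the deletion cannot get that far.
  It stops near a zero beyond \<open>y1\<close>, where \<open>psi\<close> is negative, and at least
  about \<open>\<alpha> * y1 ^ r * n\<close> rows are left.\<close>

lemma core_dense:
  assumes y1: "0 < y1" "y1 < 1" "threshold_h r y1 < \<alpha>" "\<And>x. y1 \<le> x \<Longrightarrow> x < 1 \<Longrightarrow> psi r x < 0"
    and \<epsilon>: "0 < \<epsilon>" "\<epsilon> < \<alpha> * y1 ^ r / 2"
  shows "(\<lambda>n. prob n (\<lambda>c. simple_rows (m n) (w n) c \<and> \<not> dense_core n (m n) \<epsilon> (rows_of (m n) (w n) c))) \<longlonglongrightarrow> 0"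
proof -
  have "- ln (1 - y1) < mu y1"
  proof -
    have "0 < real r * y1 ^ (r - 1)" using y1 r3 by simp
    moreover have "- ln (1 - y1) / (real r * y1 ^ (r - 1)) < \<alpha>" using y1(3) by (simp add: threshold_h_def)
    ultimately have "- ln (1 - y1) < \<alpha> * (real r * y1 ^ (r - 1))" by (simp only: pos_divide_less_eq)
    then show ?thesis unfolding mu_eq by (simp only: mult_ac)
  qed
  then have "exp (- mu y1) < 1 - y1" using y1 by (metis exp_less_cancel_iff exp_ln diff_gt_0_iff_gt minus_less_iff)
  then have neg: "light_density y1 < 0" using mu_pos[OF y1(1)] by (simp add: light_density_eq mult_pos_neg)
  obtain c0 where c0: "0 < c0" "\<And>y. y \<in> {y1..1} \<Longrightarrow> \<bar>light_density y\<bar> < c0 \<Longrightarrow> c0 \<le> - (column_density y - \<alpha> * y ^ r)"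
  proof (rule compact_positive_max[of y1 1 light_density "\<lambda>y. - (column_density y - \<alpha> * y ^ r)"])
    fix y assume y: "y \<in> {y1..1}" "light_density y = 0"
    then have "0 < y" "y \<le> 1" using y1 by auto
    note z = light_density_zero[OF this y(2)]
    show "0 < - (column_density y - \<alpha> * y ^ r)" unfolding z(3) using y1(4)[of y] y z(1) by simp
  qed (auto intro!: continuous_on_minus continuous_densities simp del: minus_diff_eq)
  \<comment> \<open>The three bounds keep the rows ahead of the columns, exclude the first
    alternative of \<open>good_stop\<close>, and leave at least \<open>\<epsilon> * n\<close>
    rows.\<close>
  define \<delta> where "\<delta> = min (c0 / 4) (min (- light_density y1 / 2) (\<alpha> * y1 ^ r / 8))"
  have \<delta>: "0 < \<delta>" "4 * \<delta> \<le> c0" "light_density y1 < - \<delta>" "8 * \<delta> \<le> \<alpha> * y1 ^ r"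
    using c0(1) neg \<alpha> y1(1) by (auto simp: \<delta>_def)
  show ?thesis
  proof (rule prob_lim_mono[OF good_stop_lim[OF y1(1,2) \<delta>(1)]])
    show "\<forall>\<^sub>F n in sequentially. \<forall>c\<in>configs n. simple_rows (m n) (w n) c \<and> \<not> dense_core n (m n) \<epsilon> (rows_of (m n) (w n) c) \<longrightarrow> \<not> good_stop \<delta> y1 n c"
      using order_tendstoD(2)[OF dev \<delta>(1)] eventually_gt_at_top[of 0]
    proof eventually_elim
      case (elim n)
      have n: "1 \<le> n" using elim by simp
      show ?case
      proof (intro ballI impI notI)
        fix c assume c: "c \<in> configs n" and sd: "simple_rows (m n) (w n) c \<and> \<not> dense_core n (m n) \<epsilon> (rows_of (m n) (w n) c)"
          and good: "good_stop \<delta> y1 n c"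
        note b = core_rows_bounds[OF c conjunct1[OF sd] n]
        obtain y where y: "y1 \<le> y" "y \<le> 1" "\<bar>light_density y\<bar> \<le> \<delta>"
            "\<bar>real (card (core_cells n c)) / real n - real r * \<alpha> * y ^ r\<bar> \<le> \<delta>"
            "\<bar>heavy_columns n c (core_cells n c) / real n - column_density y\<bar> \<le> \<delta>"
          using good \<delta>(3) by (auto simp: good_stop_def split: if_splits)
        have 1: "4 * \<delta> \<le> - (column_density y - \<alpha> * y ^ r)" using c0(2)[of y] y \<delta> by auto
        have 2: "\<bar>real (card (core_rows n c)) / real n - \<alpha> * y ^ r\<bar> \<le> \<delta>"
          by (rule row_density[OF b(1)]) (use y(4) elim in \<open>auto simp: mult.assoc\<close>)
        have "\<alpha> * y1 ^ r \<le> \<alpha> * y ^ r" using y(1) y1 \<alpha> by (intro mult_left_mono power_mono) auto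
        then have "\<epsilon> \<le> real (card (core_rows n c)) / real n" using 2 \<epsilon> \<delta> by linarith
        then have "\<epsilon> * real n \<le> real (card (core_rows n c))" using elim by (simp add: le_divide_eq)
        moreover have "heavy_columns n c (core_cells n c) / real n < real (card (core_rows n c)) / real n"
          using 1 2 y(5) \<delta>(1) by linarith
        then have "heavy_columns n c (core_cells n c) < real (card (core_rows n c))"
          using elim by (simp add: divide_less_cancel)
        ultimately have "dense_core n (m n) \<epsilon> (rows_of (m n) (w n) c)"
          using b(3) unfolding dense_core_def b(4) by auto
        then show False using sd by simp
      qed
    qed
  qed
qed

end

section \<open>From given weights to random rows\<close>

locale row_sequence =
  fixes r :: nat
    and Q :: "nat \<Rightarrow> 'w measure" and W :: "nat \<Rightarrow> 'w \<Rightarrow> nat"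
    and P :: "nat \<Rightarrow> 'a measure" and X :: "nat \<Rightarrow> nat \<Rightarrow> 'a \<Rightarrow> bit vec"
  assumes r1: "1 \<le> r"
    and rows: "\<And>n. 1 \<le> n \<Longrightarrow> random_rows n (Q n) (W n) (P n) (X n)"
    and W_to_r: "\<And>\<delta> :: real. 0 < \<delta> \<Longrightarrow>
      (\<lambda>n. \<P>(x in Q n. \<bar>real (W n x) - real r\<bar> > \<delta>)) \<longlonglongrightarrow> 0"
begin

abbreviation "wprob n \<equiv> random_rows.weight_prob (Q n) (W n)"
abbreviation "row_sets n \<equiv> random_rows.rows (X n)"

definition miss :: "nat \<Rightarrow> real" where
  "miss n = (\<Sum>k\<le>n. wprob n k * of_bool (k \<noteq> r))"

text \<open>The weights are integers, so differing from \<open>r\<close> is the same as deviating by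
  more than \<open>1/2\<close>.\<close>

lemma miss_lim: "miss \<longlonglongrightarrow> 0"
proof (rule Lim_transform_eventually[OF W_to_r[of "1/2"]])
  show "\<forall>\<^sub>F n in sequentially. \<P>(x in Q n. 1 / 2 < \<bar>real (W n x) - real r\<bar>) = miss n"
    using eventually_gt_at_top[of 0]
  proof eventually_elim
    case (elim n)
    interpret random_rows n "Q n" "W n" "P n" "X n" using rows elim by simp
    have "1 / 2 < \<bar>real k - real r\<bar> \<longleftrightarrow> k \<noteq> r" for k by linarith
    then show ?case unfolding miss_def expectation_W by simp
  qed
qed simp

lemma miss_nonneg: "1 \<le> n \<Longrightarrow> 0 \<le> miss n"
  unfolding miss_def using random_rows.weight_prob_nonneg[OF rows] by (auto intro!: sum_nonneg)

end

locale bounded_row_sequence = row_sequence +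
  fixes R :: nat
  assumes R: "r \<le> R" and W_le: "\<And>n. 1 \<le> n \<Longrightarrow> \<P>(x in Q n. W n x \<le> R) = 1"
    and W_ge: "\<forall>\<^sub>F n in sequentially. \<P>(x in Q n. 3 \<le> W n x) = 1"
begin

lemma weight_prob_zero:
  assumes "1 \<le> n" "\<P>(x in Q n. A (W n x)) = 1" "\<not> A k"
  shows "wprob n k = 0"
proof -
  interpret random_rows n "Q n" "W n" "P n" "X n" using rows assms by simp
  have ev: "{x \<in> space (Q n). B (W n x)} \<in> Q.events" for B
    using measurable_sets[OF W_random_variable, of "{k. B k}"] by (simp add: vimage_def Int_def conj_commute)
  have "Q.prob {x \<in> space (Q n). W n x = k} \<le> Q.prob {x \<in> space (Q n). \<not> A (W n x)}"
    by (rule Q.finite_measure_mono) (use assms ev[of "\<lambda>k. \<not> A k"] in auto)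
  also have "\<dots> = 0" using Q.prob_neg[OF ev[of A]] assms by simp
  finally show ?thesis unfolding weight_prob_def by (simp only: measure_le_0_iff)
qed

lemma weight_prob_above: "1 \<le> n \<Longrightarrow> R < k \<Longrightarrow> wprob n k = 0"
  using weight_prob_zero[of n "\<lambda>k. k \<le> R" k] W_le by simp

lemma weight_prob_below: "\<forall>\<^sub>F n in sequentially. \<forall>k<3. wprob n k = 0"
  using W_ge eventually_gt_at_top[of 0]
proof eventually_elim
  case (elim n)
  then show ?case using weight_prob_zero[of n "\<lambda>k. 3 \<le> k"] by auto
qed

lemma r3: "3 \<le> r"
proof (rule ccontr)
  assume "\<not> 3 \<le> r"
  then have r: "r < 3" by simp
  have "\<forall>\<^sub>F n in sequentially. miss n < 1" using order_tendstoD(2)[OF miss_lim, of 1] by simp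
  then have "\<forall>\<^sub>F n in sequentially. False"
    using weight_prob_below eventually_gt_at_top[of 0]
  proof eventually_elim
    case (elim n)
    interpret random_rows n "Q n" "W n" "P n" "X n" using rows elim by simp
    have "miss n = (\<Sum>k\<le>n. weight_prob k)" unfolding miss_def
      by (rule sum.cong) (use elim r in auto)
    then show False using sum_weight_prob elim by simp
  qed
  then show False by simp
qed

lemma mean_deviation_le:
  assumes n: "1 \<le> n"
  shows "(\<Sum>k\<le>n. wprob n k * \<bar>real k - real r\<bar>) \<le> real R * miss n"
proof -
  interpret random_rows n "Q n" "W n" "P n" "X n" using rows n by simp
  show ?thesis unfolding miss_def sum_distrib_left
  proof (rule sum_mono)
    fix k
    show "weight_prob k * \<bar>real k - real r\<bar> \<le> real R * (weight_prob k * of_bool (k \<noteq> r))"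
    proof (cases "k \<le> R")
      case True
      then have "\<bar>real k - real r\<bar> \<le> real R * of_bool (k \<noteq> r)" using R by auto
      then have "weight_prob k * \<bar>real k - real r\<bar> \<le> weight_prob k * (real R * of_bool (k \<noteq> r))"
        using weight_prob_nonneg by (rule mult_left_mono)
      then show ?thesis by (simp only: mult_ac)
    next
      case False then show ?thesis using weight_prob_above[OF n] by simp
    qed
  qed
qed

text \<open>For each \<open>n\<close> the least favourable weights among those of small deviation
  are chosen. They form one deterministic sequence, to which the hypothesis on cells applies, and
  \<open>prob_rows_le\<close> bounds the probability by this worst case plus a Markov error.\<close>

theorem rows_prob_lim:
  assumes m: "(\<lambda>n. real (m n) / real n) \<longlonglongrightarrow> \<alpha>"
    and A: "\<And>w. (\<And>n i. 1 \<le> w n i) \<Longrightarrow> (\<And>n i. w n i \<le> R) \<Longrightarrow>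
      (\<lambda>n. (\<Sum>i<m n. \<bar>real (w n i) - real r\<bar>) / real n) \<longlonglongrightarrow> 0 \<Longrightarrow>
      (\<lambda>n. cell_system.prob (cells (m n) (w n)) n
         (\<lambda>c. simple_rows (m n) (w n) c \<and> \<Psi> n (rows_of (m n) (w n) c))) \<longlonglongrightarrow> 0"
  shows "(\<lambda>n. \<P>(\<omega> in P n. \<Psi> n (row_sets n (m n) \<omega>))) \<longlonglongrightarrow> 0"
proof -
  \<comment> \<open>The square root lets \<eta> tend to \<open>0\<close> while the Markov error, of
    order \<open>miss n / \<eta> n\<close>, tends to \<open>0\<close> too; the summand
    \<open>1 / n\<close> keeps \<eta> positive.\<close>
  define \<eta> where "\<eta> n = sqrt (miss n) + 1 / real n" for n
  have \<eta>0: "0 < \<eta> n" if "0 < n" for n using that miss_nonneg[of n] by (simp add: \<eta>_def add_nonneg_pos)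
  have \<eta>_lim: "\<eta> \<longlonglongrightarrow> 0"
    unfolding \<eta>_def[abs_def] using tendsto_add[OF tendsto_real_sqrt[OF miss_lim] lim_1_over_n] by simp
  define G where "G n = {w \<in> {..<m n} \<rightarrow>\<^sub>E {1..R}. (\<Sum>i<m n. \<bar>real (w i) - real r\<bar>) \<le> \<eta> n * real n}" for n
  define F where "F n w = real (card {s \<in> row_families n (m n). (\<forall>i<m n. card (s i) = w i) \<and> \<Psi> n s})
     / (\<Prod>i<m n. real (n choose w i))" for n w
  have "\<exists>w. w \<in> G n \<and> (\<forall>v\<in>G n. F n v \<le> F n w)" for n
  proof -
    have fin: "finite (G n)" unfolding G_def by (intro finite_Collect_conjI disjI1) (simp add: finite_PiE)
    have "0 \<le> \<eta> n * real n" using \<eta>0[of n] by (cases "n = 0") auto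
    then have "(\<lambda>i\<in>{..<m n}. r) \<in> G n" using R r1 by (auto simp: G_def)
    then have ne: "F n ` G n \<noteq> {}" by auto
    obtain w where w: "w \<in> G n" "F n w = Max (F n ` G n)"
      using Max_in[OF finite_imageI[OF fin] ne] by auto
    then show ?thesis using fin Max_ge[OF finite_imageI[OF fin]] by (metis imageI)
  qed
  then obtain v where v: "\<And>n. v n \<in> G n" "\<And>n u. u \<in> G n \<Longrightarrow> F n u \<le> F n (v n)" by metis
  \<comment> \<open>Beyond the first \<open>m n\<close> indices the value \<open>r\<close> keeps the
    bounds on weights valid for all indices.\<close>
  define w where "w n i = (if i < m n then v n i else r)" for n i
  have w_bounds: "1 \<le> w n i" "w n i \<le> R" for n i
    using v(1)[of n] R r1 by (auto simp: w_def G_def PiE_iff)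
  have w_dev: "(\<Sum>i<m n. \<bar>real (w n i) - real r\<bar>) \<le> \<eta> n * real n" for n
    using v(1)[of n] by (simp add: w_def G_def)
  have Fw: "F n (w n) = F n (v n)" for n by (simp add: F_def w_def)
  let ?p = "\<lambda>n. cell_system.prob (cells (m n) (w n)) n
         (\<lambda>c. simple_rows (m n) (w n) c \<and> \<Psi> n (rows_of (m n) (w n) c))"
  have p: "?p \<longlonglongrightarrow> 0"
  proof (rule A)
    show "(\<lambda>n. (\<Sum>i<m n. \<bar>real (w n i) - real r\<bar>) / real n) \<longlonglongrightarrow> 0"
    proof (rule tendsto_sandwich[OF _ _ tendsto_const \<eta>_lim])
      show "\<forall>\<^sub>F n in sequentially. 0 \<le> (\<Sum>i<m n. \<bar>real (w n i) - real r\<bar>) / real n"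
        by (auto intro!: always_eventually divide_nonneg_nonneg sum_nonneg)
      show "\<forall>\<^sub>F n in sequentially. (\<Sum>i<m n. \<bar>real (w n i) - real r\<bar>) / real n \<le> \<eta> n"
        using eventually_gt_at_top[of 0] by eventually_elim (use w_dev in \<open>simp add: divide_le_eq\<close>)
    qed
  qed (use w_bounds in auto)
  \<comment> \<open>Bounds the factor from \<open>families_le_prob\<close> for at most
    \<open>R * (\<alpha> + 1) * n\<close> cells, once \<open>2 * R < n\<close>.\<close>
  define K where "K = exp (2 * real R * real R * (\<alpha> + 1))"
  have up: "(\<lambda>n. ?p n * K + (real (m n) / real n) * (real R * \<eta> n)) \<longlonglongrightarrow> 0"
    by (rule tendsto_eq_rhs[OF tendsto_add[OF tendsto_mult[OF p tendsto_const] tendsto_mult[OF m tendsto_mult[OF tendsto_const \<eta>_lim]]]]) simp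
  show ?thesis
  proof (rule tendsto_sandwich[OF _ _ tendsto_const up])
    show "\<forall>\<^sub>F n in sequentially. 0 \<le> \<P>(\<omega> in P n. \<Psi> n (row_sets n (m n) \<omega>))" by simp
    have m1: "\<forall>\<^sub>F n in sequentially. real (m n) / real n < \<alpha> + 1"
      using order_tendstoD(2)[OF m, of "\<alpha> + 1"] by simp
    show "\<forall>\<^sub>F n in sequentially. \<P>(\<omega> in P n. \<Psi> n (row_sets n (m n) \<omega>)) \<le> ?p n * K + (real (m n) / real n) * (real R * \<eta> n)"
      using weight_prob_below m1 eventually_gt_at_top[of "2 * R"] eventually_gt_at_top[of 0]
    proof eventually_elim
      case (elim n)
      have n: "1 \<le> n" "R < n" using elim by auto
      interpret random_rows n "Q n" "W n" "P n" "X n" using rows n by simp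
      interpret S: cell_system "cells (m n) (w n)" fst n using n by unfold_locales (auto simp: finite_cells)
      let ?N = "card (cells (m n) (w n))"
      have N: "real ?N \<le> real R * ((\<alpha> + 1) * real n)"
      proof -
        have "?N \<le> (\<Sum>i<m n. R)" unfolding card_cells by (intro sum_mono w_bounds)
        then have "real ?N \<le> real (m n * R)" by (simp only: of_nat_le_iff sum_constant card_lessThan of_nat_id)
        also have "\<dots> = real R * real (m n)" by simp
        also have "\<dots> \<le> real R * ((\<alpha> + 1) * real n)"
          using elim by (intro mult_left_mono) (auto simp: divide_less_eq)
        finally show ?thesis .
      qed
      have half: "real n / 2 \<le> real n - real R" using elim by simp
      have "(real n / (real n - real R)) ^ ?N \<le> K"
      proof -
        have "real n / (real n - real R) = 1 + real R / (real n - real R)" using n by (simp add: field_simps)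
        also have "\<dots> \<le> exp (real R / (real n - real R))" by (rule exp_ge_add_one_self)
        also have "\<dots> \<le> exp (real R / (real n / 2))"
        proof -
          have "real R / (real n - real R) \<le> real R / (real n / 2)" using half n by (intro divide_left_mono) auto
          then show ?thesis by (simp only: exp_le_cancel_iff)
        qed
        finally have "(real n / (real n - real R)) ^ ?N \<le> exp (real R / (real n / 2)) ^ ?N"
          using n by (intro power_mono) auto
        also have "\<dots> = exp (real ?N * (real R / (real n / 2)))" by (rule exp_of_nat_mult[symmetric])
        also have "real ?N * (real R / (real n / 2)) \<le> (real R * ((\<alpha> + 1) * real n)) * (real R / (real n / 2))"
          using N by (intro mult_right_mono) auto
        also have "\<dots> = 2 * real R * real R * (\<alpha> + 1)" using n by simp
        finally show ?thesis by (simp add: K_def)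
      qed
      then have pK: "?p n * (real n / (real n - real R)) ^ ?N \<le> ?p n * K"
        by (intro mult_left_mono S.prob_nonneg)
      have p0: "0 \<le> ?p n * K" by (auto intro!: mult_nonneg_nonneg S.prob_nonneg simp: K_def)
      have Cpos: "0 < (\<Prod>i<m n. real (n choose u i))" if "\<And>i. i < m n \<Longrightarrow> u i \<le> R" for u :: "nat \<Rightarrow> nat"
        using that n by (intro prod_pos) (auto intro: le_trans less_imp_le)
      have Fv: "F n (v n) \<le> ?p n * K"
      proof -
        have "F n (w n) \<le> ?p n * (real n / (real n - real R)) ^ ?N"
          unfolding F_def using Cpos[of "w n"] w_bounds
          by (subst pos_divide_le_eq) (auto intro!: families_le_prob n)
        then show ?thesis using pK Fw[of n] by linarith
      qed
      have "\<P>(\<omega> in P n. \<Psi> n (rows (m n) \<omega>))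
        \<le> ?p n * K + real (m n) * (\<Sum>k\<le>n. weight_prob k * \<bar>real k - real r\<bar>) / (\<eta> n * real n)"
      proof (rule prob_rows_le[where S = "{1..R}"])
        show "0 < \<eta> n * real n" using \<eta>0 n by simp
        show "0 \<le> ?p n * K" by (rule p0)
        show "weight_prob k = 0" if "k \<le> n" "k \<notin> {1..R}" for k
          using that elim(1) weight_prob_above[OF n(1), of k] by (cases "k = 0") auto
        fix u assume u: "u \<in> {..<m n} \<rightarrow>\<^sub>E {1..R}" "(\<Sum>i<m n. \<bar>real (u i) - real r\<bar>) \<le> \<eta> n * real n"
        then have "F n u \<le> ?p n * K" using v(2)[of u n] Fv by (force simp: G_def)
        then show "real (card {s \<in> row_families n (m n). (\<forall>i<m n. card (s i) = u i) \<and> \<Psi> n s})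
            \<le> ?p n * K * (\<Prod>i<m n. real (n choose u i))"
          unfolding F_def using Cpos[of u] u by (subst (asm) pos_divide_le_eq) (auto simp: PiE_iff)
      qed
      also have "real (m n) * (\<Sum>k\<le>n. weight_prob k * \<bar>real k - real r\<bar>) / (\<eta> n * real n)
        \<le> (real (m n) / real n) * (real R * \<eta> n)"
      proof -
        have "miss n \<le> \<eta> n * \<eta> n"
        proof -
          have "sqrt (miss n) * sqrt (miss n) \<le> \<eta> n * \<eta> n"
            using miss_nonneg[OF n(1)] by (intro mult_mono) (auto simp: \<eta>_def)
          then show ?thesis using miss_nonneg[OF n(1)] by simp
        qed
        then have "real R * miss n \<le> real R * (\<eta> n * \<eta> n)" by (rule mult_left_mono) simp
        then have "(\<Sum>k\<le>n. weight_prob k * \<bar>real k - real r\<bar>) \<le> real R * \<eta> n * \<eta> n"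
          using mean_deviation_le[OF n(1)] by simp
        then have "(\<Sum>k\<le>n. weight_prob k * \<bar>real k - real r\<bar>) / \<eta> n \<le> real R * \<eta> n"
          using \<eta>0[of n] n by (simp add: divide_le_eq)
        then have "(real (m n) / real n) * ((\<Sum>k\<le>n. weight_prob k * \<bar>real k - real r\<bar>) / \<eta> n)
            \<le> (real (m n) / real n) * (real R * \<eta> n)" by (rule mult_left_mono) simp
        then show ?thesis by (simp add: mult.commute)
      qed
      finally show ?case by simp
    qed
  qed
qed

theorem dense_core_prob_below:
  assumes m: "(\<lambda>n. real (m n) / real n) \<longlonglongrightarrow> \<alpha>" and al: "0 < \<alpha>" "\<alpha> < alpha_under r" and \<epsilon>: "0 < \<epsilon>"
  shows "(\<lambda>n. \<P>(\<omega> in P n. dense_core n (m n) \<epsilon> (row_sets n (m n) \<omega>))) \<longlonglongrightarrow> 0"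
proof (rule rows_prob_lim[OF m])
  fix w :: "nat \<Rightarrow> nat \<Rightarrow> nat"
  assume w: "\<And>n i. 1 \<le> w n i" "\<And>n i. w n i \<le> R"
    "(\<lambda>n. (\<Sum>i<m n. \<bar>real (w n i) - real r\<bar>) / real n) \<longlonglongrightarrow> 0"
  interpret weighted_cells m w r R \<alpha> using w m al r3 by unfold_locales auto
  show "(\<lambda>n. prob n (\<lambda>c. simple_rows (m n) (w n) c \<and> dense_core n (m n) \<epsilon> (rows_of (m n) (w n) c))) \<longlonglongrightarrow> 0"
    by (rule core_sparse[OF al(2) \<epsilon>])
qed

theorem dense_core_prob_above:
  assumes m: "(\<lambda>n. real (m n) / real n) \<longlonglongrightarrow> \<alpha>" and al: "0 < \<alpha>"
    and y: "0 < y" "y < 1" "threshold_h r y < \<alpha>" "\<And>x. y \<le> x \<Longrightarrow> x < 1 \<Longrightarrow> psi r x < 0"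
    and \<epsilon>: "0 < \<epsilon>" "\<epsilon> < \<alpha> * y ^ r / 2"
  shows "(\<lambda>n. \<P>(\<omega> in P n. \<not> dense_core n (m n) \<epsilon> (row_sets n (m n) \<omega>))) \<longlonglongrightarrow> 0"
proof (rule rows_prob_lim[OF m])
  fix w :: "nat \<Rightarrow> nat \<Rightarrow> nat"
  assume w: "\<And>n i. 1 \<le> w n i" "\<And>n i. w n i \<le> R"
    "(\<lambda>n. (\<Sum>i<m n. \<bar>real (w n i) - real r\<bar>) / real n) \<longlonglongrightarrow> 0"
  interpret weighted_cells m w r R \<alpha> using w m al r3 by unfold_locales auto
  show "(\<lambda>n. prob n (\<lambda>c. simple_rows (m n) (w n) c \<and> \<not> dense_core n (m n) \<epsilon> (rows_of (m n) (w n) c))) \<longlonglongrightarrow> 0"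
    by (rule core_dense[OF y \<epsilon>])
qed

end

subsection \<open>Linear dependence\<close>

definition null_families :: "nat \<Rightarrow> nat \<Rightarrow> (nat \<Rightarrow> nat set) \<Rightarrow> nat set set" where
  "null_families n m s = {J. J \<subseteq> {..<m} \<and> (\<forall>j<n. even (card {i \<in> J. j \<in> s i}))}"

lemma finite_null_families [simp]: "finite (null_families n m s)"
  by (rule finite_subset[of _ "Pow {..<m}"]) (auto simp: null_families_def)

lemma empty_null_family [simp]: "{} \<in> null_families n m s"
  by (simp add: null_families_def)

lemma of_nat_bit: "(of_nat k :: bit) = of_bool (odd k)"
  by (induction k) auto

lemma even_card_sym_diff:
  assumes "finite A" "finite B"
  shows "even (card (sym_diff A B)) \<longleftrightarrow> (even (card A) \<longleftrightarrow> even (card B))"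
proof -
  have "card A = card (A - B) + card (A \<inter> B)" "card B = card (B - A) + card (A \<inter> B)"
    using assms card_Int_Diff[of A B] card_Int_Diff[of B A] by (auto simp: Int_commute)
  moreover have "card (sym_diff A B) = card (A - B) + card (B - A)"
    using assms by (intro card_Un_disjoint) auto
  ultimately show ?thesis by auto
qed

text \<open>There are more subsets of \<open>R\<close> than parity patterns on the hit columns. Two
  subsets with the same pattern have a symmetric difference that is even in every column.\<close>

lemma null_family_pigeonhole:
  assumes "finite R" "card (hit_columns n s R) < card R"
  obtains J where "J \<subseteq> R" "J \<noteq> {}" "\<And>j. j < n \<Longrightarrow> even (card {i \<in> J. j \<in> s i})"
proof -
  define f where "f J = {j. j < n \<and> odd (card {i \<in> J. j \<in> s i})}" for J
  have "f J \<subseteq> hit_columns n s R" if "J \<subseteq> R" for J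
  proof
    fix j assume j: "j \<in> f J"
    then have "{i \<in> J. j \<in> s i} \<noteq> {}" unfolding f_def by (metis (no_types, lifting) card.empty even_zero mem_Collect_eq)
    then show "j \<in> hit_columns n s R" using j that by (auto simp: f_def hit_columns_def)
  qed
  then have "card (f ` Pow R) \<le> card (Pow (hit_columns n s R))"
    by (intro card_mono) auto
  also have "\<dots> < card (Pow R)" using assms by (simp add: card_Pow)
  finally have "\<not> inj_on f (Pow R)" by (rule pigeonhole)
  then obtain A B where AB: "A \<subseteq> R" "B \<subseteq> R" "A \<noteq> B" "f A = f B" by (auto simp: inj_on_def)
  show ?thesis
  proof
    show "sym_diff A B \<subseteq> R" "sym_diff A B \<noteq> {}" using AB by auto
    fix j assume j: "j < n"
    have "finite A" "finite B" using finite_subset[OF AB(1) assms(1)] finite_subset[OF AB(2) assms(1)] by auto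
    moreover have "{i \<in> sym_diff A B. j \<in> s i} = sym_diff {i \<in> A. j \<in> s i} {i \<in> B. j \<in> s i}" by auto
    moreover have "even (card {i \<in> A. j \<in> s i}) \<longleftrightarrow> even (card {i \<in> B. j \<in> s i})"
      using AB(4) j by (auto simp: f_def set_eq_iff)
    moreover from calculation have "even (card (sym_diff {i \<in> A. j \<in> s i} {i \<in> B. j \<in> s i}))
        \<longleftrightarrow> (even (card {i \<in> A. j \<in> s i}) \<longleftrightarrow> even (card {i \<in> B. j \<in> s i}))"
      by (intro even_card_sym_diff) auto
    ultimately show "even (card {i \<in> sym_diff A B. j \<in> s i})" by (simp only: simp_thms)
  qed
qed

lemma dense_core_null_family:
  assumes "dense_core n m \<epsilon> s"
  obtains J where "J \<in> null_families n m s" "J \<noteq> {}"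
proof -
  obtain R where R: "is_core n m s R" "card (hit_columns n s R) < card R"
    using assms by (auto simp: dense_core_def)
  then have "R \<subseteq> {..<m}" "finite R" by (auto simp: is_core_def finite_subset)
  then obtain J where "J \<subseteq> R" "J \<noteq> {}" "\<And>j. j < n \<Longrightarrow> even (card {i \<in> J. j \<in> s i})"
    using null_family_pigeonhole[OF _ R(2)] by blast
  then show ?thesis using \<open>R \<subseteq> {..<m}\<close> by (intro that[of J]) (auto simp: null_families_def)
qed

context random_rows
begin

lemma rows_apply: "i < m \<Longrightarrow> rows m \<omega> i = support (X (Suc i) \<omega>)"
  by (simp add: rows_def)

lemma null_vector_count_eq:
  assumes \<omega>: "\<omega> \<in> space P"
  shows "null_vector_count (random_matrix n m X \<omega>) = card (null_families n m (rows m \<omega>))"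
proof -
  let ?A = "random_matrix n m X \<omega>"
  note A = random_matrix_entries[OF \<omega>, where m = m]
  have entry: "(mat_of_row a * ?A) $$ (0, j) = of_nat (card {i \<in> support a. j \<in> rows m \<omega> i})"
    if a: "a \<in> carrier_vec m" and j: "j < n" for a :: "bit vec" and j
  proof -
    have "(mat_of_row a * ?A) $$ (0, j) = (\<Sum>i = 0..<m. a $ i * ?A $$ (i, j))"
      using a j A by (simp add: scalar_prod_def)
    also have "\<dots> = (\<Sum>i = 0..<m. of_bool (i \<in> support a \<and> j \<in> rows m \<omega> i))"
    proof (rule sum.cong)
      fix i assume "i \<in> {0..<m}"
      then show "a $ i * ?A $$ (i, j) = of_bool (i \<in> support a \<and> j \<in> rows m \<omega> i)"
        using a A(4)[of i j] j by (cases "a $ i"; cases "?A $$ (i, j)") (auto simp: support_def)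
    qed simp
    also have "\<dots> = of_nat (card {i \<in> {0..<m}. i \<in> support a \<and> j \<in> rows m \<omega> i})"
      by (simp add: of_bool_def sum.If_cases Int_def)
    also have "{i \<in> {0..<m}. i \<in> support a \<and> j \<in> rows m \<omega> i} = {i \<in> support a. j \<in> rows m \<omega> i}"
      using support_subset[OF a] by auto
    finally show ?thesis .
  qed
  have "bij_betw support {a \<in> carrier_vec m. mat_of_row a * ?A = 0\<^sub>m 1 n}
     {J \<in> Pow {..<m}. \<forall>j<n. even (card {i \<in> J. j \<in> rows m \<omega> i})}"
  proof (rule bij_betw_Collect[OF bij_betw_support])
    fix a :: "bit vec" assume a: "a \<in> carrier_vec m"
    have "mat_of_row a * ?A = 0\<^sub>m 1 n \<longleftrightarrow> (\<forall>j<n. (mat_of_row a * ?A) $$ (0, j) = 0)"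
    proof
      assume e: "mat_of_row a * ?A = 0\<^sub>m 1 n"
      show "\<forall>j<n. (mat_of_row a * ?A) $$ (0, j) = 0" unfolding e by simp
    next
      assume "\<forall>j<n. (mat_of_row a * ?A) $$ (0, j) = 0"
      then show "mat_of_row a * ?A = 0\<^sub>m 1 n"
        by (intro eq_matI) (simp_all only: index_zero_mat index_mult_mat A(2) mat_of_row_carrier less_one, simp_all add: mat_of_row_def)
    qed
    then show "(\<forall>j<n. even (card {i \<in> support a. j \<in> rows m \<omega> i})) = (mat_of_row a * ?A = 0\<^sub>m 1 n)"
      using entry[OF a] by (auto simp: of_nat_bit)
  qed
  then show ?thesis
    unfolding null_vector_count_def null_families_def A(1,2) by (auto dest: bij_betw_same_card)
qed

text \<open>A relation among the first \<open>k\<close> rows that involves the last one expresses it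
  through the earlier ones; \<open>k - 1\<close> is the position of \<open>X k\<close>.\<close>

lemma span_iff_null_family:
  assumes \<omega>: "\<omega> \<in> space P" and k: "1 \<le> k"
  shows "X k \<omega> \<in> LinearCombinations.module.span class_ring (module_vec TYPE(bit) n) ((\<lambda>i. X i \<omega>) ` {1..<k})
    \<longleftrightarrow> (\<exists>J\<in>null_families n k (rows k \<omega>). k - 1 \<in> J)"
proof -
  interpret V: vec_space "TYPE(bit)" n .
  let ?S = "(\<lambda>i. X i \<omega>) ` {1..<k}"
  let ?s = "rows k \<omega>"
  have Xc: "X i \<omega> \<in> carrier_vec n" if "1 \<le> i" for i using X_range[OF that \<omega>] .
  have S: "?S \<subseteq> carrier_vec n" "finite ?S" using Xc by auto
  have Xj: "X (Suc i) \<omega> $ j = of_bool (j \<in> ?s i)" if "i < k" "j < n" for i j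
    using that Xc[of "Suc i"] by (cases "X (Suc i) \<omega> $ j") (auto simp: rows_apply support_def)
  define v where "v J = vec n (\<lambda>j. of_nat (card {i \<in> J. j \<in> ?s i}) :: bit)" for J
  have v_in: "v J \<in> V.span ?S" if "J \<subseteq> {..<k - 1}" for J
    using finite_subset[OF that finite_lessThan] that
  proof (induction J rule: finite_induct)
    case empty
    have "v {} = 0\<^sub>v n" by (auto simp: v_def)
    then show ?case by (simp only: V.span_zero)
  next
    case (insert i J)
    have "{l \<in> insert i J. j \<in> ?s l} = (if j \<in> ?s i then insert i {l \<in> J. j \<in> ?s l} else {l \<in> J. j \<in> ?s l})" for j
      by auto
    then have "v (insert i J) = X (Suc i) \<omega> + v J"
      using insert Xc[of "Suc i"] Xj[of i] by (intro eq_vecI) (auto simp: v_def)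
    moreover have "X (Suc i) \<omega> \<in> V.span ?S"
      using V.in_own_span[OF S(1)] insert by force
    moreover have "J \<subseteq> {..<k - 1}" using insert by auto
    then have "v J \<in> V.span ?S" by (rule insert.IH)
    ultimately show ?case by (simp only: V.span_add1[OF S(1)])
  qed
  show ?thesis
  proof
    assume "\<exists>J\<in>null_families n k ?s. k - 1 \<in> J"
    then obtain J where J: "J \<in> null_families n k ?s" "k - 1 \<in> J" by auto
    then have Jk: "J - {k - 1} \<subseteq> {..<k - 1}" "finite J" by (auto simp: null_families_def finite_subset)
    have "v (J - {k - 1}) = X k \<omega>"
    proof (rule eq_vecI)
      fix j assume "j < dim_vec (X k \<omega>)"
      then have j: "j < n" using Xc[OF k] by simp
      have "{i \<in> J. j \<in> ?s i} = (if j \<in> ?s (k - 1) then insert (k - 1) {i \<in> J - {k - 1}. j \<in> ?s i} else {i \<in> J - {k - 1}. j \<in> ?s i})"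
        using J(2) by auto
      then have "card {i \<in> J. j \<in> ?s i} = card {i \<in> J - {k - 1}. j \<in> ?s i} + of_bool (j \<in> ?s (k - 1))"
        using Jk(2) by auto
      moreover have "even (card {i \<in> J. j \<in> ?s i})" using J(1) j by (simp add: null_families_def)
      ultimately have "odd (card {i \<in> J - {k - 1}. j \<in> ?s i}) \<longleftrightarrow> j \<in> ?s (k - 1)" by (auto split: if_splits)
      then show "v (J - {k - 1}) $ j = X k \<omega> $ j"
        using Xj[of "k - 1" j] j k by (simp add: v_def of_nat_bit)
    qed (use Xc[OF k] in \<open>auto simp: v_def\<close>)
    then show "X k \<omega> \<in> V.span ?S" using v_in[OF Jk(1)] by simp
  next
    assume "X k \<omega> \<in> V.span ?S"
    then obtain a where a: "X k \<omega> = V.lincomb a ?S" using V.finite_span[OF S(2,1)] by auto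
    \<comment> \<open>The span is that of a set of vectors, in which equal rows coincide. Below,
      \<open>h\<close> picks one index for each vector with coefficient \<open>1\<close>, so that
      the combination becomes a sum over indices.\<close>
    define T where "T = {x \<in> ?S. a x = 1}"
    have "\<forall>x\<in>T. \<exists>i. i < k - 1 \<and> X (Suc i) \<omega> = x"
    proof
      fix x assume "x \<in> T"
      then obtain i where "1 \<le> i" "i < k" "x = X i \<omega>" by (auto simp: T_def)
      then show "\<exists>i. i < k - 1 \<and> X (Suc i) \<omega> = x" by (intro exI[of _ "i - 1"]) auto
    qed
    then obtain h where h: "\<And>x. x \<in> T \<Longrightarrow> h x < k - 1 \<and> X (Suc (h x)) \<omega> = x" by metis
    have inj: "inj_on h T" using h by (metis inj_onI)
    have fT: "finite T" using S by (simp add: T_def)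
    let ?J = "insert (k - 1) (h ` T)"
    have "?J \<in> null_families n k ?s"
      unfolding null_families_def
    proof (intro CollectI conjI allI impI)
      show "?J \<subseteq> {..<k}" using h k by force
      fix j assume j: "j < n"
      have "X k \<omega> $ j = (\<Sum>x\<in>?S. a x * x $ j)" using V.lincomb_index[OF j S(1), of a] a by simp
      also have "\<dots> = (\<Sum>x\<in>T. x $ j)"
      proof (rule sum.mono_neutral_cong_right)
        show "\<forall>x\<in>?S - T. a x * x $ j = 0" by (auto simp: T_def bit_not_one_iff)
      qed (use S in \<open>auto simp: T_def\<close>)
      also have "\<dots> = (\<Sum>x\<in>T. of_bool (j \<in> ?s (h x)))"
      proof (rule sum.cong)
        fix x assume "x \<in> T"
        then show "x $ j = of_bool (j \<in> ?s (h x))" using Xj[of "h x" j] h[of x] j by auto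
      qed simp
      also have "\<dots> = (\<Sum>i\<in>h ` T. of_bool (j \<in> ?s i))" by (simp add: sum.reindex[OF inj])
      also have "\<dots> = of_nat (card {i \<in> h ` T. j \<in> ?s i})" using fT by (simp add: of_bool_def sum.If_cases Int_def)
      finally have odd: "j \<in> ?s (k - 1) \<longleftrightarrow> odd (card {i \<in> h ` T. j \<in> ?s i})"
        using Xj[of "k - 1" j] j k by (auto simp: of_nat_bit split: if_splits)
      have nin: "k - 1 \<notin> h ` T" using h by fastforce
      have "{i \<in> ?J. j \<in> ?s i} = (if j \<in> ?s (k - 1) then insert (k - 1) {i \<in> h ` T. j \<in> ?s i} else {i \<in> h ` T. j \<in> ?s i})"
        by auto
      then show "even (card {i \<in> ?J. j \<in> ?s i})" using odd nin fT by auto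
    qed
    then show "\<exists>J\<in>null_families n k ?s. k - 1 \<in> J" by blast
  qed
qed

lemma null_families_rows_mono:
  assumes "J \<in> null_families n k (rows k \<omega>)" "k \<le> m"
  shows "J \<in> null_families n m (rows m \<omega>)"
proof -
  have "{i \<in> J. j \<in> rows k \<omega> i} = {i \<in> J. j \<in> rows m \<omega> i}" for j
    using assms by (auto simp: null_families_def rows_def)
  then show ?thesis using assms by (auto simp: null_families_def)
qed

text \<open>The minimum defining the first dependence is over a nonempty set: \<open>n + 1\<close> rows are dependent.\<close>

lemma first_dependence_le_iff:
  assumes \<omega>: "\<omega> \<in> space P"
  shows "first_dependence n X \<omega> \<le> m \<longleftrightarrow> (\<exists>J\<in>null_families n m (rows m \<omega>). J \<noteq> {})"
    and "first_dependence n X \<omega> \<le> Suc n"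
proof -
  define D where "D k \<longleftrightarrow> 1 \<le> k \<and> (\<exists>J\<in>null_families n k (rows k \<omega>). k - 1 \<in> J)" for k
  have T: "first_dependence n X \<omega> = (LEAST k. D k)"
    unfolding first_dependence_def D_def
    by (intro arg_cong[where f = Least] ext conj_cong refl span_iff_null_family[OF \<omega>])
  \<comment> \<open>In a nonempty relation the row with the largest index depends on those before
    it.\<close>
  have DI: "\<exists>k\<le>m. D k" if J: "J \<in> null_families n m (rows m \<omega>)" "J \<noteq> {}" for J m
  proof (intro exI conjI)
    have fJ: "finite J" "J \<subseteq> {..<m}" using J by (auto simp: null_families_def finite_subset)
    have M: "Max J \<in> J" using fJ J(2) by simp
    show "Suc (Max J) \<le> m" using M fJ by (auto simp: less_eq_Suc_le)
    have sub: "J \<subseteq> {..<Suc (Max J)}" using fJ by (auto simp: less_Suc_eq_le)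
    have "{i \<in> J. j \<in> rows (Suc (Max J)) \<omega> i} = {i \<in> J. j \<in> rows m \<omega> i}" for j
      using sub fJ by (auto simp: rows_def)
    then have "J \<in> null_families n (Suc (Max J)) (rows (Suc (Max J)) \<omega>)"
      using J sub by (auto simp: null_families_def)
    then show "D (Suc (Max J))" using M by (auto simp: D_def)
  qed
  have "\<exists>k\<le>Suc n. D k"
  proof -
    have "card (hit_columns n (rows (Suc n) \<omega>) {..<Suc n}) \<le> card {..<n}"
      by (rule card_mono) (auto simp: hit_columns_def)
    then have "card (hit_columns n (rows (Suc n) \<omega>) {..<Suc n}) < card {..<Suc n}" by simp
    from null_family_pigeonhole[OF finite_lessThan this]
    obtain J where "J \<subseteq> {..<Suc n}" "J \<noteq> {}" "\<And>j. j < n \<Longrightarrow> even (card {i \<in> J. j \<in> rows (Suc n) \<omega> i})" by blast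
    then show ?thesis by (intro DI[of J]) (auto simp: null_families_def)
  qed
  then obtain k where k: "k \<le> Suc n" "D k" by auto
  have DT: "D (first_dependence n X \<omega>)" unfolding T using k(2) by (rule LeastI)
  show "first_dependence n X \<omega> \<le> Suc n" unfolding T using Least_le[of D, OF k(2)] k(1) by simp
  show "first_dependence n X \<omega> \<le> m \<longleftrightarrow> (\<exists>J\<in>null_families n m (rows m \<omega>). J \<noteq> {})"
  proof
    assume le: "first_dependence n X \<omega> \<le> m"
    from DT obtain J where "J \<in> null_families n (first_dependence n X \<omega>) (rows (first_dependence n X \<omega>) \<omega>)"
      "first_dependence n X \<omega> - 1 \<in> J" by (auto simp: D_def)
    then show "\<exists>J\<in>null_families n m (rows m \<omega>). J \<noteq> {}" using null_families_rows_mono[OF _ le] by blast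
  next
    assume "\<exists>J\<in>null_families n m (rows m \<omega>). J \<noteq> {}"
    then obtain k' where "k' \<le> m" "D k'" using DI by blast
    then show "first_dependence n X \<omega> \<le> m" unfolding T using Least_le[of D k'] by simp
  qed
qed

lemma first_dependence_event: "{\<omega> \<in> space P. \<Phi> (first_dependence n X \<omega>)} \<in> P.events"
proof -
  have le: "{\<omega> \<in> space P. first_dependence n X \<omega> \<le> k} \<in> P.events" for k
  proof -
    have "{\<omega> \<in> space P. first_dependence n X \<omega> \<le> k} = {\<omega> \<in> space P. \<exists>J\<in>null_families n k (rows k \<omega>). J \<noteq> {}}"
      using first_dependence_le_iff(1) by blast
    then show ?thesis using rows_pred_event[of "\<lambda>s. \<exists>J\<in>null_families n k s. J \<noteq> {}"] by simp
  qed
  have eq: "{\<omega> \<in> space P. first_dependence n X \<omega> = k} \<in> P.events" for k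
  proof -
    have "{\<omega> \<in> space P. first_dependence n X \<omega> = k} = {\<omega> \<in> space P. first_dependence n X \<omega> \<le> k}
      - (if k = 0 then {} else {\<omega> \<in> space P. first_dependence n X \<omega> \<le> k - 1})" by auto
    then show ?thesis using le[of k] le[of "k - 1"] by (simp only: sets.Diff sets.empty_sets split: if_split) simp
  qed
  have "{\<omega> \<in> space P. \<Phi> (first_dependence n X \<omega>)}
      = (\<Union>k\<in>{k. k \<le> Suc n \<and> \<Phi> k}. {\<omega> \<in> space P. first_dependence n X \<omega> = k})"
    using first_dependence_le_iff(2) by auto
  also have "\<dots> \<in> P.events" using eq by (intro sets.finite_UN) auto
  finally show ?thesis .
qed

end

lemma floor_ratio_lim: "0 < \<alpha> \<Longrightarrow> (\<lambda>n. real (nat \<lfloor>\<alpha> * real n\<rfloor>) / real n) \<longlonglongrightarrow> \<alpha>"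
proof -
  assume \<alpha>: "0 < \<alpha>"
  have lo: "(\<lambda>n. \<alpha> - 1 / real n) \<longlonglongrightarrow> \<alpha>"
    by (rule tendsto_eq_rhs[OF tendsto_diff[OF tendsto_const lim_1_over_n]]) simp
  show ?thesis
  proof (rule tendsto_sandwich[OF _ _ lo tendsto_const])
    show "\<forall>\<^sub>F n in sequentially. \<alpha> - 1 / real n \<le> real (nat \<lfloor>\<alpha> * real n\<rfloor>) / real n"
      using eventually_gt_at_top[of 0]
    proof eventually_elim
      case (elim n)
      have "(\<alpha> * real n - 1) / real n \<le> real (nat \<lfloor>\<alpha> * real n\<rfloor>) / real n"
        by (intro divide_right_mono) linarith+
      then show ?case using elim by (simp add: diff_divide_distrib)
    qed
    show "\<forall>\<^sub>F n in sequentially. real (nat \<lfloor>\<alpha> * real n\<rfloor>) / real n \<le> \<alpha>"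
      using eventually_gt_at_top[of 0]
    proof eventually_elim
      case (elim n)
      have "0 \<le> \<alpha> * real n" using \<alpha> by simp
      then have "real (nat \<lfloor>\<alpha> * real n\<rfloor>) \<le> \<alpha> * real n" by linarith
      then show ?case using elim by (simp add: divide_le_eq)
    qed
  qed
qed

context bounded_row_sequence
begin

theorem first_dependence_upper:
  assumes \<epsilon>: "0 < \<epsilon>"
  shows "(\<lambda>n. \<P>(\<omega> in P n. (alpha_under r + \<epsilon>) * real n < real (first_dependence n (X n) \<omega>))) \<longlonglongrightarrow> 0"
proof -
  define \<alpha> where "\<alpha> = alpha_under r + \<epsilon>"
  define m where "m n = nat \<lfloor>\<alpha> * real n\<rfloor>" for n
  have \<alpha>: "0 < \<alpha>" "alpha_under r < \<alpha>" using \<epsilon> alpha_under_nonneg_nonempty(2)[OF r3] by (auto simp: \<alpha>_def)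
  obtain y where y: "0 < y" "y < 1" "threshold_h r y < \<alpha>" "\<And>x. y \<le> x \<Longrightarrow> x < 1 \<Longrightarrow> psi r x < 0"
    using psi_neg_of_greater_alpha_under[OF r3 \<alpha>(2)] by metis
  define e where "e = \<alpha> * y ^ r / 4"
  have e: "0 < e" "e < \<alpha> * y ^ r / 2" using \<alpha> y by (auto simp: e_def)
  have m: "(\<lambda>n. real (m n) / real n) \<longlonglongrightarrow> \<alpha>" unfolding m_def by (rule floor_ratio_lim[OF \<alpha>(1)])
  note lim = dense_core_prob_above[OF m \<alpha>(1) y e]
  show ?thesis
  proof (rule tendsto_sandwich[OF _ _ tendsto_const lim])
    show "\<forall>\<^sub>F n in sequentially. \<P>(\<omega> in P n. (alpha_under r + \<epsilon>) * real n < real (first_dependence n (X n) \<omega>))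
       \<le> \<P>(\<omega> in P n. \<not> dense_core n (m n) e (row_sets n (m n) \<omega>))"
      using eventually_gt_at_top[of 0]
    proof eventually_elim
      case (elim n)
      interpret random_rows n "Q n" "W n" "P n" "X n" using rows elim by simp
      show ?case
      proof (rule P.finite_measure_mono)
        show "{\<omega> \<in> space (P n). \<not> dense_core n (m n) e (row_sets n (m n) \<omega>)} \<in> P.events"
          by (rule rows_pred_event[of "\<lambda>s. \<not> dense_core n (m n) e s"])
        show "{\<omega> \<in> space (P n). (alpha_under r + \<epsilon>) * real n < real (first_dependence n (X n) \<omega>)}
           \<subseteq> {\<omega> \<in> space (P n). \<not> dense_core n (m n) e (row_sets n (m n) \<omega>)}"
        proof safe
          fix \<omega> assume \<omega>: "\<omega> \<in> space (P n)" and T: "(alpha_under r + \<epsilon>) * real n < real (first_dependence n (X n) \<omega>)"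
            and d: "dense_core n (m n) e (row_sets n (m n) \<omega>)"
          obtain J where "J \<in> null_families n (m n) (row_sets n (m n) \<omega>)" "J \<noteq> {}"
            by (rule dense_core_null_family[OF d])
          then have "first_dependence n (X n) \<omega> \<le> m n"
            using first_dependence_le_iff(1)[OF \<omega>, of "m n"] by blast
          moreover have "real (m n) \<le> \<alpha> * real n" using \<alpha> unfolding m_def by simp
          ultimately show False using T by (simp add: \<alpha>_def)
        qed
      qed
    qed
  qed simp
qed

text \<open>A probabilistic proof of an analytic inequality. For 1 < \<alpha> <
  \<open>alpha_under r\<close> the core event would have vanishing probability, yet with more rows
  than columns the surplus survives in the core with certainty.\<close>

lemma alpha_under_le_1: "alpha_under r \<le> 1"
proof (rule ccontr)
  assume "\<not> alpha_under r \<le> 1"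
  then obtain \<alpha> where \<alpha>: "1 < \<alpha>" "\<alpha> < alpha_under r" using dense[of 1 "alpha_under r"] by auto
  define m where "m n = nat \<lfloor>\<alpha> * real n\<rfloor>" for n
  define e where "e = (\<alpha> - 1) / 2"
  have m: "(\<lambda>n. real (m n) / real n) \<longlonglongrightarrow> \<alpha>" unfolding m_def using \<alpha> by (intro floor_ratio_lim) simp
  have lim: "(\<lambda>n. \<P>(\<omega> in P n. dense_core n (m n) e (row_sets n (m n) \<omega>))) \<longlonglongrightarrow> 0"
    by (rule dense_core_prob_below[OF m]) (use \<alpha> in \<open>auto simp: e_def\<close>)
  have "1 + e < \<alpha>" using \<alpha> by (simp add: e_def field_simps)
  from order_tendstoD(1)[OF m this]
  have "\<forall>\<^sub>F n in sequentially. \<P>(\<omega> in P n. dense_core n (m n) e (row_sets n (m n) \<omega>)) = 1"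
    using eventually_gt_at_top[of 0]
  proof eventually_elim
    case (elim n)
    interpret random_rows n "Q n" "W n" "P n" "X n" using rows elim by simp
    have "(1 + e) * real n < real (m n)" using elim by (simp add: less_divide_eq)
    moreover have "0 < e" using \<alpha> by (simp add: e_def)
    moreover have "0 < e * real n" using \<open>0 < e\<close> elim by simp
    ultimately have mn: "n < m n" "e * real n \<le> real (m n) - real n" by (auto simp: distrib_right)
    then have mn': "e * real n \<le> real (m n - n)" by (simp add: of_nat_diff)
    have "{\<omega> \<in> space (P n). dense_core n (m n) e (row_sets n (m n) \<omega>)} = space (P n)"
      using dense_core_surplus[OF _ mn(1) mn'] by blast
    then show ?case by (simp add: P.prob_space)
  qed
  then have "(\<lambda>n. \<P>(\<omega> in P n. dense_core n (m n) e (row_sets n (m n) \<omega>))) \<longlonglongrightarrow> 1"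
    by (rule tendsto_eventually)
  with lim show False using LIMSEQ_unique by fastforce
qed

end

subsection \<open>The mean number of null vectors\<close>

definition character :: "nat set \<Rightarrow> nat set \<Rightarrow> real" where
  "character u s = (-1) ^ card (u \<inter> s)"

lemma abs_character [simp]: "\<bar>character u s\<bar> = 1"
  by (simp add: character_def power_abs)

text \<open>Orthogonality: the product over rows becomes a product over the columns in
  \<open>u\<close>, so the sum over \<open>u\<close> factorises into one factor
  \<open>(-1) ^ d + 1\<close> per column, which is \<open>0\<close> or \<open>2\<close>.\<close>

lemma sum_characters:
  assumes "finite J"
  shows "(\<Sum>u\<in>Pow {..<n}. \<Prod>i\<in>J. character u (s i)) = 2 ^ n * of_bool (\<forall>j<n. even (card {i \<in> J. j \<in> s i}))"
proof -
  have "(\<Prod>i\<in>J. character u (s i)) = (\<Prod>j\<in>u. (-1) ^ card {i \<in> J. j \<in> s i})" if "u \<subseteq> {..<n}" for u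
  proof -
    have u: "finite u" using that finite_subset by blast
    have "character u (s i) = (\<Prod>j\<in>u. if j \<in> s i then -1 else 1)" for i
      using u by (simp add: character_def prod.If_cases)
    then have "(\<Prod>i\<in>J. character u (s i)) = (\<Prod>j\<in>u. \<Prod>i\<in>J. if j \<in> s i then -1 else 1)"
      by (simp add: prod.swap[of _ u J])
    also have "\<dots> = (\<Prod>j\<in>u. (-1) ^ card {i \<in> J. j \<in> s i})"
      using assms by (simp add: prod.If_cases Int_def)
    finally show ?thesis .
  qed
  then have "(\<Sum>u\<in>Pow {..<n}. \<Prod>i\<in>J. character u (s i)) = (\<Sum>u\<in>Pow {..<n}. (\<Prod>j\<in>u. (-1) ^ card {i \<in> J. j \<in> s i}) * (\<Prod>j\<in>{..<n} - u. 1))"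
    by (intro sum.cong) auto
  also have "\<dots> = (\<Prod>j<n. (-1) ^ card {i \<in> J. j \<in> s i} + 1)"
    by (rule prod_add[symmetric]) simp
  also have "\<dots> = 2 ^ n * of_bool (\<forall>j<n. even (card {i \<in> J. j \<in> s i}))"
  proof (cases "\<forall>j<n. even (card {i \<in> J. j \<in> s i})")
    case True then show ?thesis by simp
  next
    case False
    then obtain j where "j < n" "odd (card {i \<in> J. j \<in> s i})" by auto
    then have "\<exists>j\<in>{..<n}. (-1::real) ^ card {i \<in> J. j \<in> s i} + 1 = 0" by (auto intro!: bexI[of _ j])
    then have "(\<Prod>j<n. (-1::real) ^ card {i \<in> J. j \<in> s i} + 1) = 0" by (intro prod_zero) auto
    then show ?thesis using False by simp
  qed
  finally show ?thesis .
qed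

text \<open>Orthogonality detects the relations \<open>J\<close>. Summing over all \<open>J\<close>
  before summing over \<open>u\<close> gives one factor per row, the form in which independence of
  the rows can be used.\<close>

lemma card_null_families:
  "real (card (null_families n m s)) = (\<Sum>u\<in>Pow {..<n}. \<Prod>i<m. 1 + character u (s i)) / 2 ^ n"
proof -
  have "(\<Prod>i<m. 1 + character u (s i)) = (\<Sum>J\<in>Pow {..<m}. \<Prod>i\<in>J. character u (s i))" for u
    using prod_add[of "{..<m}" "\<lambda>i. character u (s i)" "\<lambda>_. 1"] by (simp add: add.commute)
  then have "(\<Sum>u\<in>Pow {..<n}. \<Prod>i<m. 1 + character u (s i)) = (\<Sum>J\<in>Pow {..<m}. \<Sum>u\<in>Pow {..<n}. \<Prod>i\<in>J. character u (s i))"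
    by (simp add: sum.swap[of _ "Pow {..<n}"])
  also have "\<dots> = (\<Sum>J\<in>Pow {..<m}. 2 ^ n * of_bool (\<forall>j<n. even (card {i \<in> J. j \<in> s i})))"
    by (intro sum.cong refl sum_characters) (auto intro: finite_subset)
  also have "\<dots> = 2 ^ n * real (card {J \<in> Pow {..<m}. \<forall>j<n. even (card {i \<in> J. j \<in> s i})})"
    unfolding sum_distrib_left[symmetric] of_bool_def by (subst sum.If_cases) (simp_all add: Int_def)
  finally show ?thesis by (simp add: null_families_def Pow_def)
qed

lemma sum_lists_prod:
  fixes f :: "'b \<Rightarrow> real"
  assumes "finite A"
  shows "(\<Sum>xs\<in>{xs. set xs \<subseteq> A \<and> length xs = k}. \<Prod>x\<leftarrow>xs. f x) = (\<Sum>x\<in>A. f x) ^ k"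
proof (induction k)
  case 0
  have "{xs. set xs \<subseteq> A \<and> length xs = 0} = {[]}" by auto
  then show ?case by simp
next
  case (Suc k)
  have fin: "finite {xs. set xs \<subseteq> A \<and> length xs = k}" by (rule finite_lists_length_eq[OF assms])
  have "{xs. set xs \<subseteq> A \<and> length xs = Suc k} = (\<lambda>(x, xs). x # xs) ` (A \<times> {xs. set xs \<subseteq> A \<and> length xs = k})"
    by (auto simp: length_Suc_conv image_iff)
  moreover have "inj_on (\<lambda>(x, xs). x # xs) (A \<times> {xs. set xs \<subseteq> A \<and> length xs = k})" by (auto simp: inj_on_def)
  ultimately have "(\<Sum>xs\<in>{xs. set xs \<subseteq> A \<and> length xs = Suc k}. \<Prod>x\<leftarrow>xs. f x)
    = (\<Sum>(x, xs)\<in>A \<times> {xs. set xs \<subseteq> A \<and> length xs = k}. f x * (\<Prod>x\<leftarrow>xs. f x))"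
    by (simp add: sum.reindex case_prod_unfold)
  also have "\<dots> = (\<Sum>x\<in>A. f x) * (\<Sum>xs\<in>{xs. set xs \<subseteq> A \<and> length xs = k}. \<Prod>x\<leftarrow>xs. f x)"
    by (simp add: sum.cartesian_product[symmetric] sum_product)
  finally show ?case using Suc by simp
qed

text \<open>Sampling with and without replacement agree up to \<open>O(1/n)\<close>.\<close>

lemma kravchuk_estimate:
  assumes u: "u \<subseteq> {..<n}" and k: "k < n"
  shows "\<bar>(\<Sum>s\<in>{s \<in> Pow {..<n}. card s = k}. character u s) / real (n choose k) - (1 - 2 * real (card u) / real n) ^ k\<bar>
    \<le> 2 * real k * real k / real n"
proof -
  define L where "L = {xs. set xs \<subseteq> {..<n} \<and> length xs = k}"
  define f where "f x = (if x \<in> u then -1 else 1 :: real)" for x :: nat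
  define S where "S = (\<Sum>s\<in>{s \<in> Pow {..<n}. card s = k}. character u s)"
  define C where "C = real (n choose k)"
  have finL: "finite L" unfolding L_def by (rule finite_lists_length_eq) simp
  have cardL: "card L = n ^ k" using card_lists_length_eq[of "{..<n}" k] by (simp add: L_def)
  have n: "0 < real n" using k by simp
  have fu: "finite u" using u finite_subset by blast
  have f1: "\<bar>\<Prod>x\<leftarrow>xs. f x\<bar> \<le> 1" for xs by (induction xs) (auto simp: f_def abs_mult)
  have "(\<Sum>x<n. f x) = (\<Sum>x<n. 1 - (if x \<in> u then 2 else 0))" by (intro sum.cong) (auto simp: f_def)
  also have "\<dots> = real n - 2 * real (card u)" using u by (simp add: sum_subtractf sum.If_cases Int_absorb1)
  finally have total: "(\<Sum>xs\<in>L. \<Prod>x\<leftarrow>xs. f x) = (real n - 2 * real (card u)) ^ k"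
    unfolding L_def by (subst sum_lists_prod) simp_all
  have dist: "(\<Prod>x\<leftarrow>xs. f x) = character u (set xs)" if "distinct xs" for xs
  proof -
    have "(\<Prod>x\<leftarrow>xs. f x) = (\<Prod>x\<in>set xs. f x)" using that by (simp add: prod.distinct_set_conv_list)
    also have "\<dots> = (-1) ^ card (set xs \<inter> u)" by (simp add: f_def prod.If_cases)
    finally show ?thesis by (simp add: character_def Int_commute)
  qed
  let ?D = "{xs \<in> L. distinct xs}"
  have fib: "{xs \<in> ?D. set xs = s} = {xs. length xs = k \<and> distinct xs \<and> set xs \<subseteq> s}" if "s \<subseteq> {..<n}" "card s = k" for s
  proof -
    have "set xs = s" if "length xs = k" "distinct xs" "set xs \<subseteq> s" for xs
      using that \<open>card s = k\<close> \<open>s \<subseteq> {..<n}\<close> finite_subset[OF \<open>s \<subseteq> {..<n}\<close>] by (intro card_subset_eq) (auto simp: distinct_card)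
    then show ?thesis using that by (auto simp: L_def)
  qed
  have img: "set ` ?D \<subseteq> {s \<in> Pow {..<n}. card s = k}" by (auto simp: L_def distinct_card)
  have fibcard: "card {xs \<in> ?D. set xs = s} = fact k" if "s \<in> {s \<in> Pow {..<n}. card s = k}" for s
  proof -
    have "finite s" using that finite_subset[of s "{..<n}"] by auto
    then show ?thesis using that fib[of s] card_lists_distinct_length_eq[of s k]
      by (simp add: fact_prod atLeastAtMost_iff)
  qed
  have D_sum: "(\<Sum>xs\<in>?D. g (set xs)) = fact k * (\<Sum>s\<in>{s \<in> Pow {..<n}. card s = k}. g s)" for g :: "nat set \<Rightarrow> real"
  proof -
    have "(\<Sum>xs\<in>?D. g (set xs)) = (\<Sum>s\<in>{s \<in> Pow {..<n}. card s = k}. \<Sum>xs\<in>{xs \<in> ?D. set xs = s}. g (set xs))"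
      by (rule sum.group[symmetric]) (use finL img in auto)
    also have "\<dots> = (\<Sum>s\<in>{s \<in> Pow {..<n}. card s = k}. fact k * g s)"
    proof (rule sum.cong[OF refl])
      fix s assume s: "s \<in> {s \<in> Pow {..<n}. card s = k}"
      have "(\<Sum>xs\<in>{xs \<in> ?D. set xs = s}. g (set xs)) = (\<Sum>xs\<in>{xs \<in> ?D. set xs = s}. g s)" by (rule sum.cong) auto
      then show "(\<Sum>xs\<in>{xs \<in> ?D. set xs = s}. g (set xs)) = fact k * g s" by (simp only: sum_constant fibcard[OF s] of_nat_fact)
    qed
    finally show ?thesis by (simp add: sum_distrib_left)
  qed
  have cardD: "real (card ?D) = fact k * C"
    using D_sum[of "\<lambda>_. 1"] n_subsets[of "{..<n}" k] by (simp add: C_def)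
  have Dsum: "(\<Sum>xs\<in>?D. \<Prod>x\<leftarrow>xs. f x) = fact k * S"
    unfolding S_def D_sum[symmetric] by (rule sum.cong) (auto simp: dist)
  have "(\<Sum>xs\<in>L. \<Prod>x\<leftarrow>xs. f x) - (\<Sum>xs\<in>?D. \<Prod>x\<leftarrow>xs. f x) = (\<Sum>xs\<in>L - ?D. \<Prod>x\<leftarrow>xs. f x)"
    using finL by (simp add: sum_diff)
  also have "\<bar>\<dots>\<bar> \<le> (\<Sum>xs\<in>L - ?D. 1)" by (rule order_trans[OF sum_abs sum_mono]) (rule f1)
  also have "\<dots> = real n ^ k - fact k * C"
  proof -
    have "card ?D \<le> n ^ k" using card_mono[OF finL, of ?D] cardL by auto
    then show ?thesis using finL cardL cardD by (simp add: card_Diff_subset of_nat_diff)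
  qed
  finally have main: "\<bar>(real n - 2 * real (card u)) ^ k - fact k * S\<bar> \<le> real n ^ k - fact k * C"
    unfolding total Dsum .
  \<comment> \<open>The probability that \<open>k\<close> draws with replacement are distinct. Both
    comparisons below cost at most \<open>1 - \<theta>\<close>, which Bernoulli's inequality bounds
    by \<open>k\<^sup>2 / n\<close>.\<close>
  define \<theta> where "\<theta> = fact k * C / real n ^ k"
  have Cpos: "0 < C" using k by (simp add: C_def)
  have S_le: "\<bar>S / C\<bar> \<le> 1"
  proof -
    have "\<bar>S\<bar> \<le> (\<Sum>s\<in>{s \<in> Pow {..<n}. card s = k}. 1)"
      unfolding S_def by (rule order_trans[OF sum_abs sum_mono]) simp
    then show ?thesis using Cpos n_subsets[of "{..<n}" k] by (simp add: C_def abs_divide)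
  qed
  have "\<bar>(1 - 2 * real (card u) / real n) ^ k - \<theta> * (S / C)\<bar> \<le> 1 - \<theta>"
  proof -
    have e: "(1 - 2 * real (card u) / real n) = (real n - 2 * real (card u)) / real n" using n by (simp add: field_simps)
    have "(1 - 2 * real (card u) / real n) ^ k - \<theta> * (S / C) = ((real n - 2 * real (card u)) ^ k - fact k * S) / real n ^ k"
      unfolding e power_divide using Cpos by (simp add: \<theta>_def diff_divide_distrib)
    moreover have "1 - \<theta> = (real n ^ k - fact k * C) / real n ^ k" using n by (simp add: \<theta>_def diff_divide_distrib)
    ultimately show ?thesis using main n by (simp add: abs_divide divide_right_mono)
  qed
  moreover have "\<bar>\<theta> * (S / C) - S / C\<bar> \<le> \<bar>1 - \<theta>\<bar>"
  proof -
    have "\<theta> * q - q = - ((1 - \<theta>) * q)" for q :: real by (simp add: left_diff_distrib)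
    from this[of "S / C"] show ?thesis using mult_left_mono[OF S_le, of "\<bar>1 - \<theta>\<bar>"] by (simp add: abs_mult)
  qed
  moreover have "\<bar>s - p\<bar> \<le> 2 * (1 - t)" if "\<bar>p - x\<bar> \<le> 1 - t" "\<bar>x - s\<bar> \<le> \<bar>1 - t\<bar>" for s p x t :: real
  proof -
    have "0 \<le> 1 - t" using that(1) abs_ge_zero order_trans by blast
    then show ?thesis using that by (simp add: abs_le_iff)
  qed
  ultimately have "\<bar>S / C - (1 - 2 * real (card u) / real n) ^ k\<bar> \<le> 2 * (1 - \<theta>)" by blast
  moreover have "1 - \<theta> \<le> real k * real k / real n"
  proof -
    have "1 + real k * (- (real k / real n)) \<le> (1 + - (real k / real n)) ^ k"
      using k by (intro Bernoulli_inequality) (simp add: field_simps)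
    also have "\<dots> = (real n - real k) ^ k / real n ^ k"
      using n by (simp add: power_divide[symmetric] diff_divide_distrib)
    also have "\<dots> \<le> \<theta>" unfolding \<theta>_def C_def using n k by (intro divide_right_mono fact_binomial_ge) auto
    finally show ?thesis by simp
  qed
  ultimately show ?thesis by (simp add: S_def C_def)
qed

context random_rows
begin

definition \<phi> :: "nat set \<Rightarrow> real" where
  "\<phi> u = (\<Sum>s\<in>Pow {..<n}. row_law s * character u s)"

lemma row_law_nonneg: "0 \<le> row_law s"
  by (simp add: row_law_def weight_prob_nonneg)

lemma sum_row_law_1: "(\<Sum>s\<in>Pow {..<n}. row_law s) = 1"
  using sum_row_law[of "\<lambda>_. 1"] by (simp add: sum_weight_prob)

lemma abs_phi_le: "\<bar>\<phi> u\<bar> \<le> 1"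
proof -
  have "\<bar>\<phi> u\<bar> \<le> (\<Sum>s\<in>Pow {..<n}. row_law s)"
    unfolding \<phi>_def by (rule order_trans[OF sum_abs sum_mono]) (simp add: abs_mult row_law_nonneg)
  then show ?thesis by (simp add: sum_row_law_1)
qed

lemma expectation_prod_rows:
  fixes g :: "nat set \<Rightarrow> real"
  shows "(\<Sum>s\<in>row_families n m. (\<Prod>i<m. g (s i)) * (\<Prod>i<m. row_law (s i))) = (\<Sum>t\<in>Pow {..<n}. row_law t * g t) ^ m"
proof -
  have "(\<Sum>s\<in>row_families n m. (\<Prod>i<m. g (s i)) * (\<Prod>i<m. row_law (s i))) = (\<Sum>s\<in>row_families n m. \<Prod>i<m. row_law (s i) * g (s i))"
    by (simp add: prod.distrib mult.commute)
  also have "\<dots> = (\<Prod>i<m. \<Sum>t\<in>Pow {..<n}. row_law t * g t)"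
    by (rule prod_sum_PiE[symmetric]) auto
  finally show ?thesis by simp
qed

theorem expectation_null_families:
  "P.expectation (\<lambda>\<omega>. real (card (null_families n m (rows m \<omega>)))) = (\<Sum>u\<in>Pow {..<n}. (1 + \<phi> u) ^ m) / 2 ^ n"
proof -
  have "P.expectation (\<lambda>\<omega>. real (card (null_families n m (rows m \<omega>))))
     = (\<Sum>s\<in>row_families n m. real (card (null_families n m s)) * (\<Prod>i<m. row_law (s i)))"
    by (rule expectation_rows)
  also have "\<dots> = (\<Sum>u\<in>Pow {..<n}. \<Sum>s\<in>row_families n m. (\<Prod>i<m. 1 + character u (s i)) * (\<Prod>i<m. row_law (s i))) / 2 ^ n"
    unfolding card_null_families by (subst sum.swap) (simp add: sum_divide_distrib sum_distrib_right)
  also have "\<dots> = (\<Sum>u\<in>Pow {..<n}. (1 + \<phi> u) ^ m) / 2 ^ n"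
  proof -
    have "(\<Sum>s\<in>row_families n m. (\<Prod>i<m. 1 + character u (s i)) * (\<Prod>i<m. row_law (s i))) = (1 + \<phi> u) ^ m" for u
      using expectation_prod_rows[where g = "\<lambda>t. 1 + character u t"]
      by (simp add: \<phi>_def distrib_left sum.distrib sum_row_law_1)
    then show ?thesis by simp
  qed
  finally show ?thesis .
qed

text \<open>The probability that \<open>k\<close> rows sum to zero. It ties the character sums to a
  quantity that can also be estimated by counting configurations.\<close>

lemma prob_all_even:
  "\<P>(\<omega> in P. \<forall>j<n. even (card {i \<in> {..<k}. j \<in> rows k \<omega> i})) = (\<Sum>u\<in>Pow {..<n}. \<phi> u ^ k) / 2 ^ n"
proof -
  have "\<P>(\<omega> in P. \<forall>j<n. even (card {i \<in> {..<k}. j \<in> rows k \<omega> i}))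
     = (\<Sum>s\<in>row_families n k. (\<Sum>u\<in>Pow {..<n}. \<Prod>i<k. character u (s i)) / 2 ^ n * (\<Prod>i<k. row_law (s i)))"
    unfolding prob_rows[of "\<lambda>s. \<forall>j<n. even (card {i \<in> {..<k}. j \<in> s i})"] sum_characters[OF finite_lessThan] by simp
  also have "\<dots> = (\<Sum>u\<in>Pow {..<n}. \<Sum>s\<in>row_families n k. (\<Prod>i<k. character u (s i)) * (\<Prod>i<k. row_law (s i))) / 2 ^ n"
    by (subst sum.swap) (simp add: sum_divide_distrib sum_distrib_right)
  finally show ?thesis unfolding expectation_prod_rows \<phi>_def .
qed

lemma phi_estimate:
  assumes u: "u \<subseteq> {..<n}" and r: "r < n"
  shows "\<bar>\<phi> u - (1 - 2 * real (card u) / real n) ^ r\<bar>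
     \<le> 2 * (\<Sum>k\<le>n. weight_prob k * of_bool (k \<noteq> r)) + 2 * real r * real r / real n"
proof -
  define \<kappa> where "\<kappa> k = (\<Sum>s\<in>{s \<in> Pow {..<n}. card s = k}. character u s) / real (n choose k)" for k
  have \<kappa>1: "\<bar>\<kappa> k\<bar> \<le> 1" for k
  proof -
    have "\<bar>\<Sum>s\<in>{s \<in> Pow {..<n}. card s = k}. character u s\<bar> \<le> (\<Sum>s\<in>{s \<in> Pow {..<n}. card s = k}. 1)"
      by (rule order_trans[OF sum_abs sum_mono]) simp
    also have "\<dots> = real (n choose k)" using n_subsets[of "{..<n}" k] by simp
    finally show ?thesis unfolding \<kappa>_def by (cases "n choose k = 0") (auto simp: abs_divide divide_le_eq)
  qed
  have "\<phi> u = (\<Sum>k\<le>n. \<Sum>s\<in>{s \<in> Pow {..<n}. card s = k}. row_law s * character u s)"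
    unfolding \<phi>_def by (rule sum.group[symmetric]) (auto intro: card_mono[of "{..<n}", simplified])
  also have "\<dots> = (\<Sum>k\<le>n. weight_prob k * \<kappa> k)"
    by (intro sum.cong refl) (auto simp: row_law_def \<kappa>_def sum_distrib_left sum_divide_distrib intro!: sum.cong)
  finally have phi: "\<phi> u = (\<Sum>k\<le>n. weight_prob k * \<kappa> k)" .
  have "\<kappa> r = (\<Sum>k\<le>n. weight_prob k * \<kappa> r)" by (simp add: sum_distrib_right[symmetric] sum_weight_prob)
  then have "\<phi> u - \<kappa> r = (\<Sum>k\<le>n. weight_prob k * (\<kappa> k - \<kappa> r))"
    unfolding phi by (simp add: right_diff_distrib sum_subtractf)
  also have "\<bar>\<dots>\<bar> \<le> (\<Sum>k\<le>n. 2 * (weight_prob k * of_bool (k \<noteq> r)))"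
  proof (rule order_trans[OF sum_abs sum_mono])
    fix k
    have "\<bar>\<kappa> k - \<kappa> r\<bar> \<le> 2 * of_bool (k \<noteq> r)" using \<kappa>1[of k] \<kappa>1[of r] by (cases "k = r") auto
    from mult_left_mono[OF this weight_prob_nonneg[of k]]
    show "\<bar>weight_prob k * (\<kappa> k - \<kappa> r)\<bar> \<le> 2 * (weight_prob k * of_bool (k \<noteq> r))"
      by (simp add: abs_mult weight_prob_nonneg mult_ac)
  qed
  finally have "\<bar>\<phi> u - \<kappa> r\<bar> \<le> 2 * (\<Sum>k\<le>n. weight_prob k * of_bool (k \<noteq> r))" by (simp only: sum_distrib_left)
  then show ?thesis using kravchuk_estimate[OF u r] unfolding \<kappa>_def by linarith
qed

end

section \<open>The rate function and \<open>alpha_star\<close>\<close>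

definition objective :: "nat \<Rightarrow> real \<Rightarrow> real \<Rightarrow> real" where
  "objective r \<alpha> \<gamma> = rpow (1 + (1 - 2 * \<gamma>) ^ r) \<alpha> / (2 * rpow \<gamma> \<gamma> * rpow (1 - \<gamma>) (1 - \<gamma>))"

definition sup_objective :: "nat \<Rightarrow> real \<Rightarrow> real" where
  "sup_objective r \<alpha> = (SUP \<gamma>\<in>{0..1/2}. objective r \<alpha> \<gamma>)"

lemma threshold_F_eq: "threshold_F r \<alpha> = ln (sup_objective r \<alpha>)"
  by (simp add: threshold_F_def sup_objective_def objective_def)

lemma rpow_self_pos: "0 \<le> x \<Longrightarrow> 0 < rpow x x"
  by (auto simp: rpow_def)

lemma rpow_self_ge:
  assumes "0 \<le> x" "x \<le> 1" shows "exp (-1) \<le> rpow x x"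
proof (cases "x = 0")
  case False
  then have x: "0 < x" using assms by simp
  have "ln (1 / x) \<le> 1 / x - 1" using x by (intro ln_le_minus_one) simp
  then have "x * (- ln x) \<le> x * (1 / x - 1)" using x by (intro mult_left_mono) (auto simp: ln_div)
  then have "-1 \<le> x * ln x" using x by (simp add: algebra_simps)
  then show ?thesis using x by (simp add: rpow_def powr_def mult.commute)
qed (simp add: rpow_def)

lemma rpow_powr: "0 < x \<Longrightarrow> rpow x \<alpha> = x powr \<alpha>"
  by (simp add: rpow_def)

lemma base_bounds:
  fixes x :: real
  assumes "0 \<le> x" "x \<le> 1"
  shows "1 \<le> 1 + x ^ r" "1 + x ^ r \<le> 2"
  using assms by (auto simp: power_le_one)

lemma base_pos: "0 \<le> \<gamma> \<Longrightarrow> \<gamma> \<le> 1/2 \<Longrightarrow> 0 < 1 + (1 - 2 * \<gamma>) ^ r" for \<gamma> :: real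
  using base_bounds(1)[of "1 - 2 * \<gamma>" r] by linarith

lemma objective_powr:
  assumes "0 \<le> \<gamma>" "\<gamma> \<le> 1/2"
  shows "objective r \<alpha> \<gamma> = (1 + (1 - 2 * \<gamma>) ^ r) powr \<alpha> / (2 * rpow \<gamma> \<gamma> * rpow (1 - \<gamma>) (1 - \<gamma>))"
  using base_pos[OF assms, of r] by (simp add: objective_def rpow_powr)

lemma objective_pos: "0 \<le> \<gamma> \<Longrightarrow> \<gamma> \<le> 1/2 \<Longrightarrow> 0 < objective r \<alpha> \<gamma>"
  using base_pos[of \<gamma> r]
  by (simp add: objective_powr) (auto intro!: divide_pos_pos mult_pos_pos rpow_self_pos simp: less_imp_neq[THEN not_sym])

text \<open>Changing \<alpha> multiplies by a power of a base that is at least \<open>1\<close>.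
  Monotonicity and continuity in \<alpha> and the strict decay below \<open>alpha_star\<close> all
  come from this identity.\<close>

lemma objective_shift:
  assumes "0 \<le> \<gamma>" "\<gamma> \<le> 1/2"
  shows "objective r \<beta> \<gamma> = objective r \<alpha> \<gamma> * (1 + (1 - 2 * \<gamma>) ^ r) powr (\<beta> - \<alpha>)"
  using base_bounds(1)[of "1 - 2 * \<gamma>" r] assms
  by (simp add: objective_powr powr_diff)

lemma objective_mono:
  assumes "0 \<le> \<gamma>" "\<gamma> \<le> 1/2" "\<alpha> \<le> \<beta>"
  shows "objective r \<alpha> \<gamma> \<le> objective r \<beta> \<gamma>"
proof -
  have "1 \<le> (1 + (1 - 2 * \<gamma>) ^ r) powr (\<beta> - \<alpha>)"
    using base_bounds(1)[of "1 - 2 * \<gamma>" r] assms by (intro ge_one_powr_ge_zero) auto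
  then show ?thesis using objective_shift[OF assms(1,2), of r \<beta> \<alpha>] objective_pos[OF assms(1,2), of r \<alpha>]
    by (simp add: mult_le_cancel_left1)
qed

lemma bdd_above_objective: "bdd_above (objective r \<alpha> ` {0..1/2})"
proof (rule bdd_aboveI2)
  fix \<gamma> :: real assume g: "\<gamma> \<in> {0..1/2}"
  have "objective r \<alpha> \<gamma> \<le> objective r \<bar>\<alpha>\<bar> \<gamma>" using g by (intro objective_mono) auto
  also have "\<dots> \<le> 2 powr \<bar>\<alpha>\<bar> / (2 * exp (-1) * exp (-1))"
    unfolding objective_powr[OF g[unfolded atLeastAtMost_iff, THEN conjunct1] g[unfolded atLeastAtMost_iff, THEN conjunct2]]
    using g base_bounds[of "1 - 2 * \<gamma>" r]
    by (intro frac_le mult_mono powr_mono2 rpow_self_ge) (auto intro: less_imp_le[OF rpow_self_pos])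
  finally show "objective r \<alpha> \<gamma> \<le> 2 powr \<bar>\<alpha>\<bar> / (2 * exp (-1) * exp (-1))" .
qed

lemma objective_le_sup: "0 \<le> \<gamma> \<Longrightarrow> \<gamma> \<le> 1/2 \<Longrightarrow> objective r \<alpha> \<gamma> \<le> sup_objective r \<alpha>"
  unfolding sup_objective_def by (intro cSUP_upper bdd_above_objective) auto

lemma less_sup_objective_iff: "c < sup_objective r \<alpha> \<longleftrightarrow> (\<exists>\<gamma>. 0 \<le> \<gamma> \<and> \<gamma> \<le> 1/2 \<and> c < objective r \<alpha> \<gamma>)"
  unfolding sup_objective_def by (subst less_cSUP_iff) (auto intro: bdd_above_objective)

text \<open>The value at \<gamma> = 1/2 is \<open>1\<close> for every \<alpha>, so
  \<open>threshold_F\<close> is never negative.\<close>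

lemma sup_objective_ge_1: "1 \<le> r \<Longrightarrow> 1 \<le> sup_objective r \<alpha>"
proof -
  assume r: "1 \<le> r"
  have "2 * (1 / 2) powr (1 / 2) * (1 / 2) powr (1 / 2) = (1::real)"
    by (simp only: mult.assoc powr_add[symmetric]) simp
  then have "objective r \<alpha> (1/2) = 1" using r by (simp add: objective_def rpow_def zero_power split: if_splits)
  then show ?thesis using objective_le_sup[of "1/2" r \<alpha>] by simp
qed

lemma threshold_F_pos_iff: "1 \<le> r \<Longrightarrow> 0 < threshold_F r \<alpha> \<longleftrightarrow> 1 < sup_objective r \<alpha>"
  using sup_objective_ge_1[of r \<alpha>] by (simp add: threshold_F_eq)

text \<open>Positivity of \<open>threshold_F\<close> at \<alpha> is witnessed by one \<gamma>, at
  which the objective is monotone and continuous in \<alpha>. The set of such positive \<alpha> is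
  therefore closed upwards and open to the left, which gives a strict inequality in the
  equivalence.\<close>

lemma threshold_F_pos_alpha_star:
  assumes r: "1 \<le> r"
  shows "0 < \<alpha> \<Longrightarrow> 0 < threshold_F r \<alpha> \<longleftrightarrow> alpha_star r < \<alpha>" "0 \<le> alpha_star r"
    "0 \<le> \<alpha> \<Longrightarrow> \<alpha> < alpha_star r \<Longrightarrow> 0 \<le> \<gamma> \<Longrightarrow> \<gamma> \<le> 1/2 \<Longrightarrow> objective r \<alpha> \<gamma> \<le> 1"
proof -
  let ?A = "{\<alpha>. 0 \<le> \<alpha> \<and> threshold_F r \<alpha> > 0}"
  have bdd: "bdd_below ?A" by (rule bdd_belowI[of _ 0]) auto
  \<comment> \<open>\<open>objective r 2 0 = 2\<close>, so the set defining
    \<open>alpha_star\<close> contains \<open>2\<close>.\<close>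
  have "1 < objective r 2 0" by (simp add: objective_def rpow_def)
  then have "1 < sup_objective r 2" unfolding less_sup_objective_iff by (intro exI[of _ 0]) auto
  then have "2 \<in> ?A" using threshold_F_pos_iff[OF r] by simp
  then have ne: "?A \<noteq> {}" by (metis empty_iff)
  show "0 \<le> alpha_star r" unfolding alpha_star_def by (rule cInf_greatest[OF ne]) auto
  show "0 < threshold_F r \<alpha> \<longleftrightarrow> alpha_star r < \<alpha>" if \<alpha>: "0 < \<alpha>"
  proof
    assume "alpha_star r < \<alpha>"
    then obtain \<beta> where \<beta>: "\<beta> < \<alpha>" "0 < threshold_F r \<beta>"
      using cInf_less_iff[OF ne bdd] unfolding alpha_star_def by auto
    then obtain \<gamma> where \<gamma>: "0 \<le> \<gamma>" "\<gamma> \<le> 1/2" "1 < objective r \<beta> \<gamma>"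
      using threshold_F_pos_iff[OF r] less_sup_objective_iff by blast
    then have "1 < objective r \<alpha> \<gamma>" using objective_mono[OF \<gamma>(1,2), of \<beta> \<alpha> r] \<beta> by simp
    then show "0 < threshold_F r \<alpha>" using threshold_F_pos_iff[OF r] less_sup_objective_iff \<gamma> by blast
  next
    assume "0 < threshold_F r \<alpha>"
    then obtain \<gamma> where \<gamma>: "0 \<le> \<gamma>" "\<gamma> \<le> 1/2" "1 < objective r \<alpha> \<gamma>"
      using threshold_F_pos_iff[OF r] less_sup_objective_iff by blast
    define b where "b = 1 + (1 - 2 * \<gamma>) ^ r"
    have b: "1 \<le> b" unfolding b_def by (rule base_bounds) (use \<gamma> in auto)
    have "continuous (at \<alpha>) (\<lambda>\<beta>. objective r \<alpha> \<gamma> * b powr (\<beta> - \<alpha>))"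
      using b by (intro continuous_intros) auto
    then have "((\<lambda>\<beta>. objective r \<alpha> \<gamma> * b powr (\<beta> - \<alpha>)) \<longlongrightarrow> objective r \<alpha> \<gamma> * b powr (\<alpha> - \<alpha>)) (at \<alpha>)"
      by (simp only: continuous_at)
    moreover have "1 < objective r \<alpha> \<gamma> * b powr (\<alpha> - \<alpha>)" using \<gamma> b by simp
    ultimately have "\<forall>\<^sub>F \<beta> in at \<alpha>. 1 < objective r \<alpha> \<gamma> * b powr (\<beta> - \<alpha>)" by (rule order_tendstoD(1))
    then obtain d where d: "0 < d" "\<And>\<beta>. \<beta> \<noteq> \<alpha> \<Longrightarrow> dist \<beta> \<alpha> < d \<Longrightarrow> 1 < objective r \<alpha> \<gamma> * b powr (\<beta> - \<alpha>)"
      unfolding eventually_at by blast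
    define \<beta> where "\<beta> = \<alpha> - min (d/2) (\<alpha>/2)"
    have \<beta>: "0 \<le> \<beta>" "\<beta> < \<alpha>" "dist \<beta> \<alpha> < d" using d(1) \<alpha> by (auto simp: \<beta>_def dist_real_def min_def)
    have "1 < objective r \<beta> \<gamma>"
      using d(2)[of \<beta>] \<beta> objective_shift[OF \<gamma>(1,2), of r \<beta> \<alpha>] by (auto simp: b_def)
    then have "0 < threshold_F r \<beta>" using threshold_F_pos_iff[OF r] less_sup_objective_iff \<gamma> by blast
    then have "alpha_star r \<le> \<beta>" unfolding alpha_star_def using \<beta> bdd by (intro cInf_lower) auto
    then show "alpha_star r < \<alpha>" using \<beta> by simp
  qed
  show "objective r \<alpha> \<gamma> \<le> 1" if "0 \<le> \<alpha>" "\<alpha> < alpha_star r" "0 \<le> \<gamma>" "\<gamma> \<le> 1/2"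
  proof (rule ccontr)
    assume "\<not> objective r \<alpha> \<gamma> \<le> 1"
    then have "0 < threshold_F r \<alpha>" using threshold_F_pos_iff[OF r] less_sup_objective_iff that by (meson not_le)
    then have "alpha_star r \<le> \<alpha>" unfolding alpha_star_def using that bdd by (intro cInf_lower) auto
    then show False using that by simp
  qed
qed

section \<open>Binomial coefficients and entropy\<close>

lemma binomial_mode:
  assumes j: "j \<le> n" and i: "i \<le> n"
  shows "(n choose i) * j ^ i * (n - j) ^ (n - i) \<le> (n choose j) * j ^ j * (n - j) ^ (n - j)"
proof -
  define t where "t i = (n choose i) * j ^ i * (n - j) ^ (n - i)" for i
  \<comment> \<open>The ratio of consecutive binomial probabilities with parameter
    \<open>j / n\<close>, with denominators cleared. It is at least \<open>1\<close> before
    \<open>j\<close> and at most \<open>1\<close> from \<open>j\<close> on.\<close>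
  have step: "Suc i * t (Suc i) * (n - j) = (n - i) * t i * j" if "i < n" for i
  proof -
    have "Suc i * (n choose Suc i) = (n - i) * (n choose i)"
      using binomial_absorb_comp[of n i] that by (metis binomial_absorption Suc_diff_1 less_nat_zero_code not_gr_zero)
    moreover have "(n - j) ^ (n - i) = (n - j) * (n - j) ^ (n - Suc i)" using that by (metis Suc_diff_Suc power_Suc)
    moreover have "s * (a * (j * x) * p) * q = t * (b * x * (q * p)) * j" if "s * a = t * b" for s a x p q t b :: nat
    proof -
      have "s * (a * (j * x) * p) * q = (s * a) * (j * x * p * q)" by (simp only: mult_ac)
      also have "\<dots> = t * (b * x * (q * p)) * j" unfolding that by (simp only: mult_ac)
      finally show ?thesis .
    qed
    ultimately show ?thesis unfolding t_def by (simp only: power_Suc)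
  qed
  have up: "t i \<le> t (Suc i)" if "i < j" for i
  proof (cases "t i = 0 \<or> j = n")
    case True
    show ?thesis
    proof (cases "j = n")
      case True
      then have "t i = 0" using that j unfolding t_def by simp
      then show ?thesis by simp
    qed (use True in auto)
  next
    case False
    have "Suc i * (n - j) \<le> (n - i) * j"
    proof -
      have "Suc i * (n - j) \<le> j * (n - j)" using that by (intro mult_right_mono) auto
      also have "\<dots> \<le> j * (n - i)" using that by (intro mult_left_mono) auto
      finally show ?thesis by (simp add: mult.commute)
    qed
    then have "(Suc i * (n - j)) * t i \<le> (n - i) * j * t i" by (rule mult_right_mono) simp
    also have "\<dots> = (Suc i * (n - j)) * t (Suc i)" using step[of i] that j by (simp add: algebra_simps)
    finally show ?thesis using False j by (simp del: mult_Suc)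
  qed
  have down: "t (Suc i) \<le> t i" if "j \<le> i" "i < n" for i
  proof -
    have "(n - i) * j \<le> Suc i * (n - j)"
    proof -
      have "(n - i) * j \<le> (n - j) * Suc i" using that by (intro mult_mono) auto
      then show ?thesis by (simp add: mult.commute)
    qed
    then have "(n - i) * j * t i \<le> (Suc i * (n - j)) * t i" by (rule mult_right_mono) simp
    moreover have "(n - i) * j * t i = (Suc i * (n - j)) * t (Suc i)" using step[of i] that by (simp add: algebra_simps)
    ultimately have "(Suc i * (n - j)) * t (Suc i) \<le> (Suc i * (n - j)) * t i" by simp
    then show ?thesis using that j by (simp del: mult_Suc)
  qed
  have "t i \<le> t j"
  proof (cases "i \<le> j")
    case True
    then show ?thesis by (induction i rule: inc_induct) (use up in \<open>auto intro: order_trans\<close>)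
  next
    case False
    then have "j \<le> i" by simp
    then show ?thesis using i
    proof (induction i rule: dec_induct)
      case (step k)
      then show ?case using down[of k] by (auto intro: le_trans)
    qed simp
  qed
  then show ?thesis by (simp add: t_def)
qed

text \<open>The binomial probabilities with parameter \<open>j / n\<close> sum to \<open>1\<close>,
  and the one at \<open>j\<close> is the largest of \<open>n + 1\<close>. This takes the place of
  Stirling's formula, at the price of a polynomial factor.\<close>

lemma binomial_entropy:
  assumes j: "j \<le> n" and n: "0 < n"
  defines "\<gamma> \<equiv> real j / real n"
  shows "real (n choose j) * (\<gamma> ^ j * (1 - \<gamma>) ^ (n - j)) \<le> 1"
    "1 \<le> real (Suc n) * (real (n choose j) * (\<gamma> ^ j * (1 - \<gamma>) ^ (n - j)))"
proof -
  define T where "T i = real (n choose i) * \<gamma> ^ i * (1 - \<gamma>) ^ (n - i)" for i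
  have \<gamma>: "0 \<le> \<gamma>" "\<gamma> \<le> 1" using j n by (auto simp: \<gamma>_def)
  have sum: "(\<Sum>i\<le>n. T i) = 1" using binomial_ring[of \<gamma> "1 - \<gamma>" n] by (simp add: T_def)
  have nonneg: "0 \<le> T i" for i using \<gamma> by (simp add: T_def)
  have "T j \<le> (\<Sum>i\<le>n. T i)" using j nonneg by (intro member_le_sum) auto
  then show "real (n choose j) * (\<gamma> ^ j * (1 - \<gamma>) ^ (n - j)) \<le> 1" using sum by (simp add: T_def mult.assoc)
  have scale: "T i = real ((n choose i) * j ^ i * (n - j) ^ (n - i)) / real n ^ n" if "i \<le> n" for i
  proof -
    have "1 - \<gamma> = real (n - j) / real n" using j n by (simp add: \<gamma>_def of_nat_diff diff_divide_distrib)
    moreover have "real n ^ n = real n ^ i * real n ^ (n - i)" using that by (simp add: power_add[symmetric])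
    ultimately show ?thesis by (simp add: T_def \<gamma>_def power_divide)
  qed
  have "T i \<le> T j" if "i \<le> n" for i
    unfolding scale[OF that] scale[OF j] by (intro divide_right_mono of_nat_mono binomial_mode j that) simp
  then have "(\<Sum>i\<le>n. T i) \<le> (\<Sum>i\<le>n. T j)" by (intro sum_mono) auto
  then show "1 \<le> real (Suc n) * (real (n choose j) * (\<gamma> ^ j * (1 - \<gamma>) ^ (n - j)))"
    using sum by (simp add: T_def mult.assoc)
qed

lemma rpow_self_power:
  assumes n: "0 < n" shows "rpow (real j / real n) (real j / real n) ^ n = (real j / real n) ^ j"
proof (cases "j = 0")
  case False
  then have x: "0 < real j / real n" using n by simp
  have "rpow (real j / real n) (real j / real n) ^ n = ((real j / real n) powr (real j / real n)) powr real n"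
    unfolding rpow_powr[OF x] by (rule powr_realpow[symmetric]) (use x in \<open>simp only: powr_gt_zero less_imp_neq[THEN not_sym] simp_thms not_False_eq_True\<close>)
  also have "\<dots> = (real j / real n) powr real j" using n by (simp add: powr_powr)
  finally show ?thesis using x by (simp add: powr_realpow)
qed (simp add: rpow_def)

text \<open>The characters of weight \<open>j\<close> together contribute
  \<open>objective ^ n\<close> up to the factor \<open>n + 1\<close>. This explains the denominator
  of the objective, the exponential of the entropy taken relative to \<open>2 ^ n\<close>.\<close>

lemma binomial_objective:
  assumes j: "2 * j \<le> n" and n: "0 < n"
  defines "\<gamma> \<equiv> real j / real n"
  shows "real (n choose j) / 2 ^ n * (1 + (1 - 2 * \<gamma>) ^ r) powr (\<alpha> * real n) \<le> objective r \<alpha> \<gamma> ^ n"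
    "objective r \<alpha> \<gamma> ^ n \<le> real (Suc n) * (real (n choose j) / 2 ^ n * (1 + (1 - 2 * \<gamma>) ^ r) powr (\<alpha> * real n))"
proof -
  have \<gamma>: "0 \<le> \<gamma>" "\<gamma> \<le> 1/2" using j n by (auto simp: \<gamma>_def field_simps)
  have b: "1 \<le> 1 + (1 - 2 * \<gamma>) ^ r" by (rule base_bounds) (use \<gamma> in auto)
  define E where "E = \<gamma> ^ j * (1 - \<gamma>) ^ (n - j)"
  define B where "B = (1 + (1 - 2 * \<gamma>) ^ r) powr (\<alpha> * real n) / 2 ^ n"
  have jn: "j \<le> n" using j by simp
  have g1: "1 - \<gamma> = real (n - j) / real n" using j n by (simp add: \<gamma>_def of_nat_diff diff_divide_distrib)
  have "rpow (1 - \<gamma>) (1 - \<gamma>) ^ n = (1 - \<gamma>) ^ (n - j)" unfolding g1 by (rule rpow_self_power[OF n])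
  moreover have "rpow \<gamma> \<gamma> ^ n = \<gamma> ^ j" unfolding \<gamma>_def by (rule rpow_self_power[OF n])
  moreover have "((1 + (1 - 2 * \<gamma>) ^ r) powr \<alpha>) ^ n = (1 + (1 - 2 * \<gamma>) ^ r) powr (\<alpha> * real n)"
    using b by (simp add: powr_powr[symmetric] powr_realpow)
  ultimately have O: "objective r \<alpha> \<gamma> ^ n = B / E"
    unfolding objective_powr[OF \<gamma>] by (simp add: power_divide power_mult_distrib B_def E_def)
  have Epos: "0 < E"
  proof -
    have "0 < 1 - \<gamma>" using \<gamma> by simp
    moreover have "0 < \<gamma> ^ j" by (cases "j = 0") (use n in \<open>auto simp: \<gamma>_def\<close>)
    ultimately show ?thesis by (simp add: E_def)
  qed
  have B0: "0 \<le> B" by (simp add: B_def)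
  note be = binomial_entropy[OF jn n, folded \<gamma>_def, folded E_def]
  have eq: "real (n choose j) / 2 ^ n * (1 + (1 - 2 * \<gamma>) ^ r) powr (\<alpha> * real n) = B * real (n choose j)"
    by (simp add: B_def)
  have "B * real (n choose j) * E \<le> B * 1" using mult_left_mono[OF be(1) B0] by (simp add: mult.assoc)
  then show "real (n choose j) / 2 ^ n * (1 + (1 - 2 * \<gamma>) ^ r) powr (\<alpha> * real n) \<le> objective r \<alpha> \<gamma> ^ n"
    unfolding eq O using Epos by (simp add: le_divide_eq)
  have "B * 1 \<le> B * (real (Suc n) * (real (n choose j) * E))" by (rule mult_left_mono[OF be(2) B0])
  then show "objective r \<alpha> \<gamma> ^ n \<le> real (Suc n) * (real (n choose j) / 2 ^ n * (1 + (1 - 2 * \<gamma>) ^ r) powr (\<alpha> * real n))"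
    unfolding eq O using Epos by (simp add: divide_le_eq mult_ac)
qed

text \<open>Allows the exponent \<open>m n\<close> to be replaced by \<open>\<alpha> * n\<close>;
  the price is exponential only in their difference, which is of smaller order than
  \<open>n\<close>.\<close>

lemma power_powr_bounds:
  fixes b x :: real
  assumes "1 \<le> b" "b \<le> 2"
  shows "b ^ m \<le> b powr x * 2 powr \<bar>real m - x\<bar>" "b powr x * 2 powr (- \<bar>real m - x\<bar>) \<le> b ^ m"
proof -
  have eq: "b ^ m = b powr x * b powr (real m - x)" using assms by (simp add: powr_add[symmetric] powr_realpow)
  have "b powr (real m - x) \<le> b powr \<bar>real m - x\<bar>" using assms by (intro powr_mono) auto
  also have "\<dots> \<le> 2 powr \<bar>real m - x\<bar>" using assms by (intro powr_mono2) auto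
  finally show "b ^ m \<le> b powr x * 2 powr \<bar>real m - x\<bar>" unfolding eq by (intro mult_left_mono) auto
  have "2 powr (- \<bar>real m - x\<bar>) \<le> b powr (- \<bar>real m - x\<bar>)"
    using assms by (simp add: powr_minus powr_mono2 le_imp_inverse_le)
  also have "\<dots> \<le> b powr (real m - x)" using assms by (intro powr_mono) auto
  finally show "b powr x * 2 powr (- \<bar>real m - x\<bar>) \<le> b ^ m" unfolding eq by (intro mult_left_mono) auto
qed

lemma sum_by_card: "(\<Sum>u\<in>{u \<in> Pow {..<n}. card u \<in> J}. f (card u)) = (\<Sum>j\<in>{..n} \<inter> J. real (n choose j) * f j)" for f :: "nat \<Rightarrow> real"
proof -
  have "(\<Sum>u\<in>{u \<in> Pow {..<n}. card u \<in> J}. f (card u))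
      = (\<Sum>j\<in>{..n} \<inter> J. \<Sum>u\<in>{u \<in> {u \<in> Pow {..<n}. card u \<in> J}. card u = j}. f (card u))"
    by (rule sum.group[symmetric]) (auto intro: card_mono[of "{..<n}", simplified])
  also have "\<dots> = (\<Sum>j\<in>{..n} \<inter> J. real (n choose j) * f j)"
  proof (rule sum.cong[OF refl])
    fix j assume j: "j \<in> {..n} \<inter> J"
    have "{u \<in> {u \<in> Pow {..<n}. card u \<in> J}. card u = j} = {u. u \<subseteq> {..<n} \<and> card u = j}" using j by auto
    then show "(\<Sum>u\<in>{u \<in> {u \<in> Pow {..<n}. card u \<in> J}. card u = j}. f (card u)) = real (n choose j) * f j"
      using n_subsets[of "{..<n}" j] by simp
  qed
  finally show ?thesis .
qed

text \<open>\<open>J\<close> selects the weights of the characters and \<open>h\<close> stands for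
  \<open>1 + phi\<close> or \<open>1 + \<bar>phi\<bar>\<close>. With all weights and
  \<open>B\<close> the supremum this bounds the mean count; with weights away from
  \<open>n / 2\<close> and \<open>B < 1\<close> it is the decay below
  \<open>alpha_star\<close>.\<close>

lemma weighted_sum_le:
  assumes n: "0 < n" and \<eta>: "0 \<le> \<eta>" and B: "0 \<le> B"
    and obj: "\<And>j. 2 * j \<le> n \<Longrightarrow> j \<in> J \<or> n - j \<in> J \<Longrightarrow> objective r \<alpha> (real j / real n) \<le> B"
    and h: "\<And>u. u \<subseteq> {..<n} \<Longrightarrow> card u \<in> J \<Longrightarrow> 0 \<le> h u \<and> h u \<le> 1 + \<bar>1 - 2 * real (card u) / real n\<bar> ^ r + \<eta>"
  shows "(\<Sum>u\<in>{u \<in> Pow {..<n}. card u \<in> J}. h u ^ m) / 2 ^ n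
     \<le> real (Suc n) * B ^ n * (exp (\<eta> * real m) * 2 powr \<bar>real m - \<alpha> * real n\<bar>)"
proof -
  let ?x = "\<lambda>j. \<bar>1 - 2 * real j / real n\<bar>"
  let ?c = "exp (\<eta> * real m) * 2 powr \<bar>real m - \<alpha> * real n\<bar>"
  have x: "0 \<le> ?x j" "?x j \<le> 1" if "j \<le> n" for j using that n by (auto simp: abs_le_iff field_simps)
  have each: "h u ^ m \<le> (1 + ?x (card u) ^ r) powr (\<alpha> * real n) * ?c" if u: "u \<subseteq> {..<n}" "card u \<in> J" for u
  proof -
    have cu: "card u \<le> n" using card_mono[OF finite_lessThan u(1)] by simp
    note b = base_bounds[OF x[OF cu], of r]
    \<comment> \<open>As the base is at least \<open>1\<close>, the additive error \<eta> is
      dominated by a factor \<open>1 + \<eta>\<close>, whose \<open>m\<close>-th power is at most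
      \<open>exp (\<eta> * m)\<close>.\<close>
    have "h u \<le> (1 + ?x (card u) ^ r) * (1 + \<eta>)"
    proof -
      have "h u \<le> 1 + ?x (card u) ^ r + \<eta>" using h[OF u] by simp
      moreover have "1 * \<eta> \<le> (1 + ?x (card u) ^ r) * \<eta>" by (rule mult_right_mono[OF b(1) \<eta>])
      ultimately show ?thesis unfolding distrib_left mult_1_right by linarith
    qed
    then have "h u ^ m \<le> (1 + ?x (card u) ^ r) ^ m * (1 + \<eta>) ^ m"
      using h[OF u] by (metis power_mono power_mult_distrib)
    also have "\<dots> \<le> ((1 + ?x (card u) ^ r) powr (\<alpha> * real n) * 2 powr \<bar>real m - \<alpha> * real n\<bar>) * exp (\<eta> * real m)"
    proof (rule mult_mono)
      show "(1 + ?x (card u) ^ r) ^ m \<le> (1 + ?x (card u) ^ r) powr (\<alpha> * real n) * 2 powr \<bar>real m - \<alpha> * real n\<bar>"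
        by (rule power_powr_bounds(1)[OF b])
      have "(1 + \<eta>) ^ m \<le> exp \<eta> ^ m" using \<eta> by (intro power_mono) auto
      then show "(1 + \<eta>) ^ m \<le> exp (\<eta> * real m)" by (simp add: exp_of_nat_mult[symmetric] mult.commute)
    qed (use \<eta> in auto)
    finally show ?thesis by (simp add: mult_ac)
  qed
  have bound: "real (n choose j) / 2 ^ n * (1 + ?x j ^ r) powr (\<alpha> * real n) \<le> B ^ n" if j: "j \<le> n" "j \<in> J" for j
  proof (cases "2 * j \<le> n")
    case True
    have g: "0 \<le> 1 - 2 * (real j / real n)" using True n by (simp add: field_simps)
    have "real (n choose j) / 2 ^ n * (1 + ?x j ^ r) powr (\<alpha> * real n) \<le> objective r \<alpha> (real j / real n) ^ n"
      using binomial_objective(1)[OF True n, of r \<alpha>] g by simp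
    also have "\<dots> \<le> B ^ n"
      using obj[OF True] j objective_pos[of "real j / real n" r \<alpha>] g n by (intro power_mono) (auto intro: less_imp_le)
    finally show ?thesis .
  next
    case False
    \<comment> \<open>Weights above \<open>n / 2\<close> are reflected, which changes neither the
      binomial coefficient nor \<open>?x\<close>.\<close>
    define i where "i = n - j"
    have i: "2 * i \<le> n" "n - i = j" using False j by (auto simp: i_def)
    have "real i = real n - real j" using j by (simp add: i_def of_nat_diff)
    then have "real i / real n + real j / real n = 1" using n by (simp add: add_divide_distrib[symmetric])
    then have xi: "1 - 2 * (real i / real n) = - (1 - 2 * real j / real n)"
      by (simp only: times_divide_eq_right[symmetric])
    have g: "0 \<le> 1 - 2 * (real i / real n)" using i n by (simp add: field_simps)
    have x': "?x j = 1 - 2 * (real i / real n)" using g unfolding xi by simp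
    have "real (n choose j) / 2 ^ n * (1 + ?x j ^ r) powr (\<alpha> * real n) \<le> objective r \<alpha> (real i / real n) ^ n"
      using binomial_objective(1)[OF i(1) n, of r \<alpha>] binomial_symmetric[OF j(1)] unfolding x' i_def by simp
    also have "\<dots> \<le> B ^ n"
      using obj[OF i(1)] j i objective_pos[of "real i / real n" r \<alpha>] g n by (intro power_mono) (auto intro: less_imp_le)
    finally show ?thesis .
  qed
  have "(\<Sum>u\<in>{u \<in> Pow {..<n}. card u \<in> J}. h u ^ m) \<le> (\<Sum>u\<in>{u \<in> Pow {..<n}. card u \<in> J}. (1 + ?x (card u) ^ r) powr (\<alpha> * real n) * ?c)"
    by (rule sum_mono) (use each in auto)
  also have "\<dots> = (\<Sum>j\<in>{..n} \<inter> J. real (n choose j) * ((1 + ?x j ^ r) powr (\<alpha> * real n) * ?c))"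
    by (rule sum_by_card)
  finally have "(\<Sum>u\<in>{u \<in> Pow {..<n}. card u \<in> J}. h u ^ m) / 2 ^ n
     \<le> (\<Sum>j\<in>{..n} \<inter> J. real (n choose j) * ((1 + ?x j ^ r) powr (\<alpha> * real n) * ?c)) / 2 ^ n"
    by (rule divide_right_mono) simp
  also have "\<dots> = (\<Sum>j\<in>{..n} \<inter> J. (real (n choose j) / 2 ^ n * (1 + ?x j ^ r) powr (\<alpha> * real n)) * ?c)"
    by (simp add: sum_divide_distrib mult.assoc)
  also have "\<dots> \<le> (\<Sum>j\<in>{..n} \<inter> J. B ^ n * ?c)"
    by (intro sum_mono mult_right_mono bound) auto
  also have "\<dots> \<le> (\<Sum>j\<le>n. B ^ n * ?c)"
    by (rule sum_mono2) (use B in auto)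
  finally show ?thesis by (simp add: mult.assoc)
qed

lemma power_le_fact_exp: "0 \<le> x \<Longrightarrow> x ^ k \<le> fact k * exp x" for x :: real
proof -
  assume x: "0 \<le> x"
  have "(\<lambda>n. x ^ n /\<^sub>R fact n) sums exp x" by (rule exp_converges)
  then have "(\<Sum>n\<in>{k}. x ^ n /\<^sub>R fact n) \<le> exp x"
    using sum_le_suminf[of "\<lambda>n. x ^ n /\<^sub>R fact n" "{k}"] x by (auto simp: sums_iff)
  then show ?thesis by (simp add: field_simps)
qed

lemma binomial_le_exp_power:
  assumes "1 \<le> k" shows "real (m choose k) \<le> (exp 1 * (real m / real k)) ^ k"
proof -
  have "real (m choose k) * fact k \<le> real m ^ k"
    using binomial_fact_pow[of m k] by (metis of_nat_fact of_nat_le_iff of_nat_mult of_nat_power)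
  then have "real (m choose k) \<le> real m ^ k / fact k" by (simp add: le_divide_eq)
  also have "\<dots> \<le> real m ^ k * (exp (real k) / real k ^ k)"
  proof -
    have "1 / fact k \<le> exp (real k) / real k ^ k"
      using power_le_fact_exp[of "real k" k] assms by (simp add: field_simps)
    from mult_left_mono[OF this, of "real m ^ k"] show ?thesis by simp
  qed
  also have "\<dots> = (exp 1 * (real m / real k)) ^ k"
    by (simp add: power_mult_distrib power_divide exp_of_nat_mult[symmetric])
  finally show ?thesis .
qed

section \<open>Few rows that sum to zero\<close>

definition even_configs :: "nat \<Rightarrow> 'c set \<Rightarrow> ('c \<Rightarrow> nat) set" where
  "even_configs n Z = {c \<in> Z \<rightarrow>\<^sub>E {..<n}. \<forall>j<n. even (card {x \<in> Z. c x = j})}"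

text \<open>In an even configuration some cell other than \<open>x\<close> shares the column of \<open>x\<close>; removing both
  leaves an even configuration.\<close>

lemma card_even_configs:
  assumes "finite Z" "0 < n"
  shows "real (card (even_configs n Z)) \<le> sqrt ((real (card Z) * real n) ^ card Z)"
  using assms(1)
proof (induction "card Z" arbitrary: Z rule: less_induct)
  case less
  have finE: "finite (even_configs n Y)" if "finite Y" for Y :: "'a set"
    using that unfolding even_configs_def by (intro finite_Collect_conjI disjI1) (simp add: finite_PiE)
  show ?case
  proof (cases "Z = {}")
    case True
    have "even_configs n {} = {\<lambda>x::'a. undefined}" by (auto simp: even_configs_def)
    then show ?thesis using True by simp
  next
    case False
    then obtain x where x: "x \<in> Z" by auto
    define z where "z = card Z"
    have z: "1 \<le> z" using False less.prems by (simp add: z_def Suc_le_eq card_gt_0_iff)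
    let ?f = "\<lambda>y j d. d(x := j, y := j)"
    have sub: "even_configs n Z \<subseteq> (\<Union>y\<in>Z - {x}. \<Union>j\<in>{..<n}. ?f y j ` even_configs n (Z - {x, y}))"
    proof
      fix c assume c: "c \<in> even_configs n Z"
      have cx: "c x < n" using c x by (auto simp: even_configs_def PiE_iff)
      then have ev: "even (card {w \<in> Z. c w = c x})" using c by (auto simp: even_configs_def)
      have "{w \<in> Z. c w = c x} \<noteq> {x}" using ev by (metis One_nat_def card.empty card_insert_if empty_iff finite.emptyI odd_one)
      then obtain y where y: "y \<in> Z - {x}" "c y = c x" using x by blast
      define d where "d = (\<lambda>w\<in>Z - {x, y}. c w)"
      have "d \<in> even_configs n (Z - {x, y})"
        unfolding even_configs_def
      proof (intro CollectI conjI allI impI)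
        show "d \<in> Z - {x, y} \<rightarrow>\<^sub>E {..<n}" using c by (auto simp: d_def even_configs_def)
        fix j assume j: "j < n"
        have e: "even (card {w \<in> Z. c w = j})" using c j by (auto simp: even_configs_def)
        have eq: "{w \<in> Z - {x, y}. d w = j} = {w \<in> Z. c w = j} - {x, y}" by (auto simp: d_def)
        show "even (card {w \<in> Z - {x, y}. d w = j})"
        proof (cases "j = c x")
          case True
          then have "{x, y} \<subseteq> {w \<in> Z. c w = j}" using x y by auto
          then have "card ({w \<in> Z. c w = j} - {x, y}) = card {w \<in> Z. c w = j} - 2"
            using y by (subst card_Diff_subset) auto
          then show ?thesis using e unfolding eq by simp
        next
          case False
          then have "{w \<in> Z. c w = j} - {x, y} = {w \<in> Z. c w = j}" using y by auto
          then show ?thesis using e unfolding eq by simp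
        qed
      qed
      moreover have "c = ?f y (c x) d"
      proof (rule ext)
        fix w
        have "c w = undefined" if "w \<notin> Z" using c that by (auto simp: even_configs_def PiE_iff extensional_def)
        then show "c w = ?f y (c x) d w" using y(2) by (simp add: d_def restrict_def)
      qed
      ultimately show "c \<in> (\<Union>y\<in>Z - {x}. \<Union>j\<in>{..<n}. ?f y j ` even_configs n (Z - {x, y}))"
        using y(1) cx by (intro UN_I[of y] UN_I[of "c x"] image_eqI[of c _ d]) simp_all
    qed
    have q: "real (card (even_configs n (Z - {x, y}))) \<le> sqrt ((real z * real n) ^ (z - 2))" if y: "y \<in> Z - {x}" for y
    proof -
      have c: "card (Z - {x, y}) = z - 2" using x y less.prems by (subst card_Diff_subset) (auto simp: z_def)
      have "real (card (even_configs n (Z - {x, y}))) \<le> sqrt ((real (z - 2) * real n) ^ (z - 2))"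
        using less.hyps[of "Z - {x, y}"] c z less.prems by (simp add: z_def)
      also have "\<dots> \<le> sqrt ((real z * real n) ^ (z - 2))"
        by (intro real_sqrt_le_mono power_mono mult_right_mono) auto
      finally show ?thesis .
    qed
    \<comment> \<open>There are at most \<open>card Z - 1\<close> partners for \<open>x\<close> and
      \<open>n\<close> columns for the pair. Every two cells thus cost a factor
      \<open>card Z * n\<close>, whence the square root.\<close>
    have "card (even_configs n Z) \<le> (\<Sum>y\<in>Z - {x}. \<Sum>j<n. card (even_configs n (Z - {x, y})))"
    proof -
      have "card (even_configs n Z) \<le> card (\<Union>y\<in>Z - {x}. \<Union>j\<in>{..<n}. ?f y j ` even_configs n (Z - {x, y}))"
        by (rule card_mono[OF _ sub]) (use less.prems finE in auto)
      also have "\<dots> \<le> (\<Sum>y\<in>Z - {x}. card (\<Union>j\<in>{..<n}. ?f y j ` even_configs n (Z - {x, y})))"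
        by (rule card_UN_le) (use less.prems in auto)
      also have "\<dots> \<le> (\<Sum>y\<in>Z - {x}. \<Sum>j<n. card (?f y j ` even_configs n (Z - {x, y})))"
        by (intro sum_mono card_UN_le) auto
      also have "\<dots> \<le> (\<Sum>y\<in>Z - {x}. \<Sum>j<n. card (even_configs n (Z - {x, y})))"
        using finE less.prems by (intro sum_mono card_image_le) auto
      finally show ?thesis .
    qed
    from of_nat_mono[OF this, where ?'a = real]
    have "real (card (even_configs n Z)) \<le> (\<Sum>y\<in>Z - {x}. \<Sum>j<n. real (card (even_configs n (Z - {x, y}))))"
      by (simp only: of_nat_sum)
    also have "\<dots> \<le> (\<Sum>y\<in>Z - {x}. \<Sum>j<n. sqrt ((real z * real n) ^ (z - 2)))"
      by (intro sum_mono q)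
    also have "\<dots> = real (z - 1) * real n * sqrt ((real z * real n) ^ (z - 2))"
      using x less.prems by (simp add: z_def)
    also have "\<dots> \<le> sqrt ((real z * real n) ^ z)"
    proof (cases "z = 1")
      case False
      then have "(real z * real n) ^ z = (real z * real n)\<^sup>2 * (real z * real n) ^ (z - 2)"
        using z by (metis One_nat_def Suc_1 Suc_leI le_add_diff_inverse le_neq_implies_less power_add)
      then have "sqrt ((real z * real n) ^ z) = real z * real n * sqrt ((real z * real n) ^ (z - 2))"
        by (simp add: real_sqrt_mult)
      then show ?thesis by (simp add: mult_right_mono)
    qed simp
    finally show ?thesis by (simp add: z_def)
  qed
qed

context random_rows
begin

text \<open>There are at least \<open>3 * k\<close> cells, and a configuration of \<open>z\<close>
  cells is even with probability at most \<open>(z / n) ^ (z / 2)\<close>; each row therefore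
  contributes the power \<open>3 / 2\<close> of \<open>R * k / n\<close>. The hypothesis
  \<open>R * k \<le> n\<close> keeps this base at most \<open>1\<close>, and \<open>2 ^ R\<close>
  per row pays for simple rows.\<close>

lemma prob_all_even_le:
  assumes wp: "\<And>k. k \<le> n \<Longrightarrow> k \<notin> {3..R} \<Longrightarrow> weight_prob k = 0" and n: "2 * R < n" and k: "1 \<le> k" "R * k \<le> n"
  shows "\<P>(\<omega> in P. \<forall>j<n. even (card {i \<in> {..<k}. j \<in> rows k \<omega> i})) \<le> (2 ^ R * sqrt ((real R * real k / real n) ^ 3)) ^ k"
    (is "?p \<le> ?\<beta>")
proof -
  define c where "c = real k * (\<Sum>l\<le>n. weight_prob l * \<bar>real l - real R\<bar>)"
  have n0: "0 < n" using n by simp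
  have bound: "real (card {s \<in> row_families n k. (\<forall>i<k. card (s i) = w i) \<and> (\<forall>j<n. even (card {i \<in> {..<k}. j \<in> s i}))})
      \<le> ?\<beta> * (\<Prod>i<k. real (n choose w i))" if w: "w \<in> {..<k} \<rightarrow>\<^sub>E {3..R}" for w
  proof -
    let ?Z = "cells k w"
    let ?A = "\<lambda>c. \<forall>j<n. even (card {x \<in> ?Z. c x = j})"
    interpret S: cell_system ?Z fst n using n0 by unfold_locales (auto simp: finite_cells)
    have wi: "3 \<le> w i" "w i \<le> R" if "i < k" for i using w that by (auto simp: PiE_iff)
    have R: "3 \<le> R" using wi[of 0] k by simp
    have Z: "3 * k \<le> card ?Z" "card ?Z \<le> R * k"
    proof -
      have "(\<Sum>i<k. 3) \<le> (\<Sum>i<k. w i)" by (intro sum_mono) (use wi in auto)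
      then show "3 * k \<le> card ?Z" by (simp add: card_cells)
      have "(\<Sum>i<k. w i) \<le> (\<Sum>i<k. R)" by (intro sum_mono) (use wi in auto)
      then show "card ?Z \<le> R * k" by (simp add: card_cells mult.commute)
    qed
    let ?q = "real R * real k / real n"
    have q: "0 \<le> ?q" "?q \<le> 1" using k n0 by (auto simp: divide_le_eq simp flip: of_nat_mult)
    have cells_eq: "{x \<in> ?Z. fst x \<in> {..<k}} = ?Z" by (auto simp: cells_def)
    have "real (card {s \<in> row_families n k. (\<forall>i<k. card (s i) = w i) \<and> (\<forall>j<n. even (card {i \<in> {..<k}. j \<in> s i}))})
      \<le> S.prob ?A * (real n / (real n - real R)) ^ card ?Z * (\<Prod>i<k. real (n choose w i))"
    proof (rule families_le_prob)
      fix c assume c: "c \<in> ?Z \<rightarrow>\<^sub>E {..<n}" "simple_rows k w c" "\<forall>j<n. even (card {i \<in> {..<k}. j \<in> rows_of k w c i})"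
      have "S.deg c {x \<in> ?Z. fst x \<in> {..<k}} j = card {i \<in> {..<k}. j \<in> rows_of k w c i}" for j
        by (rule deg_rows[OF n0 c(2)]) simp
      then show "?A c" using c(3) unfolding cells_eq S.deg_def by simp
    qed (use n wi in auto)
    also have "S.prob ?A * (real n / (real n - real R)) ^ card ?Z \<le> sqrt (?q ^ (3 * k)) * 2 ^ (R * k)"
    proof (rule mult_mono)
      have "S.prob ?A = real (card (even_configs n ?Z)) / real n ^ card ?Z"
        unfolding S.prob_def S.mean_def of_bool_def
        by (subst sum.If_cases) (auto simp: S.configs_def even_configs_def Int_def finite_cells intro!: finite_PiE arg_cong[where f = card])
      also have "\<dots> \<le> sqrt ((real (card ?Z) * real n) ^ card ?Z) / real n ^ card ?Z"
        by (intro divide_right_mono card_even_configs finite_cells n0) simp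
      also have "\<dots> = sqrt ((real (card ?Z) / real n) ^ card ?Z)"
      proof -
        have "(real (card ?Z) / real n) ^ card ?Z = (real (card ?Z) * real n) ^ card ?Z / (real n ^ card ?Z)\<^sup>2"
          using n0 by (simp add: power_mult_distrib power_divide power2_eq_square)
        then show ?thesis by (simp add: real_sqrt_divide)
      qed
      also have "\<dots> \<le> sqrt (?q ^ card ?Z)"
        using Z by (intro real_sqrt_le_mono power_mono divide_right_mono) (auto simp flip: of_nat_mult)
      also have "\<dots> \<le> sqrt (?q ^ (3 * k))"
        using Z q by (intro real_sqrt_le_mono power_decreasing) auto
      finally show "S.prob ?A \<le> sqrt (?q ^ (3 * k))" .
      have "real n / (real n - real R) \<le> 2" using n by (simp add: divide_le_eq)
      then have "(real n / (real n - real R)) ^ card ?Z \<le> 2 ^ card ?Z" using n by (intro power_mono) auto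
      also have "\<dots> \<le> 2 ^ (R * k)" using Z by (intro power_increasing) auto
      finally show "(real n / (real n - real R)) ^ card ?Z \<le> 2 ^ (R * k)" .
    qed (use n q in \<open>auto intro!: zero_le_power divide_nonneg_nonneg\<close>)
    also have "sqrt (?q ^ (3 * k)) * 2 ^ (R * k) = ?\<beta>"
      by (simp add: power_mult real_sqrt_power power_mult_distrib)
    finally show ?thesis by (simp add: mult_right_mono prod_nonneg)
  qed
  have q0: "0 \<le> ?\<beta>" by (intro zero_le_power mult_nonneg_nonneg) auto
  \<comment> \<open>The bound holds for all weights \<open>w\<close>, so the threshold
    \<open>\<eta> = i + 1\<close> in \<open>prob_rows_le\<close> can tend to infinity, which removes
    the Markov term.\<close>
  have le: "?p \<le> ?\<beta> + c / real (i + 1)" for i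
  proof -
    have "?p \<le> ?\<beta> + real k * (\<Sum>l\<le>n. weight_prob l * \<bar>real l - real R\<bar>) / real (i + 1)"
      by (rule prob_rows_le[where S = "{3..R}" and r = R and \<Phi> = "\<lambda>s. \<forall>j<n. even (card {i \<in> {..<k}. j \<in> s i})"])
         (use q0 wp bound in auto)
    then show ?thesis by (simp add: c_def)
  qed
  have "(\<lambda>i. ?\<beta> + c / real (i + 1)) \<longlonglongrightarrow> ?\<beta> + 0"
    by (intro tendsto_add tendsto_const) (use LIMSEQ_ignore_initial_segment[OF lim_const_over_n[of c], of 1] in simp)
  then show ?thesis using le by (intro LIMSEQ_le_const[of _ ?\<beta>]) auto
qed

text \<open>The first moment bound for the number of nonzero null vectors; the subtracted
  \<open>1\<close> is the zero vector.\<close>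

lemma first_dependence_le_prob:
  "\<P>(\<omega> in P. first_dependence n X \<omega> \<le> m) \<le> (\<Sum>u\<in>Pow {..<n}. (1 + \<phi> u) ^ m) / 2 ^ n - 1"
proof -
  let ?N = "\<lambda>s. card (null_families n m s)"
  let ?p = "\<lambda>s. \<Prod>i<m. row_law (s i)"
  have "\<P>(\<omega> in P. first_dependence n X \<omega> \<le> m) = \<P>(\<omega> in P. \<exists>J\<in>null_families n m (rows m \<omega>). J \<noteq> {})"
    by (rule arg_cong[where f = "measure P"]) (use first_dependence_le_iff(1) in blast)
  also have "\<dots> = (\<Sum>s\<in>row_families n m. of_bool (\<exists>J\<in>null_families n m s. J \<noteq> {}) * ?p s)"
    by (rule prob_rows)
  also have "\<dots> \<le> (\<Sum>s\<in>row_families n m. (real (?N s) - 1) * ?p s)"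
  proof (intro sum_mono mult_right_mono)
    fix s
    have "{} \<in> null_families n m s" by simp
    then have 1: "1 \<le> ?N s" by (metis One_nat_def Suc_leI card_gt_0_iff empty_iff finite_null_families)
    moreover have "2 \<le> ?N s" if "J \<in> null_families n m s" "J \<noteq> {}" for J
      using card_mono[of "null_families n m s" "{{}, J}"] that by simp
    ultimately show "of_bool (\<exists>J\<in>null_families n m s. J \<noteq> {}) \<le> real (?N s) - 1"
    proof (cases "\<exists>J\<in>null_families n m s. J \<noteq> {}")
      case True
      then have "2 \<le> ?N s" using \<open>\<And>J. J \<in> null_families n m s \<Longrightarrow> J \<noteq> {} \<Longrightarrow> 2 \<le> ?N s\<close> by blast
      then show ?thesis using True by simp
    next
      case False
      then show ?thesis using 1 by simp
    qed
  qed (auto intro: prod_nonneg row_law_nonneg)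
  also have "\<dots> = (\<Sum>s\<in>row_families n m. real (?N s) * ?p s) - (\<Sum>s\<in>row_families n m. ?p s)"
    by (simp add: left_diff_distrib sum_subtractf)
  also have "(\<Sum>s\<in>row_families n m. real (?N s) * ?p s) = (\<Sum>u\<in>Pow {..<n}. (1 + \<phi> u) ^ m) / 2 ^ n"
    using expectation_null_families[of m] expectation_rows[of "\<lambda>s. real (?N s)" m] by simp
  also have "(\<Sum>s\<in>row_families n m. ?p s) = 1"
    using expectation_prod_rows[of "\<lambda>_. 1" m] by (simp add: sum_row_law_1)
  finally show ?thesis .
qed

end

section \<open>The exponential growth of the mean number of null vectors\<close>

context row_sequence
begin

abbreviation "phi n \<equiv> random_rows.\<phi> n (Q n) (W n)"

definition null_mean :: "nat \<Rightarrow> nat \<Rightarrow> real" where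
  "null_mean n m = (\<Sum>u\<in>Pow {..<n}. (1 + phi n u) ^ m) / 2 ^ n"

definition \<eta> :: "nat \<Rightarrow> real" where
  "\<eta> n = 2 * miss n + 2 * real r * real r / real n"

lemma eta_lim: "\<eta> \<longlonglongrightarrow> 0"
  unfolding \<eta>_def[abs_def]
  by (rule tendsto_eq_rhs[OF tendsto_add[OF tendsto_mult[OF tendsto_const miss_lim] lim_const_over_n]]) simp

lemma eta_nonneg: "1 \<le> n \<Longrightarrow> 0 \<le> \<eta> n"
  using miss_nonneg by (simp add: \<eta>_def)

lemma abs_phi: "1 \<le> n \<Longrightarrow> \<bar>phi n u\<bar> \<le> 1"
  by (rule random_rows.abs_phi_le[OF rows])

lemma phi_near:
  assumes "r < n" "u \<subseteq> {..<n}"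
  shows "\<bar>phi n u - (1 - 2 * real (card u) / real n) ^ r\<bar> \<le> \<eta> n"
proof -
  interpret random_rows n "Q n" "W n" "P n" "X n" using rows assms by simp
  show ?thesis unfolding \<eta>_def miss_def by (rule phi_estimate[OF assms(2,1)])
qed

lemma expectation_null_vectors:
  assumes "1 \<le> n"
  shows "prob_space.expectation (P n) (\<lambda>\<omega>. real (null_vector_count (random_matrix n m (X n) \<omega>))) = null_mean n m"
proof -
  interpret random_rows n "Q n" "W n" "P n" "X n" using rows assms by simp
  have "P.expectation (\<lambda>\<omega>. real (null_vector_count (random_matrix n m (X n) \<omega>)))
      = P.expectation (\<lambda>\<omega>. real (card (null_families n m (rows m \<omega>))))"
    by (rule Bochner_Integration.integral_cong) (simp_all add: null_vector_count_eq)
  then show ?thesis unfolding null_mean_def expectation_null_families .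
qed

lemma log_lim: "(\<lambda>n. ln (real (Suc n)) / real n) \<longlonglongrightarrow> 0"
  by real_asymp

lemma objective_tendsto:
  assumes \<gamma>: "0 \<le> \<gamma>" "\<gamma> \<le> 1/2"
  shows "(\<lambda>n. objective r \<alpha> (real (nat \<lfloor>\<gamma> * real n\<rfloor>) / real n)) \<longlonglongrightarrow> objective r \<alpha> \<gamma>"
proof (cases "\<gamma> = 0")
  \<comment> \<open>At \<gamma> = 0 the sequence is constant; elsewhere \<open>powr\<close> is
    continuous and agrees with \<open>rpow\<close>.\<close>
  case True then show ?thesis by simp
next
  case False
  then have \<gamma>0: "0 < \<gamma>" using \<gamma> by simp
  let ?g = "\<lambda>n. real (nat \<lfloor>\<gamma> * real n\<rfloor>) / real n"
  let ?o = "\<lambda>g. (1 + (1 - 2 * g) ^ r) powr \<alpha> / (2 * g powr g * (1 - g) powr (1 - g))"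
  have lim: "?g \<longlonglongrightarrow> \<gamma>" by (rule floor_ratio_lim[OF \<gamma>0])
  have le: "\<forall>\<^sub>F n in sequentially. ?g n \<le> 1/2"
    using eventually_gt_at_top[of 0]
  proof eventually_elim
    case (elim n)
    have "0 \<le> \<gamma> * real n" using \<gamma> by simp
    then have "real (nat \<lfloor>\<gamma> * real n\<rfloor>) \<le> \<gamma> * real n" by linarith
    also have "\<dots> \<le> 1/2 * real n" using \<gamma> by (intro mult_right_mono) auto
    finally show ?case using elim by (simp add: divide_le_eq)
  qed
  have "(\<lambda>n. ?o (?g n)) \<longlonglongrightarrow> ?o \<gamma>"
    using \<gamma> \<gamma>0 base_pos[OF \<gamma>, of r] by (intro tendsto_intros lim) auto
  moreover have "\<forall>\<^sub>F n in sequentially. ?o (?g n) = objective r \<alpha> (?g n)"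
    using order_tendstoD(1)[OF lim \<gamma>0] le
  proof eventually_elim
    case (elim n)
    then have "0 < ?g n" "0 < 1 - ?g n" "0 \<le> ?g n" by linarith+
    then show ?case using elim by (simp only: objective_powr less_imp_le rpow_powr)
  qed
  ultimately have "(\<lambda>n. objective r \<alpha> (?g n)) \<longlonglongrightarrow> ?o \<gamma>" by (rule Lim_transform_eventually)
  moreover have "0 < 1 - \<gamma>" using \<gamma> by simp
  then have "?o \<gamma> = objective r \<alpha> \<gamma>" using \<gamma>0 \<gamma> by (simp only: objective_powr rpow_powr)
  ultimately show ?thesis by simp
qed

text \<open>All terms of the character sum are nonnegative, because
  \<open>\<bar>phi\<bar> \<le> 1\<close>, so those of weight \<open>j\<close> alone give a lower
  bound.\<close>

lemma null_mean_lower: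
  assumes n: "r < n" and \<eta>: "\<eta> n \<le> 1/2" and j: "2 * j \<le> n"
  shows "objective r \<alpha> (real j / real n) ^ n * ((1 - \<eta> n) ^ m * 2 powr (- \<bar>real m - \<alpha> * real n\<bar>)) / real (Suc n) \<le> null_mean n m"
proof -
  let ?x = "1 - 2 * (real j / real n)"
  have n0: "0 < n" "1 \<le> n" using n r1 by auto
  have x: "0 \<le> ?x" "?x \<le> 1" using j n0 by (auto simp: field_simps)
  note b = base_bounds[OF x, of r]
  have e0: "0 \<le> \<eta> n" by (rule eta_nonneg[OF n0(2)])
  let ?c = "(1 - \<eta> n) ^ m * 2 powr (- \<bar>real m - \<alpha> * real n\<bar>)"
  have c0: "0 \<le> ?c" using \<eta> by simp
  have each: "(1 + ?x ^ r) powr (\<alpha> * real n) * ?c \<le> (1 + phi n u) ^ m" if u: "u \<subseteq> {..<n}" "card u = j" for u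
  proof -
    have "(1 + ?x ^ r) * (1 - \<eta> n) \<le> 1 + ?x ^ r - \<eta> n"
      using mult_right_mono[OF b(1) e0] unfolding right_diff_distrib by simp
    also have "\<dots> \<le> 1 + phi n u" using phi_near[OF n u(1)] u(2) by (simp add: abs_le_iff)
    finally have "((1 + ?x ^ r) * (1 - \<eta> n)) ^ m \<le> (1 + phi n u) ^ m"
      using b \<eta> by (intro power_mono) auto
    moreover have "(1 + ?x ^ r) powr (\<alpha> * real n) * 2 powr (- \<bar>real m - \<alpha> * real n\<bar>) \<le> (1 + ?x ^ r) ^ m"
      by (rule power_powr_bounds(2)[OF b])
    then have "(1 + ?x ^ r) powr (\<alpha> * real n) * 2 powr (- \<bar>real m - \<alpha> * real n\<bar>) * (1 - \<eta> n) ^ m \<le> (1 + ?x ^ r) ^ m * (1 - \<eta> n) ^ m"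
      using \<eta> by (intro mult_right_mono) auto
    ultimately show ?thesis by (simp only: power_mult_distrib mult_ac)
  qed
  have "objective r \<alpha> (real j / real n) ^ n * ?c \<le> (real (Suc n) * (real (n choose j) / 2 ^ n * (1 + ?x ^ r) powr (\<alpha> * real n))) * ?c"
    by (rule mult_right_mono[OF binomial_objective(2)[OF j n0(1)] c0])
  also have "\<dots> = real (Suc n) * ((real (n choose j) * ((1 + ?x ^ r) powr (\<alpha> * real n) * ?c)) / 2 ^ n)" by simp
  also have "real (n choose j) * ((1 + ?x ^ r) powr (\<alpha> * real n) * ?c) = (\<Sum>u\<in>{u. u \<subseteq> {..<n} \<and> card u = j}. (1 + ?x ^ r) powr (\<alpha> * real n) * ?c)"
    using n_subsets[of "{..<n}" j] by simp
  also have "\<dots> \<le> (\<Sum>u\<in>{u. u \<subseteq> {..<n} \<and> card u = j}. (1 + phi n u) ^ m)" by (rule sum_mono) (use each in auto)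
  also have "\<dots> \<le> (\<Sum>u\<in>Pow {..<n}. (1 + phi n u) ^ m)"
  proof (rule sum_mono2)
    fix u
    have "0 \<le> 1 + phi n u" using abs_phi[OF n0(2), of u] by (simp add: abs_le_iff)
    then show "0 \<le> (1 + phi n u) ^ m" by simp
  qed auto
  finally have "objective r \<alpha> (real j / real n) ^ n * ?c \<le> real (Suc n) * null_mean n m"
    by (simp add: null_mean_def divide_right_mono mult_left_mono)
  then show ?thesis by (simp add: divide_le_eq mult.commute)
qed

text \<open>From below, the characters of weight about \<open>\<gamma> * n\<close> give the rate
  \<open>ln (objective r \<alpha> \<gamma>)\<close> for any \<gamma>. From above, each of the
  \<open>n + 1\<close> weights contributes at most \<open>sup_objective ^ n\<close> up to
  subexponential factors.\<close>

theorem null_mean_lim: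
  assumes m: "(\<lambda>n. real (m n) / real n) \<longlonglongrightarrow> \<alpha>"
  shows "(\<lambda>n. ln (null_mean n (m n)) / real n) \<longlonglongrightarrow> threshold_F r \<alpha>"
proof -
  let ?S = "sup_objective r \<alpha>"
  have S1: "1 \<le> ?S" by (rule sup_objective_ge_1[OF r1])
  have half: "\<forall>\<^sub>F n in sequentially. \<eta> n < 1/2" using order_tendstoD(2)[OF eta_lim, of "1/2"] by simp
  have dev: "(\<lambda>n. \<bar>real (m n) / real n - \<alpha>\<bar> * ln 2) \<longlonglongrightarrow> 0"
    by (rule tendsto_eq_rhs[OF tendsto_mult[OF tendsto_rabs[OF tendsto_diff[OF m tendsto_const]] tendsto_const]]) simp
  have dev_eq: "\<bar>real k - \<alpha> * real n\<bar> / real n = \<bar>real k / real n - \<alpha>\<bar>" if "0 < n" for n k :: nat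
  proof -
    have "real k / real n - \<alpha> = (real k - \<alpha> * real n) / real n" using that by (simp add: field_simps)
    then show ?thesis by (simp add: abs_divide)
  qed
  have dev_ln: "\<bar>real k - \<alpha> * real n\<bar> * ln 2 / real n = \<bar>real k / real n - \<alpha>\<bar> * ln 2" if "0 < n" for n k :: nat
    using dev_eq[OF that, of k] by (metis times_divide_eq_left)
  define lo where "lo g n = ln g - ln (real (Suc n)) / real n + real (m n) / real n * ln (1 - \<eta> n) - \<bar>real (m n) / real n - \<alpha>\<bar> * ln 2" for g n
  have lower: "\<forall>\<^sub>F n in sequentially. lo (objective r \<alpha> (real (nat \<lfloor>\<gamma> * real n\<rfloor>) / real n)) n \<le> ln (null_mean n (m n)) / real n \<and> 0 < null_mean n (m n)"
    if \<gamma>: "0 \<le> \<gamma>" "\<gamma> \<le> 1/2" for \<gamma>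
    using half eventually_gt_at_top[of r] eventually_gt_at_top[of 0]
  proof eventually_elim
    case (elim n)
    define j where "j = nat \<lfloor>\<gamma> * real n\<rfloor>"
    have "0 \<le> \<gamma> * real n" using \<gamma> by simp
    then have "real j \<le> \<gamma> * real n" unfolding j_def by linarith
    also have "\<dots> \<le> 1/2 * real n" using \<gamma> by (intro mult_right_mono) auto
    finally have j: "2 * j \<le> n" by simp
    let ?o = "objective r \<alpha> (real j / real n)"
    have o: "0 < ?o" using j elim by (intro objective_pos) (auto simp: divide_le_eq)
    let ?L = "?o ^ n * ((1 - \<eta> n) ^ m n * 2 powr (- \<bar>real (m n) - \<alpha> * real n\<bar>)) / real (Suc n)"
    have L: "?L \<le> null_mean n (m n)" by (rule null_mean_lower) (use elim j in auto)
    have Lpos: "0 < ?L" using o elim by (intro divide_pos_pos mult_pos_pos) auto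
    have "ln ?L = real n * ln ?o + real (m n) * ln (1 - \<eta> n) - \<bar>real (m n) - \<alpha> * real n\<bar> * ln 2 - ln (real (Suc n))"
      using o elim by (simp add: ln_div ln_mult ln_realpow ln_powr)
    then have "ln ?L / real n = lo ?o n"
      using elim dev_ln[of n "m n"] unfolding lo_def by (simp add: add_divide_distrib diff_divide_distrib)
    moreover have "ln ?L \<le> ln (null_mean n (m n))" using L Lpos by (intro ln_mono) auto
    then have "ln ?L / real n \<le> ln (null_mean n (m n)) / real n" by (rule divide_right_mono) simp
    ultimately show ?case using less_le_trans[OF Lpos L] unfolding j_def by simp
  qed
  have lo_lim: "(\<lambda>n. lo (objective r \<alpha> (real (nat \<lfloor>\<gamma> * real n\<rfloor>) / real n)) n) \<longlonglongrightarrow> ln (objective r \<alpha> \<gamma>)"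
    if \<gamma>: "0 \<le> \<gamma>" "\<gamma> \<le> 1/2" for \<gamma>
  proof -
    have "(\<lambda>n. ln (1 - \<eta> n)) \<longlonglongrightarrow> ln (1 - 0)" by (intro tendsto_intros eta_lim) simp
    then have "(\<lambda>n. lo (objective r \<alpha> (real (nat \<lfloor>\<gamma> * real n\<rfloor>) / real n)) n) \<longlonglongrightarrow> ln (objective r \<alpha> \<gamma>) - 0 + \<alpha> * ln (1 - 0) - 0"
      unfolding lo_def using objective_pos[OF \<gamma>, of r \<alpha>]
      by (intro tendsto_intros objective_tendsto \<gamma> log_lim dev m eta_lim) auto
    then show ?thesis by simp
  qed
  define up where "up n = ln (real (Suc n)) / real n + ln ?S + \<eta> n * (real (m n) / real n) + \<bar>real (m n) / real n - \<alpha>\<bar> * ln 2" for n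
  have up_lim: "up \<longlonglongrightarrow> ln ?S"
    unfolding up_def[abs_def]
    by (rule tendsto_eq_rhs[OF tendsto_add[OF tendsto_add[OF tendsto_add[OF log_lim tendsto_const] tendsto_mult[OF eta_lim m]] dev]]) simp
  have upper: "\<forall>\<^sub>F n in sequentially. ln (null_mean n (m n)) / real n \<le> up n"
    \<comment> \<open>Supplies the positivity of \<open>null_mean\<close>, on which the monotonicity
      of \<open>ln\<close> depends.\<close>
    using lower[of 0, simplified] eventually_gt_at_top[of r] eventually_gt_at_top[of 0]
  proof eventually_elim
    case (elim n)
    have n: "0 < n" "1 \<le> n" using elim by auto
    let ?U = "real (Suc n) * ?S ^ n * (exp (\<eta> n * real (m n)) * 2 powr \<bar>real (m n) - \<alpha> * real n\<bar>)"
    have "(\<Sum>u\<in>{u \<in> Pow {..<n}. card u \<in> UNIV}. (1 + phi n u) ^ m n) / 2 ^ n \<le> ?U"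
    proof (rule weighted_sum_le[OF n(1) eta_nonneg[OF n(2)]])
      show "0 \<le> ?S" using S1 by simp
      show "objective r \<alpha> (real j / real n) \<le> ?S" if "2 * j \<le> n" for j
        using that n by (intro objective_le_sup) (auto simp: divide_le_eq)
      fix u assume u: "u \<subseteq> {..<n}"
      have "0 \<le> 1 + phi n u" using abs_phi[OF n(2), of u] by (simp add: abs_le_iff)
      moreover have "(1 - 2 * real (card u) / real n) ^ r \<le> \<bar>1 - 2 * real (card u) / real n\<bar> ^ r"
        using abs_ge_self[of "(1 - 2 * real (card u) / real n) ^ r"] by (simp only: power_abs)
      then have "1 + phi n u \<le> 1 + \<bar>1 - 2 * real (card u) / real n\<bar> ^ r + \<eta> n"
        using phi_near[OF elim(2) u] by linarith
      ultimately show "0 \<le> 1 + phi n u \<and> 1 + phi n u \<le> 1 + \<bar>1 - 2 * real (card u) / real n\<bar> ^ r + \<eta> n" by simp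
    qed
    then have U: "null_mean n (m n) \<le> ?U" by (simp add: null_mean_def Pow_def)
    have "ln (null_mean n (m n)) \<le> ln ?U" using U elim by (intro ln_mono) auto
    also have "ln ?U = ln (real (Suc n)) + real n * ln ?S + \<eta> n * real (m n) + \<bar>real (m n) - \<alpha> * real n\<bar> * ln 2"
    proof -
      have a: "0 < real (Suc n)" "0 < ?S" "0 < exp (\<eta> n * real (m n))" "0 < (2::real) powr \<bar>real (m n) - \<alpha> * real n\<bar>"
        using S1 by auto
      then have "ln ?U = ln (real (Suc n)) + ln (?S ^ n) + (ln (exp (\<eta> n * real (m n))) + ln (2 powr \<bar>real (m n) - \<alpha> * real n\<bar>))"
        by (simp only: ln_mult_pos mult_pos_pos zero_less_power)
      moreover have "ln (2 powr \<bar>real (m n) - \<alpha> * real n\<bar>) = \<bar>real (m n) - \<alpha> * real n\<bar> * ln 2" by (rule ln_powr)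
      moreover have "ln (?S ^ n) = real n * ln ?S" by (rule ln_realpow)
      ultimately show ?thesis by simp
    qed
    finally have "ln (null_mean n (m n)) / real n \<le> (ln (real (Suc n)) + real n * ln ?S + \<eta> n * real (m n) + \<bar>real (m n) - \<alpha> * real n\<bar> * ln 2) / real n"
      by (rule divide_right_mono) simp
    also have "\<dots> = up n" using n dev_ln[of n "m n"] unfolding up_def by (simp add: add_divide_distrib)
    finally show ?case .
  qed
  show ?thesis unfolding threshold_F_eq
  proof (rule order_tendstoI)
    fix c assume "c < ln ?S"
    then have "exp c < ?S" using S1 by (simp add: exp_less_cancel_iff[of c, symmetric] del: exp_less_cancel_iff)
    then obtain \<gamma> where \<gamma>: "0 \<le> \<gamma>" "\<gamma> \<le> 1/2" "exp c < objective r \<alpha> \<gamma>" unfolding less_sup_objective_iff by auto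
    then have "c < ln (objective r \<alpha> \<gamma>)" using ln_strict_mono[of "exp c" "objective r \<alpha> \<gamma>"] by simp
    from order_tendstoD(1)[OF lo_lim[OF \<gamma>(1,2)] this] lower[OF \<gamma>(1,2)]
    show "\<forall>\<^sub>F n in sequentially. c < ln (null_mean n (m n)) / real n"
      by eventually_elim auto
  next
    fix c assume "ln ?S < c"
    from order_tendstoD(2)[OF up_lim this] upper
    show "\<forall>\<^sub>F n in sequentially. ln (null_mean n (m n)) / real n < c"
      by eventually_elim auto
  qed
qed

end

subsection \<open>The lower bound for the first dependence\<close>

lemma sum_half_powers_le: "(\<Sum>k\<in>{1..m}. real k * (1/2) ^ k) \<le> 2"
proof -
  have "(\<Sum>k\<in>{1..m}. real k * (1/2) ^ k) = 2 - (real m + 2) * (1/2) ^ m"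
    by (induction m) (simp_all add: field_simps)
  then show ?thesis by simp
qed

lemma geometric_decay_lim:
  assumes c: "c \<longlonglongrightarrow> l" "l < 0"
  shows "(\<lambda>n. exp (real n * c n)) \<longlonglongrightarrow> (0::real)"
proof -
  have "filterlim (\<lambda>n. c n * real n) at_bot sequentially"
    by (rule filterlim_tendsto_neg_mult_at_bot[OF c filterlim_real_sequentially])
  then have "filterlim (\<lambda>n. real n * c n) at_bot sequentially" by (simp add: mult.commute)
  then show ?thesis by (rule filterlim_compose[OF exp_at_bot])
qed

context random_rows
begin

text \<open>By \<open>prob_all_even\<close>, the probability that \<open>k\<close> given rows sum to
  zero, in terms of the characters.\<close>

definition even_prob :: "nat \<Rightarrow> real" where
  "even_prob k = (\<Sum>u\<in>Pow {..<n}. \<phi> u ^ k) / 2 ^ n"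

text \<open>Null vectors are sorted by the number \<open>k\<close> of rows involved;
  \<open>k = 0\<close> is the zero vector, the \<open>1\<close> on the left.\<close>

lemma mean_count_expansion:
  "(\<Sum>u\<in>Pow {..<n}. (1 + \<phi> u) ^ m) / 2 ^ n - 1 = (\<Sum>k\<in>{1..m}. real (m choose k) * even_prob k)"
proof -
  have "(\<Sum>u\<in>Pow {..<n}. (1 + \<phi> u) ^ m) / 2 ^ n = (\<Sum>u\<in>Pow {..<n}. \<Sum>k\<le>m. real (m choose k) * \<phi> u ^ k) / 2 ^ n"
    by (simp add: add.commute[of 1] binomial_ring)
  also have "\<dots> = (\<Sum>k\<le>m. real (m choose k) * even_prob k)"
    by (subst sum.swap) (simp add: even_prob_def sum_distrib_left sum_divide_distrib)
  also have "{..m} = insert 0 {1..m}" by auto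
  also have "(\<Sum>k\<in>insert 0 {1..m}. real (m choose k) * even_prob k) = 1 + (\<Sum>k\<in>{1..m}. real (m choose k) * even_prob k)"
    by (subst sum.insert) (auto simp: even_prob_def card_Pow)
  finally show ?thesis by simp
qed

text \<open>Rows of weight at least \<open>3\<close> make the exponent \<open>3 / 2\<close> of \<open>k / n\<close> exceed the exponent \<open>1\<close> that
  is lost to the binomial coefficient.\<close>

lemma few_rows_even_le:
  assumes wp: "\<And>k. k \<le> n \<Longrightarrow> k \<notin> {3..R} \<Longrightarrow> weight_prob k = 0" and n: "2 * R < n"
    and m: "real m \<le> A * real n" and k: "1 \<le> k" "real k \<le> \<delta> * real n"
    and C: "C = exp 1 * A * 2 ^ R * sqrt (real R ^ 3)" and \<delta>: "\<delta> * real R \<le> 1" "C * sqrt \<delta> \<le> 1/2" and R: "1 \<le> R" and A: "0 \<le> A"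
  shows "real (m choose k) * even_prob k \<le> 2 * C / sqrt (real n) * (real k * (1/2) ^ k)"
proof -
  have n0: "0 < real n" using n by simp
  have "real R * real k \<le> real R * (\<delta> * real n)" using k by (intro mult_left_mono) auto
  also have "\<dots> \<le> 1 * real n" using \<delta>(1) n0 by (metis mult.assoc mult.commute mult_right_mono of_nat_0_le_iff)
  finally have Rk: "R * k \<le> n" by (simp flip: of_nat_mult)
  let ?q = "real k / real n"
  have q0: "0 \<le> ?q" by simp
  have p: "even_prob k \<le> (2 ^ R * sqrt ((real R * real k / real n) ^ 3)) ^ k"
    using prob_all_even_le[OF wp n k(1) Rk] prob_all_even[of k] by (simp add: even_prob_def)
  have C0: "0 \<le> C" using C A by simp
  have "real (m choose k) * even_prob k
      \<le> (exp 1 * (real m / real k)) ^ k * (2 ^ R * sqrt ((real R * real k / real n) ^ 3)) ^ k"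
    using p binomial_le_exp_power[OF k(1), of m] by (intro mult_mono) (auto simp: even_prob_def prob_all_even[symmetric])
  also have "\<dots> = (exp 1 * (real m / real k) * (2 ^ R * sqrt ((real R * real k / real n) ^ 3))) ^ k"
    by (rule power_mult_distrib[symmetric])
  also have "\<dots> \<le> (C * sqrt ?q) ^ k"
  proof (rule power_mono)
    have "sqrt ((real R * real k / real n) ^ 3) = sqrt (real R ^ 3) * (?q * sqrt ?q)"
    proof -
      have "(real R * real k / real n) ^ 3 = real R ^ 3 * (?q\<^sup>2 * ?q)"
        by (simp add: power_mult_distrib power_divide power2_eq_square power3_eq_cube)
      then show ?thesis using q0 by (simp only: real_sqrt_mult real_sqrt_abs abs_of_nonneg)
    qed
    then have "exp 1 * (real m / real k) * (2 ^ R * sqrt ((real R * real k / real n) ^ 3))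
        = exp 1 * (real m / real n) * 2 ^ R * sqrt (real R ^ 3) * sqrt ?q"
      using k n0 by simp
    also have "\<dots> \<le> exp 1 * A * 2 ^ R * sqrt (real R ^ 3) * sqrt ?q"
      using m n0 by (intro mult_right_mono mult_left_mono) (auto simp: divide_le_eq)
    finally show "exp 1 * (real m / real k) * (2 ^ R * sqrt ((real R * real k / real n) ^ 3)) \<le> C * sqrt ?q"
      unfolding C .
  qed simp
  \<comment> \<open>One factor is set aside to yield \<open>1 / sqrt n\<close>; each of the others
    is at most \<open>1/2\<close>.\<close>
  also have "\<dots> = C * sqrt ?q * (C * sqrt ?q) ^ (k - 1)" using k by (cases k) auto
  also have "\<dots> \<le> C * (real k / sqrt (real n)) * (1/2) ^ (k - 1)"
  proof (intro mult_mono mult_left_mono power_mono)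
    have "sqrt (real k) \<le> real k"
      using k by (intro real_le_lsqrt) (auto simp: power2_eq_square)
    then show "sqrt ?q \<le> real k / sqrt (real n)" by (simp add: real_sqrt_divide divide_right_mono)
    have "sqrt ?q \<le> sqrt \<delta>" using k n0 by (intro real_sqrt_le_mono) (simp add: divide_le_eq)
    then have "C * sqrt ?q \<le> C * sqrt \<delta>" using C0 by (intro mult_left_mono) auto
    then show "C * sqrt ?q \<le> 1/2" using \<delta> by simp
  qed (use C0 in auto)
  also have "\<dots> = 2 * C / sqrt (real n) * (real k * (1/2) ^ k)" using k by (cases k) auto
  finally show ?thesis .
qed

text \<open>Outside \<open>U\<close> the mean of the character is small and its power
  \<open>k \<ge> t\<close> is tiny, even against all \<open>2 ^ m\<close> choices of rows. On
  \<open>U\<close> the full sum over \<open>k\<close> is restored, so that the exponential rate can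
  be applied.\<close>

lemma many_rows_even_le:
  assumes \<theta>: "0 < \<theta>" "\<theta> \<le> 1" and t: "0 \<le> t" and L: "L \<subseteq> {1..m}" "\<And>k. k \<in> L \<Longrightarrow> t \<le> real k"
    and U: "U \<subseteq> Pow {..<n}" "\<And>u. u \<in> Pow {..<n} - U \<Longrightarrow> \<bar>\<phi> u\<bar> \<le> \<theta>"
  shows "(\<Sum>k\<in>L. real (m choose k) * even_prob k) \<le> 2 ^ m * \<theta> powr t + (\<Sum>u\<in>U. (1 + \<bar>\<phi> u\<bar>) ^ m) / 2 ^ n"
proof -
  let ?s = "\<lambda>u. \<Sum>k\<in>L. real (m choose k) * \<bar>\<phi> u\<bar> ^ k"
  have fL: "finite L" using L(1) finite_subset by blast
  have sub: "L \<subseteq> {..m}" using L(1) by auto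
  have "(\<Sum>k\<in>L. real (m choose k) * even_prob k) \<le> (\<Sum>k\<in>L. real (m choose k) * ((\<Sum>u\<in>Pow {..<n}. \<bar>\<phi> u\<bar> ^ k) / 2 ^ n))"
    unfolding even_prob_def
    by (intro sum_mono mult_left_mono divide_right_mono) (auto simp: power_abs[symmetric])
  also have "\<dots> = (\<Sum>u\<in>Pow {..<n}. ?s u) / 2 ^ n"
    by (subst sum.swap) (simp add: sum_distrib_left sum_divide_distrib)
  also have "(\<Sum>u\<in>Pow {..<n}. ?s u) = (\<Sum>u\<in>Pow {..<n} - U. ?s u) + (\<Sum>u\<in>U. ?s u)"
    by (rule sum.subset_diff[OF U(1)]) simp
  also have "\<dots> \<le> (\<Sum>u\<in>Pow {..<n} - U. 2 ^ m * \<theta> powr t) + (\<Sum>u\<in>U. (1 + \<bar>\<phi> u\<bar>) ^ m)"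
  proof (intro add_mono sum_mono)
    fix u assume u: "u \<in> Pow {..<n} - U"
    have "?s u \<le> (\<Sum>k\<in>L. real (m choose k) * \<theta> powr t)"
    proof (intro sum_mono mult_left_mono)
      fix k assume k: "k \<in> L"
      have "\<bar>\<phi> u\<bar> ^ k \<le> \<theta> ^ k" using U(2)[OF u] by (intro power_mono) auto
      also have "\<dots> = \<theta> powr real k" using \<theta> by (simp add: powr_realpow)
      also have "\<dots> \<le> \<theta> powr t" using \<theta> L(2)[OF k] by (intro powr_mono') auto
      finally show "\<bar>\<phi> u\<bar> ^ k \<le> \<theta> powr t" .
    qed simp
    also have "\<dots> \<le> (\<Sum>k\<le>m. real (m choose k) * \<theta> powr t)"
      using sub by (intro sum_mono2) auto
    also have "\<dots> = real (\<Sum>k\<le>m. m choose k) * \<theta> powr t" by (simp add: sum_distrib_right)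
    also have "\<dots> = 2 ^ m * \<theta> powr t" by (simp only: choose_row_sum) simp
    finally show "?s u \<le> 2 ^ m * \<theta> powr t" .
  next
    fix u
    have "?s u \<le> (\<Sum>k\<le>m. real (m choose k) * \<bar>\<phi> u\<bar> ^ k)"
      using sub by (intro sum_mono2) auto
    also have "\<dots> = (\<bar>\<phi> u\<bar> + 1) ^ m" by (simp add: binomial_ring)
    finally show "?s u \<le> (1 + \<bar>\<phi> u\<bar>) ^ m" by (simp add: add.commute)
  qed
  also have "(\<Sum>u\<in>Pow {..<n} - U. 2 ^ m * \<theta> powr t) \<le> (\<Sum>u\<in>Pow {..<n}. 2 ^ m * \<theta> powr t)"
    by (intro sum_mono2) auto
  also have "\<dots> = 2 ^ n * (2 ^ m * \<theta> powr t)" by (simp add: card_Pow)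
  finally show ?thesis by (simp add: divide_right_mono add_divide_distrib)
qed

end

context bounded_row_sequence
begin

text \<open>Relations of at most \<open>\<delta> * n\<close> rows fall under
  \<open>few_rows_even_le\<close>, longer ones under \<open>many_rows_even_le\<close>, with the
  characters split according to whether \<open>\<bar>1 - 2 * \<gamma>\<bar> ^ r\<close> exceeds
  \<open>\<theta> / 2\<close>.\<close>

lemma null_mean_upper_lim:
  assumes m: "(\<lambda>n. real (m n) / real n) \<longlonglongrightarrow> \<alpha>" and \<alpha>: "0 < \<alpha>" "\<alpha> < alpha_star r"
  obtains g where "g \<longlonglongrightarrow> 0" "\<forall>\<^sub>F n in sequentially. null_mean n (m n) - 1 \<le> g n"
proof -
  obtain \<beta> where \<beta>: "\<alpha> < \<beta>" "\<beta> < alpha_star r" using dense[OF \<alpha>(2)] by auto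
  define A where "A = \<alpha> + 1"
  define C where "C = exp 1 * A * 2 ^ R * sqrt (real R ^ 3)"
  have R1: "1 \<le> R" using R r1 by simp
  have A0: "0 < A" using \<alpha> by (simp add: A_def)
  have C0: "0 < C" using A0 R1 by (simp add: C_def)
  \<comment> \<open>The first bound ensures \<open>\<delta> * R \<le> 1\<close>, the second
    \<open>C * sqrt \<delta> \<le> 1/2\<close>, the ratio of the geometric series.\<close>
  define \<delta> where "\<delta> = min (1 / real R) ((1 / (2 * C))\<^sup>2)"
  have \<delta>: "0 < \<delta>" "\<delta> * real R \<le> 1"
  proof -
    show "0 < \<delta>" using R1 C0 by (simp add: \<delta>_def)
    have "\<delta> * real R \<le> 1 / real R * real R" unfolding \<delta>_def by (intro mult_right_mono) auto
    then show "\<delta> * real R \<le> 1" using R1 by simp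
  qed
  have C\<delta>: "C * sqrt \<delta> \<le> 1/2"
  proof -
    have "sqrt \<delta> \<le> 1 / (2 * C)" using C0 by (intro real_le_lsqrt) (auto simp: \<delta>_def)
    then have "C * sqrt \<delta> \<le> C * (1 / (2 * C))" using C0 by (intro mult_left_mono) auto
    then show ?thesis using C0 by simp
  qed
  \<comment> \<open>Chosen so that \<open>\<theta> powr (\<delta> * n)\<close> is \<open>2\<close>
    to the power \<open>- (\<alpha> + 2) * n\<close>. Against \<open>2 ^ m n\<close> with
    \<open>m n \<le> (\<alpha> + 1) * n\<close> this leaves \<open>(1/2) ^ n\<close>.\<close>
  define \<theta> where "\<theta> = (2::real) powr (- (\<alpha> + 2) / \<delta>)"
  have \<theta>: "0 < \<theta>" "\<theta> \<le> 1"
  proof -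
    show "0 < \<theta>" by (simp add: \<theta>_def)
    have "(2::real) powr (- (\<alpha> + 2) / \<delta>) \<le> 2 powr 0" using \<alpha> \<delta> by (intro powr_mono) (auto simp: divide_le_0_iff)
    then show "\<theta> \<le> 1" by (simp add: \<theta>_def)
  qed
  \<comment> \<open>The objective is at most \<open>1\<close> at \<beta>. Lowering \<beta> to
    \<alpha> gains a power of the base, which is uniform in \<gamma> because the base exceeds
    \<open>1 + \<theta> / 2\<close> on \<open>J\<close>.\<close>
  define B where "B = (1 + \<theta> / 2) powr (\<alpha> - \<beta>)"
  have B: "0 < B" "ln B < 0"
  proof -
    show "0 < B" using \<theta> by (simp add: B_def add_pos_pos)
    have "ln B = (\<alpha> - \<beta>) * ln (1 + \<theta> / 2)" by (simp add: B_def ln_powr)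
    then show "ln B < 0" using \<beta> \<theta> by (simp add: mult_neg_pos)
  qed
  define c where "c n = ln (real (Suc n)) / real n + ln B + \<eta> n * (real (m n) / real n) + \<bar>real (m n) / real n - \<alpha>\<bar> * ln 2" for n
  have c_lim: "c \<longlonglongrightarrow> ln B"
  proof -
    have dev: "(\<lambda>n. \<bar>real (m n) / real n - \<alpha>\<bar> * ln 2) \<longlonglongrightarrow> 0"
      by (rule tendsto_eq_rhs[OF tendsto_mult[OF tendsto_rabs[OF tendsto_diff[OF m tendsto_const]] tendsto_const]]) simp
    show ?thesis unfolding c_def[abs_def]
      by (rule tendsto_eq_rhs[OF tendsto_add[OF tendsto_add[OF tendsto_add[OF log_lim tendsto_const] tendsto_mult[OF eta_lim m]] dev]]) simp
  qed
  define g where "g n = 4 * C / sqrt (real n) + ((1/2) ^ n + exp (real n * c n))" for n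
  have g: "g \<longlonglongrightarrow> 0"
  proof -
    have "(\<lambda>n. 4 * C / sqrt (real n)) \<longlonglongrightarrow> 0" by real_asymp
    moreover have "(\<lambda>n. (1/2::real) ^ n) \<longlonglongrightarrow> 0" by (rule LIMSEQ_realpow_zero) auto
    ultimately show ?thesis unfolding g_def[abs_def]
      by (intro tendsto_add_zero geometric_decay_lim[OF c_lim B(2)])
  qed
  have mA: "\<forall>\<^sub>F n in sequentially. real (m n) / real n < A"
    using order_tendstoD(2)[OF m, of A] by (simp add: A_def)
  have e\<theta>: "\<forall>\<^sub>F n in sequentially. \<eta> n < \<theta> / 2" using order_tendstoD(2)[OF eta_lim, of "\<theta> / 2"] \<theta> by simp
  have "\<forall>\<^sub>F n in sequentially. null_mean n (m n) - 1 \<le> g n"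
    using mA e\<theta> weight_prob_below eventually_gt_at_top[of "2 * R"] eventually_gt_at_top[of r]
  proof eventually_elim
    case (elim n)
    have n: "0 < n" "1 \<le> n" using elim by auto
    interpret random_rows n "Q n" "W n" "P n" "X n" using rows n by simp
    have mn: "real (m n) \<le> A * real n" using elim n by (simp add: divide_less_eq)
    define K where "K = {k \<in> {1..m n}. real k \<le> \<delta> * real n}"
    define L where "L = {k \<in> {1..m n}. \<delta> * real n < real k}"
    \<comment> \<open>The margin between \<open>\<theta> / 2\<close> and \<theta> absorbs the error
      \<open>\<eta> n\<close> of \<open>phi\<close>.\<close>
    define J where "J = {j. \<theta> / 2 < \<bar>1 - 2 * real j / real n\<bar> ^ r}"
    have K: "(\<Sum>k\<in>K. real (m n choose k) * even_prob k) \<le> 4 * C / sqrt (real n)"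
    proof -
      have "(\<Sum>k\<in>K. real (m n choose k) * even_prob k) \<le> (\<Sum>k\<in>K. 2 * C / sqrt (real n) * (real k * (1/2) ^ k))"
      proof (rule sum_mono)
        fix k assume k: "k \<in> K"
        show "real (m n choose k) * even_prob k \<le> 2 * C / sqrt (real n) * (real k * (1/2) ^ k)"
        proof (rule few_rows_even_le[OF _ elim(4) mn _ _ C_def \<delta>(2) C\<delta> R1])
          show "weight_prob k' = 0" if "k' \<notin> {3..R}" for k'
            using that elim(3) weight_prob_above[OF n(2), of k'] by force
        qed (use k A0 in \<open>auto simp: K_def\<close>)
      qed
      also have "\<dots> = 2 * C / sqrt (real n) * (\<Sum>k\<in>K. real k * (1/2) ^ k)" by (simp add: sum_distrib_left)
      also have "\<dots> \<le> 2 * C / sqrt (real n) * (\<Sum>k\<in>{1..m n}. real k * (1/2) ^ k)"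
        using C0 by (intro mult_left_mono sum_mono2) (auto simp: K_def)
      also have "\<dots> \<le> 2 * C / sqrt (real n) * 2"
        using C0 by (intro mult_left_mono sum_half_powers_le) auto
      finally show ?thesis by simp
    qed
    have near: "\<bar>phi n u\<bar> \<le> \<bar>1 - 2 * real (card u) / real n\<bar> ^ r + \<eta> n" if "u \<subseteq> {..<n}" for u
      using phi_near[OF elim(5) that] unfolding power_abs[symmetric] by linarith
    have "(\<Sum>k\<in>L. real (m n choose k) * even_prob k)
      \<le> 2 ^ m n * \<theta> powr (\<delta> * real n) + (\<Sum>u\<in>{u \<in> Pow {..<n}. card u \<in> J}. (1 + \<bar>\<phi> u\<bar>) ^ m n) / 2 ^ n"
    proof (rule many_rows_even_le[OF \<theta>])
      fix u assume u: "u \<in> Pow {..<n} - {u \<in> Pow {..<n}. card u \<in> J}"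
      then have "\<bar>1 - 2 * real (card u) / real n\<bar> ^ r \<le> \<theta> / 2" by (auto simp: J_def)
      then show "\<bar>\<phi> u\<bar> \<le> \<theta>" using near[of u] u elim(2) by auto
    qed (use \<delta> in \<open>auto simp: L_def\<close>)
    also have "2 ^ m n * \<theta> powr (\<delta> * real n) \<le> (1/2) ^ n"
    proof -
      have "2 ^ m n * \<theta> powr (\<delta> * real n) = 2 powr (real (m n) - (\<alpha> + 2) * real n)"
      proof -
        have "- a / \<delta> * (\<delta> * real n) = - (a * real n)" for a using \<delta> by simp
        note this[of "\<alpha> + 2"]
        then have "\<theta> powr (\<delta> * real n) = 2 powr (- ((\<alpha> + 2) * real n))" unfolding \<theta>_def powr_powr by (rule arg_cong)
        then show ?thesis by (simp add: powr_realpow[symmetric] powr_diff powr_minus divide_inverse)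
      qed
      also have "\<dots> \<le> 2 powr (- real n)" using mn by (intro powr_mono) (auto simp: A_def algebra_simps)
      also have "\<dots> = (1/2) ^ n" by (simp add: powr_minus powr_realpow power_divide inverse_eq_divide)
      finally show ?thesis .
    qed
    also have "(\<Sum>u\<in>{u \<in> Pow {..<n}. card u \<in> J}. (1 + \<bar>\<phi> u\<bar>) ^ m n) / 2 ^ n
      \<le> real (Suc n) * B ^ n * (exp (\<eta> n * real (m n)) * 2 powr \<bar>real (m n) - \<alpha> * real n\<bar>)"
    proof (rule weighted_sum_le[OF n(1) eta_nonneg[OF n(2)]])
      fix j assume j: "2 * j \<le> n" "j \<in> J \<or> n - j \<in> J"
      let ?\<gamma> = "real j / real n"
      have \<gamma>: "0 \<le> ?\<gamma>" "?\<gamma> \<le> 1/2" using j(1) n by (auto simp: field_simps)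
      have "1 - 2 * real (n - j) / real n = - (1 - 2 * real j / real n)"
        using j(1) n by (simp add: of_nat_diff field_simps)
      then have "\<bar>1 - 2 * real (n - j) / real n\<bar> = \<bar>1 - 2 * real j / real n\<bar>" by simp
      then have "\<theta> / 2 < \<bar>1 - 2 * real j / real n\<bar> ^ r" using j(2) by (auto simp: J_def)
      moreover have "\<bar>1 - 2 * real j / real n\<bar> = 1 - 2 * ?\<gamma>" using \<gamma> by simp
      ultimately have x: "\<theta> / 2 < (1 - 2 * ?\<gamma>) ^ r" by simp
      have "objective r \<alpha> ?\<gamma> = objective r \<beta> ?\<gamma> * (1 + (1 - 2 * ?\<gamma>) ^ r) powr (\<alpha> - \<beta>)"
        by (rule objective_shift[OF \<gamma>])
      also have "\<dots> \<le> 1 * B"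
      proof (rule mult_mono)
        show "objective r \<beta> ?\<gamma> \<le> 1" by (rule threshold_F_pos_alpha_star(3)[OF r1 _ \<beta>(2) \<gamma>]) (use \<alpha> \<beta> in simp)
        show "(1 + (1 - 2 * ?\<gamma>) ^ r) powr (\<alpha> - \<beta>) \<le> B" unfolding B_def
          using x \<theta> \<beta> by (intro powr_mono2') auto
      qed auto
      finally show "objective r \<alpha> ?\<gamma> \<le> B" by simp
    next
      fix u assume "u \<subseteq> {..<n}"
      then show "0 \<le> 1 + \<bar>\<phi> u\<bar> \<and> 1 + \<bar>\<phi> u\<bar> \<le> 1 + \<bar>1 - 2 * real (card u) / real n\<bar> ^ r + \<eta> n"
        using near[of u] by simp
    qed (use B in simp)
    also have "real (Suc n) * B ^ n * (exp (\<eta> n * real (m n)) * 2 powr \<bar>real (m n) - \<alpha> * real n\<bar>) = exp (real n * c n)"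
    proof -
      have "real (m n) / real n - \<alpha> = (real (m n) - \<alpha> * real n) / real n" using n by (simp add: field_simps)
      then have d: "real n * \<bar>real (m n) / real n - \<alpha>\<bar> = \<bar>real (m n) - \<alpha> * real n\<bar>" using n by (simp add: abs_divide)
      have "real n * c n = ln (real (Suc n)) + real n * ln B + (\<eta> n * real (m n) + real n * \<bar>real (m n) / real n - \<alpha>\<bar> * ln 2)"
        using n by (simp add: c_def distrib_left mult.assoc)
      then have "real n * c n = ln (real (Suc n)) + real n * ln B + (\<eta> n * real (m n) + \<bar>real (m n) - \<alpha> * real n\<bar> * ln 2)"
        unfolding d .
      moreover have "exp (real n * ln B) = B ^ n" using B by (simp add: exp_of_nat_mult)
      moreover have "exp (\<bar>real (m n) - \<alpha> * real n\<bar> * ln 2) = 2 powr \<bar>real (m n) - \<alpha> * real n\<bar>" by (simp add: powr_def)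
      moreover have "exp (ln (real (Suc n))) = real (Suc n)" by (rule exp_ln) simp
      ultimately show ?thesis by (simp only: exp_add)
    qed
    finally have L: "(\<Sum>k\<in>L. real (m n choose k) * even_prob k) \<le> (1/2) ^ n + exp (real n * c n)" by simp
    have KL: "{1..m n} = K \<union> L" by (auto simp: K_def L_def)
    have "(\<Sum>k\<in>{1..m n}. real (m n choose k) * even_prob k)
      = (\<Sum>k\<in>K. real (m n choose k) * even_prob k) + (\<Sum>k\<in>L. real (m n choose k) * even_prob k)"
      unfolding KL by (rule sum.union_disjoint) (auto simp: K_def L_def)
    then show ?case using mean_count_expansion[of "m n"] K L unfolding null_mean_def g_def by linarith
  qed
  with g show ?thesis by (rule that)
qed

theorem first_dependence_lower:
  assumes \<epsilon>: "0 < \<epsilon>"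
  shows "(\<lambda>n. \<P>(\<omega> in P n. real (first_dependence n (X n) \<omega>) < (alpha_star r - \<epsilon>) * real n)) \<longlonglongrightarrow> 0"
proof (cases "0 < alpha_star r - \<epsilon>")
  case False
  then have "\<not> real k < (alpha_star r - \<epsilon>) * real n" for k n
    by (meson less_le_trans mult_nonpos_nonneg not_le of_nat_0_le_iff)
  then show ?thesis by simp
next
  case True
  define \<alpha> where "\<alpha> = alpha_star r - \<epsilon>"
  define m where "m n = nat \<lfloor>\<alpha> * real n\<rfloor>" for n
  have \<alpha>: "0 < \<alpha>" "\<alpha> < alpha_star r" using True \<epsilon> by (auto simp: \<alpha>_def)
  have m: "(\<lambda>n. real (m n) / real n) \<longlonglongrightarrow> \<alpha>" unfolding m_def by (rule floor_ratio_lim[OF \<alpha>(1)])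
  obtain g where g: "g \<longlonglongrightarrow> 0" "\<forall>\<^sub>F n in sequentially. null_mean n (m n) - 1 \<le> g n"
    by (rule null_mean_upper_lim[OF m \<alpha>])
  show ?thesis
  proof (rule tendsto_sandwich[OF _ _ tendsto_const g(1)])
    show "\<forall>\<^sub>F n in sequentially. \<P>(\<omega> in P n. real (first_dependence n (X n) \<omega>) < (alpha_star r - \<epsilon>) * real n) \<le> g n"
      using g(2) eventually_gt_at_top[of 0]
    proof eventually_elim
      case (elim n)
      interpret random_rows n "Q n" "W n" "P n" "X n" using rows elim by simp
      have "\<P>(\<omega> in P n. real (first_dependence n (X n) \<omega>) < (alpha_star r - \<epsilon>) * real n)
        \<le> \<P>(\<omega> in P n. first_dependence n (X n) \<omega> \<le> m n)"
      proof (rule P.finite_measure_mono)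
        show "{\<omega> \<in> space (P n). first_dependence n (X n) \<omega> \<le> m n} \<in> P.events"
          using first_dependence_event[of "\<lambda>k. k \<le> m n"] .
        show "{\<omega> \<in> space (P n). real (first_dependence n (X n) \<omega>) < (alpha_star r - \<epsilon>) * real n}
          \<subseteq> {\<omega> \<in> space (P n). first_dependence n (X n) \<omega> \<le> m n}"
          proof (intro Collect_mono impI conjI; elim conjE)
          fix \<omega> assume "real (first_dependence n (X n) \<omega>) < (alpha_star r - \<epsilon>) * real n"
          then show "first_dependence n (X n) \<omega> \<le> m n" unfolding m_def \<alpha>_def by linarith
        qed
      qed
      also have "\<dots> \<le> null_mean n (m n) - 1" unfolding null_mean_def by (rule first_dependence_le_prob)
      finally show ?case using elim by simp
    qed
  qed simp
qed

end

section \<open>The limit statements\<close>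

context row_sequence
begin

lemma expectation_null_vectors_lim:
  assumes m: "(\<lambda>n. real (m n) / real n) \<longlonglongrightarrow> \<alpha>" and \<alpha>: "0 < \<alpha>"
  shows "(\<lambda>n. ln (prob_space.expectation (P n)
      (\<lambda>\<omega>. real (null_vector_count (random_matrix n (m n) (X n) \<omega>)))) / real n) \<longlonglongrightarrow> threshold_F r \<alpha>"
proof (rule Lim_transform_eventually[OF null_mean_lim[OF m]])
  show "\<forall>\<^sub>F n in sequentially. ln (null_mean n (m n)) / real n
    = ln (prob_space.expectation (P n) (\<lambda>\<omega>. real (null_vector_count (random_matrix n (m n) (X n) \<omega>)))) / real n"
    using eventually_ge_at_top[of 1] by eventually_elim (simp add: expectation_null_vectors)
qed

end

context bounded_row_sequence
begin

lemma first_dependence_between: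
  assumes \<epsilon>: "0 < \<epsilon>"
  shows "(\<lambda>n. \<P>(\<omega> in P n. (alpha_star r - \<epsilon>) * real n \<le> real (first_dependence n (X n) \<omega>) \<and>
      real (first_dependence n (X n) \<omega>) \<le> (alpha_under r + \<epsilon>) * real n)) \<longlonglongrightarrow> 1"
proof -
  let ?lo = "\<lambda>n. \<P>(\<omega> in P n. real (first_dependence n (X n) \<omega>) < (alpha_star r - \<epsilon>) * real n)"
  let ?up = "\<lambda>n. \<P>(\<omega> in P n. (alpha_under r + \<epsilon>) * real n < real (first_dependence n (X n) \<omega>))"
  have lim: "(\<lambda>n. 1 - (?lo n + ?up n)) \<longlonglongrightarrow> 1"
    by (rule tendsto_eq_rhs[OF tendsto_diff[OF tendsto_const tendsto_add[OF first_dependence_lower[OF \<epsilon>] first_dependence_upper[OF \<epsilon>]]]]) simp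
  show ?thesis
  proof (rule tendsto_sandwich[OF _ _ lim tendsto_const])
    show "\<forall>\<^sub>F n in sequentially. 1 - (?lo n + ?up n) \<le> \<P>(\<omega> in P n. (alpha_star r - \<epsilon>) * real n \<le> real (first_dependence n (X n) \<omega>) \<and>
      real (first_dependence n (X n) \<omega>) \<le> (alpha_under r + \<epsilon>) * real n)"
      using eventually_ge_at_top[of 1]
    proof eventually_elim
      case (elim n)
      interpret random_rows n "Q n" "W n" "P n" "X n" using rows elim by simp
      let ?T = "first_dependence n (X n)"
      let ?A = "{\<omega> \<in> space (P n). real (?T \<omega>) < (alpha_star r - \<epsilon>) * real n}"
      let ?B = "{\<omega> \<in> space (P n). (alpha_under r + \<epsilon>) * real n < real (?T \<omega>)}"
      have e: "?A \<in> P.events" "?B \<in> P.events"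
        using first_dependence_event[of "\<lambda>k. real k < (alpha_star r - \<epsilon>) * real n"]
          first_dependence_event[of "\<lambda>k. (alpha_under r + \<epsilon>) * real n < real k"] by auto
      have "1 - (?lo n + ?up n) \<le> 1 - P.prob (?A \<union> ?B)"
        using measure_Un_le[OF e] by simp
      also have "\<dots> = P.prob (space (P n) - (?A \<union> ?B))"
        using P.prob_compl[OF sets.Un[OF e]] by simp
      also have "space (P n) - (?A \<union> ?B) = {\<omega> \<in> space (P n). (alpha_star r - \<epsilon>) * real n \<le> real (?T \<omega>) \<and>
          real (?T \<omega>) \<le> (alpha_under r + \<epsilon>) * real n}"
        by auto
      finally show ?case .
    qed
    show "\<forall>\<^sub>F n in sequentially. \<P>(\<omega> in P n. (alpha_star r - \<epsilon>) * real n \<le> real (first_dependence n (X n) \<omega>) \<and>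
      real (first_dependence n (X n) \<omega>) \<le> (alpha_under r + \<epsilon>) * real n) \<le> 1"
      using eventually_ge_at_top[of 1]
    proof eventually_elim
      case (elim n)
      interpret random_rows n "Q n" "W n" "P n" "X n" using rows elim by simp
      show ?case by (rule P.prob_le_1)
    qed
  qed
qed

text \<open>Again probabilistic: if the thresholds were in the opposite order, the first dependence
  would lie in an empty interval with probability tending to \<open>1\<close>.\<close>

lemma alpha_star_le_alpha_under: "alpha_star r \<le> alpha_under r"
proof (rule ccontr)
  assume "\<not> ?thesis"
  then have gap: "alpha_under r < alpha_star r" by simp
  define \<epsilon> where "\<epsilon> = (alpha_star r - alpha_under r) / 3"
  have \<epsilon>: "0 < \<epsilon>" "alpha_under r + \<epsilon> < alpha_star r - \<epsilon>" using gap by (auto simp: \<epsilon>_def field_simps)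
  have "\<forall>\<^sub>F n in sequentially. \<P>(\<omega> in P n. (alpha_star r - \<epsilon>) * real n \<le> real (first_dependence n (X n) \<omega>) \<and>
      real (first_dependence n (X n) \<omega>) \<le> (alpha_under r + \<epsilon>) * real n) > 1/2"
    using order_tendstoD(1)[OF first_dependence_between[OF \<epsilon>(1)], of "1/2"] by simp
  then have "\<forall>\<^sub>F n::nat in sequentially. False"
    using eventually_gt_at_top[of 0]
  proof eventually_elim
    case (elim n)
    have "(alpha_under r + \<epsilon>) * real n < (alpha_star r - \<epsilon>) * real n"
      using \<epsilon>(2) elim(2) by (intro mult_strict_right_mono) auto
    then have "{\<omega> \<in> space (P n). (alpha_star r - \<epsilon>) * real n \<le> real (first_dependence n (X n) \<omega>) \<and>
      real (first_dependence n (X n) \<omega>) \<le> (alpha_under r + \<epsilon>) * real n} = {}" by auto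
    then show ?case using elim(1) by (simp only: measure_empty)
  qed
  then show False by simp
qed

lemma core_event_prob_eq:
  "1 \<le> n \<Longrightarrow> \<P>(\<omega> in P n. core_event n m \<epsilon> (X n) \<omega>) = \<P>(\<omega> in P n. dense_core n m \<epsilon> (row_sets n m \<omega>))"
  by (intro arg_cong[where f = "measure (P n)"] Collect_cong conj_cong refl random_rows.core_event_iff[OF rows])

lemma core_event_prob_below:
  assumes "(\<lambda>n. real (m n) / real n) \<longlonglongrightarrow> \<alpha>" "0 < \<alpha>" "\<alpha> < alpha_under r" "0 < \<epsilon>"
  shows "(\<lambda>n. \<P>(\<omega> in P n. core_event n (m n) \<epsilon> (X n) \<omega>)) \<longlonglongrightarrow> 0"
proof (rule Lim_transform_eventually[OF dense_core_prob_below[OF assms]])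
  show "\<forall>\<^sub>F n in sequentially. \<P>(\<omega> in P n. dense_core n (m n) \<epsilon> (row_sets n (m n) \<omega>))
      = \<P>(\<omega> in P n. core_event n (m n) \<epsilon> (X n) \<omega>)"
    using eventually_ge_at_top[of 1] by eventually_elim (simp add: core_event_prob_eq)
qed

text \<open>The barrier \<open>y\<close> depends on \<alpha> alone, so one bound on \<epsilon>, half
  the limiting density of rows at \<open>level y\<close>, serves all sequences
  \<open>m\<close>.\<close>

lemma core_event_prob_above:
  assumes "0 < \<alpha>" "alpha_under r < \<alpha>"
  shows "\<exists>e>0. \<forall>m \<epsilon>. (\<lambda>n. real (m n) / real n) \<longlonglongrightarrow> \<alpha> \<longrightarrow> 0 < \<epsilon> \<longrightarrow> \<epsilon> < e \<longrightarrow>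
      (\<lambda>n. \<P>(\<omega> in P n. core_event n (m n) \<epsilon> (X n) \<omega>)) \<longlonglongrightarrow> 1"
proof -
  obtain y where y: "0 < y" "y < 1" "threshold_h r y < \<alpha>" "\<And>x. y \<le> x \<Longrightarrow> x < 1 \<Longrightarrow> psi r x < 0"
    using psi_neg_of_greater_alpha_under[OF r3 assms(2)] by metis
  show ?thesis
  proof (intro exI[of _ "\<alpha> * y ^ r / 2"] conjI allI impI)
    show "0 < \<alpha> * y ^ r / 2" using assms y by simp
    fix m :: "nat \<Rightarrow> nat" and \<epsilon> :: real
    assume m: "(\<lambda>n. real (m n) / real n) \<longlonglongrightarrow> \<alpha>" and \<epsilon>: "0 < \<epsilon>" "\<epsilon> < \<alpha> * y ^ r / 2"
    have lim: "(\<lambda>n. 1 - \<P>(\<omega> in P n. \<not> dense_core n (m n) \<epsilon> (row_sets n (m n) \<omega>))) \<longlonglongrightarrow> 1"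
      using tendsto_diff[OF tendsto_const[of 1] dense_core_prob_above[OF m assms(1) y \<epsilon>]] by simp
    show "(\<lambda>n. \<P>(\<omega> in P n. core_event n (m n) \<epsilon> (X n) \<omega>)) \<longlonglongrightarrow> 1"
    proof (rule Lim_transform_eventually[OF lim])
      show "\<forall>\<^sub>F n in sequentially. 1 - \<P>(\<omega> in P n. \<not> dense_core n (m n) \<epsilon> (row_sets n (m n) \<omega>))
          = \<P>(\<omega> in P n. core_event n (m n) \<epsilon> (X n) \<omega>)"
        using eventually_ge_at_top[of 1]
      proof eventually_elim
        case (elim n)
        interpret random_rows n "Q n" "W n" "P n" "X n" using rows elim by simp
        let ?S = "{\<omega> \<in> space (P n). dense_core n (m n) \<epsilon> (row_sets n (m n) \<omega>)}"
        have "?S \<in> P.events" by (rule rows_pred_event)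
        from P.prob_compl[OF this] have "P.prob (space (P n) - ?S) = 1 - P.prob ?S" .
        moreover have "space (P n) - ?S = {\<omega> \<in> space (P n). \<not> dense_core n (m n) \<epsilon> (row_sets n (m n) \<omega>)}" by auto
        ultimately show ?case using core_event_prob_eq[OF elim, of "m n" \<epsilon>] by simp
      qed
    qed
  qed
qed

end

theorem theorem2p7:
  fixes r :: nat
    and Q :: "nat \<Rightarrow> 'w measure" and W :: "nat \<Rightarrow> 'w \<Rightarrow> nat"
    and P :: "nat \<Rightarrow> 'a measure" and X :: "nat \<Rightarrow> nat \<Rightarrow> 'a \<Rightarrow> bit vec"
  assumes r: "1 \<le> r"
    and rows: "\<And>n. 1 \<le> n \<Longrightarrow> random_rows n (Q n) (W n) (P n) (X n)"
    and W_to_r: "\<And>\<delta> :: real. 0 < \<delta> \<Longrightarrow>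
      (\<lambda>n. \<P>(x in Q n. \<bar>real (W n x) - real r\<bar> > \<delta>)) \<longlonglongrightarrow> 0"
  shows
    "(\<forall>(\<alpha> :: real) (m :: nat \<Rightarrow> nat).
        0 < \<alpha> \<and> (\<forall>n\<ge>1. 0 < m n) \<and> (\<lambda>n. real (m n) / real n) \<longlonglongrightarrow> \<alpha> \<longrightarrow>
        (\<lambda>n. ln (prob_space.expectation (P n)
                  (\<lambda>\<omega>. real (null_vector_count (random_matrix n (m n) (X n) \<omega>)))) / real n)
          \<longlonglongrightarrow> threshold_F r \<alpha> \<and>
        (0 < threshold_F r \<alpha> \<longleftrightarrow> alpha_star r < \<alpha>)) \<and>
     ((\<forall>\<^sub>F n in sequentially. \<P>(x in Q n. 3 \<le> W n x) = 1) \<and>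
      (\<exists>r1 :: real. \<forall>n\<ge>1. \<P>(x in Q n. real (W n x) \<le> r1) = 1) \<longrightarrow>
        3 \<le> r \<and>
        alpha_star r \<le> alpha_under r \<and> alpha_under r \<le> 1 \<and>
        (\<forall>\<epsilon>>0. (\<lambda>n. \<P>(\<omega> in P n.
            (alpha_star r - \<epsilon>) * real n \<le> real (first_dependence n (X n) \<omega>) \<and>
            real (first_dependence n (X n) \<omega>) \<le> (alpha_under r + \<epsilon>) * real n)) \<longlonglongrightarrow> 1) \<and>
        (\<forall>\<alpha>>0. \<exists>\<epsilon>\<^sub>\<alpha>>0. \<forall>m :: nat \<Rightarrow> nat.
            (\<forall>n\<ge>1. 0 < m n) \<and> (\<lambda>n. real (m n) / real n) \<longlonglongrightarrow> \<alpha> \<longrightarrow>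
            (\<forall>\<epsilon>. 0 < \<epsilon> \<and> \<epsilon> < \<epsilon>\<^sub>\<alpha> \<longrightarrow>
              (\<alpha> < alpha_under r \<longrightarrow>
                 (\<lambda>n. \<P>(\<omega> in P n. core_event n (m n) \<epsilon> (X n) \<omega>)) \<longlonglongrightarrow> 0) \<and>
              (alpha_under r < \<alpha> \<longrightarrow>
                 (\<lambda>n. \<P>(\<omega> in P n. core_event n (m n) \<epsilon> (X n) \<omega>)) \<longlonglongrightarrow> 1))))"
proof -
  interpret S: row_sequence r Q W P X by (rule row_sequence.intro[OF r rows W_to_r])
  show ?thesis
  proof (intro conjI[where P = "\<forall>\<alpha> m. _ \<alpha> m"] allI impI; elim conjE exE)
    fix \<alpha> :: real and m :: "nat \<Rightarrow> nat"
    assume \<alpha>: "0 < \<alpha>" and m: "(\<lambda>n. real (m n) / real n) \<longlonglongrightarrow> \<alpha>"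
    show "(\<lambda>n. ln (prob_space.expectation (P n)
                  (\<lambda>\<omega>. real (null_vector_count (random_matrix n (m n) (X n) \<omega>)))) / real n)
          \<longlonglongrightarrow> threshold_F r \<alpha> \<and>
        (0 < threshold_F r \<alpha> \<longleftrightarrow> alpha_star r < \<alpha>)"
      using S.expectation_null_vectors_lim[OF m \<alpha>] threshold_F_pos_alpha_star(1)[OF r \<alpha>] by blast
  next
    fix r1 :: real
    assume ge: "\<forall>\<^sub>F n in sequentially. \<P>(x in Q n. 3 \<le> W n x) = 1"
      and le: "\<forall>n\<ge>1. \<P>(x in Q n. real (W n x) \<le> r1) = 1"
    \<comment> \<open>The weights are integers, so the real bound may be rounded down; the maximum
      supplies \<open>r \<le> R\<close>.\<close>
    define R where "R = max r (nat \<lfloor>r1\<rfloor>)"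
    interpret B: bounded_row_sequence r Q W P X R
    proof unfold_locales
      fix n :: nat assume n: "1 \<le> n"
      interpret random_rows n "Q n" "W n" "P n" "X n" using rows n by simp
      have "\<P>(x in Q n. real (W n x) \<le> r1) \<le> \<P>(x in Q n. W n x \<le> R)"
      proof (rule Q.finite_measure_mono)
        show "{x \<in> space (Q n). real (W n x) \<le> r1} \<subseteq> {x \<in> space (Q n). W n x \<le> R}"
          by (auto simp: R_def le_max_iff_disj le_nat_iff le_floor_iff)
        show "{x \<in> space (Q n). W n x \<le> R} \<in> Q.events"
          using measurable_sets[OF W_random_variable, of "{..R}"] by (simp add: vimage_def Int_def conj_commute)
      qed
      then show "\<P>(x in Q n. W n x \<le> R) = 1" using le n Q.prob_le_1 by (simp add: antisym)
    qed (use ge in \<open>auto simp: R_def\<close>)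
    show "3 \<le> r \<and>
        alpha_star r \<le> alpha_under r \<and> alpha_under r \<le> 1 \<and>
        (\<forall>\<epsilon>>0. (\<lambda>n. \<P>(\<omega> in P n.
            (alpha_star r - \<epsilon>) * real n \<le> real (first_dependence n (X n) \<omega>) \<and>
            real (first_dependence n (X n) \<omega>) \<le> (alpha_under r + \<epsilon>) * real n)) \<longlonglongrightarrow> 1) \<and>
        (\<forall>\<alpha>>0. \<exists>\<epsilon>\<^sub>\<alpha>>0. \<forall>m :: nat \<Rightarrow> nat.
            (\<forall>n\<ge>1. 0 < m n) \<and> (\<lambda>n. real (m n) / real n) \<longlonglongrightarrow> \<alpha> \<longrightarrow>
            (\<forall>\<epsilon>. 0 < \<epsilon> \<and> \<epsilon> < \<epsilon>\<^sub>\<alpha> \<longrightarrow>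
              (\<alpha> < alpha_under r \<longrightarrow>
                 (\<lambda>n. \<P>(\<omega> in P n. core_event n (m n) \<epsilon> (X n) \<omega>)) \<longlonglongrightarrow> 0) \<and>
              (alpha_under r < \<alpha> \<longrightarrow>
                 (\<lambda>n. \<P>(\<omega> in P n. core_event n (m n) \<epsilon> (X n) \<omega>)) \<longlonglongrightarrow> 1)))"
    proof (intro conjI allI impI)
      show "3 \<le> r" by (rule B.r3)
      show "alpha_star r \<le> alpha_under r" by (rule B.alpha_star_le_alpha_under)
      show "alpha_under r \<le> 1" by (rule B.alpha_under_le_1)
    next
      fix \<epsilon> :: real assume "0 < \<epsilon>"
      then show "(\<lambda>n. \<P>(\<omega> in P n.
            (alpha_star r - \<epsilon>) * real n \<le> real (first_dependence n (X n) \<omega>) \<and>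
            real (first_dependence n (X n) \<omega>) \<le> (alpha_under r + \<epsilon>) * real n)) \<longlonglongrightarrow> 1"
        by (rule B.first_dependence_between)
    next
      fix \<alpha> :: real assume \<alpha>: "0 < \<alpha>"
      show "\<exists>\<epsilon>\<^sub>\<alpha>>0. \<forall>m :: nat \<Rightarrow> nat.
            (\<forall>n\<ge>1. 0 < m n) \<and> (\<lambda>n. real (m n) / real n) \<longlonglongrightarrow> \<alpha> \<longrightarrow>
            (\<forall>\<epsilon>. 0 < \<epsilon> \<and> \<epsilon> < \<epsilon>\<^sub>\<alpha> \<longrightarrow>
              (\<alpha> < alpha_under r \<longrightarrow>
                 (\<lambda>n. \<P>(\<omega> in P n. core_event n (m n) \<epsilon> (X n) \<omega>)) \<longlonglongrightarrow> 0) \<and>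
              (alpha_under r < \<alpha> \<longrightarrow>
                 (\<lambda>n. \<P>(\<omega> in P n. core_event n (m n) \<epsilon> (X n) \<omega>)) \<longlonglongrightarrow> 1))"
      proof (cases "alpha_under r < \<alpha>")
        case True
        from B.core_event_prob_above[OF \<alpha> True] obtain e where "0 < e"
          and e: "\<forall>m \<epsilon>. (\<lambda>n. real (m n) / real n) \<longlonglongrightarrow> \<alpha> \<longrightarrow> 0 < \<epsilon> \<longrightarrow> \<epsilon> < e \<longrightarrow>
            (\<lambda>n. \<P>(\<omega> in P n. core_event n (m n) \<epsilon> (X n) \<omega>)) \<longlonglongrightarrow> 1"
          by (elim exE conjE)
        then show ?thesis using True by (intro exI[of _ e]) simp
      next
        case False
        \<comment> \<open>Below the threshold every positive \<epsilon> works, so the witness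
          \<open>1\<close> is arbitrary; for \<alpha> equal to \<open>alpha_under r\<close> both
          claims are vacuous.\<close>
        then show ?thesis using B.core_event_prob_below[OF _ \<alpha>] by (intro exI[of _ 1]) simp
      qed
    qed
  qed
qed

end
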